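(* Let $B_H=\{B_H(t)\}_{t\in\mathbb{R}}$ be a bivariate ($n=2$) time-reversible operator fractional Brownian motion with $H=P\,\mathrm{diag}(h_1,h_2)P^{-1}$, $0<h_1<h_2<1$, as described in the context. Fix $j\in\mathbb{N}$ and let $a(\nu)$ be a sequence of powers of $2$ with $a(\nu)\le\nu/2^j$ and $\frac{a(\nu)}{\nu}+\frac{\nu}{a(\nu)^{1+2h_1}}\to0$ as $\nu\to\infty$. Write $$W(a(\nu)2^j)=\begin{pmatrix}\widehat a&\widehat b\\ \widehat b&\widehat c\end{pmatrix},\qquad EW(a(\nu)2^j)=\begin{pmatrix}a&b\\ b&c\end{pmatrix}$$ (the dependence of the entries on $j,\nu$ being omitted), let $\lambda_1(a(\nu)2^j)$, $\lambda_1^E(a(\nu)2^j)$ be the smallest eigenvalues of these two matrices, and set $$\widehat\theta(a(\nu)2^j)=\frac{\lambda_1(a(\nu)2^j)-\widehat a}{\widehat b},\qquad \theta(a(\nu)2^j)=\frac{\lambda^E_1(a(\nu)2^j)-a}{b}.$$ Let $B(2^j)=(b_{i_1,i_2})_{i_1,i_2=1,2}:=P^{-1}EW(2^j)(P^* )^{-1}$. Suppose that $p_{22}\neq0$. (i) If either $p_{12}\neq0$, or $p_{12}=0$ and $b_{12}\neq0$, then, as $\nu\to\infty$, $$\widehat\theta(a(\nu)2^j)\to-\frac{p_{12}}{p_{22}}\ \text{ in probability},\qquad \theta(a(\nu)2^j)\to-\frac{p_{12}}{p_{22}}.$$ (ii) If $p_{12}\neq0$ and $b_{12}\neq0$, then,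 as $\nu\to\infty$, $$a(\nu)^{h_2-h_1}\sqrt{K_{a,j}}\,\{\widehat\theta(a(\nu)2^j)-\theta(a(\nu)2^j)\}\stackrel{d}{\to}N(0,\sigma_\theta^2),$$ where $\sigma_\theta^2=\mathcal R^*\Sigma_B(2^j)\mathcal R$ with $\mathcal R^*=\frac{\det P}{b_{22}\,p_{22}^2}\big(0,-1,\frac{b_{12}}{b_{22}}\big)$ and $\Sigma_B(2^j)$ the $3\times3$ matrix defined in the context.
   Context: Matrix conventions: $^*$ is (Hermitian) transposition; $c^M=\exp(\log(c)M)$ for $c>0$; $x_\pm=\max\{\pm x,0\}$, and $x_\pm^{-D}$ is read as the zero matrix when $x_\pm=0$; $|0|^H\Sigma|0|^{H^*}=0$. Operator fractional Brownian motion (OFBM). $B_H$ is the $\mathbb{R}^2$-valued centered Gaussian process with finite-dimensional distributions those of $\int_{\mathbb{R}}\frac{e^{itx}-1}{ix}(x_+^{-D}A+x_-^{-D}\overline A)\widetilde B(dx)$, where $D=H-\frac12I$, $A\in M(2,\mathbb{C})$, and $\widetilde B(dx)$ is a complex Gaussian random measure with $\widetilde B(-dx)=\overline{\widetilde B(dx)}$, $E\widetilde B(dx)\widetilde B(dx)^*=dx\,I$. Assumptions: $H=P\,\mathrm{diag}(h_1,h_2)P^{-1}$ with $0<h_1<h_2<1$, $P=(p_{i_1i_2})\in GL(2,\mathbb{R})$ having unit-vector columns; $\Re(AA^* )$ has full rank; $\Im(AA^* )=0$ (time reversibility). Put $\Sigma=EB_H(1)B_H(1)^*$. Wavelet. $\psi\in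 L^1(\mathbb{R})$ is real-valued with $\int\psi^2=1$, $\int t^q\psi(t)dt=0$ for $q=0,\dots,N_\psi-1$, $N_\psi\ge2$; $\mathrm{supp}(\psi)$ is a compact interval; $\sup_x|\widehat\psi(x)|(1+|x|)^\alpha<\infty$ for some $\alpha>1$. Wavelet coefficients: $D(2^j,k)=\int_{\mathbb{R}}\psi(z)B_H(2^jz+2^jk)dz$ (mean-square sense), $j\in\mathbb{N}\cup\{0\}$, $k\in\mathbb{Z}$; $EW(2^j):=ED(2^j,0)D(2^j,0)^*$. Here $\nu$ (the number of data points) is a power of $2$, $K_{a,j}=\nu/(a(\nu)2^j)$, and $W(a(\nu)2^j)=\frac1{K_{a,j}}\sum_{k=1}^{K_{a,j}}D(a(\nu)2^j,k)D(a(\nu)2^j,k)^*$. The ratios $\widehat\theta(a(\nu)2^j)$, $\theta(a(\nu)2^j)$ are well defined, respectively, with probability tending to 1 and for large $\nu$. Asymptotic covariance. For $z\in\mathbb{Z}$ let $$\Omega_{j,j}(z)=-\frac12\int_{\mathbb{R}}\int_{\mathbb{R}}\psi(t)\psi(t')\,|2^j(t-t'+z)|^H\,\Sigma\,|2^j(t-t'+z)|^{H^*}dt'dt .$$ Let $G_{jj}$ be the $3\times3$ matrix with rows and columns indexed by $(1,1),(1,2),(2,2)$ in this order, whose entry at row $(i_1,i_2)$, column $(l_1,l_2)$ is $$\sum_{z\in\mathbb{Z}}\big[\Omega_{j,j}(z)_{i_1l_1}\Omega_{j,j}(z)_{i_2l_2}+\Omega_{j,j}(z)_{i_1l_2}\Omega_{j,j}(z)_{i_2l_1}\big].$$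 With $(\pi_{i_1i_2})=P^{-1}$ and $$\mathcal P=\begin{pmatrix}\pi_{11}^2&2\pi_{11}\pi_{12}&\pi_{12}^2\\ \pi_{11}\pi_{21}&\pi_{11}\pi_{22}+\pi_{12}\pi_{21}&\pi_{12}\pi_{22}\\ \pi_{21}^2&2\pi_{21}\pi_{22}&\pi_{22}^2\end{pmatrix},$$ $\Sigma_B(2^j)=\mathcal P\,G_{jj}\,\mathcal P^*$. *)

theory Defs
  imports "HOL-Probability.Probability"
begin

section \<open>Matrices\<close>

text \<open>
  The multiplication of the type \<^typ>\<open>real^'n^'n\<close> as an algebra is componentwise, so the library
  function \<open>exp\<close> is not the matrix exponential.
\<close>

definition mat_exp :: "real^'n^'n \<Rightarrow> real^'n^'n" where
  "mat_exp M = (\<Sum>k. (1 / fact k) *\<^sub>R (((**) M) ^^ k) (mat 1))"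

text \<open>
  \<open>c\<^sup>M = exp (log c M)\<close> for \<open>c > 0\<close>. The value zero for \<open>c \<le> 0\<close> encodes the conventions
  \<open>x\<^sub>+\<^sup>-\<^sup>D = 0\<close> if \<open>x\<^sub>+ = 0\<close>, \<open>x\<^sub>-\<^sup>-\<^sup>D = 0\<close> if \<open>x\<^sub>- = 0\<close>, and \<open>|0|\<^sup>H \<Sigma> |0|\<^sup>H\<^sup>* = 0\<close>.
\<close>

definition mat_powr :: "real \<Rightarrow> real^'n^'n \<Rightarrow> real^'n^'n" where
  "mat_powr c M = (if c > 0 then mat_exp (ln c *\<^sub>R M) else 0)"

definition hermitian_transpose :: "complex^'n^'m \<Rightarrow> complex^'m^'n" where
  "hermitian_transpose A = map_matrix cnj (transpose A)"

definition diag2 :: "real \<Rightarrow> real \<Rightarrow> real^2^2" where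
  "diag2 x y = vector [vector [x, 0], vector [0, y]]"

definition outer :: "'a::semiring_1^'n \<Rightarrow> 'a^'m \<Rightarrow> 'a^'m^'n" where
  "outer v w = (\<chi> i k. v $ i * w $ k)"

definition complex_vec :: "real^'n \<Rightarrow> complex^'n" where
  "complex_vec v = (\<chi> i. complex_of_real (v $ i))"

definition cnj_vec :: "complex^'n \<Rightarrow> complex^'n" where
  "cnj_vec v = (\<chi> i. cnj (v $ i))"

definition smallest_eigenvalue :: "real^'n^'n \<Rightarrow> real" where
  "smallest_eigenvalue S = Min {l. \<exists>v. v \<noteq> 0 \<and> S *v v = l *\<^sub>R v}"


section \<open>Gaussian families and convergence of random variables\<close>

text \<open>The normal law with mean zero and variance \<open>v \<ge> 0\<close>, a point mass if \<open>v = 0\<close>.\<close>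

definition centered_normal :: "real \<Rightarrow> real measure" where
  "centered_normal v =
     (if v = 0 then return borel 0
      else density lborel (\<lambda>x. ennreal (normal_density 0 (sqrt v) x)))"

text \<open>
  Joint (possibly degenerate) Gaussianity: all finite real linear combinations of the real
  coordinates are centered normal. On \<^typ>\<open>complex^2\<close> the inner product is the real one, so
  that the coordinates are the real and imaginary parts of the entries.
\<close>

definition centered_gaussian_family ::
  "'a measure \<Rightarrow> 'i set \<Rightarrow> ('i \<Rightarrow> 'a \<Rightarrow> 'b::euclidean_space) \<Rightarrow> bool" where
  "centered_gaussian_family M I X \<longleftrightarrow>
     (\<forall>i\<in>I. X i \<in> borel_measurable M) \<and>
     (\<forall>J c. finite J \<and> J \<subseteq> I \<longrightarrow>
        (\<exists>v\<ge>0. distr M borel (\<lambda>\<omega>. \<Sum>i\<in>J. c i \<bullet> X i \<omega>) = centered_normal v))"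

definition tendsto_in_prob :: "'a measure \<Rightarrow> (nat \<Rightarrow> 'a \<Rightarrow> real) \<Rightarrow> real \<Rightarrow> bool" where
  "tendsto_in_prob M X c \<longleftrightarrow>
     (\<forall>\<epsilon>>0. (\<lambda>n. measure M {\<omega> \<in> space M. \<bar>X n \<omega> - c\<bar> > \<epsilon>}) \<longlonglongrightarrow> 0)"


section \<open>Mean-square integrals\<close>

definition square_integrable :: "'a measure \<Rightarrow> ('a \<Rightarrow> 'b::euclidean_space) \<Rightarrow> bool" where
  "square_integrable M X \<longleftrightarrow>
     X \<in> borel_measurable M \<and> integrable M (\<lambda>\<omega>. (norm (X \<omega>))\<^sup>2)"

definition l2norm :: "'a measure \<Rightarrow> ('a \<Rightarrow> 'b::euclidean_space) \<Rightarrow> real" where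
  "l2norm M X = sqrt (\<integral>\<omega>. (norm (X \<omega>))\<^sup>2 \<partial>M)"

definition finite_borel :: "real set set" where
  "finite_borel = {E \<in> sets borel. emeasure lborel E < \<infinity>}"

text \<open>
  \<open>X = \<integral> F(z) dz\<close> in the mean-square sense, i.e. as a Bochner integral with values in \<open>L\<^sup>2(M)\<close>:
  there are \<open>L\<^sup>2(M)\<close>-valued simple functions \<open>\<Sum> 1\<^sub>E(z) Y\<close>, given as lists of pairs \<open>(E, Y)\<close>, that
  converge to \<open>F\<close> in \<open>L\<^sup>1(dz; L\<^sup>2(M))\<close> and whose integrals \<open>\<Sum> |E| Y\<close> converge to \<open>X\<close> in
  \<open>L\<^sup>2(M)\<close>. The random variable \<open>X\<close> is determined up to almost sure equality.
\<close>

definition mean_square_integral ::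
  "'a measure \<Rightarrow> (real \<Rightarrow> 'a \<Rightarrow> 'b::euclidean_space) \<Rightarrow> ('a \<Rightarrow> 'b) \<Rightarrow> bool" where
  "mean_square_integral M F X \<longleftrightarrow>
     square_integrable M X \<and> (\<forall>z. square_integrable M (F z)) \<and>
     (\<exists>S :: nat \<Rightarrow> (real set \<times> ('a \<Rightarrow> 'b)) list.
        (\<forall>n. \<forall>(E, Y)\<in>set (S n). E \<in> finite_borel \<and> square_integrable M Y) \<and>
        (\<forall>n. (\<lambda>z. l2norm M (\<lambda>\<omega>. F z \<omega> - (\<Sum>(E, Y)\<leftarrow>S n. indicator E z *\<^sub>R Y \<omega>)))
               \<in> borel_measurable borel) \<and>
        (\<lambda>n. \<integral>\<^sup>+z. ennreal (l2norm M (\<lambda>\<omega>. F z \<omega> - (\<Sum>(E, Y)\<leftarrow>S n. indicator E z *\<^sub>R Y \<omega>)))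
               \<partial>lborel) \<longlonglongrightarrow> 0 \<and>
        (\<lambda>n. l2norm M (\<lambda>\<omega>. X \<omega> - (\<Sum>(E, Y)\<leftarrow>S n. measure lborel E *\<^sub>R Y \<omega>))) \<longlonglongrightarrow> 0)"

text \<open>
  A complex Gaussian random measure \<open>B(dx)\<close> with \<open>B(-dx)\<close> the conjugate of \<open>B(dx)\<close> and
  \<open>E B(dx) B(dx)\<^sup>* = dx I\<close>. The last condition is the usual one for orthogonal increments,
  \<open>E B(E) B(F)\<^sup>* = |E \<inter> F| I\<close>; it makes \<open>B\<close> countably additive in mean square.
\<close>

definition hermitian_gaussian_measure ::
  "'b measure \<Rightarrow> (real set \<Rightarrow> 'b \<Rightarrow> complex^2) \<Rightarrow> bool" where
  "hermitian_gaussian_measure N Bt \<longleftrightarrow>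
     centered_gaussian_family N finite_borel Bt \<and>
     (\<forall>E\<in>finite_borel. AE \<omega> in N. Bt (uminus ` E) \<omega> = cnj_vec (Bt E \<omega>)) \<and>
     (\<forall>E\<in>finite_borel. \<forall>F\<in>finite_borel.
        (\<integral>\<omega>. outer (Bt E \<omega>) (cnj_vec (Bt F \<omega>)) \<partial>N)
          = mat (complex_of_real (measure lborel (E \<inter> F))))"

text \<open>
  \<open>X = \<integral> f(x) B(dx)\<close>: simple functions \<open>\<Sum> 1\<^sub>E(x) C\<close>, given as lists of pairs \<open>(E, C)\<close>, converge
  to \<open>f\<close> in \<open>L\<^sup>2(dx)\<close>, and their integrals \<open>\<Sum> C B(E)\<close> converge to \<open>X\<close> in mean square.
\<close>

definition stochastic_integral ::
  "'b measure \<Rightarrow> (real set \<Rightarrow> 'b \<Rightarrow> complex^2) \<Rightarrow> (real \<Rightarrow> complex^2^2) \<Rightarrow> ('b \<Rightarrow> complex^2) \<Rightarrow> bool"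
  where
  "stochastic_integral N Bt f X \<longleftrightarrow>
     f \<in> borel_measurable borel \<and> X \<in> borel_measurable N \<and>
     (\<exists>S :: nat \<Rightarrow> (real set \<times> (complex^2^2)) list.
        (\<forall>n. \<forall>(E, C)\<in>set (S n). E \<in> finite_borel) \<and>
        (\<lambda>n. \<integral>\<^sup>+x. ennreal ((norm (f x - (\<Sum>(E, C)\<leftarrow>S n. indicator E x *\<^sub>R C)))\<^sup>2) \<partial>lborel)
          \<longlonglongrightarrow> 0 \<and>
        (\<lambda>n. \<integral>\<^sup>+\<omega>. ennreal ((norm (X \<omega> - (\<Sum>(E, C)\<leftarrow>S n. C *v Bt E \<omega>)))\<^sup>2) \<partial>N)
          \<longlonglongrightarrow> 0)"


section \<open>Operator fractional Brownian motion\<close>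

definition ofbm_kernel :: "real^2^2 \<Rightarrow> complex^2^2 \<Rightarrow> real \<Rightarrow> real \<Rightarrow> complex^2^2" where
  "ofbm_kernel H A t x =
     (let D = H - (1/2) *\<^sub>R mat 1 in
      mat ((exp (\<i> * complex_of_real (t * x)) - 1) / (\<i> * complex_of_real x)) **
        (map_matrix complex_of_real (mat_powr (max x 0) (- D)) ** A +
         map_matrix complex_of_real (mat_powr (max (- x) 0) (- D)) ** map_matrix cnj A))"

text \<open>
  \<open>B\<close>, on the probability space \<open>M\<close>, is a centered Gaussian process with the finite-dimensional
  distributions of the stochastic integrals of the kernel with respect to a random measure \<open>Bt\<close>,
  which may live on another probability space \<open>N\<close>. The integrals take values in \<^typ>\<open>complex^2\<close>
  (and are almost surely real), hence the embedding of \<open>B\<close> into that space.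
\<close>

definition ofbm ::
  "'a measure \<Rightarrow> (real \<Rightarrow> 'a \<Rightarrow> real^2) \<Rightarrow> real^2^2 \<Rightarrow> complex^2^2 \<Rightarrow>
   'b measure \<Rightarrow> (real set \<Rightarrow> 'b \<Rightarrow> complex^2) \<Rightarrow> bool" where
  "ofbm M B H A N Bt \<longleftrightarrow>
     prob_space M \<and> prob_space N \<and>
     hermitian_gaussian_measure N Bt \<and>
     centered_gaussian_family M UNIV B \<and>
     (\<exists>Y. (\<forall>t. stochastic_integral N Bt (ofbm_kernel H A t) (Y t)) \<and>
          (\<forall>J. finite J \<longrightarrow>
             distr M (PiM J (\<lambda>_. borel)) (\<lambda>\<omega>. \<lambda>t\<in>J. complex_vec (B t \<omega>)) =
             distr N (PiM J (\<lambda>_. borel)) (\<lambda>\<omega>. \<lambda>t\<in>J. Y t \<omega>)))"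


section \<open>Wavelet analysis\<close>

definition wavelet :: "(real \<Rightarrow> real) \<Rightarrow> nat \<Rightarrow> real \<Rightarrow> bool" where
  "wavelet \<psi> N\<^sub>\<psi> \<alpha> \<longleftrightarrow>
     integrable lborel \<psi> \<and>
     (\<integral>t. (\<psi> t)\<^sup>2 \<partial>lborel) = 1 \<and>
     N\<^sub>\<psi> \<ge> 2 \<and> (\<forall>q<N\<^sub>\<psi>. (\<integral>t. t ^ q * \<psi> t \<partial>lborel) = 0) \<and>
     (\<exists>c d. closure {t. \<psi> t \<noteq> 0} = {c..d}) \<and>
     \<alpha> > 1 \<and>
     bdd_above (range (\<lambda>x. cmod (\<integral>t. exp (- (\<i> * complex_of_real (x * t))) *
                                     complex_of_real (\<psi> t) \<partial>lborel) * (1 + \<bar>x\<bar>) powr \<alpha>))"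

text \<open>
  \<open>D s k\<close> is the wavelet coefficient at scale \<open>s\<close> (a power of two) and shift \<open>k\<close>; any version of the
  mean-square integral is allowed.
\<close>

definition wavelet_coefficients ::
  "'a measure \<Rightarrow> (real \<Rightarrow> 'a \<Rightarrow> real^2) \<Rightarrow> (real \<Rightarrow> real) \<Rightarrow> (nat \<Rightarrow> int \<Rightarrow> 'a \<Rightarrow> real^2) \<Rightarrow> bool"
  where
  "wavelet_coefficients M B \<psi> D \<longleftrightarrow>
     (\<forall>i k. mean_square_integral M
        (\<lambda>z \<omega>. \<psi> z *\<^sub>R B (2 ^ i * z + 2 ^ i * of_int k) \<omega>) (D (2 ^ i) k))"

definition wavelet_variance :: "'a measure \<Rightarrow> (nat \<Rightarrow> int \<Rightarrow> 'a \<Rightarrow> real^2) \<Rightarrow> nat \<Rightarrow> real^2^2" where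
  "wavelet_variance M D s = (\<integral>\<omega>. outer (D s 0 \<omega>) (D s 0 \<omega>) \<partial>M)"

definition sample_wavelet_variance ::
  "(nat \<Rightarrow> int \<Rightarrow> 'a \<Rightarrow> real^2) \<Rightarrow> nat \<Rightarrow> nat \<Rightarrow> 'a \<Rightarrow> real^2^2" where
  "sample_wavelet_variance D s K \<omega> =
     (1 / real K) *\<^sub>R (\<Sum>k=1..K. outer (D s (int k) \<omega>) (D s (int k) \<omega>))"

text \<open>
  For \<open>W = ((a, b), (b, c))\<close> the ratio \<open>(\<lambda>\<^sub>1 - a) / b\<close>. It is totalized to \<open>0\<close> if \<open>b = 0\<close>.
\<close>

definition eigen_ratio :: "real^2^2 \<Rightarrow> real" where
  "eigen_ratio W = (smallest_eigenvalue W - W $ 1 $ 1) / W $ 1 $ 2"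


section \<open>Asymptotic covariance\<close>

definition Omega ::
  "(real \<Rightarrow> real) \<Rightarrow> real^2^2 \<Rightarrow> real^2^2 \<Rightarrow> nat \<Rightarrow> int \<Rightarrow> real^2^2" where
  "Omega \<psi> H \<Sigma> j z =
     - (1/2) *\<^sub>R (\<integral>t. (\<integral>t'.
         (let R = mat_powr \<bar>2 ^ j * (t - t' + of_int z)\<bar> H in
          (\<psi> t * \<psi> t') *\<^sub>R (R ** \<Sigma> ** transpose R)) \<partial>lborel) \<partial>lborel)"

text \<open>The order \<open>(1,1), (1,2), (2,2)\<close> of the rows and columns of the three-by-three matrices.\<close>

definition pair_index :: "3 \<Rightarrow> 2 \<times> 2" where
  "pair_index r = (if r = 1 then (1, 1) else if r = 2 then (1, 2) else (2, 2))"

definition G_mat :: "(real \<Rightarrow> real) \<Rightarrow> real^2^2 \<Rightarrow> real^2^2 \<Rightarrow> nat \<Rightarrow> real^3^3" where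
  "G_mat \<psi> H \<Sigma> j = (\<chi> r s.
     case (pair_index r, pair_index s) of ((i1, i2), (l1, l2)) \<Rightarrow>
       (\<Sum>\<^sub>\<infinity>z\<in>UNIV. Omega \<psi> H \<Sigma> j z $ i1 $ l1 * Omega \<psi> H \<Sigma> j z $ i2 $ l2 +
                 Omega \<psi> H \<Sigma> j z $ i1 $ l2 * Omega \<psi> H \<Sigma> j z $ i2 $ l1))"

definition cal_P :: "real^2^2 \<Rightarrow> real^3^3" where
  "cal_P P = (let Q = matrix_inv P in
     vector [vector [(Q$1$1)\<^sup>2, 2 * Q$1$1 * Q$1$2, (Q$1$2)\<^sup>2],
             vector [Q$1$1 * Q$2$1, Q$1$1 * Q$2$2 + Q$1$2 * Q$2$1, Q$1$2 * Q$2$2],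
             vector [(Q$2$1)\<^sup>2, 2 * Q$2$1 * Q$2$2, (Q$2$2)\<^sup>2]])"

definition Sigma_B ::
  "(real \<Rightarrow> real) \<Rightarrow> real^2^2 \<Rightarrow> real^2^2 \<Rightarrow> real^2^2 \<Rightarrow> nat \<Rightarrow> real^3^3" where
  "Sigma_B \<psi> P H \<Sigma> j = cal_P P ** G_mat \<psi> H \<Sigma> j ** transpose (cal_P P)"

end

theory Submission
  imports Defs
begin

text \<open>
  In the coordinates \<open>P\<^sup>-\<^sup>1\<close>, and divided by \<open>a\<close> to the powers \<open>h\<^sub>1\<close> and \<open>h\<^sub>2\<close>, the wavelet coefficients at
  scale \<open>a 2\<^sup>j\<close> form a stationary Gaussian sequence whose law does not depend on \<open>a\<close>. The vanishing
  moments of \<open>\<psi>\<close> make its covariances decay like a power below \<open>-1\<close>, so that they are summable.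
  A centered quadratic form \<open>V\<close> in a Gaussian vector has characteristic function \<open>\<phi>\<close> with
  \<open>\<phi>'(s) = - s Var(V) \<phi>(s)\<close> up to an error governed by the fluctuation of another quadratic form, which is
  small if the row sums of the covariance and of the form are. (The form has the same law at
  \<open>X + \<epsilon> X'\<close>, \<open>X'\<close> an independent copy of \<open>X\<close>, and at \<open>X\<close> times the root of \<open>1 + \<epsilon>\<^sup>2\<close>; compare the
  terms of order \<open>\<epsilon>\<^sup>2\<close>.) This gives the central limit theorem for the sample covariance \<open>b'\<close> of the
  rescaled sequence.

  Both ratios are slopes of eigenvectors, namely of \<open>P diag(e, 1) x diag(e, 1) P\<^sup>T\<close> for \<open>x = b'\<close> and \<open>x = b\<close>
  with \<open>e\<close> the power \<open>h\<^sub>1 - h\<^sub>2\<close> of \<open>a\<close>, which tends to \<open>0\<close>. At \<open>e = 0\<close> the matrix has rank one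
  and slope \<open>- p\<^sub>1\<^sub>2 / p\<^sub>2\<^sub>2\<close>; the term of order \<open>e\<close> of the slope is a multiple of \<open>x\<^sub>1\<^sub>2 / x\<^sub>2\<^sub>2\<close>, and
  the delta method applies to it.
\<close>

section \<open>Square-integrable random variables and normal laws\<close>

text \<open>The ratio is rewritten as \<open>slope\<close>, with the root in the denominator. In
  this form it is continuous at the rank-one limit: the denominator is there
  \<open>2 p22^2 b22\<close>, which is positive also if \<open>p12 = 0\<close> and the off-diagonal
  entry tends to 0. Consistency in both cases is then one continuous mapping argument. It rests on
  \<open>b22 > 0\<close>, which comes from writing the variance as an integral of the squared
  Fourier transform of the wavelet. The limit theorem divides a difference of slopes by the
  vanishing \<open>e\<close>, so an expansion would have to be uniform in \<open>e\<close>. Instead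
  the quadratic equation of the slope is written in \<open>t = (theta + p12 / p22) / e\<close>, in
  which it stays regular. Subtracting its deterministic from its random instance gives the error of
  \<open>t\<close> exactly, as a linear form in the errors of the sample covariance. The error of
  the entry (1,1) carries a factor \<open>e\<close> and drops out, hence the 0 in \<open>R\<close>.
  Only this one scalar form is needed in the limit, so characteristic functions suffice. Row sums
  measure the error because they are submultiplicative and, for the covariance, bounded in the
  sample size.\<close>

lemma square_integrable_measurable [measurable_dest]:
  "square_integrable M X \<Longrightarrow> X \<in> borel_measurable M"
  by (simp add: square_integrable_def)

lemma square_integrable_bound:
  fixes X :: "'a \<Rightarrow> 'b::euclidean_space" and Y :: "'a \<Rightarrow> 'c::euclidean_space"
  assumes "square_integrable M X" "Y \<in> borel_measurable M" "\<And>\<omega>. norm (Y \<omega>) \<le> c * norm (X \<omega>)"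
  shows "square_integrable M Y"
  unfolding square_integrable_def
proof
  show "Y \<in> borel_measurable M" by fact
  show "integrable M (\<lambda>\<omega>. (norm (Y \<omega>))\<^sup>2)"
  proof (rule Bochner_Integration.integrable_bound)
    show "integrable M (\<lambda>\<omega>. c\<^sup>2 * (norm (X \<omega>))\<^sup>2)"
      using assms(1) by (auto simp: square_integrable_def)
    show "(\<lambda>\<omega>. (norm (Y \<omega>))\<^sup>2) \<in> borel_measurable M" using assms(2) by measurable
    show "AE \<omega> in M. norm ((norm (Y \<omega>))\<^sup>2) \<le> norm (c\<^sup>2 * (norm (X \<omega>))\<^sup>2)"
      using power_mono[OF assms(3) norm_ge_zero, of _ 2] by (auto simp: power_mult_distrib)
  qed
qed

lemma square_integrable_zero [simp]: "square_integrable M (\<lambda>_. 0)"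
  by (simp add: square_integrable_def)

lemma square_integrable_add:
  fixes X Y :: "'a \<Rightarrow> 'b::euclidean_space"
  assumes X: "square_integrable M X" and Y: "square_integrable M Y"
  shows "square_integrable M (\<lambda>\<omega>. X \<omega> + Y \<omega>)"
  unfolding square_integrable_def
proof
  show m: "(\<lambda>\<omega>. X \<omega> + Y \<omega>) \<in> borel_measurable M" using X Y by measurable
  show "integrable M (\<lambda>\<omega>. (norm (X \<omega> + Y \<omega>))\<^sup>2)"
  proof (rule Bochner_Integration.integrable_bound)
    show "integrable M (\<lambda>\<omega>. 2 * (norm (X \<omega>))\<^sup>2 + 2 * (norm (Y \<omega>))\<^sup>2)"
      using X Y by (auto simp: square_integrable_def)
    show "(\<lambda>\<omega>. (norm (X \<omega> + Y \<omega>))\<^sup>2) \<in> borel_measurable M" using m by measurable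
    have "(norm (x + y))\<^sup>2 \<le> 2 * (norm x)\<^sup>2 + 2 * (norm y)\<^sup>2" for x y :: 'b
    proof -
      have "(norm (x + y))\<^sup>2 \<le> (norm x + norm y)\<^sup>2"
        by (intro power_mono norm_triangle_ineq) auto
      also have "\<dots> \<le> 2 * (norm x)\<^sup>2 + 2 * (norm y)\<^sup>2"
        using sum_squares_bound[of "norm x" "norm y"] by (simp add: power2_sum)
      finally show ?thesis .
    qed
    then show "AE \<omega> in M. norm ((norm (X \<omega> + Y \<omega>))\<^sup>2)
        \<le> norm (2 * (norm (X \<omega>))\<^sup>2 + 2 * (norm (Y \<omega>))\<^sup>2)" by auto
  qed
qed

lemma square_integrable_scaleR:
  "square_integrable M X \<Longrightarrow> square_integrable M (\<lambda>\<omega>. c *\<^sub>R X \<omega>)"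
  by (rule square_integrable_bound[where c="\<bar>c\<bar>"]) (auto simp: square_integrable_def)

lemma square_integrable_cmult:
  fixes X :: "'a \<Rightarrow> real"
  shows "square_integrable M X \<Longrightarrow> square_integrable M (\<lambda>\<omega>. c * X \<omega>)"
  using square_integrable_scaleR[of M X c] by simp

lemma square_integrable_diff:
  fixes X Y :: "'a \<Rightarrow> 'b::euclidean_space"
  assumes "square_integrable M X" "square_integrable M Y"
  shows "square_integrable M (\<lambda>\<omega>. X \<omega> - Y \<omega>)"
  using square_integrable_add[OF assms(1) square_integrable_scaleR[OF assms(2), of "-1"]] by simp

lemma square_integrable_sum:
  fixes X :: "'i \<Rightarrow> 'a \<Rightarrow> 'b::euclidean_space"
  assumes "\<And>i. i \<in> I \<Longrightarrow> square_integrable M (X i)"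
  shows "square_integrable M (\<lambda>\<omega>. \<Sum>i\<in>I. X i \<omega>)"
  using assms by (induction I rule: infinite_finite_induct) (auto intro: square_integrable_add)

lemma square_integrable_sum_list:
  fixes X :: "'i \<Rightarrow> 'a \<Rightarrow> 'b::euclidean_space"
  assumes "\<And>i. i \<in> set L \<Longrightarrow> square_integrable M (X i)"
  shows "square_integrable M (\<lambda>\<omega>. \<Sum>i\<leftarrow>L. X i \<omega>)"
  using assms by (induction L) (auto intro: square_integrable_add)

lemma square_integrable_inner_const:
  fixes X :: "'a \<Rightarrow> 'b::euclidean_space"
  assumes "square_integrable M X"
  shows "square_integrable M (\<lambda>\<omega>. c \<bullet> X \<omega>)"
  by (rule square_integrable_bound[OF assms, where c="norm c"])
    (use assms Cauchy_Schwarz_ineq2 in \<open>auto simp: square_integrable_def\<close>)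

lemma square_integrable_nth:
  fixes X :: "'a \<Rightarrow> real^'n"
  assumes "square_integrable M X"
  shows "square_integrable M (\<lambda>\<omega>. X \<omega> $ i)"
  using square_integrable_inner_const[OF assms, of "axis i 1"] by (simp add: inner_axis' )

lemma integrable_inner_square_integrable:
  fixes X Y :: "'a \<Rightarrow> 'b::euclidean_space"
  assumes X: "square_integrable M X" and Y: "square_integrable M Y"
  shows "integrable M (\<lambda>\<omega>. X \<omega> \<bullet> Y \<omega>)"
proof (rule Bochner_Integration.integrable_bound)
  show "integrable M (\<lambda>\<omega>. (norm (X \<omega>))\<^sup>2 + (norm (Y \<omega>))\<^sup>2)"
    using X Y by (auto simp: square_integrable_def)
  show "(\<lambda>\<omega>. X \<omega> \<bullet> Y \<omega>) \<in> borel_measurable M" using X Y by measurable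
  have "\<bar>x \<bullet> y\<bar> \<le> (norm x)\<^sup>2 + (norm y)\<^sup>2" for x y :: 'b
    using Cauchy_Schwarz_ineq2[of x y] sum_squares_bound[of "norm x" "norm y"]
      zero_le_power2[of "norm x"] zero_le_power2[of "norm y"]
      mult_nonneg_nonneg[OF norm_ge_zero norm_ge_zero, of x y] by linarith
  then show "AE \<omega> in M. norm (X \<omega> \<bullet> Y \<omega>) \<le> norm ((norm (X \<omega>))\<^sup>2 + (norm (Y \<omega>))\<^sup>2)" by auto
qed

lemma integrable_mult_square_integrable:
  fixes X Y :: "'a \<Rightarrow> real"
  assumes "square_integrable M X" "square_integrable M Y"
  shows "integrable M (\<lambda>\<omega>. X \<omega> * Y \<omega>)"
  using integrable_inner_square_integrable[OF assms] by (simp add: inner_real_def)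

lemma l2norm_nonneg [simp]: "0 \<le> l2norm M X"
  by (simp add: l2norm_def)

lemma l2norm_sq: "(l2norm M X)\<^sup>2 = (\<integral>\<omega>. (norm (X \<omega>))\<^sup>2 \<partial>M)"
  by (simp add: l2norm_def)

lemma inner_le_l2norm:
  fixes X Y :: "'a \<Rightarrow> 'b::euclidean_space"
  assumes X: "square_integrable M X" and Y: "square_integrable M Y"
  shows "\<bar>\<integral>\<omega>. X \<omega> \<bullet> Y \<omega> \<partial>M\<bar> \<le> l2norm M X * l2norm M Y"
proof -
  \<comment> \<open>The squared norm of \<open>X - t Y\<close> is a nonnegative quadratic polynomial
    in \<open>t\<close>; the claim is that its discriminant is not positive.\<close>
  have quad: "0 \<le> (l2norm M X)\<^sup>2 - 2 * t * (\<integral>\<omega>. X \<omega> \<bullet> Y \<omega> \<partial>M) + t\<^sup>2 * (l2norm M Y)\<^sup>2" for t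
  proof -
    have i: "integrable M (\<lambda>\<omega>. (norm (X \<omega>))\<^sup>2)" "integrable M (\<lambda>\<omega>. (norm (Y \<omega>))\<^sup>2)"
      "integrable M (\<lambda>\<omega>. X \<omega> \<bullet> Y \<omega>)"
      using X Y integrable_inner_square_integrable[OF X Y] by (auto simp: square_integrable_def)
    have "0 \<le> (\<integral>\<omega>. (norm (X \<omega> - t *\<^sub>R Y \<omega>))\<^sup>2 \<partial>M)" by simp
    also have "\<dots> = (\<integral>\<omega>. (norm (X \<omega>))\<^sup>2 - (2 * t) * (X \<omega> \<bullet> Y \<omega>) + t\<^sup>2 * (norm (Y \<omega>))\<^sup>2 \<partial>M)"
      by (intro Bochner_Integration.integral_cong refl)
        (simp add: power2_norm_eq_inner inner_diff inner_commute algebra_simps, simp add: power2_eq_square)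
    also have "\<dots> = (l2norm M X)\<^sup>2 - 2 * t * (\<integral>\<omega>. X \<omega> \<bullet> Y \<omega> \<partial>M) + t\<^sup>2 * (l2norm M Y)\<^sup>2"
      using i by (simp add: l2norm_sq)
    finally show ?thesis .
  qed
  define x where "x = (\<integral>\<omega>. X \<omega> \<bullet> Y \<omega> \<partial>M)"
  have "x\<^sup>2 \<le> (l2norm M X)\<^sup>2 * (l2norm M Y)\<^sup>2"
  proof (cases "l2norm M Y = 0")
    case True
    have "x = 0"
    proof (rule ccontr)
      assume "x \<noteq> 0"
      \<comment> \<open>If \<open>Y\<close> has norm 0 the polynomial is affine in \<open>t\<close>,
        and at this \<open>t\<close> it equals -1.\<close>
      then show False using quad[of "((l2norm M X)\<^sup>2 + 1) / (2 * x)"] True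
        by (simp add: x_def[symmetric] field_simps)
    qed
    then show ?thesis by simp
  next
    case False
    define d where "d = (l2norm M Y)\<^sup>2"
    have d: "d > 0" using False by (simp add: d_def)
    have "0 \<le> (l2norm M X)\<^sup>2 - x\<^sup>2 / d"
    proof -
      have "(x / d)\<^sup>2 * d = x\<^sup>2 / d" using d by (simp add: power2_eq_square)
      moreover have "2 * (x / d) * x = 2 * (x\<^sup>2 / d)" by (simp add: power2_eq_square)
      ultimately show ?thesis
        using quad[of "x / d"] unfolding x_def[symmetric] d_def[symmetric] by linarith
    qed
    then show ?thesis using d by (simp add: d_def[symmetric] field_simps)
  qed
  then have "\<bar>x\<bar> \<le> \<bar>l2norm M X * l2norm M Y\<bar>"
    unfolding power_mult_distrib[symmetric] by (rule abs_le_square_iff[THEN iffD2])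
  then show ?thesis by (simp add: x_def abs_mult)
qed

lemma l2norm_triangle:
  fixes X Y :: "'a \<Rightarrow> 'b::euclidean_space"
  assumes X: "square_integrable M X" and Y: "square_integrable M Y"
  shows "l2norm M (\<lambda>\<omega>. X \<omega> + Y \<omega>) \<le> l2norm M X + l2norm M Y"
proof (rule power2_le_imp_le)
  have i: "integrable M (\<lambda>\<omega>. (norm (X \<omega>))\<^sup>2)" "integrable M (\<lambda>\<omega>. (norm (Y \<omega>))\<^sup>2)"
    "integrable M (\<lambda>\<omega>. X \<omega> \<bullet> Y \<omega>)"
    using X Y integrable_inner_square_integrable[OF X Y] by (auto simp: square_integrable_def)
  have "(l2norm M (\<lambda>\<omega>. X \<omega> + Y \<omega>))\<^sup>2 = (\<integral>\<omega>. (norm (X \<omega>))\<^sup>2 + 2 * (X \<omega> \<bullet> Y \<omega>) + (norm (Y \<omega>))\<^sup>2 \<partial>M)"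
    unfolding l2norm_sq by (intro Bochner_Integration.integral_cong refl)
      (simp add: power2_norm_eq_inner inner_add inner_commute)
  also have "\<dots> = (l2norm M X)\<^sup>2 + 2 * (\<integral>\<omega>. X \<omega> \<bullet> Y \<omega> \<partial>M) + (l2norm M Y)\<^sup>2"
    using i by (simp add: l2norm_sq)
  also have "\<dots> \<le> (l2norm M X + l2norm M Y)\<^sup>2"
    using inner_le_l2norm[OF X Y] by (simp add: power2_sum abs_le_iff)
  finally show "(l2norm M (\<lambda>\<omega>. X \<omega> + Y \<omega>))\<^sup>2 \<le> (l2norm M X + l2norm M Y)\<^sup>2" .
qed simp

lemma l2norm_minus: "l2norm M (\<lambda>\<omega>. X \<omega> - Y \<omega>) = l2norm M (\<lambda>\<omega>. Y \<omega> - X \<omega>)"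
  by (simp add: l2norm_def norm_minus_commute)

text \<open>The image of the standard normal law under a scaling covers the point mass at
  \<open>v = 0\<close> too, so moments and characteristic functions need no case distinction
  later.\<close>

lemma centered_normal_eq_distr:
  assumes "v \<ge> 0"
  shows "centered_normal v = distr std_normal_distribution borel (\<lambda>x. sqrt v * x)"
proof (cases "v = 0")
  case True
  interpret N: prob_space std_normal_distribution by (rule prob_space_normal_density) simp
  have "distr std_normal_distribution borel (\<lambda>x. 0::real) = return borel 0"
    using N.prob_space_axioms
    by (intro measure_eqI)
      (auto simp: emeasure_distr indicator_def N.emeasure_space_1 space_density
        intro!: arg_cong2[where f=emeasure])
  then show ?thesis using True by (simp add: centered_normal_def)
next
  case False
  interpret N: prob_space std_normal_distribution by (rule prob_space_normal_density) simp
  have "distributed std_normal_distribution lborel (\<lambda>x. x) std_normal_density"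
    unfolding distributed_def by (auto simp: distr_id2)
  from N.normal_density_affine[OF this, of "sqrt v" 0] assms False
  have "distr std_normal_distribution lborel (\<lambda>x. sqrt v * x)
      = density lborel (normal_density 0 (sqrt v))"
    by (simp add: distributed_def mult.commute)
  moreover have "distr std_normal_distribution lborel (\<lambda>x. sqrt v * x)
      = distr std_normal_distribution borel (\<lambda>x. sqrt v * x)"
    by (intro distr_cong) auto
  ultimately show ?thesis using False by (simp add: centered_normal_def)
qed

lemma real_distribution_centered_normal:
  assumes "v \<ge> 0"
  shows "real_distribution (centered_normal v)"
proof -
  interpret N: prob_space std_normal_distribution by (rule prob_space_normal_density) simp
  show ?thesis unfolding centered_normal_eq_distr[OF assms]
    by (intro N.real_distribution_distr) auto
qed

lemma char_centered_normal:
  assumes "v \<ge> 0"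
  shows "char (centered_normal v) t = complex_of_real (exp (- (v * t\<^sup>2) / 2))"
proof -
  have "char (centered_normal v) t = (CLINT x|std_normal_distribution. iexp (t * (sqrt v * x)))"
    unfolding char_def centered_normal_eq_distr[OF assms] by (subst integral_distr) auto
  also have "\<dots> = char std_normal_distribution (t * sqrt v)"
    by (simp add: char_def mult.assoc)
  finally show ?thesis
    using assms by (simp add: char_std_normal_distribution power_mult_distrib mult.commute)
qed

lemma integrable_centered_normal_power:
  assumes "v \<ge> 0"
  shows "integrable (centered_normal v) (\<lambda>x. x ^ k)"
  unfolding centered_normal_eq_distr[OF assms]
  by (subst integrable_distr_eq)
    (auto simp: power_mult_distrib intro!: integrable_std_normal_distribution_moment)

lemma second_moment_centered_normal:
  assumes "v \<ge> 0"
  shows "(\<integral>x. x\<^sup>2 \<partial>centered_normal v) = v"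
  unfolding centered_normal_eq_distr[OF assms]
  using assms std_normal_distribution_even_moments(1)[of 1]
  by (subst integral_distr) (auto simp: power_mult_distrib)

lemma (in prob_space) integral_iexp_distr:
  assumes [measurable]: "X \<in> borel_measurable M"
  shows "char (distr M borel X) t = (CLINT \<omega>|M. iexp (t * X \<omega>))"
  unfolding char_def by (subst integral_distr) auto

lemma cmod_iexp [simp]: "cmod (iexp x) = 1"
  by (simp add: norm_exp_eq_Re)

text \<open>Weights of total mass \<open>m > 0\<close> become probability densities after division
  by \<open>m\<close>, and uniqueness of characteristic functions applies to the images of these
  measures. The underlying measures are arbitrary: the positive and negative parts of the wavelet
  will serve as weights on the line.\<close>

lemma fourier_determines_nonneg:
  fixes Z :: "'a \<Rightarrow> real" and Z' :: "'b \<Rightarrow> real"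
  assumes Z: "integrable M Z" "\<And>\<omega>. Z \<omega> \<ge> 0" and Z': "integrable N Z'" "\<And>\<omega>. Z' \<omega> \<ge> 0"
    and [measurable]: "X \<in> borel_measurable M" "X' \<in> borel_measurable N" "A \<in> sets borel"
    and eq: "\<And>u. (CLINT \<omega>|M. Z \<omega> * iexp (u * X \<omega>)) = (CLINT \<omega>|N. Z' \<omega> * iexp (u * X' \<omega>))"
  shows "(\<integral>\<omega>. Z \<omega> * indicator A (X \<omega>) \<partial>M) = (\<integral>\<omega>. Z' \<omega> * indicator A (X' \<omega>) \<partial>N)"
proof -
  have [measurable]: "Z \<in> borel_measurable M" "Z' \<in> borel_measurable N" using Z Z' by auto
  define m where "m = (\<integral>\<omega>. Z \<omega> \<partial>M)"
  \<comment> \<open>At \<open>u = 0\<close> the hypothesis compares the total masses.\<close>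
  have "complex_of_real m = complex_of_real (\<integral>\<omega>. Z' \<omega> \<partial>N)"
    using eq[of 0] by (simp add: m_def)
  then have m': "m = (\<integral>\<omega>. Z' \<omega> \<partial>N)" by (simp only: of_real_eq_iff)
  have m0: "m \<ge> 0" unfolding m_def using Z by simp
  show ?thesis
  proof (cases "m = 0")
    case True
    then have "AE \<omega> in M. Z \<omega> = 0" "AE \<omega> in N. Z' \<omega> = 0"
      using Z Z' m' integral_nonneg_eq_0_iff_AE[of M Z] integral_nonneg_eq_0_iff_AE[of N Z']
      by (auto simp: m_def)
    then have "AE \<omega> in M. Z \<omega> * indicator A (X \<omega>) = 0" "AE \<omega> in N. Z' \<omega> * indicator A (X' \<omega>) = 0"
      by auto
    then show ?thesis by (simp add: integral_eq_zero_AE)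
  next
    case False
    with m0 have mp: "m > 0" by simp
    \<comment> \<open>Both sides need the same three facts on the normalized weighted law: it is a
      distribution, its characteristic function, its mass on \<open>A\<close>.\<close>
    have dist: "real_distribution (distr (density K (\<lambda>\<omega>. ennreal (W \<omega> / m))) borel V) \<and>
        char (distr (density K (\<lambda>\<omega>. ennreal (W \<omega> / m))) borel V) u
          = (CLINT \<omega>|K. W \<omega> * iexp (u * V \<omega>)) / m \<and>
        measure (distr (density K (\<lambda>\<omega>. ennreal (W \<omega> / m))) borel V) A
          = (\<integral>\<omega>. W \<omega> * indicator A (V \<omega>) \<partial>K) / m"
      if W: "integrable K W" "\<And>\<omega>. W \<omega> \<ge> 0" "(\<integral>\<omega>. W \<omega> \<partial>K) = m"
        and [measurable]: "V \<in> borel_measurable K"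
      for W V u and K :: "'c measure"
    proof -
      have [measurable]: "W \<in> borel_measurable K" using W by auto
      have p: "prob_space (density K (\<lambda>\<omega>. ennreal (W \<omega> / m)))"
      proof
        have "emeasure (density K (\<lambda>\<omega>. ennreal (W \<omega> / m)))
            (space (density K (\<lambda>\<omega>. ennreal (W \<omega> / m)))) = (\<integral>\<^sup>+\<omega>. ennreal (W \<omega> / m) \<partial>K)"
          by (subst emeasure_density) (auto intro!: nn_integral_cong)
        also have "\<dots> = ennreal (\<integral>\<omega>. W \<omega> / m \<partial>K)"
          using W mp by (intro nn_integral_eq_integral) auto
        finally show "emeasure (density K (\<lambda>\<omega>. ennreal (W \<omega> / m)))
            (space (density K (\<lambda>\<omega>. ennreal (W \<omega> / m)))) = 1"
          using W mp by simp
      qed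
      then interpret D: prob_space "density K (\<lambda>\<omega>. ennreal (W \<omega> / m))" .
      interpret E: real_distribution "distr (density K (\<lambda>\<omega>. ennreal (W \<omega> / m))) borel V"
        by (rule D.real_distribution_distr) auto
      have "char (distr (density K (\<lambda>\<omega>. ennreal (W \<omega> / m))) borel V) u
          = (CLINT \<omega>|K. (W \<omega> / m) *\<^sub>R iexp (u * V \<omega>))"
        using W mp unfolding char_def by (subst integral_distr) (auto simp: integral_density)
      also have "\<dots> = (CLINT \<omega>|K. (W \<omega> * iexp (u * V \<omega>)) / m)"
        by (simp add: scaleR_conv_of_real)
      finally have c: "char (distr (density K (\<lambda>\<omega>. ennreal (W \<omega> / m))) borel V) u
          = (CLINT \<omega>|K. W \<omega> * iexp (u * V \<omega>)) / m" by simp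
      have "measure (distr (density K (\<lambda>\<omega>. ennreal (W \<omega> / m))) borel V) A
          = (\<integral>x. indicator A x \<partial>(distr (density K (\<lambda>\<omega>. ennreal (W \<omega> / m))) borel V))"
        by simp
      also have "\<dots> = (\<integral>\<omega>. (W \<omega> / m) *\<^sub>R indicator A (V \<omega>) \<partial>K)"
        using W mp by (subst integral_distr) (auto simp: integral_density)
      finally show ?thesis using c E.real_distribution_axioms by simp
    qed
    let ?P = "distr (density M (\<lambda>\<omega>. ennreal (Z \<omega> / m))) borel X"
    let ?Q = "distr (density N (\<lambda>\<omega>. ennreal (Z' \<omega> / m))) borel X'"
    have "?P = ?Q"
      using dist[where K1=M and W1=Z and V1=X] dist[where K1=N and W1=Z' and V1=X'] Z Z' m' eq
      by (intro Levy_uniqueness ext) (auto simp: m_def)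
    then have "(\<integral>\<omega>. Z \<omega> * indicator A (X \<omega>) \<partial>M) / m = (\<integral>\<omega>. Z' \<omega> * indicator A (X' \<omega>) \<partial>N) / m"
      using dist[where K1=M and W1=Z and V1=X] dist[where K1=N and W1=Z' and V1=X'] Z Z' m' by (auto simp: m_def)
    then show ?thesis using mp by simp
  qed
qed

section \<open>Uniqueness of characteristic functions in several variables\<close>

lemma borel_measurable_cnj [measurable]: "cnj \<in> borel_measurable borel"
  by (intro borel_measurable_continuous_onI continuous_intros)

lemma cmod_prod_indicator_le: "cmod (\<Prod>i\<in>J. complex_of_real (indicator (A i) (X i))) \<le> 1"
  unfolding prod_norm[symmetric] by (intro prod_le_1) (auto simp: indicator_def)

text \<open>For \<open>w\<close> of modulus 1, \<open>Re (w * Z) + 1\<close> is a nonnegative weight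
  whose transform combines those of \<open>Z\<close>, of its conjugate and of 1. The choices
  \<open>w = 1\<close> and \<open>w = - \<i>\<close> recover the real and the imaginary
  part.\<close>

lemma fourier_determines_bounded:
  fixes Z :: "'a \<Rightarrow> complex" and Z' :: "'b \<Rightarrow> complex"
  assumes "prob_space M" "prob_space N"
    and [measurable]: "Z \<in> borel_measurable M" "Z' \<in> borel_measurable N"
      "X \<in> borel_measurable M" "X' \<in> borel_measurable N" "A \<in> sets borel"
    and le1: "\<And>\<omega>. cmod (Z \<omega>) \<le> 1" "\<And>\<omega>. cmod (Z' \<omega>) \<le> 1"
    and eq: "\<And>u. (CLINT \<omega>|M. Z \<omega> * iexp (u * X \<omega>)) = (CLINT \<omega>|N. Z' \<omega> * iexp (u * X' \<omega>))"
    and eq1: "\<And>u. (CLINT \<omega>|M. iexp (u * X \<omega>)) = (CLINT \<omega>|N. iexp (u * X' \<omega>))"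
  shows "(CLINT \<omega>|M. Z \<omega> * indicator A (X \<omega>)) = (CLINT \<omega>|N. Z' \<omega> * indicator A (X' \<omega>))"
proof -
  interpret M: prob_space M by fact
  interpret N: prob_space N by fact
  have intM: "integrable M f" if "f \<in> borel_measurable M" "\<And>\<omega>. cmod (f \<omega>) \<le> 1" for f :: "'a \<Rightarrow> complex"
    using that by (intro M.integrable_const_bound[where B=1]) auto
  have intN: "integrable N f" if "f \<in> borel_measurable N" "\<And>\<omega>. cmod (f \<omega>) \<le> 1" for f :: "'b \<Rightarrow> complex"
    using that by (intro N.integrable_const_bound[where B=1]) auto
  have one: "(\<integral>\<omega>. 1 * indicator A (X \<omega>) \<partial>M) = (\<integral>\<omega>. 1 * indicator A (X' \<omega>) \<partial>N :: real)"
    using eq1 by (intro fourier_determines_nonneg) auto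
  \<comment> \<open>The transform of the conjugate weight at \<open>u\<close> is the conjugate of
    the transform of \<open>Z\<close> at \<open>- u\<close>.\<close>
  have eqc: "(CLINT \<omega>|M. cnj (Z \<omega>) * iexp (u * X \<omega>)) = (CLINT \<omega>|N. cnj (Z' \<omega>) * iexp (u * X' \<omega>))" for u
  proof -
    have "(CLINT \<omega>|M. cnj (Z \<omega>) * iexp (u * X \<omega>)) = cnj (CLINT \<omega>|M. Z \<omega> * iexp (- u * X \<omega>))"
      unfolding Bochner_Integration.integral_cnj[symmetric] by (simp add: exp_cnj)
    also have "\<dots> = (CLINT \<omega>|N. cnj (Z' \<omega>) * iexp (u * X' \<omega>))"
      unfolding eq unfolding Bochner_Integration.integral_cnj[symmetric] by (simp add: exp_cnj)
    finally show ?thesis .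
  qed
  have re: "(\<integral>\<omega>. Re (w * Z \<omega>) * indicator A (X \<omega>) \<partial>M)
          = (\<integral>\<omega>. Re (w * Z' \<omega>) * indicator A (X' \<omega>) \<partial>N)" if w: "cmod w = 1" for w
  proof -
    have b: "\<bar>Re (w * Z \<omega>)\<bar> \<le> 1" "\<bar>Re (w * Z' \<omega>')\<bar> \<le> 1" for \<omega> \<omega>'
      using le1(1)[of \<omega>] le1(2)[of \<omega>'] abs_Re_le_cmod[of "w * Z \<omega>"] abs_Re_le_cmod[of "w * Z' \<omega>'"] w
      by (auto simp: norm_mult)
    have conv: "complex_of_real (Re (w * z) + 1) * e = w / 2 * (z * e) + cnj w / 2 * (cnj z * e) + e" for z e
    proof -
      have "complex_of_real (Re (w * z)) = (w * z + cnj w * cnj z) / 2"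
        using complex_add_cnj[of "w * z"] by simp
      then show ?thesis by (simp add: field_simps)
    qed
    have RM: "(CLINT \<omega>|M. complex_of_real (Re (w * Z \<omega>) + 1) * iexp (u * X \<omega>))
      = w / 2 * (CLINT \<omega>|M. Z \<omega> * iexp (u * X \<omega>)) + cnj w / 2 * (CLINT \<omega>|M. cnj (Z \<omega>) * iexp (u * X \<omega>))
        + (CLINT \<omega>|M. iexp (u * X \<omega>))" for u
    proof -
      have "integrable M (\<lambda>\<omega>. Z \<omega> * iexp (u * X \<omega>))"
        using le1(1) by (intro intM) (auto simp: norm_mult)
      moreover have "integrable M (\<lambda>\<omega>. cnj (Z \<omega>) * iexp (u * X \<omega>))"
        using le1(1) by (intro intM) (auto simp: norm_mult)
      moreover have "integrable M (\<lambda>\<omega>. iexp (u * X \<omega>))" by (intro intM) auto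
      ultimately show ?thesis unfolding conv by simp
    qed
    have RN: "(CLINT \<omega>|N. complex_of_real (Re (w * Z' \<omega>) + 1) * iexp (u * X' \<omega>))
      = w / 2 * (CLINT \<omega>|N. Z' \<omega> * iexp (u * X' \<omega>)) + cnj w / 2 * (CLINT \<omega>|N. cnj (Z' \<omega>) * iexp (u * X' \<omega>))
        + (CLINT \<omega>|N. iexp (u * X' \<omega>))" for u
    proof -
      have "integrable N (\<lambda>\<omega>. Z' \<omega> * iexp (u * X' \<omega>))"
        using le1(2) by (intro intN) (auto simp: norm_mult)
      moreover have "integrable N (\<lambda>\<omega>. cnj (Z' \<omega>) * iexp (u * X' \<omega>))"
        using le1(2) by (intro intN) (auto simp: norm_mult)
      moreover have "integrable N (\<lambda>\<omega>. iexp (u * X' \<omega>))" by (intro intN) auto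
      ultimately show ?thesis unfolding conv by simp
    qed
    have "(\<integral>\<omega>. (Re (w * Z \<omega>) + 1) * indicator A (X \<omega>) \<partial>M)
        = (\<integral>\<omega>. (Re (w * Z' \<omega>) + 1) * indicator A (X' \<omega>) \<partial>N)"
    proof (rule fourier_determines_nonneg)
      show "integrable M (\<lambda>\<omega>. Re (w * Z \<omega>) + 1)" "integrable N (\<lambda>\<omega>. Re (w * Z' \<omega>) + 1)"
        using b by (intro Bochner_Integration.integrable_add M.integrable_const_bound[where B=1]
            N.integrable_const_bound[where B=1], auto)+
      show "0 \<le> Re (w * Z \<omega>) + 1" "0 \<le> Re (w * Z' \<omega>') + 1" for \<omega> \<omega>'
        using b(1)[of \<omega>] b(2)[of \<omega>'] by (auto simp: abs_le_iff)
    qed (auto simp only: RM RN eq eqc eq1 assms)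
    moreover have "(\<integral>\<omega>. (Re (w * Z \<omega>) + 1) * indicator A (X \<omega>) \<partial>M)
        = (\<integral>\<omega>. Re (w * Z \<omega>) * indicator A (X \<omega>) \<partial>M) + (\<integral>\<omega>. 1 * indicator A (X \<omega>) \<partial>M)"
      unfolding distrib_right using b
      by (intro Bochner_Integration.integral_add M.integrable_const_bound[where B=1])
        (auto simp: indicator_def)
    moreover have "(\<integral>\<omega>. (Re (w * Z' \<omega>) + 1) * indicator A (X' \<omega>) \<partial>N)
        = (\<integral>\<omega>. Re (w * Z' \<omega>) * indicator A (X' \<omega>) \<partial>N) + (\<integral>\<omega>. 1 * indicator A (X' \<omega>) \<partial>N)"
      unfolding distrib_right using b
      by (intro Bochner_Integration.integral_add N.integrable_const_bound[where B=1])
        (auto simp: indicator_def)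
    ultimately show ?thesis using one by simp
  qed
  have iM: "integrable M (\<lambda>\<omega>. Z \<omega> * indicator A (X \<omega>))"
    using le1(1) by (intro intM) (auto simp: indicator_def)
  have iN: "integrable N (\<lambda>\<omega>. Z' \<omega> * indicator A (X' \<omega>))"
    using le1(2) by (intro intN) (auto simp: indicator_def)
  have ri: "Re (z * indicator A x) = Re (1 * z) * indicator A x"
    "Im (z * indicator A x) = Re (- \<i> * z) * indicator A x" for z and x :: real
    by (auto simp: indicator_def)
  show ?thesis
  proof (rule complex_eqI)
    show "Re (CLINT \<omega>|M. Z \<omega> * indicator A (X \<omega>)) = Re (CLINT \<omega>|N. Z' \<omega> * indicator A (X' \<omega>))"
      unfolding integral_Re[OF iM, symmetric] integral_Re[OF iN, symmetric] ri by (rule re) simp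
    show "Im (CLINT \<omega>|M. Z \<omega> * indicator A (X \<omega>)) = Im (CLINT \<omega>|N. Z' \<omega> * indicator A (X' \<omega>))"
      unfolding integral_Im[OF iM, symmetric] integral_Im[OF iN, symmetric] ri by (rule re) simp
  qed
qed

text \<open>Exponential factors are exchanged for indicators one coordinate at a time. Moving
  coordinate \<open>j\<close> over to the indicators is Fourier uniqueness in one dimension, with
  all remaining factors as a complex weight of modulus at most 1.\<close>

lemma cramer_wold:
  fixes X :: "'i \<Rightarrow> 'a \<Rightarrow> real" and Y :: "'i \<Rightarrow> 'b \<Rightarrow> real"
  assumes "prob_space M" "prob_space N" and fin: "finite I"
    and X: "\<And>i. i \<in> I \<Longrightarrow> X i \<in> borel_measurable M" and Y: "\<And>i. i \<in> I \<Longrightarrow> Y i \<in> borel_measurable N"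
    and eq: "\<And>c. (CLINT \<omega>|M. iexp (\<Sum>i\<in>I. c i * X i \<omega>)) = (CLINT \<omega>|N. iexp (\<Sum>i\<in>I. c i * Y i \<omega>))"
  shows "distr M (PiM I (\<lambda>_. borel)) (\<lambda>\<omega>. \<lambda>i\<in>I. X i \<omega>) = distr N (PiM I (\<lambda>_. borel)) (\<lambda>\<omega>. \<lambda>i\<in>I. Y i \<omega>)"
proof -
  interpret M: prob_space M by fact
  interpret N: prob_space N by fact
  have key: "(CLINT \<omega>|M. (\<Prod>i\<in>J. indicator (A i) (X i \<omega>)) * iexp (\<Sum>i\<in>I - J. c i * X i \<omega>))
           = (CLINT \<omega>|N. (\<Prod>i\<in>J. indicator (A i) (Y i \<omega>)) * iexp (\<Sum>i\<in>I - J. c i * Y i \<omega>))"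
    if "J \<subseteq> I" "\<And>i. i \<in> J \<Longrightarrow> A i \<in> sets borel" for J A c
    using finite_subset[OF that(1) fin] that
  proof (induction J arbitrary: c rule: finite_induct)
    case empty
    then show ?case using eq by simp
  next
    case (insert j J)
    note [measurable] = X Y
    have A[measurable]: "\<And>i. i \<in> J \<Longrightarrow> A i \<in> sets borel" "A j \<in> sets borel" using insert by auto
    have JI: "J \<subseteq> I" "j \<in> I" using insert by auto
    have XJ[measurable]: "\<And>i. i \<in> J \<Longrightarrow> X i \<in> borel_measurable M" "X j \<in> borel_measurable M"
      "\<And>i. i \<in> J \<Longrightarrow> Y i \<in> borel_measurable N" "Y j \<in> borel_measurable N" using JI X Y by auto
    have ZM: "(\<lambda>\<omega>. (\<Prod>i\<in>J. complex_of_real (indicator (A i) (X i \<omega>))) * iexp (\<Sum>i\<in>I - insert j J. c i * X i \<omega>))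
        \<in> borel_measurable M"
      using A(1) XJ(1) X by (intro borel_measurable_times borel_measurable_prod) (auto intro!: borel_measurable_sum)
    have ZN: "(\<lambda>\<omega>. (\<Prod>i\<in>J. complex_of_real (indicator (A i) (Y i \<omega>))) * iexp (\<Sum>i\<in>I - insert j J. c i * Y i \<omega>))
        \<in> borel_measurable N"
      using A(1) XJ(3) Y by (intro borel_measurable_times borel_measurable_prod) (auto intro!: borel_measurable_sum)
    \<comment> \<open>With \<open>c j\<close> replaced by a free \<open>u\<close>, the induction
      hypothesis becomes an equality of weighted Fourier transforms in coordinate
      \<open>j\<close>.\<close>
    have split: "(\<Sum>i\<in>I - J. (c(j := u)) i * x i) = (\<Sum>i\<in>I - insert j J. c i * x i) + u * x j" for u and x :: "'i \<Rightarrow> real"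
    proof -
      have IJ: "I - J - {j} = I - insert j J" by auto
      have "(\<Sum>i\<in>I - J. (c(j := u)) i * x i)
          = u * x j + (\<Sum>i\<in>I - insert j J. (c(j := u)) i * x i)"
        using fin JI insert.hyps by (subst sum.remove[of _ j]) (auto simp: IJ)
      also have "(\<Sum>i\<in>I - insert j J. (c(j := u)) i * x i) = (\<Sum>i\<in>I - insert j J. c i * x i)"
        by (intro sum.cong) auto
      finally show ?thesis by simp
    qed
    have one: "(\<Sum>i\<in>I. (if i = j then u else 0) * x i) = u * x j" for u and x :: "'i \<Rightarrow> real"
      using JI fin by (subst sum.remove[of I j]) (auto intro!: sum.neutral)
    have "(CLINT \<omega>|M. ((\<Prod>i\<in>J. indicator (A i) (X i \<omega>)) * iexp (\<Sum>i\<in>I - insert j J. c i * X i \<omega>)) * indicator (A j) (X j \<omega>))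
      = (CLINT \<omega>|N. ((\<Prod>i\<in>J. indicator (A i) (Y i \<omega>)) * iexp (\<Sum>i\<in>I - insert j J. c i * Y i \<omega>)) * indicator (A j) (Y j \<omega>))"
    proof (rule fourier_determines_bounded[OF assms(1,2)])
      show "cmod ((\<Prod>i\<in>J. indicator (A i) (X i \<omega>)) * iexp (\<Sum>i\<in>I - insert j J. c i * X i \<omega>)) \<le> 1" for \<omega>
        using cmod_prod_indicator_le[of A "\<lambda>i. X i \<omega>" J] by (simp add: norm_mult of_real_indicator)
      show "cmod ((\<Prod>i\<in>J. indicator (A i) (Y i \<omega>)) * iexp (\<Sum>i\<in>I - insert j J. c i * Y i \<omega>)) \<le> 1" for \<omega>
        using cmod_prod_indicator_le[of A "\<lambda>i. Y i \<omega>" J] by (simp add: norm_mult of_real_indicator)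
      show "(CLINT \<omega>|M. ((\<Prod>i\<in>J. indicator (A i) (X i \<omega>)) * iexp (\<Sum>i\<in>I - insert j J. c i * X i \<omega>)) * iexp (u * X j \<omega>))
        = (CLINT \<omega>|N. ((\<Prod>i\<in>J. indicator (A i) (Y i \<omega>)) * iexp (\<Sum>i\<in>I - insert j J. c i * Y i \<omega>)) * iexp (u * Y j \<omega>))" for u
        using insert.IH[OF JI(1) A(1), of "c(j := u)"] unfolding split
        by (simp add: distrib_left exp_add mult.assoc)
      show "(CLINT \<omega>|M. iexp (u * X j \<omega>)) = (CLINT \<omega>|N. iexp (u * Y j \<omega>))" for u
        using eq[of "\<lambda>i. if i = j then u else 0"] unfolding one .
    qed (use ZM ZN in \<open>auto simp: of_real_indicator\<close>)
    then show ?case using insert.hyps by (simp add: mult_ac)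
  qed
  have XI[measurable]: "(\<lambda>\<omega>. \<lambda>i\<in>I. X i \<omega>) \<in> measurable M (PiM I (\<lambda>_. borel))"
    "(\<lambda>\<omega>. \<lambda>i\<in>I. Y i \<omega>) \<in> measurable N (PiM I (\<lambda>_. borel))" using X Y by auto
  show ?thesis
  proof (rule measure_eqI_PiM_finite[OF fin])
    fix A assume A: "\<And>i. i \<in> I \<Longrightarrow> A i \<in> sets (borel :: real measure)"
    have PA: "Pi\<^sub>E I A \<in> sets (PiM I (\<lambda>_. borel))" using A fin by (intro sets_PiM_I_finite) auto
    have ind: "indicator (Pi\<^sub>E I A) (\<lambda>i\<in>I. x i) = (\<Prod>i\<in>I. indicator (A i) (x i) :: real)" for x :: "'i \<Rightarrow> real"
      using fin by (auto simp: indicator_def PiE_iff prod_zero_iff intro!: prod.neutral[symmetric])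
    have "complex_of_real (measure (distr M (PiM I (\<lambda>_. borel)) (\<lambda>\<omega>. \<lambda>i\<in>I. X i \<omega>)) (Pi\<^sub>E I A))
        = complex_of_real (\<integral>x. indicator (Pi\<^sub>E I A) x \<partial>(distr M (PiM I (\<lambda>_. borel)) (\<lambda>\<omega>. \<lambda>i\<in>I. X i \<omega>)))"
      using PA by simp
    also have "\<dots> = (CLINT \<omega>|M. (\<Prod>i\<in>I. indicator (A i) (X i \<omega>)))"
      using PA by (subst integral_distr) (auto simp: ind of_real_indicator simp flip: integral_complex_of_real)
    also have "\<dots> = (CLINT \<omega>|N. (\<Prod>i\<in>I. indicator (A i) (Y i \<omega>)))"
      using key[of I A] A by simp
    also have "\<dots> = complex_of_real (\<integral>x. indicator (Pi\<^sub>E I A) x \<partial>(distr N (PiM I (\<lambda>_. borel)) (\<lambda>\<omega>. \<lambda>i\<in>I. Y i \<omega>)))"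
      using PA by (subst integral_distr) (auto simp: ind of_real_indicator simp flip: integral_complex_of_real)
    also have "\<dots> = complex_of_real (measure (distr N (PiM I (\<lambda>_. borel)) (\<lambda>\<omega>. \<lambda>i\<in>I. Y i \<omega>)) (Pi\<^sub>E I A))"
      using PA by simp
    finally show "emeasure (distr M (PiM I (\<lambda>_. borel)) (\<lambda>\<omega>. \<lambda>i\<in>I. X i \<omega>)) (Pi\<^sub>E I A)
        = emeasure (distr N (PiM I (\<lambda>_. borel)) (\<lambda>\<omega>. \<lambda>i\<in>I. Y i \<omega>)) (Pi\<^sub>E I A)"
      using M.prob_space_distr[OF XI(1)] N.prob_space_distr[OF XI(2)]
      by (simp add: finite_measure.emeasure_eq_measure prob_space.finite_measure)
  next
    \<comment> \<open>The whole space is itself a box, so a constant sequence exhausts it.\<close>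
    show "range (\<lambda>n::nat. \<Pi>\<^sub>E i\<in>I. UNIV) \<subseteq> prod_algebra I (\<lambda>_. borel :: real measure)"
      using fin by (auto intro!: prod_algebraI_finite)
    show "(\<Union>n::nat. \<Pi>\<^sub>E i\<in>I. UNIV) = space (PiM I (\<lambda>_. borel :: real measure))" by (simp add: space_PiM)
    show "emeasure (distr M (PiM I (\<lambda>_. borel)) (\<lambda>\<omega>. \<lambda>i\<in>I. X i \<omega>)) (\<Pi>\<^sub>E i\<in>I. UNIV) \<noteq> \<infinity>" for n :: nat
      using M.prob_space_distr[OF XI(1)]
      by (simp add: finite_measure.emeasure_eq_measure prob_space.finite_measure)
  qed auto
qed

section \<open>Quadratic forms in Gaussian vectors\<close>

text \<open>The quotient isolates the coefficient of \<open>e^2\<close> in the exponential once the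
  constant and the linear term are removed; the cubic Taylor remainder is of order
  \<open>e^3\<close>.\<close>

lemma iexp_second_order_tendsto:
  fixes b q :: real
  assumes e: "e \<longlonglongrightarrow> 0" "\<And>n. e n > 0"
  shows "(\<lambda>n. (iexp (e n * b + (e n)\<^sup>2 * q) - 1 - \<i> * complex_of_real (e n * b)) / complex_of_real ((e n)\<^sup>2))
     \<longlonglongrightarrow> \<i> * q - b\<^sup>2 / 2"
proof -
  define y where "y n = e n * b + (e n)\<^sup>2 * q" for n
  define R where "R n = iexp (y n) - (1 + \<i> * y n - (y n)\<^sup>2 / 2)" for n
  have R: "cmod (R n) \<le> \<bar>y n\<bar> ^ 3 / 6" for n
    using iexp_approx1[of "y n" 2] by (simp add: R_def numeral_eq_Suc power_mult_distrib fact_Suc)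
  have ye: "y n = e n * (b + e n * q)" for n by (simp add: y_def power2_eq_square algebra_simps)
  have lim: "(\<lambda>n. b + e n * q) \<longlonglongrightarrow> b + 0 * q" by (intro tendsto_intros e)
  have "(\<lambda>n. R n / (e n)\<^sup>2) \<longlonglongrightarrow> 0"
  proof (rule Lim_null_comparison)
    have "norm (R n / (e n)\<^sup>2) \<le> e n * \<bar>b + e n * q\<bar> ^ 3 / 6" for n
    proof -
      have "norm (R n / (e n)\<^sup>2) = cmod (R n) / (e n)\<^sup>2" by (simp add: norm_divide norm_power)
      also have "\<dots> \<le> (\<bar>y n\<bar> ^ 3 / 6) / (e n)\<^sup>2" by (intro divide_right_mono R) auto
      also have "\<dots> = e n * \<bar>b + e n * q\<bar> ^ 3 / 6"
      proof -
        have "\<bar>y n\<bar> = e n * \<bar>b + e n * q\<bar>" using e(2)[of n] by (simp add: ye abs_mult)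
        then have "\<bar>y n\<bar> ^ 3 = e n ^ 3 * \<bar>b + e n * q\<bar> ^ 3" by (simp add: power_mult_distrib)
        then show ?thesis using e(2)[of n] by (simp add: power2_eq_square power3_eq_cube)
      qed
      finally show ?thesis .
    qed
    then show "\<forall>\<^sub>F n in sequentially. norm (R n / (e n)\<^sup>2) \<le> e n * \<bar>b + e n * q\<bar> ^ 3 / 6" by simp
    have "(\<lambda>n. e n * \<bar>b + e n * q\<bar> ^ 3 / 6) \<longlonglongrightarrow> 0 * \<bar>b + 0 * q\<bar> ^ 3 / 6"
      by (intro tendsto_intros e lim) simp
    then show "(\<lambda>n. e n * \<bar>b + e n * q\<bar> ^ 3 / 6) \<longlonglongrightarrow> 0" by simp
  qed
  moreover have "(\<lambda>n. complex_of_real ((b + e n * q)\<^sup>2) / 2) \<longlonglongrightarrow> complex_of_real ((b + 0 * q)\<^sup>2) / 2"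
    by (intro tendsto_intros lim e(1)) simp
  ultimately have "(\<lambda>n. R n / (e n)\<^sup>2 - complex_of_real ((b + e n * q)\<^sup>2) / 2 + \<i> * q) \<longlonglongrightarrow>
      0 - complex_of_real ((b + 0 * q)\<^sup>2) / 2 + \<i> * q"
    by (intro tendsto_add tendsto_diff tendsto_const)
  moreover have "R n / (e n)\<^sup>2 - complex_of_real ((b + e n * q)\<^sup>2) / 2 + \<i> * q
      = (iexp (e n * b + (e n)\<^sup>2 * q) - 1 - \<i> * complex_of_real (e n * b)) / complex_of_real ((e n)\<^sup>2)" for n
  proof -
    have e0: "complex_of_real (e n) \<noteq> 0" using e(2)[of n] by simp
    have "complex_of_real ((b + e n * q)\<^sup>2) / 2 = ((y n)\<^sup>2 / 2) / (e n)\<^sup>2"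
      using e0 by (simp add: ye power_mult_distrib)
    moreover have "\<i> * q = (\<i> * (y n) - \<i> * (e n * b)) / (e n)\<^sup>2"
      using e0 by (simp add: y_def field_simps)
    ultimately show ?thesis
      unfolding y_def[symmetric] R_def by (simp add: diff_divide_distrib add_divide_distrib)
  qed
  ultimately show ?thesis by simp
qed

text \<open>Gaussianity is encoded by characteristic functions of linear combinations: this allows
  degenerate covariances and passes to limits in mean square.\<close>

locale gaussian_vector = prob_space M for M :: "'a measure" +
  fixes I :: "'i set" and X :: "'i \<Rightarrow> 'a \<Rightarrow> real"
  assumes fin [simp, intro]: "finite I"
    and sq: "i \<in> I \<Longrightarrow> square_integrable M (X i)"
    and char_lin: "(CLINT \<omega>|M. iexp (\<Sum>i\<in>I. c i * X i \<omega>))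
       = complex_of_real (exp (- (\<integral>\<omega>. (\<Sum>i\<in>I. c i * X i \<omega>)\<^sup>2 \<partial>M) / 2))"
begin

definition Cov :: "'i \<Rightarrow> 'i \<Rightarrow> real" where "Cov i k = (\<integral>\<omega>. X i \<omega> * X k \<omega> \<partial>M)"

definition quad :: "('i \<Rightarrow> 'i \<Rightarrow> real) \<Rightarrow> 'a \<Rightarrow> real" where
  "quad m \<omega> = (\<Sum>i\<in>I. \<Sum>k\<in>I. m i k * X i \<omega> * X k \<omega>)"

text \<open>The two components of \<open>z\<close> carry the vector and an independent copy of
  it.\<close>

definition bilin :: "('i \<Rightarrow> 'i \<Rightarrow> real) \<Rightarrow> 'a \<times> 'a \<Rightarrow> real" where
  "bilin m z = (\<Sum>i\<in>I. \<Sum>k\<in>I. m i k * X i (fst z) * X k (snd z))"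

definition mean :: "('i \<Rightarrow> 'i \<Rightarrow> real) \<Rightarrow> real" where
  "mean m = (\<Sum>i\<in>I. \<Sum>k\<in>I. m i k * Cov i k)"

text \<open>In matrix notation \<open>m C m\<close>, with \<open>C\<close> the covariance; its
  \<open>mean\<close> is the trace of \<open>m C m C\<close>.\<close>

definition sandwich :: "('i \<Rightarrow> 'i \<Rightarrow> real) \<Rightarrow> 'i \<Rightarrow> 'i \<Rightarrow> real" where
  "sandwich m i k = (\<Sum>p\<in>I. \<Sum>r\<in>I. m i p * Cov p r * m r k)"

lemma meas [measurable]: "i \<in> I \<Longrightarrow> X i \<in> borel_measurable M"
  using sq by measurable

lemma Cov_sym: "Cov i k = Cov k i"
  by (simp add: Cov_def mult.commute)

lemma lin_sq: "square_integrable M (\<lambda>\<omega>. \<Sum>i\<in>I. c i * X i \<omega>)"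
  by (intro square_integrable_sum square_integrable_cmult sq)

lemma distr_lin:
  "distr M borel (\<lambda>\<omega>. \<Sum>i\<in>I. c i * X i \<omega>) = centered_normal (\<integral>\<omega>. (\<Sum>i\<in>I. c i * X i \<omega>)\<^sup>2 \<partial>M)"
proof (rule Levy_uniqueness)
  show "real_distribution (distr M borel (\<lambda>\<omega>. \<Sum>i\<in>I. c i * X i \<omega>))" by (rule real_distribution_distr) auto
  show "real_distribution (centered_normal (\<integral>\<omega>. (\<Sum>i\<in>I. c i * X i \<omega>)\<^sup>2 \<partial>M))"
    by (rule real_distribution_centered_normal) auto
  show "char (distr M borel (\<lambda>\<omega>. \<Sum>i\<in>I. c i * X i \<omega>)) = char (centered_normal (\<integral>\<omega>. (\<Sum>i\<in>I. c i * X i \<omega>)\<^sup>2 \<partial>M))"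
  proof
    fix t
    have "char (distr M borel (\<lambda>\<omega>. \<Sum>i\<in>I. c i * X i \<omega>)) t = (CLINT \<omega>|M. iexp (\<Sum>i\<in>I. (t * c i) * X i \<omega>))"
      by (subst integral_iexp_distr) (auto simp: sum_distrib_left mult.assoc)
    also have "\<dots> = complex_of_real (exp (- (\<integral>\<omega>. (\<Sum>i\<in>I. (t * c i) * X i \<omega>)\<^sup>2 \<partial>M) / 2))"
      by (rule char_lin)
    also have "(\<lambda>\<omega>. (\<Sum>i\<in>I. (t * c i) * X i \<omega>)\<^sup>2) = (\<lambda>\<omega>. (\<Sum>i\<in>I. c i * X i \<omega>)\<^sup>2 * t\<^sup>2)"
    proof -
      have "(\<Sum>i\<in>I. (t * c i) * X i \<omega>) = t * (\<Sum>i\<in>I. c i * X i \<omega>)" for \<omega>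
        by (simp add: sum_distrib_left mult.assoc)
      then show ?thesis by (simp add: power_mult_distrib mult.commute)
    qed
    finally show "char (distr M borel (\<lambda>\<omega>. \<Sum>i\<in>I. c i * X i \<omega>)) t
        = char (centered_normal (\<integral>\<omega>. (\<Sum>i\<in>I. c i * X i \<omega>)\<^sup>2 \<partial>M)) t"
      by (subst char_centered_normal) auto
  qed
qed

lemma coord: "i \<in> I \<Longrightarrow> (\<Sum>k\<in>I. (if k = i then 1 else 0) * X k \<omega>) = X i \<omega>"
  by (subst sum.remove[of I i]) (auto intro!: sum.neutral)

lemma integrable_power: "i \<in> I \<Longrightarrow> integrable M (\<lambda>\<omega>. X i \<omega> ^ n)"
proof -
  assume i: "i \<in> I"
  have "integrable (distr M borel (X i)) (\<lambda>x. x ^ n)"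
    using distr_lin[of "\<lambda>k. if k = i then 1 else 0"] i unfolding coord[OF i]
    by (simp add: integrable_centered_normal_power)
  then show ?thesis using i by (subst (asm) integrable_distr_eq) auto
qed

lemma mean_zero: "i \<in> I \<Longrightarrow> (\<integral>\<omega>. X i \<omega> \<partial>M) = 0"
proof -
  assume i: "i \<in> I"
  let ?v = "\<integral>\<omega>. (X i \<omega>)\<^sup>2 \<partial>M"
  have "(\<integral>\<omega>. X i \<omega> \<partial>M) = (\<integral>x. x \<partial>distr M borel (X i))"
    using i by (subst integral_distr) auto
  also have "\<dots> = (\<integral>x. x \<partial>centered_normal ?v)"
    using distr_lin[of "\<lambda>k. if k = i then 1 else 0"] i unfolding coord[OF i] by simp
  also have "\<dots> = (\<integral>x. sqrt ?v * x \<partial>std_normal_distribution)"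
    by (subst centered_normal_eq_distr) (auto simp: integral_distr)
  also have "\<dots> = 0"
    using integral_std_normal_distribution_moment_odd[of 1] by simp
  finally show ?thesis .
qed

lemma sq_mult: "i \<in> I \<Longrightarrow> k \<in> I \<Longrightarrow> square_integrable M (\<lambda>\<omega>. X i \<omega> * X k \<omega>)"
proof -
  assume i: "i \<in> I" and k: "k \<in> I"
  have s: "square_integrable M (\<lambda>\<omega>. (X p \<omega>)\<^sup>2)" if "p \<in> I" for p
    using integrable_power[OF that, of 4] that by (auto simp: square_integrable_def power_mult[symmetric])
  have "integrable M (\<lambda>\<omega>. (X i \<omega>)\<^sup>2 * (X k \<omega>)\<^sup>2)"
    by (intro integrable_mult_square_integrable s i k)
  then show ?thesis using i k by (auto simp: square_integrable_def power_mult_distrib)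
qed

lemma quad_sq: "square_integrable M (quad m)"
proof -
  have "square_integrable M (\<lambda>\<omega>. \<Sum>i\<in>I. \<Sum>k\<in>I. m i k * (X i \<omega> * X k \<omega>))"
    by (intro square_integrable_sum square_integrable_cmult sq_mult)
  then show ?thesis by (simp add: quad_def[abs_def] mult.assoc)
qed

lemma quad_measurable [measurable]: "quad m \<in> borel_measurable M"
  using quad_sq by measurable

lemma integrable_of_sq: "square_integrable M f \<Longrightarrow> integrable M (f :: 'a \<Rightarrow> real)"
  using integrable_mult_square_integrable[of M f "\<lambda>_. 1"]
  by (simp add: square_integrable_def)

lemma integral_quad: "(\<integral>\<omega>. quad m \<omega> \<partial>M) = mean m"
proof -
  have "integrable M (\<lambda>\<omega>. X i \<omega> * X k \<omega>)" if "i \<in> I" "k \<in> I" for i k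
    by (intro integrable_mult_square_integrable sq that)
  then show ?thesis
    by (simp add: quad_def mean_def Cov_def mult.assoc Bochner_Integration.integral_sum)
qed

lemma lin_second_moment:
  "(\<integral>\<omega>. (\<Sum>i\<in>I. c i * X i \<omega>)\<^sup>2 \<partial>M) = (\<Sum>i\<in>I. \<Sum>k\<in>I. c i * c k * Cov i k)"
proof -
  have "(\<Sum>i\<in>I. c i * X i \<omega>)\<^sup>2 = quad (\<lambda>i k. c i * c k) \<omega>" for \<omega>
    by (simp add: quad_def power2_eq_square sum_product mult_ac)
  then show ?thesis using integral_quad[of "\<lambda>i k. c i * c k"] by (simp add: mean_def)
qed

sublocale P: pair_prob_space M M ..

lemma bilin_sq: "square_integrable (M \<Otimes>\<^sub>M M) (bilin m)"
proof -
  have "square_integrable (M \<Otimes>\<^sub>M M) (\<lambda>z. X i (fst z) * X k (snd z))" if i: "i \<in> I" and k: "k \<in> I" for i k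
  proof -
    note [measurable] = meas[OF i] meas[OF k]
    have "integrable (M \<Otimes>\<^sub>M M) (\<lambda>z. (X i (fst z))\<^sup>2 * (X k (snd z))\<^sup>2)"
      using integrable_power[OF i, of 2] integrable_power[OF k, of 2]
      by (intro P.Fubini_integrable) (auto simp: abs_mult)
    then show ?thesis by (simp add: square_integrable_def power_mult_distrib)
  qed
  then have "square_integrable (M \<Otimes>\<^sub>M M) (\<lambda>z. \<Sum>i\<in>I. \<Sum>k\<in>I. m i k * (X i (fst z) * X k (snd z)))"
    by (intro square_integrable_sum square_integrable_cmult)
  then show ?thesis by (simp add: bilin_def[abs_def] mult.assoc)
qed

lemma bilin_measurable [measurable]: "bilin m \<in> borel_measurable (M \<Otimes>\<^sub>M M)"
  using bilin_sq by measurable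

lemma bilin_alt: "bilin m (x, y) = (\<Sum>k\<in>I. (\<Sum>i\<in>I. m i k * X i x) * X k y)"
  unfolding bilin_def fst_conv snd_conv sum_distrib_right by (rule sum.swap)

lemma integral_bilin_snd: "(\<integral>y. bilin m (x, y) \<partial>M) = 0"
  unfolding bilin_alt
  by (subst Bochner_Integration.integral_sum)
    (auto intro!: sum.neutral integrable_of_sq[OF sq] simp: mean_zero)

text \<open>For a fixed first copy, \<open>bilin m\<close> is a linear form in the second one; its
  second moment is the covariance evaluated at the coefficients of that form.\<close>

lemma integral_bilin_sq_snd:
  assumes sym: "\<And>i k. m i k = m k i"
  shows "(\<integral>y. (bilin m (x, y))\<^sup>2 \<partial>M) = quad (sandwich m) x"
proof -
  have flip: "(\<Sum>i\<in>I. m i r * X i x) = (\<Sum>k\<in>I. m r k * X k x)" for r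
    by (intro sum.cong refl) (simp only: sym[of _ r])
  have "(\<integral>y. (bilin m (x, y))\<^sup>2 \<partial>M)
      = (\<Sum>p\<in>I. \<Sum>r\<in>I. (\<Sum>i\<in>I. m i p * X i x) * (\<Sum>i\<in>I. m i r * X i x) * Cov p r)"
    unfolding bilin_alt by (rule lin_second_moment)
  also have "\<dots> = (\<Sum>p\<in>I. \<Sum>r\<in>I. (\<Sum>i\<in>I. m i p * X i x) * (\<Sum>k\<in>I. m r k * X k x) * Cov p r)"
    by (simp only: flip)
  also have "\<dots> = (\<Sum>p\<in>I. \<Sum>r\<in>I. \<Sum>i\<in>I. \<Sum>k\<in>I. m i p * Cov p r * m r k * X i x * X k x)"
    by (intro sum.cong refl, subst sum_product, subst sum_distrib_right, intro sum.cong refl,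
        subst sum_distrib_right, intro sum.cong refl) (simp add: mult_ac)
  also have "\<dots> = (\<Sum>i\<in>I. \<Sum>k\<in>I. \<Sum>p\<in>I. \<Sum>r\<in>I. m i p * Cov p r * m r k * X i x * X k x)"
    by (simp add: sum.cartesian_product, rule sum.reindex_bij_witness[of _ "\<lambda>(i,k,p,r). (p,r,i,k)" "\<lambda>(p,r,i,k). (i,k,p,r)"]) auto
  also have "\<dots> = quad (sandwich m) x"
    by (simp add: quad_def sandwich_def sum_distrib_right)
  finally show ?thesis .
qed

lemma integral_pair_fst:
  fixes f :: "'a \<Rightarrow> complex"
  assumes "f \<in> borel_measurable M"
  shows "(\<integral>z. f (fst z) \<partial>(M \<Otimes>\<^sub>M M)) = (\<integral>x. f x \<partial>M)"
  using assms by (subst integral_distr[symmetric, where g=fst and N=M])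
    (auto simp: distr_pair_fst prob_space_axioms)

lemma lin_pair_char:
  "(CLINT z|M \<Otimes>\<^sub>M M. iexp (\<Sum>i\<in>I. c i * (X i (fst z) + e * X i (snd z))))
   = (CLINT \<omega>|M. iexp (\<Sum>i\<in>I. c i * (sqrt (1 + e\<^sup>2) * X i \<omega>)))"
proof -
  let ?Q = "\<integral>\<omega>. (\<Sum>i\<in>I. c i * X i \<omega>)\<^sup>2 \<partial>M"
  have sc: "(CLINT \<omega>|M. iexp (t * (\<Sum>i\<in>I. c i * X i \<omega>))) = complex_of_real (exp (- t\<^sup>2 * ?Q / 2))" for t
    using char_lin[of "\<lambda>i. t * c i"]
    by (simp add: mult.assoc sum_distrib_left[symmetric] power_mult_distrib)
  have "(CLINT z|M \<Otimes>\<^sub>M M. iexp (\<Sum>i\<in>I. c i * (X i (fst z) + e * X i (snd z))))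
    = (CLINT z|M \<Otimes>\<^sub>M M. iexp (1 * (\<Sum>i\<in>I. c i * X i (fst z))) * iexp (e * (\<Sum>i\<in>I. c i * X i (snd z))))"
    by (intro Bochner_Integration.integral_cong refl)
      (simp add: exp_add[symmetric] algebra_simps sum.distrib sum_distrib_left)
  also have "\<dots> = (\<integral>x. \<integral>y. iexp (1 * (\<Sum>i\<in>I. c i * X i x)) * iexp (e * (\<Sum>i\<in>I. c i * X i y)) \<partial>M \<partial>M)"
    by (subst P.integral_fst'[symmetric]) (auto intro!: P.P.integrable_const_bound[where B=1] simp: norm_mult)
  also have "\<dots> = complex_of_real (exp (- 1\<^sup>2 * ?Q / 2)) * complex_of_real (exp (- e\<^sup>2 * ?Q / 2))"
    unfolding integral_mult_right_zero integral_mult_left_zero sc by simp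
  also have "\<dots> = complex_of_real (exp (- (sqrt (1 + e\<^sup>2))\<^sup>2 * ?Q / 2))"
    by (simp add: of_real_mult[symmetric] exp_add[symmetric] algebra_simps add_divide_distrib del: of_real_mult)
  also have "\<dots> = (CLINT \<omega>|M. iexp (sqrt (1 + e\<^sup>2) * (\<Sum>i\<in>I. c i * X i \<omega>)))"
    by (rule sc[symmetric])
  finally show ?thesis by (simp add: sum_distrib_left mult_ac)
qed

text \<open>Both vectors have covariance \<open>(1 + e^2) C\<close>. Equality of the full laws is
  needed, since \<open>h\<close> will be the exponential of a quadratic form.\<close>

lemma pair_law:
  fixes h :: "('i \<Rightarrow> real) \<Rightarrow> complex"
  assumes h: "h \<in> borel_measurable (PiM I (\<lambda>_. borel))"
  shows "(\<integral>z. h (\<lambda>i\<in>I. X i (fst z) + e * X i (snd z)) \<partial>(M \<Otimes>\<^sub>M M))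
       = (\<integral>\<omega>. h (\<lambda>i\<in>I. sqrt (1 + e\<^sup>2) * X i \<omega>) \<partial>M)" (is "?l = ?r")
proof -
  have eq: "distr (M \<Otimes>\<^sub>M M) (PiM I (\<lambda>_. borel)) (\<lambda>z. \<lambda>i\<in>I. X i (fst z) + e * X i (snd z))
      = distr M (PiM I (\<lambda>_. borel)) (\<lambda>\<omega>. \<lambda>i\<in>I. sqrt (1 + e\<^sup>2) * X i \<omega>)"
    by (rule cramer_wold[OF P.P.prob_space_axioms prob_space_axioms fin _ _ lin_pair_char]) auto
  have "?l = (\<integral>x. h x \<partial>distr (M \<Otimes>\<^sub>M M) (PiM I (\<lambda>_. borel)) (\<lambda>z. \<lambda>i\<in>I. X i (fst z) + e * X i (snd z)))"
    using h by (subst integral_distr) auto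
  also have "\<dots> = ?r" unfolding eq
    using h by (subst integral_distr) auto
  finally show ?thesis .
qed

lemma quad_shift:
  assumes sym: "\<And>i k. m i k = m k i"
  shows "(\<Sum>i\<in>I. \<Sum>k\<in>I. m i k * (X i x + e * X i y) * (X k x + e * X k y))
       = quad m x + 2 * e * bilin m (x, y) + e\<^sup>2 * quad m y"
proof -
  have "(\<Sum>i\<in>I. \<Sum>k\<in>I. m i k * X i y * X k x) = (\<Sum>k\<in>I. \<Sum>i\<in>I. m i k * X i y * X k x)"
    by (rule sum.swap)
  also have "\<dots> = bilin m (x, y)" unfolding bilin_def fst_conv snd_conv
  proof (intro sum.cong refl)
    fix k i
    show "m i k * X i y * X k x = m k i * X k x * X i y" using sym[of i k] by simp
  qed
  finally have b: "(\<Sum>i\<in>I. \<Sum>k\<in>I. m i k * X i y * X k x) = bilin m (x, y)" .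
  have "(\<Sum>i\<in>I. \<Sum>k\<in>I. m i k * (X i x + e * X i y) * (X k x + e * X k y))
     = (\<Sum>i\<in>I. \<Sum>k\<in>I. m i k * X i x * X k x + e * (m i k * X i x * X k y)
         + e * (m i k * X i y * X k x) + e\<^sup>2 * (m i k * X i y * X k y))"
    by (intro sum.cong refl) (simp add: power2_eq_square algebra_simps)
  also have "\<dots> = quad m x + e * bilin m (x, y) + e * (\<Sum>i\<in>I. \<Sum>k\<in>I. m i k * X i y * X k x) + e\<^sup>2 * quad m y"
    by (simp add: sum.distrib sum_distrib_left quad_def bilin_def)
  finally show ?thesis unfolding b by simp
qed

text \<open>Gaussian integration by parts in disguise. In the exponential of \<open>i s\<close>
  times the form at \<open>X + e X'\<close>, the coefficient of \<open>e^2\<close> becomes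
  \<open>i s mean m - 2 s^2 quad (sandwich m)\<close> after integration over \<open>X'\<close>; at
  the rescaled vector it is \<open>i s quad m\<close>. Both are weighted with
  \<open>iexp (s * quad m)\<close>, and their integrals agree.\<close>

lemma quad_identity:
  assumes sym: "\<And>i k. m i k = m k i"
  shows "(CLINT \<omega>|M. complex_of_real (quad m \<omega> - mean m) * iexp (s * quad m \<omega>))
       = 2 * \<i> * s * (CLINT \<omega>|M. complex_of_real (quad (sandwich m) \<omega>) * iexp (s * quad m \<omega>))"
proof (cases "s = 0")
  case True
  have "integrable M (quad m)" by (rule integrable_of_sq[OF quad_sq])
  then have "(\<integral>\<omega>. quad m \<omega> - mean m \<partial>M) = 0" by (simp add: integral_quad prob_space)
  then show ?thesis using True integral_complex_of_real[of M "\<lambda>\<omega>. quad m \<omega> - mean m"] by simp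
next
  case False
  define e :: "nat \<Rightarrow> real" where "e n = 1 / real (Suc n)" for n
  have e: "e \<longlonglongrightarrow> 0" "\<And>n. e n > 0" "\<And>n. e n \<le> 1"
    using LIMSEQ_inverse_real_of_nat by (auto simp: e_def[abs_def] inverse_eq_divide)
  have iq: "integrable M (quad m')" for m' by (rule integrable_of_sq[OF quad_sq])
  \<comment> \<open>A second-order difference quotient with the linear term removed;
    \<open>b\<close> and \<open>q\<close> are the coefficients of \<open>e\<close> and
    \<open>e^2\<close> in the exponent.\<close>
  define f where "f b q n = (iexp (e n * b + (e n)\<^sup>2 * q) - 1 - \<i> * complex_of_real (e n * b)) / complex_of_real ((e n)\<^sup>2)"
    for b q :: real and n
  have flim: "(\<lambda>n. w * f b q n) \<longlonglongrightarrow> w * (\<i> * q - b\<^sup>2 / 2)" for b q w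
    unfolding f_def by (intro tendsto_mult_left iexp_second_order_tendsto e)
  \<comment> \<open>A majorant independent of \<open>n\<close>. It is built from squares of linear
    combinations so that its integrability follows from square-integrability.\<close>
  have fbound: "cmod (f b q n) \<le> (b + q)\<^sup>2 + (b - q)\<^sup>2 + \<bar>q\<bar>" for b q n
  proof -
    define y where "y = e n * b + (e n)\<^sup>2 * q"
    have en: "0 < e n" "e n \<le> 1" using e by auto
    have "cmod (iexp y - 1 - \<i> * y) \<le> y\<^sup>2 / 2"
      using iexp_approx1[of y 1] by (simp add: power2_eq_square diff_diff_eq)
    moreover have split: "iexp y - 1 - \<i> * complex_of_real (e n * b) = (iexp y - 1 - \<i> * y) + \<i> * complex_of_real ((e n)\<^sup>2 * q)"
      by (simp add: y_def algebra_simps)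
    moreover have "cmod (\<i> * complex_of_real ((e n)\<^sup>2 * q)) = (e n)\<^sup>2 * \<bar>q\<bar>"
      by (simp add: norm_mult norm_power abs_mult)
    ultimately have "cmod (iexp y - 1 - \<i> * complex_of_real (e n * b)) \<le> y\<^sup>2 / 2 + (e n)\<^sup>2 * \<bar>q\<bar>"
      using norm_triangle_ineq[of "iexp y - 1 - \<i> * y" "\<i> * complex_of_real ((e n)\<^sup>2 * q)"]
      unfolding split by linarith
    moreover have "y\<^sup>2 = (e n)\<^sup>2 * (b + e n * q)\<^sup>2"
      unfolding y_def by (simp add: power2_eq_square algebra_simps)
    ultimately have "cmod (iexp y - 1 - \<i> * complex_of_real (e n * b)) \<le> (e n)\<^sup>2 * ((b + e n * q)\<^sup>2 / 2 + \<bar>q\<bar>)"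
      by (simp add: algebra_simps)
    then have "cmod (f b q n) \<le> (b + e n * q)\<^sup>2 / 2 + \<bar>q\<bar>"
      using en unfolding f_def y_def[symmetric]
      by (simp add: norm_divide norm_power divide_le_eq mult.commute)
    also have "(b + e n * q)\<^sup>2 / 2 \<le> b\<^sup>2 + (e n * q)\<^sup>2"
      using sum_squares_bound[of b "e n * q"] by (simp add: power2_sum)
    also have "(e n * q)\<^sup>2 \<le> q\<^sup>2"
      using en by (simp add: power_mult_distrib mult_left_le_one_le power_le_one)
    also have "b\<^sup>2 + q\<^sup>2 \<le> (b + q)\<^sup>2 + (b - q)\<^sup>2" by (simp add: power2_sum power2_diff)
    finally show ?thesis by simp
  qed
  let ?M2 = "M \<Otimes>\<^sub>M M"
  define Phi where "Phi n z = iexp (s * quad m (fst z)) * f (2 * s * bilin m z) (s * quad m (snd z)) n" for n z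
  define Psi where "Psi n x = iexp (s * quad m x) * f 0 (s * quad m x) n" for n x
  have fm: "(\<lambda>z. f (u z) (v z) n) \<in> borel_measurable K"
    if [measurable]: "u \<in> borel_measurable K" "v \<in> borel_measurable K" for u v n and K :: "'k measure"
    unfolding f_def by measurable
  have qsq2: "square_integrable ?M2 (\<lambda>z. quad m (snd z))"
  proof -
    have "integrable M (\<lambda>x. (quad m x)\<^sup>2)" using quad_sq by (simp add: square_integrable_def)
    then have "integrable ?M2 (\<lambda>z. (quad m (snd z))\<^sup>2)"
      by (intro P.Fubini_integrable) auto
    then show ?thesis by (simp add: square_integrable_def)
  qed
  have i2: "integrable ?M2 (\<lambda>z. (2 * s * bilin m z + s * quad m (snd z))\<^sup>2 + (2 * s * bilin m z - s * quad m (snd z))\<^sup>2 + \<bar>s * quad m (snd z)\<bar>)"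
  proof -
    have "square_integrable ?M2 (\<lambda>z. 2 * s * bilin m z + s * quad m (snd z))"
      "square_integrable ?M2 (\<lambda>z. 2 * s * bilin m z - s * quad m (snd z))"
      by (intro square_integrable_add square_integrable_diff square_integrable_cmult bilin_sq qsq2)+
    moreover have "integrable ?M2 (\<lambda>z. quad m (snd z))"
      using integrable_mult_square_integrable[OF qsq2, of "\<lambda>_. 1"] by (simp add: square_integrable_def P.P.emeasure_space_1)
    ultimately show ?thesis by (auto simp: square_integrable_def)
  qed
  \<comment> \<open>\<open>pair_law\<close> for the exponential of the quadratic form; the factor
    \<open>sqrt (1 + e^2)\<close> enters it squared.\<close>
  have law: "(CLINT z|?M2. iexp (s * (quad m (fst z) + 2 * e n * bilin m z + (e n)\<^sup>2 * quad m (snd z))))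
           = (CLINT x|M. iexp (s * ((1 + (e n)\<^sup>2) * quad m x)))" for n
  proof -
    let ?h = "\<lambda>x. iexp (s * (\<Sum>i\<in>I. \<Sum>k\<in>I. m i k * x i * x k))"
    have "?h \<in> borel_measurable (PiM I (\<lambda>_. borel))" by measurable
    from pair_law[OF this, of "e n"]
    have *: "(CLINT z|?M2. iexp (s * (\<Sum>i\<in>I. \<Sum>k\<in>I. m i k * (X i (fst z) + e n * X i (snd z)) * (X k (fst z) + e n * X k (snd z)))))
       = (CLINT x|M. iexp (s * (\<Sum>i\<in>I. \<Sum>k\<in>I. m i k * (sqrt (1 + (e n)\<^sup>2) * X i x) * (sqrt (1 + (e n)\<^sup>2) * X k x))))"
      by simp
    have "(\<Sum>i\<in>I. \<Sum>k\<in>I. m i k * (sqrt (1 + (e n)\<^sup>2) * X i x) * (sqrt (1 + (e n)\<^sup>2) * X k x)) = (1 + (e n)\<^sup>2) * quad m x" for x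
    proof -
      have sq: "sqrt (1 + (e n)\<^sup>2) * sqrt (1 + (e n)\<^sup>2) = 1 + (e n)\<^sup>2" by simp
      have "m i k * (sqrt (1 + (e n)\<^sup>2) * X i x) * (sqrt (1 + (e n)\<^sup>2) * X k x)
        = (sqrt (1 + (e n)\<^sup>2) * sqrt (1 + (e n)\<^sup>2)) * (m i k * X i x * X k x)" for i k by (simp only: mult_ac)
      then show ?thesis unfolding quad_def sum_distrib_left sq by (intro sum.cong refl)
    qed
    with * show ?thesis unfolding quad_shift[of m, OF sym] by simp
  qed
  \<comment> \<open>The term of order \<open>e\<close> has mean zero because the copy is centered;
    this is what makes division by \<open>e^2\<close> possible.\<close>
  have lin0: "(CLINT z|?M2. iexp (s * quad m (fst z)) * complex_of_real (bilin m z)) = 0"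
    and ilin: "integrable ?M2 (\<lambda>z. iexp (s * quad m (fst z)) * complex_of_real (bilin m z))"
  proof -
    have "integrable ?M2 (bilin m)"
      using integrable_mult_square_integrable[OF bilin_sq[of m], of "\<lambda>_. 1"] by (simp add: square_integrable_def P.P.emeasure_space_1)
    then show i: "integrable ?M2 (\<lambda>z. iexp (s * quad m (fst z)) * complex_of_real (bilin m z))"
      by (rule Bochner_Integration.integrable_bound) (auto simp: norm_mult)
    show "(CLINT z|?M2. iexp (s * quad m (fst z)) * complex_of_real (bilin m z)) = 0"
      by (subst P.integral_fst'[OF i, symmetric]) (simp add: integral_bilin_snd)
  qed
  have int1: "integrable ?M2 (\<lambda>z. iexp (g z))" if "g \<in> borel_measurable ?M2" for g
    using that by (intro P.P.integrable_const_bound[where B=1]) auto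
  have eqn: "(CLINT z|?M2. Phi n z) = (CLINT x|M. Psi n x)" for n
  proof -
    have e0: "complex_of_real (e n) \<noteq> 0" using e(2)[of n] by simp
    have "Phi n z = (iexp (s * (quad m (fst z) + 2 * e n * bilin m z + (e n)\<^sup>2 * quad m (snd z))) - iexp (s * quad m (fst z))
       - (\<i> * e n * 2 * s) * (iexp (s * quad m (fst z)) * complex_of_real (bilin m z))) / (e n)\<^sup>2" for z
      unfolding Phi_def f_def by (simp add: algebra_simps exp_add diff_divide_distrib)
    then have "(CLINT z|?M2. Phi n z) = ((CLINT z|?M2. iexp (s * (quad m (fst z) + 2 * e n * bilin m z + (e n)\<^sup>2 * quad m (snd z))))
       - (CLINT z|?M2. iexp (s * quad m (fst z)))) / (e n)\<^sup>2"
      using ilin lin0 int1 by (simp del: of_real_mult of_real_add)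
    also have "\<dots> = ((CLINT x|M. iexp (s * ((1 + (e n)\<^sup>2) * quad m x))) - (CLINT x|M. iexp (s * quad m x))) / (e n)\<^sup>2"
      unfolding law by (subst integral_pair_fst[of "\<lambda>x. iexp (s * quad m x)"]) auto
    also have "\<dots> = (CLINT x|M. (iexp (s * ((1 + (e n)\<^sup>2) * quad m x)) - iexp (s * quad m x)) / (e n)\<^sup>2)"
    proof -
      have "integrable M (\<lambda>x. iexp (s * ((1 + (e n)\<^sup>2) * quad m x)))" "integrable M (\<lambda>x. iexp (s * quad m x))"
        by (intro integrable_const_bound[where B=1]; simp)+
      then show ?thesis by simp
    qed
    also have "\<dots> = (CLINT x|M. Psi n x)"
      unfolding Psi_def f_def by (simp add: algebra_simps exp_add diff_divide_distrib)
    finally show ?thesis .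
  qed
  have "(\<lambda>n. CLINT z|?M2. Phi n z) \<longlonglongrightarrow> (CLINT z|?M2. iexp (s * quad m (fst z)) * (\<i> * complex_of_real (s * quad m (snd z)) - complex_of_real ((2 * s * bilin m z)\<^sup>2) / 2))"
  proof (rule integral_dominated_convergence[OF _ _ i2])
    show "AE z in ?M2. (\<lambda>n. Phi n z) \<longlonglongrightarrow> iexp (s * quad m (fst z)) * (\<i> * complex_of_real (s * quad m (snd z)) - complex_of_real ((2 * s * bilin m z)\<^sup>2) / 2)"
      unfolding Phi_def using flim[of _ "2 * s * bilin m z" "s * quad m (snd z)" for z] by simp
    show "AE z in ?M2. norm (Phi n z) \<le> (2 * s * bilin m z + s * quad m (snd z))\<^sup>2 + (2 * s * bilin m z - s * quad m (snd z))\<^sup>2 + \<bar>s * quad m (snd z)\<bar>" for n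
      unfolding Phi_def norm_mult cmod_iexp mult_1 by (intro AE_I2 fbound)
    show "Phi n \<in> borel_measurable ?M2" for n
      unfolding Phi_def by (intro borel_measurable_times fm) measurable
  qed measurable
  moreover have "(\<lambda>n. CLINT x|M. Psi n x) \<longlonglongrightarrow> (CLINT x|M. iexp (s * quad m x) * (\<i> * complex_of_real (s * quad m x) - complex_of_real (0\<^sup>2) / 2))"
  proof (rule integral_dominated_convergence)
    show "AE z in M. (\<lambda>n. Psi n z) \<longlonglongrightarrow> iexp (s * quad m z) * (\<i> * complex_of_real (s * quad m z) - complex_of_real (0\<^sup>2) / 2)"
      unfolding Psi_def using flim[of _ 0 "s * quad m z" for z] by simp
    show "AE z in M. norm (Psi n z) \<le> (0 + s * quad m z)\<^sup>2 + (0 - s * quad m z)\<^sup>2 + \<bar>s * quad m z\<bar>" for n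
      unfolding Psi_def norm_mult cmod_iexp mult_1 by (intro AE_I2 fbound)
    show "integrable M (\<lambda>z. (0 + s * quad m z)\<^sup>2 + (0 - s * quad m z)\<^sup>2 + \<bar>s * quad m z\<bar>)"
      using quad_sq[of m] iq[of m] by (auto simp: square_integrable_def power_mult_distrib)
    show "Psi n \<in> borel_measurable M" for n
      unfolding Psi_def by (intro borel_measurable_times fm) measurable
  qed measurable
  ultimately have "(CLINT z|?M2. iexp (s * quad m (fst z)) * (\<i> * complex_of_real (s * quad m (snd z)) - complex_of_real ((2 * s * bilin m z)\<^sup>2) / 2))
     = (CLINT x|M. iexp (s * quad m x) * (\<i> * complex_of_real (s * quad m x)))"
    unfolding eqn by (auto dest: LIMSEQ_unique)
  moreover have "(CLINT z|?M2. iexp (s * quad m (fst z)) * (\<i> * complex_of_real (s * quad m (snd z)) - complex_of_real ((2 * s * bilin m z)\<^sup>2) / 2))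
     = (CLINT x|M. iexp (s * quad m x) * (\<i> * complex_of_real (s * mean m) - complex_of_real (2 * s\<^sup>2 * quad (sandwich m) x)))"
  proof -
    have i: "integrable ?M2 (\<lambda>z. iexp (s * quad m (fst z)) * (\<i> * complex_of_real (s * quad m (snd z)) - complex_of_real ((2 * s * bilin m z)\<^sup>2) / 2))"
    proof (rule Bochner_Integration.integrable_bound)
      show "integrable ?M2 (\<lambda>z. \<bar>s * quad m (snd z)\<bar> + (2 * s * bilin m z)\<^sup>2)"
        using bilin_sq[of m] integrable_mult_square_integrable[OF qsq2, of "\<lambda>_. 1"]
        by (auto simp: square_integrable_def power_mult_distrib P.P.emeasure_space_1)
      show "AE z in ?M2. norm (iexp (s * quad m (fst z)) * (\<i> * complex_of_real (s * quad m (snd z)) - complex_of_real ((2 * s * bilin m z)\<^sup>2) / 2))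
         \<le> norm (\<bar>s * quad m (snd z)\<bar> + (2 * s * bilin m z)\<^sup>2)"
      proof (rule AE_I2)
        fix z
        have "cmod (\<i> * complex_of_real p - complex_of_real (r\<^sup>2) / 2) \<le> \<bar>p\<bar> + r\<^sup>2" for p r :: real
          using norm_triangle_ineq4[of "\<i> * complex_of_real p" "complex_of_real (r\<^sup>2) / 2"]
          by (simp add: norm_mult norm_power norm_divide) (use zero_le_power2[of r] in linarith)
        from this[of "s * quad m (snd z)" "2 * s * bilin m z"]
        show "norm (iexp (s * quad m (fst z)) * (\<i> * complex_of_real (s * quad m (snd z)) - complex_of_real ((2 * s * bilin m z)\<^sup>2) / 2))
         \<le> norm (\<bar>s * quad m (snd z)\<bar> + (2 * s * bilin m z)\<^sup>2)"
          unfolding norm_mult cmod_iexp mult_1 by (metis abs_ge_self order.trans real_norm_def)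
      qed
    qed measurable
    have "(CLINT y|M. \<i> * complex_of_real (s * quad m y) - complex_of_real ((2 * s * bilin m (x, y))\<^sup>2) / 2)
       = \<i> * complex_of_real (s * mean m) - complex_of_real (2 * s\<^sup>2 * quad (sandwich m) x)" if x: "x \<in> space M" for x
    proof -
      have "square_integrable M (\<lambda>y. bilin m (x, y))" unfolding bilin_alt by (rule lin_sq)
      then have ib: "integrable M (\<lambda>y. (bilin m (x, y))\<^sup>2)" by (simp add: square_integrable_def)
      have "(CLINT y|M. \<i> * complex_of_real (s * quad m y) - complex_of_real ((2 * s * bilin m (x, y))\<^sup>2) / 2)
        = (CLINT y|M. \<i> * s * complex_of_real (quad m y) - complex_of_real (2 * s\<^sup>2) * complex_of_real ((bilin m (x, y))\<^sup>2))"
        by (simp add: power_mult_distrib mult_ac)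
      also have "\<dots> = \<i> * s * complex_of_real (mean m) - complex_of_real (2 * s\<^sup>2) * complex_of_real (quad (sandwich m) x)"
        using iq[of m] ib
        by (simp add: integral_complex_of_real integral_quad integral_bilin_sq_snd[of m, OF sym] del: of_real_power of_real_mult)
      finally show ?thesis by simp
    qed
    then show ?thesis
      by (subst P.integral_fst'[OF i, symmetric])
        (auto intro!: Bochner_Integration.integral_cong simp del: of_real_mult of_real_power)
  qed
  ultimately have E: "(CLINT x|M. iexp (s * quad m x) * (\<i> * complex_of_real (s * quad m x)))
    = (CLINT x|M. iexp (s * quad m x) * (\<i> * complex_of_real (s * mean m) - complex_of_real (2 * s\<^sup>2 * quad (sandwich m) x)))"
    by simp
  have ii: "integrable M (\<lambda>x. complex_of_real (g x) * iexp (s * quad m x))" if "integrable M g" for g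
    by (rule Bochner_Integration.integrable_bound[OF that]) (use that in \<open>auto simp: norm_mult\<close>)
  have ie: "integrable M (\<lambda>x. iexp (s * quad m x))" by (intro integrable_const_bound[where B=1]) auto
  have e1: "(CLINT x|M. iexp (s * quad m x) * (\<i> * complex_of_real (s * quad m x)))
     = \<i> * s * (CLINT x|M. complex_of_real (quad m x) * iexp (s * quad m x))"
    by (simp add: mult_ac flip: integral_mult_right_zero)
  have e2: "(CLINT x|M. iexp (s * quad m x) * (\<i> * complex_of_real (s * mean m) - complex_of_real (2 * s\<^sup>2 * quad (sandwich m) x)))
     = \<i> * s * mean m * (CLINT x|M. iexp (s * quad m x)) - 2 * s\<^sup>2 * (CLINT x|M. complex_of_real (quad (sandwich m) x) * iexp (s * quad m x))"
  proof -
    have "(CLINT x|M. iexp (s * quad m x) * (\<i> * complex_of_real (s * mean m) - complex_of_real (2 * s\<^sup>2 * quad (sandwich m) x)))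
      = (CLINT x|M. (\<i> * s * mean m) * iexp (s * quad m x) - (2 * s\<^sup>2) * (complex_of_real (quad (sandwich m) x) * iexp (s * quad m x)))"
      by (simp add: algebra_simps)
    also have "\<dots> = (\<i> * s * mean m) * (CLINT x|M. iexp (s * quad m x)) - (2 * s\<^sup>2) * (CLINT x|M. (complex_of_real (quad (sandwich m) x) * iexp (s * quad m x)))"
      using ie ii[OF iq] by simp
    finally show ?thesis by simp
  qed
  have e3: "(CLINT x|M. complex_of_real (quad m x - mean m) * iexp (s * quad m x))
     = (CLINT x|M. complex_of_real (quad m x) * iexp (s * quad m x)) - mean m * (CLINT x|M. iexp (s * quad m x))"
    using ie ii[OF iq] by (simp add: left_diff_distrib)
  \<comment> \<open>Both sides carry the common factor \<open>i s\<close>, which is cancelled at the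
    end for \<open>s\<close> different from 0.\<close>
  have alg: "\<i> * z * Dv = \<i> * z * (2 * \<i> * z * Bv)"
    if "L = R'" "L = \<i> * z * Av" "R' = \<i> * z * \<mu> * Fv - 2 * z\<^sup>2 * Bv" "Dv = Av - \<mu> * Fv"
    for L R' Av Bv Dv Fv \<mu> z :: complex
  proof -
    have "\<i> * z * Dv = - 2 * z\<^sup>2 * Bv" using that by (simp add: right_diff_distrib)
    also have "\<dots> = (\<i> * \<i>) * (2 * z\<^sup>2 * Bv)" by simp
    finally show ?thesis by (simp only: power2_eq_square mult_ac)
  qed
  have "\<i> * s * (CLINT x|M. complex_of_real (quad m x - mean m) * iexp (s * quad m x))
     = \<i> * s * (2 * \<i> * s * (CLINT x|M. complex_of_real (quad (sandwich m) x) * iexp (s * quad m x)))"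
    by (rule alg[OF E e1 _ e3]) (use e2 in simp)
  then show ?thesis using False by simp
qed

end

text \<open>One moment is enough to differentiate under the integral: the first-order remainder of
  \<open>iexp x\<close> is at most \<open>x^2 / 2\<close>, which gives the pointwise limit, and at
  most \<open>2 |x|\<close>, which gives the majorant.\<close>

lemma (in prob_space) has_vector_derivative_char:
  assumes F: "integrable M F"
  shows "((\<lambda>s. CLINT \<omega>|M. iexp (s * F \<omega>)) has_vector_derivative
            (CLINT \<omega>|M. \<i> * F \<omega> * iexp (s * F \<omega>))) (at s)"
proof -
  have [measurable]: "F \<in> borel_measurable M" using F by auto
  let ?\<phi> = "\<lambda>s. CLINT \<omega>|M. iexp (s * F \<omega>)"
  let ?D = "CLINT \<omega>|M. \<i> * F \<omega> * iexp (s * F \<omega>)"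
  have i1: "integrable M (\<lambda>\<omega>. iexp (t * F \<omega>))" for t by (intro integrable_const_bound[where B=1]) auto
  have i2: "integrable M (\<lambda>\<omega>. \<i> * F \<omega> * iexp (s * F \<omega>))"
    by (rule Bochner_Integration.integrable_bound[OF F]) (auto simp: norm_mult)
  have ap1: "cmod (iexp x - 1 - \<i> * x) \<le> x\<^sup>2 / 2" and ap2: "cmod (iexp x - 1 - \<i> * x) \<le> 2 * \<bar>x\<bar>" for x
    using iexp_approx1[of x 1] iexp_approx2[of x 1] by (auto simp: power2_eq_square diff_diff_eq)
  have le: "norm (?\<phi> (s + h) - ?\<phi> s - h *\<^sub>R ?D) / norm h
      \<le> (\<integral>\<omega>. cmod (iexp (h * F \<omega>) - 1 - \<i> * complex_of_real (h * F \<omega>)) / \<bar>h\<bar> \<partial>M)" for h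
  proof -
    have "?\<phi> (s + h) - ?\<phi> s - h *\<^sub>R ?D
        = (CLINT \<omega>|M. iexp ((s + h) * F \<omega>) - iexp (s * F \<omega>) - h *\<^sub>R (\<i> * F \<omega> * iexp (s * F \<omega>)))"
      using i1[of "s + h"] i1[of s] i2 by (simp del: of_real_add of_real_mult)
    also have "\<dots> = (CLINT \<omega>|M. iexp (s * F \<omega>) * (iexp (h * F \<omega>) - 1 - \<i> * complex_of_real (h * F \<omega>)))"
      by (intro Bochner_Integration.integral_cong refl)
        (simp add: distrib_right distrib_left exp_add right_diff_distrib scaleR_conv_of_real mult_ac)
    also have "cmod \<dots> \<le> (\<integral>\<omega>. cmod (iexp (s * F \<omega>) * (iexp (h * F \<omega>) - 1 - \<i> * complex_of_real (h * F \<omega>))) \<partial>M)"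
      by (rule integral_norm_bound)
    finally show ?thesis by (simp add: norm_mult divide_right_mono)
  qed
  have lim: "(\<lambda>h. norm (?\<phi> (s + h) - ?\<phi> s - h *\<^sub>R ?D) / norm h) \<midarrow>0\<rightarrow> 0"
    unfolding tendsto_at_iff_sequentially
  proof (intro allI impI)
    fix X :: "nat \<Rightarrow> real" assume X: "\<forall>i. X i \<in> UNIV - {0}" "X \<longlonglongrightarrow> 0"
    have "(\<lambda>n. \<integral>\<omega>. cmod (iexp (X n * F \<omega>) - 1 - \<i> * complex_of_real (X n * F \<omega>)) / \<bar>X n\<bar> \<partial>M)
        \<longlonglongrightarrow> (\<integral>\<omega>. 0 \<partial>M)"
    proof (rule integral_dominated_convergence[where w="\<lambda>\<omega>. 2 * \<bar>F \<omega>\<bar>"])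
      show "AE \<omega> in M. (\<lambda>n. cmod (iexp (X n * F \<omega>) - 1 - \<i> * complex_of_real (X n * F \<omega>)) / \<bar>X n\<bar>) \<longlonglongrightarrow> 0"
      proof (rule AE_I2)
        fix \<omega>
        show "(\<lambda>n. cmod (iexp (X n * F \<omega>) - 1 - \<i> * complex_of_real (X n * F \<omega>)) / \<bar>X n\<bar>) \<longlonglongrightarrow> 0"
        proof (rule Lim_null_comparison)
          show "\<forall>\<^sub>F n in sequentially. norm (cmod (iexp (X n * F \<omega>) - 1 - \<i> * complex_of_real (X n * F \<omega>)) / \<bar>X n\<bar>)
              \<le> \<bar>X n\<bar> * ((F \<omega>)\<^sup>2 / 2)"
          proof (rule always_eventually, rule allI)
            fix n
            have n0: "\<bar>X n\<bar> > 0" using X by auto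
            have "(X n * F \<omega>)\<^sup>2 / 2 = \<bar>X n\<bar> * ((F \<omega>)\<^sup>2 / 2) * \<bar>X n\<bar>"
            proof -
              have "(X n)\<^sup>2 = \<bar>X n\<bar> * \<bar>X n\<bar>" by (simp only: power2_eq_square abs_mult_self_eq)
              moreover have "(X n * F \<omega>)\<^sup>2 / 2 = (X n)\<^sup>2 * ((F \<omega>)\<^sup>2 / 2)"
                by (simp only: power_mult_distrib times_divide_eq_right)
              ultimately show ?thesis by (simp only: mult_ac)
            qed
            with ap1[of "X n * F \<omega>"]
            have "cmod (iexp (X n * F \<omega>) - 1 - \<i> * complex_of_real (X n * F \<omega>)) \<le> \<bar>X n\<bar> * ((F \<omega>)\<^sup>2 / 2) * \<bar>X n\<bar>"
              by linarith
            then have "cmod (iexp (X n * F \<omega>) - 1 - \<i> * complex_of_real (X n * F \<omega>)) / \<bar>X n\<bar> \<le> \<bar>X n\<bar> * ((F \<omega>)\<^sup>2 / 2)"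
              by (simp only: pos_divide_le_eq[OF n0])
            then show "norm (cmod (iexp (X n * F \<omega>) - 1 - \<i> * complex_of_real (X n * F \<omega>)) / \<bar>X n\<bar>)
                \<le> \<bar>X n\<bar> * ((F \<omega>)\<^sup>2 / 2)"
              by (simp only: real_norm_def abs_divide abs_abs abs_norm_cancel)
          qed
          have "(\<lambda>n. \<bar>X n\<bar> * ((F \<omega>)\<^sup>2 / 2)) \<longlonglongrightarrow> \<bar>0\<bar> * ((F \<omega>)\<^sup>2 / 2)" by (intro tendsto_intros X)
          then show "(\<lambda>n. \<bar>X n\<bar> * ((F \<omega>)\<^sup>2 / 2)) \<longlonglongrightarrow> 0" by simp
        qed
      qed
      show "AE \<omega> in M. norm (cmod (iexp (X n * F \<omega>) - 1 - \<i> * complex_of_real (X n * F \<omega>)) / \<bar>X n\<bar>) \<le> 2 * \<bar>F \<omega>\<bar>" for n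
      proof (rule AE_I2)
        fix \<omega>
        have n0: "\<bar>X n\<bar> > 0" using X by auto
        have "cmod (iexp (X n * F \<omega>) - 1 - \<i> * complex_of_real (X n * F \<omega>)) \<le> 2 * \<bar>F \<omega>\<bar> * \<bar>X n\<bar>"
          using ap2[of "X n * F \<omega>"] by (simp only: abs_mult mult_ac)
        then have "cmod (iexp (X n * F \<omega>) - 1 - \<i> * complex_of_real (X n * F \<omega>)) / \<bar>X n\<bar> \<le> 2 * \<bar>F \<omega>\<bar>"
          by (simp only: pos_divide_le_eq[OF n0])
        then show "norm (cmod (iexp (X n * F \<omega>) - 1 - \<i> * complex_of_real (X n * F \<omega>)) / \<bar>X n\<bar>) \<le> 2 * \<bar>F \<omega>\<bar>"
          by (simp only: real_norm_def abs_divide abs_abs abs_norm_cancel)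
      qed
    qed (use F in auto)
    then have "(\<lambda>n. \<integral>\<omega>. cmod (iexp (X n * F \<omega>) - 1 - \<i> * complex_of_real (X n * F \<omega>)) / \<bar>X n\<bar> \<partial>M) \<longlonglongrightarrow> 0" by simp
    then show "((\<lambda>h. norm (?\<phi> (s + h) - ?\<phi> s - h *\<^sub>R ?D) / norm h) \<circ> X) \<longlonglongrightarrow> 0"
      by (rule Lim_null_comparison[rotated], intro always_eventually allI) (simp only: o_def real_norm_def abs_divide abs_abs abs_norm_cancel le[unfolded real_norm_def])
  qed
  show ?thesis
    unfolding has_vector_derivative_def has_derivative_at
    by (rule conjI, rule bounded_linear_scaleR_left, rule lim)
qed

text \<open>The maximal absolute row sum is an operator norm. For a stationary, summable covariance
  it stays bounded as the index set grows.\<close>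

lemma row_sum_mult:
  fixes A B :: "'i \<Rightarrow> 'i \<Rightarrow> real"
  assumes A: "\<And>i. i \<in> I \<Longrightarrow> (\<Sum>k\<in>I. \<bar>A i k\<bar>) \<le> \<alpha>"
    and B: "\<And>i. i \<in> I \<Longrightarrow> (\<Sum>k\<in>I. \<bar>B i k\<bar>) \<le> \<beta>" and i: "i \<in> I" and \<beta>: "0 \<le> \<beta>"
  shows "(\<Sum>k\<in>I. \<bar>\<Sum>p\<in>I. A i p * B p k\<bar>) \<le> \<alpha> * \<beta>"
proof -
  have "(\<Sum>k\<in>I. \<bar>\<Sum>p\<in>I. A i p * B p k\<bar>) \<le> (\<Sum>k\<in>I. \<Sum>p\<in>I. \<bar>A i p\<bar> * \<bar>B p k\<bar>)"
    by (intro sum_mono order.trans[OF sum_abs]) (simp add: abs_mult)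
  also have "\<dots> = (\<Sum>p\<in>I. \<bar>A i p\<bar> * (\<Sum>k\<in>I. \<bar>B p k\<bar>))"
    by (subst sum.swap) (simp add: sum_distrib_left)
  also have "\<dots> \<le> (\<Sum>p\<in>I. \<bar>A i p\<bar> * \<beta>)" by (intro sum_mono mult_left_mono B) auto
  also have "\<dots> \<le> \<alpha> * \<beta>" using A[OF i] \<beta> by (simp add: sum_distrib_right[symmetric] mult_right_mono)
  finally show ?thesis .
qed

section \<open>Variance and characteristic function of a centered quadratic form\<close>

context gaussian_vector
begin

definition centered :: "('i \<Rightarrow> 'i \<Rightarrow> real) \<Rightarrow> 'a \<Rightarrow> real" where
  "centered m \<omega> = quad m \<omega> - mean m"

lemma centered_sq: "square_integrable M (centered m)"
  unfolding centered_def[abs_def]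
  by (intro square_integrable_diff quad_sq) (simp add: square_integrable_def)

lemma centered_measurable [measurable]: "centered m \<in> borel_measurable M"
  using centered_sq by measurable

lemma integrable_centered: "integrable M (centered m)"
  by (rule integrable_of_sq[OF centered_sq])

text \<open>Centering multiplies both sides of \<open>quad_identity\<close> by the same phase
  \<open>iexp (- s * mean m)\<close>.\<close>

lemma centered_identity:
  assumes sym: "\<And>i k. m i k = m k i"
  shows "(CLINT \<omega>|M. complex_of_real (centered m \<omega>) * iexp (s * centered m \<omega>))
       = 2 * \<i> * s * (CLINT \<omega>|M. complex_of_real (quad (sandwich m) \<omega>) * iexp (s * centered m \<omega>))"
proof -
  have split: "iexp (s * centered m \<omega>) = iexp (- s * mean m) * iexp (s * quad m \<omega>)" for \<omega>
    unfolding exp_add[symmetric] centered_def by (simp add: algebra_simps)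
  have pull: "(CLINT \<omega>|M. complex_of_real (g \<omega>) * iexp (s * centered m \<omega>))
      = iexp (- s * mean m) * (CLINT \<omega>|M. complex_of_real (g \<omega>) * iexp (s * quad m \<omega>))" for g
    unfolding split by (subst integral_mult_right_zero[symmetric]) (simp only: mult_ac)
  show ?thesis unfolding pull[of "centered m"] pull[of "quad (sandwich m)"] using quad_identity[of m, OF sym, where s=s, folded centered_def] by (simp only: mult_ac)
qed

text \<open>The imaginary part of \<open>centered_identity\<close>, divided by \<open>s\<close>,
  tends to the variance on one side as \<open>s\<close> tends to 0. This takes the place of a
  computation of fourth moments.\<close>

lemma variance_quad:
  assumes sym: "\<And>i k. m i k = m k i"
  shows "(\<integral>\<omega>. (centered m \<omega>)\<^sup>2 \<partial>M) = 2 * mean (sandwich m)"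
proof -
  define e :: "nat \<Rightarrow> real" where "e n = 1 / real (Suc n)" for n
  have e: "e \<longlonglongrightarrow> 0" "\<And>n. e n > 0"
    using LIMSEQ_inverse_real_of_nat by (auto simp: e_def[abs_def] inverse_eq_divide)
  have id: "(\<integral>\<omega>. centered m \<omega> * sin (s * centered m \<omega>) \<partial>M) = 2 * s * (\<integral>\<omega>. quad (sandwich m) \<omega> * cos (s * centered m \<omega>) \<partial>M)" for s
  proof -
    have i: "integrable M (\<lambda>\<omega>. complex_of_real (g \<omega>) * iexp (s * centered m \<omega>))" if "integrable M g" for g
      by (rule Bochner_Integration.integrable_bound[OF that]) (use that in \<open>auto simp: norm_mult\<close>)
    have "(\<integral>\<omega>. centered m \<omega> * sin (s * centered m \<omega>) \<partial>M) = Im (CLINT \<omega>|M. complex_of_real (centered m \<omega>) * iexp (s * centered m \<omega>))"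
      by (subst integral_Im[OF i[OF integrable_centered], symmetric]) (simp add: Im_exp)
    also have "\<dots> = 2 * s * Re (CLINT \<omega>|M. complex_of_real (quad (sandwich m) \<omega>) * iexp (s * centered m \<omega>))"
      unfolding centered_identity[of m, OF sym] by simp
    also have "\<dots> = 2 * s * (\<integral>\<omega>. quad (sandwich m) \<omega> * cos (s * centered m \<omega>) \<partial>M)"
      by (subst integral_Re[OF i[OF integrable_of_sq[OF quad_sq]], symmetric]) (simp add: Re_exp)
    finally show ?thesis .
  qed
  have "(\<lambda>n. \<integral>\<omega>. centered m \<omega> * (sin (e n * centered m \<omega>) / e n) \<partial>M) \<longlonglongrightarrow> (\<integral>\<omega>. (centered m \<omega>)\<^sup>2 \<partial>M)"
  proof (rule integral_dominated_convergence[where w="\<lambda>\<omega>. (centered m \<omega>)\<^sup>2"])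
    show "integrable M (\<lambda>\<omega>. (centered m \<omega>)\<^sup>2)" using centered_sq by (simp add: square_integrable_def)
    show "AE \<omega> in M. (\<lambda>n. centered m \<omega> * (sin (e n * centered m \<omega>) / e n)) \<longlonglongrightarrow> (centered m \<omega>)\<^sup>2"
    proof (rule AE_I2)
      fix \<omega>
      have "((\<lambda>h. sin (h * centered m \<omega>)) has_real_derivative centered m \<omega>) (at 0)"
        by (auto intro!: derivative_eq_intros)
      then have "(\<lambda>h. sin (h * centered m \<omega>) / h) \<midarrow>0\<rightarrow> centered m \<omega>" by (simp add: DERIV_def)
      moreover have "filterlim e (at 0) sequentially"
        unfolding filterlim_at using e by (auto intro!: always_eventually simp: less_imp_neq[symmetric] dest: less_imp_neq)
      ultimately have "(\<lambda>n. sin (e n * centered m \<omega>) / e n) \<longlonglongrightarrow> centered m \<omega>" by (rule filterlim_compose)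
      then have "(\<lambda>n. centered m \<omega> * (sin (e n * centered m \<omega>) / e n)) \<longlonglongrightarrow> centered m \<omega> * centered m \<omega>"
        by (intro tendsto_intros)
      then show "(\<lambda>n. centered m \<omega> * (sin (e n * centered m \<omega>) / e n)) \<longlonglongrightarrow> (centered m \<omega>)\<^sup>2"
        by (simp add: power2_eq_square)
    qed
    show "AE \<omega> in M. norm (centered m \<omega> * (sin (e n * centered m \<omega>) / e n)) \<le> (centered m \<omega>)\<^sup>2" for n
    proof (rule AE_I2)
      fix \<omega>
      have "\<bar>sin (e n * centered m \<omega>)\<bar> \<le> \<bar>e n * centered m \<omega>\<bar>" by (rule abs_sin_x_le_abs_x)
      then have "\<bar>sin (e n * centered m \<omega>) / e n\<bar> \<le> \<bar>centered m \<omega>\<bar>"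
        using e(2)[of n] by (simp add: abs_mult divide_le_eq mult.commute)
      then have "\<bar>centered m \<omega>\<bar> * \<bar>sin (e n * centered m \<omega>) / e n\<bar> \<le> \<bar>centered m \<omega>\<bar> * \<bar>centered m \<omega>\<bar>"
        by (rule mult_left_mono) simp
      then show "norm (centered m \<omega> * (sin (e n * centered m \<omega>) / e n)) \<le> (centered m \<omega>)\<^sup>2"
        unfolding real_norm_def abs_mult abs_mult_self_eq power2_eq_square .
    qed
  qed measurable
  moreover have "(\<integral>\<omega>. centered m \<omega> * (sin (e n * centered m \<omega>) / e n) \<partial>M) = 2 * (\<integral>\<omega>. quad (sandwich m) \<omega> * cos (e n * centered m \<omega>) \<partial>M)" for n
  proof -
    have "(\<integral>\<omega>. centered m \<omega> * (sin (e n * centered m \<omega>) / e n) \<partial>M) = (\<integral>\<omega>. centered m \<omega> * sin (e n * centered m \<omega>) \<partial>M) / e n" by simp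
    then show ?thesis unfolding id using e(2)[of n] by simp
  qed
  moreover have "(\<lambda>n. 2 * (\<integral>\<omega>. quad (sandwich m) \<omega> * cos (e n * centered m \<omega>) \<partial>M)) \<longlonglongrightarrow> 2 * (\<integral>\<omega>. quad (sandwich m) \<omega> * cos (0 * centered m \<omega>) \<partial>M)"
  proof (intro tendsto_mult tendsto_const integral_dominated_convergence[where w="\<lambda>\<omega>. \<bar>quad (sandwich m) \<omega>\<bar>"])
    show "AE \<omega> in M. (\<lambda>n. quad (sandwich m) \<omega> * cos (e n * centered m \<omega>)) \<longlonglongrightarrow> quad (sandwich m) \<omega> * cos (0 * centered m \<omega>)"
      by (intro AE_I2 tendsto_intros e)
  qed (use integrable_of_sq[OF quad_sq[of "sandwich m"]] in \<open>auto intro!: mult_left_le simp: abs_mult\<close>)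
  ultimately show ?thesis using integral_quad[of "sandwich m"] by (simp add: LIMSEQ_unique)
qed

lemma sandwich_sym:
  assumes sym: "\<And>i k. m i k = m k i"
  shows "sandwich m i k = sandwich m k i"
proof -
  have "sandwich m i k = (\<Sum>p\<in>I. \<Sum>r\<in>I. m k r * Cov r p * m p i)"
  proof -
    have "m i p * Cov p r * m r k = m k r * Cov r p * m p i" for p r
      using sym[of i p] sym[of r k] Cov_sym[of p r] by simp
    then show ?thesis unfolding sandwich_def by (intro sum.cong refl)
  qed
  also have "\<dots> = sandwich m k i" unfolding sandwich_def by (rule sum.swap)
  finally show ?thesis .
qed

end

lemma (in prob_space) integrable_iexp_scaled:
  assumes [measurable]: "F \<in> borel_measurable M"
  shows "integrable M (\<lambda>\<omega>. iexp (s * F \<omega>))"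
proof (rule integrable_const_bound[where B=1])
  show "AE \<omega> in M. cmod (iexp (s * F \<omega>)) \<le> 1" by (simp only: cmod_iexp) simp
qed measurable

context gaussian_vector begin
text \<open>The product of the characteristic function with \<open>exp (v s^2)\<close> would be
  constant if \<open>quad (sandwich m)\<close> were. In general its derivative is
  \<open>exp (v s^2)\<close> times an error of at most \<open>2 |s| \<kappa>\<close>, and the mean
  value inequality integrates this error; the exponential factor cancels in the end.\<close>

lemma char_quad_bound:
  assumes sym: "\<And>i k. m i k = m k i"
  shows "cmod ((CLINT \<omega>|M. iexp (s * centered m \<omega>)) - complex_of_real (exp (- mean (sandwich m) * s\<^sup>2)))
       \<le> 2 * s\<^sup>2 * (\<integral>\<omega>. \<bar>centered (sandwich m) \<omega>\<bar> \<partial>M)"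
proof -
  define \<phi> where "\<phi> s = (CLINT \<omega>|M. iexp (s * centered m \<omega>))" for s
  \<comment> \<open>The variance of \<open>centered m\<close> is \<open>2 * v\<close>, so the
    comparison function is the characteristic function of the normal law with that variance.\<close>
  define v where "v = mean (sandwich m)"
  define \<kappa> where "\<kappa> = (\<integral>\<omega>. \<bar>centered (sandwich m) \<omega>\<bar> \<partial>M)"
  have v0: "v \<ge> 0" using variance_quad[of m, OF sym] Bochner_Integration.integral_nonneg[of M "\<lambda>\<omega>. (centered m \<omega>)\<^sup>2"] by (simp add: v_def)
  have k0: "\<kappa> \<ge> 0" by (simp add: \<kappa>_def)
  have pos: "cmod (\<phi> s - complex_of_real (exp (- v * s\<^sup>2))) \<le> 2 * s\<^sup>2 * \<kappa>" if s: "s > 0" for s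
  proof -
    define \<phi>' where "\<phi>' s = (CLINT \<omega>|M. \<i> * centered m \<omega> * iexp (s * centered m \<omega>))" for s
    have d: "(\<phi> has_vector_derivative \<phi>' x) (at x)" for x
      unfolding \<phi>_def[abs_def] \<phi>'_def by (rule has_vector_derivative_char[OF integrable_centered])
    have small: "cmod (\<phi>' x + 2 * v * x * \<phi> x) \<le> 2 * \<bar>x\<bar> * \<kappa>" for x
    proof -
      have alg: "\<i> * (2 * \<i> * complex_of_real z * E) = complex_of_real (- 2 * z) * E" for z E
      proof -
        have "\<i> * (2 * \<i> * complex_of_real z * E) = (\<i> * \<i>) * (2 * complex_of_real z * E)" by (simp only: mult_ac)
        then show ?thesis by simp
      qed
      have i1: "integrable M (\<lambda>\<omega>. iexp (x * centered m \<omega>))" by (rule integrable_iexp_scaled) simp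
      have i2: "integrable M (\<lambda>\<omega>. complex_of_real (centered (sandwich m) \<omega>) * iexp (x * centered m \<omega>))"
        by (rule Bochner_Integration.integrable_bound[OF integrable_centered[of "sandwich m"]]) (auto simp: norm_mult)
      have "\<phi>' x = \<i> * (CLINT \<omega>|M. complex_of_real (centered m \<omega>) * iexp (x * centered m \<omega>))"
        unfolding \<phi>'_def by (subst integral_mult_right_zero[symmetric]) (simp only: mult.assoc)
      also have "\<dots> = - 2 * x * (CLINT \<omega>|M. complex_of_real (quad (sandwich m) \<omega>) * iexp (x * centered m \<omega>))"
        unfolding centered_identity[of m, OF sym, where s=x] by (rule alg)
      also have "(\<lambda>\<omega>. complex_of_real (quad (sandwich m) \<omega>) * iexp (x * centered m \<omega>))
          = (\<lambda>\<omega>. complex_of_real (centered (sandwich m) \<omega>) * iexp (x * centered m \<omega>) + v * iexp (x * centered m \<omega>))"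
        by (simp add: centered_def[of "sandwich m"] v_def left_diff_distrib)
      also have "(CLINT \<omega>|M. complex_of_real (centered (sandwich m) \<omega>) * iexp (x * centered m \<omega>) + v * iexp (x * centered m \<omega>))
          = (CLINT \<omega>|M. complex_of_real (centered (sandwich m) \<omega>) * iexp (x * centered m \<omega>)) + v * \<phi> x"
        unfolding \<phi>_def by (subst Bochner_Integration.integral_add[OF i2])
          (use i1 in \<open>simp_all only: integral_mult_right_zero integrable_mult_right\<close>)
      finally have "\<phi>' x + 2 * v * x * \<phi> x = - 2 * x * (CLINT \<omega>|M. complex_of_real (centered (sandwich m) \<omega>) * iexp (x * centered m \<omega>))"
        by (simp only: distrib_left) (simp add: mult_ac)
      then have "cmod (\<phi>' x + 2 * v * x * \<phi> x) = 2 * \<bar>x\<bar> * cmod (CLINT \<omega>|M. complex_of_real (centered (sandwich m) \<omega>) * iexp (x * centered m \<omega>))"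
        by (simp add: norm_mult)
      also have "\<dots> \<le> 2 * \<bar>x\<bar> * (\<integral>\<omega>. cmod (complex_of_real (centered (sandwich m) \<omega>) * iexp (x * centered m \<omega>)) \<partial>M)"
        by (intro mult_left_mono integral_norm_bound) auto
      finally show ?thesis by (simp add: norm_mult \<kappa>_def)
    qed
    define G where "G x = exp (v * x\<^sup>2) *\<^sub>R \<phi> x" for x
    have dG: "(G has_vector_derivative exp (v * x\<^sup>2) *\<^sub>R (\<phi>' x + 2 * v * x * \<phi> x)) (at x)" for x
    proof -
      have "((\<lambda>x. exp (v * x\<^sup>2)) has_field_derivative exp (v * x\<^sup>2) * (v * (2 * x))) (at x)"
        by (auto intro!: derivative_eq_intros)
      from has_vector_derivative_scaleR[OF this d]
      show ?thesis unfolding G_def[abs_def] by (simp add: scaleR_conv_of_real algebra_simps)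
    qed
    have "\<exists>x\<in>{0<..<s}. norm (G s - G 0) \<le> norm ((s - 0) *\<^sub>R (exp (v * x\<^sup>2) *\<^sub>R (\<phi>' x + 2 * v * x * \<phi> x)))"
    proof (rule mvt_general)
      show "continuous_on {0..s} G"
        by (rule continuous_at_imp_continuous_on) (metis dG has_vector_derivative_continuous)
      show "(G has_derivative (\<lambda>h. h *\<^sub>R (exp (v * x\<^sup>2) *\<^sub>R (\<phi>' x + 2 * v * x * \<phi> x)))) (at x)" for x
        using dG[of x] by (simp add: has_vector_derivative_def)
    qed (rule s)
    then obtain x where x: "0 < x" "x < s" "norm (G s - G 0) \<le> s * (exp (v * x\<^sup>2) * cmod (\<phi>' x + 2 * v * x * \<phi> x))"
      using s by auto
    have "s * (exp (v * x\<^sup>2) * cmod (\<phi>' x + 2 * v * x * \<phi> x)) \<le> s * (exp (v * s\<^sup>2) * (2 * s * \<kappa>))"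
    proof (intro mult_left_mono mult_mono)
      show "exp (v * x\<^sup>2) \<le> exp (v * s\<^sup>2)" using x v0 by (simp add: mult_left_mono power_mono)
      show "cmod (\<phi>' x + 2 * v * x * \<phi> x) \<le> 2 * s * \<kappa>"
      proof -
        have "2 * \<bar>x\<bar> * \<kappa> \<le> 2 * s * \<kappa>" using x k0 by (intro mult_right_mono) auto
        then show ?thesis using small[of x] by linarith
      qed
    qed (use s in auto)
    also have "s * (exp (v * s\<^sup>2) * (2 * s * \<kappa>)) = exp (v * s\<^sup>2) * (2 * s\<^sup>2 * \<kappa>)"
      by (simp only: power2_eq_square mult_ac)
    finally have le: "norm (G s - G 0) \<le> exp (v * s\<^sup>2) * (2 * s\<^sup>2 * \<kappa>)" using x(3) by linarith
    have inv: "exp (- v * s\<^sup>2) * exp (v * s\<^sup>2) = 1" unfolding exp_add[symmetric] by simp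
    have "exp (- v * s\<^sup>2) *\<^sub>R G s = \<phi> s" unfolding G_def scaleR_scaleR inv by (rule scaleR_one)
    moreover have "G 0 = 1" by (simp add: G_def \<phi>_def prob_space)
    ultimately have "\<phi> s - complex_of_real (exp (- v * s\<^sup>2)) = exp (- v * s\<^sup>2) *\<^sub>R (G s - G 0)"
      by (simp only: scaleR_conv_of_real right_diff_distrib mult_1_right)
    then have "cmod (\<phi> s - complex_of_real (exp (- v * s\<^sup>2))) = exp (- v * s\<^sup>2) * norm (G s - G 0)"
      by (simp only: norm_scaleR abs_exp_cancel)
    also have "\<dots> \<le> exp (- v * s\<^sup>2) * (exp (v * s\<^sup>2) * (2 * s\<^sup>2 * \<kappa>))"
      by (rule mult_left_mono[OF le]) simp
    also have "\<dots> = 2 * s\<^sup>2 * \<kappa>" unfolding mult.assoc[symmetric] inv by simp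
    finally show ?thesis .
  qed
  have "cmod (\<phi> s - complex_of_real (exp (- v * s\<^sup>2))) \<le> 2 * s\<^sup>2 * \<kappa>"
  proof (cases s "0 :: real" rule: linorder_cases)
    \<comment> \<open>The characteristic function at \<open>- s\<close> is the conjugate of that at
      \<open>s\<close>, and the comparison function is even.\<close>
    case less
    have "\<phi> (- s) = cnj (\<phi> s)" unfolding \<phi>_def Bochner_Integration.integral_cnj[symmetric] by (simp add: exp_cnj)
    then have "\<phi> s - complex_of_real (exp (- v * s\<^sup>2)) = cnj (\<phi> (- s) - complex_of_real (exp (- v * (- s)\<^sup>2)))" by simp
    then show ?thesis using pos[of "- s"] less by (simp only: complex_mod_cnj) simp
  next
    case equal
    then show ?thesis by (simp add: \<phi>_def prob_space)
  qed (rule pos)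
  then show ?thesis by (simp add: \<phi>_def v_def \<kappa>_def)
qed

lemma sandwich_row_sum:
  fixes c S :: real
  assumes m: "\<And>i. i \<in> I \<Longrightarrow> (\<Sum>k\<in>I. \<bar>m i k\<bar>) \<le> c" and C: "\<And>i. i \<in> I \<Longrightarrow> (\<Sum>k\<in>I. \<bar>Cov i k\<bar>) \<le> S"
    and i: "i \<in> I" and "0 \<le> c" "0 \<le> S"
  shows "(\<Sum>k\<in>I. \<bar>sandwich m i k\<bar>) \<le> c\<^sup>2 * S"
proof -
  have "sandwich m i k = (\<Sum>r\<in>I. (\<Sum>p\<in>I. m i p * Cov p r) * m r k)" for i k
    unfolding sandwich_def sum_distrib_right by (rule sum.swap)
  moreover have "(\<Sum>k\<in>I. \<bar>\<Sum>p\<in>I. m i p * Cov p k\<bar>) \<le> c * S" if "i \<in> I" for i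
    by (rule row_sum_mult[OF m C that assms(5)])
  then have "(\<Sum>k\<in>I. \<bar>\<Sum>r\<in>I. (\<Sum>p\<in>I. m i p * Cov p r) * m r k\<bar>) \<le> c * S * c"
    by (rule row_sum_mult[OF _ m i assms(4)])
  ultimately show ?thesis by (simp add: power2_eq_square mult_ac)
qed

lemma mean_bound:
  fixes c S :: real
  assumes m: "\<And>i. i \<in> I \<Longrightarrow> (\<Sum>k\<in>I. \<bar>m i k\<bar>) \<le> c" and C: "\<And>i. i \<in> I \<Longrightarrow> (\<Sum>k\<in>I. \<bar>Cov i k\<bar>) \<le> S"
    and "0 \<le> S"
  shows "\<bar>mean m\<bar> \<le> card I * (c * S)"
proof -
  have C1: "\<bar>Cov i k\<bar> \<le> S" if "i \<in> I" "k \<in> I" for i k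
    using member_le_sum[of k I "\<lambda>k. \<bar>Cov i k\<bar>"] C[OF that(1)] that by auto
  have "\<bar>mean m\<bar> \<le> (\<Sum>i\<in>I. \<Sum>k\<in>I. \<bar>m i k\<bar> * \<bar>Cov i k\<bar>)"
    unfolding mean_def by (intro order.trans[OF sum_abs] sum_mono order.trans[OF sum_abs]) (simp add: abs_mult)
  also have "\<dots> \<le> (\<Sum>i\<in>I. \<Sum>k\<in>I. \<bar>m i k\<bar> * S)" by (intro sum_mono mult_left_mono C1) auto
  also have "\<dots> \<le> (\<Sum>i\<in>I. c * S)"
    unfolding sum_distrib_right[symmetric] using m assms(3) by (intro mult_right_mono sum_mono) auto
  finally show ?thesis by simp
qed

lemma variance_quad_le:
  fixes c S :: real
  assumes sym: "\<And>i k. m i k = m k i"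
    and m: "\<And>i. i \<in> I \<Longrightarrow> (\<Sum>k\<in>I. \<bar>m i k\<bar>) \<le> c" and C: "\<And>i. i \<in> I \<Longrightarrow> (\<Sum>k\<in>I. \<bar>Cov i k\<bar>) \<le> S"
    and c: "0 \<le> c" "0 \<le> S"
  shows "(\<integral>\<omega>. (centered m \<omega>)\<^sup>2 \<partial>M) \<le> 2 * card I * (c * S)\<^sup>2"
proof -
  have "\<bar>mean (sandwich m)\<bar> \<le> card I * (c\<^sup>2 * S * S)"
    by (rule mean_bound) (auto intro!: sandwich_row_sum m C c)
  moreover have "(\<integral>\<omega>. (centered m \<omega>)\<^sup>2 \<partial>M) = 2 * mean (sandwich m)" by (rule variance_quad) (rule sym)
  ultimately show ?thesis by (simp add: power2_eq_square mult_ac)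
qed

text \<open>The first absolute moment of \<open>centered (sandwich m)\<close> is at most its
  standard deviation, and \<open>sandwich m\<close> has row sums at most \<open>c^2 S\<close>. For
  \<open>c\<close> of order \<open>K^(-1/2)\<close> and a number of indices of order
  \<open>K\<close> the whole bound is of order \<open>K^(-1/2)\<close>.\<close>

lemma char_quad_row_sum_bound:
  fixes c S :: real
  assumes sym: "\<And>i k. m i k = m k i"
    and m: "\<And>i. i \<in> I \<Longrightarrow> (\<Sum>k\<in>I. \<bar>m i k\<bar>) \<le> c" and C: "\<And>i. i \<in> I \<Longrightarrow> (\<Sum>k\<in>I. \<bar>Cov i k\<bar>) \<le> S"
    and c: "0 \<le> c" "0 \<le> S"
  shows "cmod ((CLINT \<omega>|M. iexp (s * centered m \<omega>)) - complex_of_real (exp (- mean (sandwich m) * s\<^sup>2)))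
       \<le> 2 * s\<^sup>2 * (sqrt (2 * card I) * (c * S)\<^sup>2)"
proof -
  have "(\<integral>\<omega>. \<bar>centered (sandwich m) \<omega>\<bar> \<partial>M)\<^sup>2 \<le> (\<integral>\<omega>. (centered (sandwich m) \<omega>)\<^sup>2 \<partial>M)"
  proof -
    let ?f = "\<lambda>\<omega>. \<bar>centered (sandwich m) \<omega>\<bar>"
    have "\<bar>\<integral>\<omega>. 1 \<bullet> ?f \<omega> \<partial>M\<bar> \<le> l2norm M (\<lambda>_. 1::real) * l2norm M ?f"
      by (rule inner_le_l2norm) (use centered_sq[of "sandwich m"] in \<open>auto simp: square_integrable_def\<close>)
    then have "(\<integral>\<omega>. ?f \<omega> \<partial>M) \<le> l2norm M ?f" by (simp add: l2norm_def prob_space)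
    then have "(\<integral>\<omega>. ?f \<omega> \<partial>M)\<^sup>2 \<le> (l2norm M ?f)\<^sup>2" by (intro power_mono) auto
    then show ?thesis by (simp add: l2norm_sq)
  qed
  also have "\<dots> \<le> 2 * card I * (c\<^sup>2 * S * S)\<^sup>2"
  proof (rule variance_quad_le)
    show "sandwich m i k = sandwich m k i" for i k by (rule sandwich_sym) (rule sym)
    show "(\<Sum>k\<in>I. \<bar>sandwich m i k\<bar>) \<le> c\<^sup>2 * S" if "i \<in> I" for i
      by (rule sandwich_row_sum[OF m C that c])
  qed (use c in \<open>auto intro: C\<close>)
  finally have "(\<integral>\<omega>. \<bar>centered (sandwich m) \<omega>\<bar> \<partial>M) \<le> sqrt (2 * card I * (c\<^sup>2 * S * S)\<^sup>2)"
    by (rule real_le_rsqrt)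
  also have "\<dots> = sqrt (2 * card I) * (c * S)\<^sup>2"
    using c by (simp add: real_sqrt_mult power2_eq_square mult_ac)
  finally have le: "(\<integral>\<omega>. \<bar>centered (sandwich m) \<omega>\<bar> \<partial>M) \<le> sqrt (2 * card I) * (c * S)\<^sup>2" .
  have "cmod ((CLINT \<omega>|M. iexp (s * centered m \<omega>)) - complex_of_real (exp (- mean (sandwich m) * s\<^sup>2)))
       \<le> 2 * s\<^sup>2 * (\<integral>\<omega>. \<bar>centered (sandwich m) \<omega>\<bar> \<partial>M)"
    by (rule char_quad_bound) (rule sym)
  also have "\<dots> \<le> 2 * s\<^sup>2 * (sqrt (2 * card I) * (c * S)\<^sup>2)" by (intro mult_left_mono le) simp
  finally show ?thesis .
qed

end

section \<open>Mean-square integrals\<close>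

lemma norm_vec_le_sum: "norm (x :: 'a::real_normed_vector ^ 'n) \<le> (\<Sum>i\<in>UNIV. norm (x $ i))"
  unfolding norm_vec_def by (rule L2_set_le_sum) simp

lemma outer_nth [simp]: "outer v w $ i $ k = v $ i * w $ k"
  by (simp add: outer_def)

lemma borel_measurable_outer [measurable (raw)]:
  fixes v :: "'s \<Rightarrow> 'a::{real_normed_field, euclidean_space}^'n" and w :: "'s \<Rightarrow> 'a^'m"
  assumes "v \<in> borel_measurable M" "w \<in> borel_measurable M"
  shows "(\<lambda>\<omega>. outer (v \<omega>) (w \<omega>)) \<in> borel_measurable M"
proof -
  have "continuous_on UNIV (\<lambda>x :: ('a^'n) \<times> ('a^'m). outer (fst x) (snd x))"
    unfolding outer_def by (intro continuous_intros)
  from borel_measurable_continuous_Pair[OF assms this] show ?thesis by simp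
qed

lemma integrable_outer:
  fixes v w :: "'s \<Rightarrow> 'a::{real_normed_field, euclidean_space}^2"
  assumes v: "square_integrable M v" and w: "square_integrable M w"
  shows "integrable M (\<lambda>\<omega>. outer (v \<omega>) (w \<omega>))"
proof (rule Bochner_Integration.integrable_bound)
  have "square_integrable M (\<lambda>\<omega>. norm (v \<omega>))" "square_integrable M (\<lambda>\<omega>. norm (w \<omega>))"
    using v w by (auto simp: square_integrable_def)
  then show "integrable M (\<lambda>\<omega>. 4 * (norm (v \<omega>) * norm (w \<omega>)))"
    by (intro integrable_mult_right integrable_mult_square_integrable)
  show "(\<lambda>\<omega>. outer (v \<omega>) (w \<omega>)) \<in> borel_measurable M" using v w by measurable
  have "norm (outer x y) \<le> 4 * (norm x * norm y)" for x y :: "'a^2"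
  proof -
    have "norm (outer x y) \<le> (\<Sum>i\<in>UNIV. norm (outer x y $ i))" by (rule norm_vec_le_sum)
    also have "\<dots> \<le> (\<Sum>i\<in>UNIV. \<Sum>k\<in>UNIV. norm (outer x y $ i $ k))" by (intro sum_mono norm_vec_le_sum)
    also have "\<dots> \<le> (\<Sum>i\<in>(UNIV :: 2 set). \<Sum>k\<in>(UNIV :: 2 set). norm x * norm y)"
      by (intro sum_mono) (simp add: norm_mult mult_mono Finite_Cartesian_Product.norm_nth_le)
    finally show ?thesis by simp
  qed
  then show "AE \<omega> in M. norm (outer (v \<omega>) (w \<omega>)) \<le> norm (4 * (norm (v \<omega>) * norm (w \<omega>)))" by simp
qed

lemma integral_vec_nth:
  fixes f :: "'s \<Rightarrow> 'a::euclidean_space^'n"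
  shows "integrable M f \<Longrightarrow> (\<integral>\<omega>. f \<omega> \<partial>M) $ i = (\<integral>\<omega>. f \<omega> $ i \<partial>M)"
  using integral_bounded_linear[OF bounded_linear_vec_nth[of i]] by metis

lemma integral_outer_nth:
  fixes v w :: "'s \<Rightarrow> 'a::{real_normed_field, euclidean_space}^2"
  assumes "square_integrable M v" "square_integrable M w"
  shows "(\<integral>\<omega>. outer (v \<omega>) (w \<omega>) \<partial>M) $ i $ k = (\<integral>\<omega>. v \<omega> $ i * w \<omega> $ k \<partial>M)"
proof -
  note i = integrable_outer[OF assms]
  have "integrable M (\<lambda>\<omega>. outer (v \<omega>) (w \<omega>) $ i)"
    by (rule integrable_bounded_linear[OF bounded_linear_vec_nth i])
  then show ?thesis by (simp add: integral_vec_nth i)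
qed

lemma square_integrable_of_centered_normal:
  fixes X :: "'a \<Rightarrow> real"
  assumes [measurable]: "X \<in> borel_measurable M" and "distr M borel X = centered_normal v" "v \<ge> 0"
  shows "square_integrable M X" "(\<integral>\<omega>. (X \<omega>)\<^sup>2 \<partial>M) = v"
proof -
  have "integrable (distr M borel X) (\<lambda>x. x\<^sup>2)"
    using assms integrable_centered_normal_power by simp
  then show "square_integrable M X"
    by (subst (asm) integrable_distr_eq) (auto simp: square_integrable_def)
  have "(\<integral>\<omega>. (X \<omega>)\<^sup>2 \<partial>M) = (\<integral>x. x\<^sup>2 \<partial>distr M borel X)"
    by (subst integral_distr) auto
  then show "(\<integral>\<omega>. (X \<omega>)\<^sup>2 \<partial>M) = v" using assms second_moment_centered_normal by simp
qed

lemma centered_gaussian_family_inner: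
  fixes X :: "'i \<Rightarrow> 'a \<Rightarrow> 'b::euclidean_space"
  assumes "centered_gaussian_family M I X" "i \<in> I"
  shows "square_integrable M (\<lambda>\<omega>. c \<bullet> X i \<omega>)"
proof -
  have [measurable]: "X i \<in> borel_measurable M" using assms by (auto simp: centered_gaussian_family_def)
  obtain v where "v \<ge> 0" "distr M borel (\<lambda>\<omega>. \<Sum>k\<in>{i}. c \<bullet> X k \<omega>) = centered_normal v"
    using assms(1)[unfolded centered_gaussian_family_def, THEN conjunct2, rule_format, of "{i}" "\<lambda>_. c"] assms(2)
    by auto
  then show ?thesis by (intro square_integrable_of_centered_normal(1)[where v=v]) auto
qed

lemma centered_gaussian_family_square_integrable:
  fixes X :: "'i \<Rightarrow> 'a \<Rightarrow> 'b::euclidean_space"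
  assumes "centered_gaussian_family M I X" "i \<in> I"
  shows "square_integrable M (X i)"
proof -
  have m: "X i \<in> borel_measurable M" using assms by (auto simp: centered_gaussian_family_def)
  have "integrable M (\<lambda>\<omega>. \<Sum>b\<in>Basis. (b \<bullet> X i \<omega>)\<^sup>2)"
    using centered_gaussian_family_inner[OF assms] by (intro Bochner_Integration.integrable_sum) (auto simp: square_integrable_def)
  moreover have "(\<Sum>b\<in>Basis. (b \<bullet> x)\<^sup>2) = (norm x)\<^sup>2" for x :: 'b
    by (subst power2_norm_eq_inner, subst euclidean_inner) (simp add: power2_eq_square inner_commute)
  ultimately show ?thesis using m by (simp add: square_integrable_def)
qed

lemma integral_sum_list_inner:
  fixes Z :: "'a \<Rightarrow> 'b::euclidean_space"
  assumes "\<And>g Y. (g, Y) \<in> set L \<Longrightarrow> square_integrable M Y" and "square_integrable M Z"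
  shows "(\<integral>\<omega>. (\<Sum>(g, Y)\<leftarrow>L. c g *\<^sub>R Y \<omega>) \<bullet> Z \<omega> \<partial>M) = (\<Sum>(g, Y)\<leftarrow>L. c g * (\<integral>\<omega>. Y \<omega> \<bullet> Z \<omega> \<partial>M))"
  using assms
proof (induction L)
  case (Cons p L)
  obtain g Y where p: "p = (g, Y)" by force
  have Y: "square_integrable M Y" using Cons.prems p by auto
  have L: "square_integrable M (\<lambda>\<omega>. \<Sum>(g, Y)\<leftarrow>L. c g *\<^sub>R Y \<omega>)"
    using Cons.prems by (intro square_integrable_sum_list) (auto intro: square_integrable_scaleR)
  have "(\<integral>\<omega>. (\<Sum>(g, Y)\<leftarrow>p # L. c g *\<^sub>R Y \<omega>) \<bullet> Z \<omega> \<partial>M)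
      = (\<integral>\<omega>. c g * (Y \<omega> \<bullet> Z \<omega>) + (\<Sum>(g, Y)\<leftarrow>L. c g *\<^sub>R Y \<omega>) \<bullet> Z \<omega> \<partial>M)"
    by (simp add: p inner_add_left)
  also have "\<dots> = c g * (\<integral>\<omega>. Y \<omega> \<bullet> Z \<omega> \<partial>M) + (\<integral>\<omega>. (\<Sum>(g, Y)\<leftarrow>L. c g *\<^sub>R Y \<omega>) \<bullet> Z \<omega> \<partial>M)"
    using integrable_inner_square_integrable[OF Y Cons.prems(2)] integrable_inner_square_integrable[OF L Cons.prems(2)]
    by simp
  also have "(\<integral>\<omega>. (\<Sum>(g, Y)\<leftarrow>L. c g *\<^sub>R Y \<omega>) \<bullet> Z \<omega> \<partial>M) = (\<Sum>(g, Y)\<leftarrow>L. c g * (\<integral>\<omega>. Y \<omega> \<bullet> Z \<omega> \<partial>M))"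
    by (rule Cons.IH) (use Cons.prems in auto)
  finally show ?case by (simp add: p)
qed simp

lemma integral_sum_list_coeff:
  assumes "\<And>g Y. (g, Y) \<in> set L \<Longrightarrow> integrable lborel g"
  shows "integrable lborel (\<lambda>z. \<Sum>(g, Y)\<leftarrow>L. g z * r Y)" (is ?int)
    and "(\<integral>z. (\<Sum>(g, Y)\<leftarrow>L. g z * r Y) \<partial>lborel) = (\<Sum>(g, Y)\<leftarrow>L. (\<integral>z. g z \<partial>lborel) * (r Y :: real))" (is ?eq)
proof -
  have "?int \<and> ?eq" using assms
  proof (induction L)
    case (Cons p L)
    obtain g Y where p: "p = (g, Y)" by force
    have "integrable lborel g" using Cons.prems p by auto
    moreover have "integrable lborel (\<lambda>z. \<Sum>(g, Y)\<leftarrow>L. g z * r Y) \<and>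
        (\<integral>z. (\<Sum>(g, Y)\<leftarrow>L. g z * r Y) \<partial>lborel) = (\<Sum>(g, Y)\<leftarrow>L. (\<integral>z. g z \<partial>lborel) * r Y)"
      by (rule Cons.IH) (use Cons.prems in auto)
    ultimately show ?case by (simp add: p)
  qed simp
  then show ?int ?eq by auto
qed

text \<open>Minkowski's integral inequality by duality: the integral \<open>T\<close>, paired with
  itself, is the integral over \<open>z\<close> of its pairings with the integrand, each at most the
  norm of \<open>T\<close> times \<open>u z\<close>. The majorant \<open>u\<close> stands in for the
  norm of the integrand, so that measurability has to be known for \<open>u\<close> only.\<close>

lemma minkowski_sum_list:
  fixes L :: "((real \<Rightarrow> real) \<times> ('a \<Rightarrow> 'b::euclidean_space)) list"
  assumes L: "\<And>g Y. (g, Y) \<in> set L \<Longrightarrow> integrable lborel g \<and> square_integrable M Y"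
    and u: "u \<in> borel_measurable lborel" "\<And>z. ennreal (l2norm M (\<lambda>\<omega>. \<Sum>(g, Y)\<leftarrow>L. g z *\<^sub>R Y \<omega>)) \<le> u z"
  shows "ennreal (l2norm M (\<lambda>\<omega>. \<Sum>(g, Y)\<leftarrow>L. (\<integral>z. g z \<partial>lborel) *\<^sub>R Y \<omega>)) \<le> (\<integral>\<^sup>+z. u z \<partial>lborel)"
proof -
  define T where "T \<omega> = (\<Sum>(g, Y)\<leftarrow>L. (\<integral>z. g z \<partial>lborel) *\<^sub>R Y \<omega>)" for \<omega>
  define G where "G z \<omega> = (\<Sum>(g, Y)\<leftarrow>L. g z *\<^sub>R Y \<omega>)" for z \<omega>
  have Y: "\<And>g Y. (g, Y) \<in> set L \<Longrightarrow> square_integrable M Y" using L by auto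
  have T: "square_integrable M T" unfolding T_def[abs_def]
    using Y by (intro square_integrable_sum_list) (auto intro: square_integrable_scaleR)
  have G: "square_integrable M (G z)" for z unfolding G_def[abs_def]
    using Y by (intro square_integrable_sum_list) (auto intro: square_integrable_scaleR)
  have GT: "(\<integral>\<omega>. G z \<omega> \<bullet> T \<omega> \<partial>M) = (\<Sum>(g, Y)\<leftarrow>L. g z * (\<integral>\<omega>. Y \<omega> \<bullet> T \<omega> \<partial>M))" for z
    unfolding G_def using integral_sum_list_inner[OF Y T, where c="\<lambda>g. g z" and L=L] by simp
  have TT: "(l2norm M T)\<^sup>2 = (\<integral>z. (\<integral>\<omega>. G z \<omega> \<bullet> T \<omega> \<partial>M) \<partial>lborel)"
  proof -
    have "(l2norm M T)\<^sup>2 = (\<integral>\<omega>. T \<omega> \<bullet> T \<omega> \<partial>M)" by (simp add: l2norm_sq power2_norm_eq_inner)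
    also have "\<dots> = (\<Sum>(g, Y)\<leftarrow>L. (\<integral>z. g z \<partial>lborel) * (\<integral>\<omega>. Y \<omega> \<bullet> T \<omega> \<partial>M))"
      using integral_sum_list_inner[OF Y T, where c="\<lambda>g. \<integral>z. g z \<partial>lborel" and L=L] by (simp add: T_def[abs_def])
    also have "\<dots> = (\<integral>z. (\<integral>\<omega>. G z \<omega> \<bullet> T \<omega> \<partial>M) \<partial>lborel)"
      unfolding GT using L by (intro integral_sum_list_coeff(2)[symmetric]) auto
    finally show ?thesis .
  qed
  show ?thesis
  proof (cases "l2norm M T = 0")
    case True
    then show ?thesis by (simp add: T_def[abs_def])
  next
    case False
    then have pos: "l2norm M T > 0" using l2norm_nonneg[of M T] by linarith
    have i: "integrable lborel (\<lambda>z. \<integral>\<omega>. G z \<omega> \<bullet> T \<omega> \<partial>M)"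
      unfolding GT using L by (intro integral_sum_list_coeff(1)) auto
    have "ennreal (l2norm M T * l2norm M T) = ennreal (\<bar>\<integral>z. (\<integral>\<omega>. G z \<omega> \<bullet> T \<omega> \<partial>M) \<partial>lborel\<bar>)"
      by (simp add: TT[symmetric] power2_eq_square)
    also have "\<dots> \<le> (\<integral>\<^sup>+z. ennreal \<bar>\<integral>\<omega>. G z \<omega> \<bullet> T \<omega> \<partial>M\<bar> \<partial>lborel)"
      using integral_norm_bound_ennreal[OF i] by simp
    also have "\<dots> \<le> (\<integral>\<^sup>+z. ennreal (l2norm M T) * u z \<partial>lborel)"
    proof (rule nn_integral_mono)
      fix z
      have "ennreal \<bar>\<integral>\<omega>. G z \<omega> \<bullet> T \<omega> \<partial>M\<bar> \<le> ennreal (l2norm M T * l2norm M (G z))"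
        using inner_le_l2norm[OF G T] by (intro ennreal_leI) (simp add: mult.commute)
      also have "\<dots> \<le> ennreal (l2norm M T) * u z"
        using u(2)[of z] by (simp add: ennreal_mult G_def[abs_def] mult_left_mono)
      finally show "ennreal \<bar>\<integral>\<omega>. G z \<omega> \<bullet> T \<omega> \<partial>M\<bar> \<le> ennreal (l2norm M T) * u z" .
    qed
    also have "\<dots> = ennreal (l2norm M T) * (\<integral>\<^sup>+z. u z \<partial>lborel)" using u by (intro nn_integral_cmult) auto
    finally have "ennreal (l2norm M T) * ennreal (l2norm M T) \<le> ennreal (l2norm M T) * (\<integral>\<^sup>+z. u z \<partial>lborel)"
      by (simp add: ennreal_mult)
    then have "ennreal (l2norm M T) \<le> (\<integral>\<^sup>+z. u z \<partial>lborel)"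
      using pos by (subst (asm) ennreal_mult_le_mult_iff) auto
    then show ?thesis by (simp add: T_def[abs_def])
  qed
qed

lemma integrable_indicator_finite_borel:
  "E \<in> finite_borel \<Longrightarrow> integrable lborel (indicator E :: real \<Rightarrow> real)"
  by (auto simp: finite_borel_def)

text \<open>The definition supplies some approximating simple functions; the Riemann sums used later
  are different ones. The difference between two approximants is again a finite sum of the form
  \<open>g(z) Y\<close>, so Minkowski's inequality compares their integrals.\<close>

lemma mean_square_integral_approx:
  fixes F :: "real \<Rightarrow> 'a \<Rightarrow> 'b::euclidean_space"
  assumes ms: "mean_square_integral M F X"
    and L: "\<And>g Y. (g, Y) \<in> set L \<Longrightarrow> integrable lborel g \<and> square_integrable M Y"
    and w: "integrable lborel w" "\<And>z. l2norm M (\<lambda>\<omega>. F z \<omega> - (\<Sum>(g, Y)\<leftarrow>L. g z *\<^sub>R Y \<omega>)) \<le> w z"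
  shows "l2norm M (\<lambda>\<omega>. X \<omega> - (\<Sum>(g, Y)\<leftarrow>L. (\<integral>z. g z \<partial>lborel) *\<^sub>R Y \<omega>)) \<le> (\<integral>z. w z \<partial>lborel)"
proof -
  define T where "T \<omega> = (\<Sum>(g, Y)\<leftarrow>L. (\<integral>z. g z \<partial>lborel) *\<^sub>R Y \<omega>)" for \<omega>
  obtain S where S: "\<And>n E Y. (E, Y) \<in> set (S n) \<Longrightarrow> E \<in> finite_borel \<and> square_integrable M Y"
    and Sm: "\<And>n. (\<lambda>z. l2norm M (\<lambda>\<omega>. F z \<omega> - (\<Sum>(E, Y)\<leftarrow>S n. indicator E z *\<^sub>R Y \<omega>))) \<in> borel_measurable borel"
    and S0: "(\<lambda>n. \<integral>\<^sup>+z. ennreal (l2norm M (\<lambda>\<omega>. F z \<omega> - (\<Sum>(E, Y)\<leftarrow>S n. indicator E z *\<^sub>R Y \<omega>))) \<partial>lborel) \<longlonglongrightarrow> 0"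
    and SX: "(\<lambda>n. l2norm M (\<lambda>\<omega>. X \<omega> - (\<Sum>(E, Y)\<leftarrow>S n. measure lborel E *\<^sub>R Y \<omega>))) \<longlonglongrightarrow> 0"
    and X: "square_integrable M X" and F: "\<And>z. square_integrable M (F z)"
    using ms unfolding mean_square_integral_def by (auto split: prod.splits) blast
  define TS where "TS n \<omega> = (\<Sum>(E, Y)\<leftarrow>S n. measure lborel E *\<^sub>R Y \<omega>)" for n \<omega>
  define d where "d n z = l2norm M (\<lambda>\<omega>. F z \<omega> - (\<Sum>(E, Y)\<leftarrow>S n. indicator E z *\<^sub>R Y \<omega>))" for n z
  have [measurable]: "d n \<in> borel_measurable borel" for n using Sm by (simp add: d_def[abs_def])
  have wm[measurable]: "w \<in> borel_measurable borel" using w by auto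
  have w0: "w z \<ge> 0" for z using w(2)[of z] l2norm_nonneg by (rule order.trans[rotated])
  have T: "square_integrable M T" unfolding T_def[abs_def]
    using L by (intro square_integrable_sum_list) (auto intro: square_integrable_scaleR)
  have TS: "square_integrable M (TS n)" for n unfolding TS_def[abs_def]
    using S by (intro square_integrable_sum_list) (auto intro: square_integrable_scaleR)
  have sL: "square_integrable M (\<lambda>\<omega>. \<Sum>(g, Y)\<leftarrow>L. g z *\<^sub>R Y \<omega>)" for z
    using L by (intro square_integrable_sum_list) (auto intro: square_integrable_scaleR)
  have sS: "square_integrable M (\<lambda>\<omega>. \<Sum>(E, Y)\<leftarrow>S n. indicator E z *\<^sub>R Y \<omega>)" for z n
    using S by (intro square_integrable_sum_list) (auto intro: square_integrable_scaleR)
  have main: "ennreal (l2norm M (\<lambda>\<omega>. TS n \<omega> - T \<omega>)) \<le> (\<integral>\<^sup>+z. ennreal (d n z) + ennreal (w z) \<partial>lborel)" for n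
  proof -
    \<comment> \<open>The list represents the simple function of the definition minus the given
      sum.\<close>
    let ?L = "map (\<lambda>(E, Y). (indicator E :: real \<Rightarrow> real, Y)) (S n) @ map (\<lambda>(g, Y). (\<lambda>z. - g z, Y)) L"
    have neg: "(\<Sum>(g, Y)\<leftarrow>map (\<lambda>(g, Y). (\<lambda>z. - g z, Y)) L. h g *\<^sub>R Y \<omega>) = - (\<Sum>(g, Y)\<leftarrow>L. k g *\<^sub>R Y \<omega>)"
      if "\<And>g. h (\<lambda>z. - g z) = - k g" for \<omega> and h k :: "(real \<Rightarrow> real) \<Rightarrow> real"
      using that by (induction L) (auto split: prod.splits)
    have ind: "(\<Sum>(g, Y)\<leftarrow>map (\<lambda>(E, Y). (indicator E :: real \<Rightarrow> real, Y)) (S n). h g *\<^sub>R Y \<omega>)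
        = (\<Sum>(E, Y)\<leftarrow>S n. h (indicator E) *\<^sub>R Y \<omega>)" for \<omega> and h :: "(real \<Rightarrow> real) \<Rightarrow> real"
      by (simp add: o_def case_prod_unfold)
    have Lz: "(\<Sum>(g, Y)\<leftarrow>?L. g z *\<^sub>R Y \<omega>) = (\<Sum>(E, Y)\<leftarrow>S n. indicator E z *\<^sub>R Y \<omega>) - (\<Sum>(g, Y)\<leftarrow>L. g z *\<^sub>R Y \<omega>)" for z \<omega>
      using neg[where h="\<lambda>g. g z" and k="\<lambda>g. g z" and \<omega>=\<omega>] ind[where h="\<lambda>g. g z" and \<omega>=\<omega>]
      by (simp only: map_append sum_list_append) simp
    have "ennreal (l2norm M (\<lambda>\<omega>. \<Sum>(g, Y)\<leftarrow>?L. (\<integral>z. g z \<partial>lborel) *\<^sub>R Y \<omega>)) \<le> (\<integral>\<^sup>+z. ennreal (d n z) + ennreal (w z) \<partial>lborel)"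
    proof (rule minkowski_sum_list)
      show "integrable lborel g \<and> square_integrable M Y" if "(g, Y) \<in> set ?L" for g Y
        using that L S integrable_indicator_finite_borel by auto
      fix z
      have "l2norm M (\<lambda>\<omega>. \<Sum>(g, Y)\<leftarrow>?L. g z *\<^sub>R Y \<omega>)
        = l2norm M (\<lambda>\<omega>. ((\<Sum>(E, Y)\<leftarrow>S n. indicator E z *\<^sub>R Y \<omega>) - F z \<omega>) + (F z \<omega> - (\<Sum>(g, Y)\<leftarrow>L. g z *\<^sub>R Y \<omega>)))"
        unfolding Lz by simp
      also have "\<dots> \<le> l2norm M (\<lambda>\<omega>. (\<Sum>(E, Y)\<leftarrow>S n. indicator E z *\<^sub>R Y \<omega>) - F z \<omega>) + l2norm M (\<lambda>\<omega>. F z \<omega> - (\<Sum>(g, Y)\<leftarrow>L. g z *\<^sub>R Y \<omega>))"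
        by (intro l2norm_triangle square_integrable_diff F sL sS)
      also have "\<dots> \<le> d n z + w z"
        using w(2)[of z] by (simp add: d_def l2norm_minus[of M "F z"])
      finally have "ennreal (l2norm M (\<lambda>\<omega>. \<Sum>(g, Y)\<leftarrow>?L. g z *\<^sub>R Y \<omega>)) \<le> ennreal (d n z + w z)" by (rule ennreal_leI)
      also have "\<dots> = ennreal (d n z) + ennreal (w z)" using w0[of z] by (intro ennreal_plus) (auto simp: d_def)
      finally show "ennreal (l2norm M (\<lambda>\<omega>. \<Sum>(g, Y)\<leftarrow>?L. g z *\<^sub>R Y \<omega>)) \<le> ennreal (d n z) + ennreal (w z)" .
    qed measurable
    moreover have "(\<lambda>\<omega>. \<Sum>(g, Y)\<leftarrow>?L. (\<integral>z. g z \<partial>lborel) *\<^sub>R Y \<omega>) = (\<lambda>\<omega>. TS n \<omega> - T \<omega>)"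
    proof
      fix \<omega>
      have "(\<Sum>(E, Y)\<leftarrow>S n. (\<integral>z. indicator E z \<partial>lborel :: real) *\<^sub>R Y \<omega>) = TS n \<omega>"
        unfolding TS_def using S
        by (intro arg_cong[where f=sum_list] map_cong refl) (auto simp: finite_borel_def)
      then show "(\<Sum>(g, Y)\<leftarrow>?L. (\<integral>z. g z \<partial>lborel) *\<^sub>R Y \<omega>) = TS n \<omega> - T \<omega>"
        using neg[where h="\<lambda>g. \<integral>z. g z \<partial>lborel" and k="\<lambda>g. \<integral>z. g z \<partial>lborel" and \<omega>=\<omega>]
          ind[where h="\<lambda>g. \<integral>z. g z \<partial>lborel" and \<omega>=\<omega>]
        by (simp only: map_append sum_list_append T_def) simp
    qed
    ultimately show ?thesis by simp
  qed
  have "ennreal (l2norm M (\<lambda>\<omega>. X \<omega> - T \<omega>)) \<le> ennreal (l2norm M (\<lambda>\<omega>. X \<omega> - TS n \<omega>)) + ((\<integral>\<^sup>+z. ennreal (d n z) \<partial>lborel) + ennreal (\<integral>z. w z \<partial>lborel))" for n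
  proof -
    have "l2norm M (\<lambda>\<omega>. X \<omega> - T \<omega>) = l2norm M (\<lambda>\<omega>. (X \<omega> - TS n \<omega>) + (TS n \<omega> - T \<omega>))" by simp
    also have "\<dots> \<le> l2norm M (\<lambda>\<omega>. X \<omega> - TS n \<omega>) + l2norm M (\<lambda>\<omega>. TS n \<omega> - T \<omega>)"
      by (intro l2norm_triangle square_integrable_diff X TS T)
    finally have "ennreal (l2norm M (\<lambda>\<omega>. X \<omega> - T \<omega>)) \<le> ennreal (l2norm M (\<lambda>\<omega>. X \<omega> - TS n \<omega>)) + ennreal (l2norm M (\<lambda>\<omega>. TS n \<omega> - T \<omega>))"
      unfolding ennreal_plus[OF l2norm_nonneg l2norm_nonneg, symmetric] by (rule ennreal_leI)
    also have "\<dots> \<le> ennreal (l2norm M (\<lambda>\<omega>. X \<omega> - TS n \<omega>)) + (\<integral>\<^sup>+z. ennreal (d n z) + ennreal (w z) \<partial>lborel)"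
      by (intro add_left_mono main)
    also have "(\<integral>\<^sup>+z. ennreal (d n z) + ennreal (w z) \<partial>lborel) = (\<integral>\<^sup>+z. ennreal (d n z) \<partial>lborel) + (\<integral>\<^sup>+z. ennreal (w z) \<partial>lborel)"
      by (intro nn_integral_add) auto
    also have "(\<integral>\<^sup>+z. ennreal (w z) \<partial>lborel) = ennreal (\<integral>z. w z \<partial>lborel)"
      using w w0 by (intro nn_integral_eq_integral) auto
    finally show ?thesis .
  qed
  moreover have "(\<lambda>n. ennreal (l2norm M (\<lambda>\<omega>. X \<omega> - TS n \<omega>)) + ((\<integral>\<^sup>+z. ennreal (d n z) \<partial>lborel) + ennreal (\<integral>z. w z \<partial>lborel)))
     \<longlonglongrightarrow> ennreal 0 + (0 + ennreal (\<integral>z. w z \<partial>lborel))"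
    using SX S0 unfolding TS_def d_def by (intro tendsto_add tendsto_ennrealI tendsto_const)
  ultimately have "ennreal (l2norm M (\<lambda>\<omega>. X \<omega> - T \<omega>)) \<le> ennreal 0 + (0 + ennreal (\<integral>z. w z \<partial>lborel))"
    by (intro LIMSEQ_le_const) auto
  then have "l2norm M (\<lambda>\<omega>. X \<omega> - T \<omega>) \<le> (\<integral>z. w z \<partial>lborel)"
    using w0 by (subst (asm) ennreal_0) (simp add: ennreal_le_iff)
  then show ?thesis by (simp add: T_def)
qed

text \<open>Pairing with a fixed \<open>Z\<close> turns the integral in \<open>L^2(M)\<close> into a
  Lebesgue integral. Applied twice, this reduces covariances of wavelet coefficients to double
  integrals.\<close>

lemma mean_square_integral_inner:
  fixes F :: "real \<Rightarrow> 'a \<Rightarrow> 'b::euclidean_space"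
  assumes ms: "mean_square_integral M F X" and Z: "square_integrable M Z"
    and m[measurable]: "(\<lambda>z. \<integral>\<omega>. F z \<omega> \<bullet> Z \<omega> \<partial>M) \<in> borel_measurable borel"
  shows "(\<integral>\<omega>. X \<omega> \<bullet> Z \<omega> \<partial>M) = (\<integral>z. (\<integral>\<omega>. F z \<omega> \<bullet> Z \<omega> \<partial>M) \<partial>lborel)"
proof -
  obtain S where S: "\<And>n E Y. (E, Y) \<in> set (S n) \<Longrightarrow> E \<in> finite_borel \<and> square_integrable M Y"
    and Sm: "\<And>n. (\<lambda>z. l2norm M (\<lambda>\<omega>. F z \<omega> - (\<Sum>(E, Y)\<leftarrow>S n. indicator E z *\<^sub>R Y \<omega>))) \<in> borel_measurable borel"
    and S0: "(\<lambda>n. \<integral>\<^sup>+z. ennreal (l2norm M (\<lambda>\<omega>. F z \<omega> - (\<Sum>(E, Y)\<leftarrow>S n. indicator E z *\<^sub>R Y \<omega>))) \<partial>lborel) \<longlonglongrightarrow> 0"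
    and SX: "(\<lambda>n. l2norm M (\<lambda>\<omega>. X \<omega> - (\<Sum>(E, Y)\<leftarrow>S n. measure lborel E *\<^sub>R Y \<omega>))) \<longlonglongrightarrow> 0"
    and X: "square_integrable M X" and F: "\<And>z. square_integrable M (F z)"
    using ms unfolding mean_square_integral_def by (auto split: prod.splits) blast
  define TS where "TS n \<omega> = (\<Sum>(E, Y)\<leftarrow>S n. measure lborel E *\<^sub>R Y \<omega>)" for n \<omega>
  define Sz where "Sz n z \<omega> = (\<Sum>(E, Y)\<leftarrow>S n. indicator E z *\<^sub>R Y \<omega>)" for n z \<omega>
  define s where "s n z = (\<integral>\<omega>. Sz n z \<omega> \<bullet> Z \<omega> \<partial>M)" for n z
  define f where "f z = (\<integral>\<omega>. F z \<omega> \<bullet> Z \<omega> \<partial>M)" for z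
  have [measurable]: "f \<in> borel_measurable borel" using m by (simp add: f_def[abs_def])
  have sY: "\<And>n E Y. (E, Y) \<in> set (S n) \<Longrightarrow> square_integrable M Y" using S by auto
  have TS: "square_integrable M (TS n)" for n unfolding TS_def[abs_def]
    using S by (intro square_integrable_sum_list) (auto intro: square_integrable_scaleR)
  have sS: "square_integrable M (Sz n z)" for z n unfolding Sz_def[abs_def]
    using S by (intro square_integrable_sum_list) (auto intro: square_integrable_scaleR)
  have s_alt: "s n z = (\<Sum>(E, Y)\<leftarrow>S n. indicator E z * (\<integral>\<omega>. Y \<omega> \<bullet> Z \<omega> \<partial>M))" for n z
    unfolding s_def Sz_def by (rule integral_sum_list_inner[OF sY Z])
  have s_map: "s n z = (\<Sum>(g, Y)\<leftarrow>map (\<lambda>(E, Y). (indicator E :: real \<Rightarrow> real, Y)) (S n). g z * (\<integral>\<omega>. Y \<omega> \<bullet> Z \<omega> \<partial>M))" for n z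
    unfolding s_alt by (simp add: o_def case_prod_unfold)
  have ind: "integrable lborel g" if "(g, Y) \<in> set (map (\<lambda>(E, Y). (indicator E :: real \<Rightarrow> real, Y)) (S n))" for g Y n
    using that S integrable_indicator_finite_borel by auto
  have isn: "integrable lborel (s n)" for n
    unfolding s_map[abs_def] using ind by (rule integral_sum_list_coeff)
  have ints: "(\<integral>z. s n z \<partial>lborel) = (\<integral>\<omega>. TS n \<omega> \<bullet> Z \<omega> \<partial>M)" for n
  proof -
    have "(\<integral>z. s n z \<partial>lborel) = (\<Sum>(g, Y)\<leftarrow>map (\<lambda>(E, Y). (indicator E :: real \<Rightarrow> real, Y)) (S n). (\<integral>z. g z \<partial>lborel) * (\<integral>\<omega>. Y \<omega> \<bullet> Z \<omega> \<partial>M))"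
      unfolding s_map using ind by (rule integral_sum_list_coeff)
    also have "\<dots> = (\<Sum>(E, Y)\<leftarrow>S n. measure lborel E * (\<integral>\<omega>. Y \<omega> \<bullet> Z \<omega> \<partial>M))"
      unfolding map_map using S
      by (intro arg_cong[where f=sum_list] map_cong refl) (auto simp: finite_borel_def)
    also have "\<dots> = (\<integral>\<omega>. TS n \<omega> \<bullet> Z \<omega> \<partial>M)"
      unfolding TS_def by (rule integral_sum_list_inner[OF sY Z, symmetric])
    finally show ?thesis .
  qed
  have diff: "(\<integral>\<^sup>+z. ennreal (norm (f z - s n z)) \<partial>lborel)
      \<le> (\<integral>\<^sup>+z. ennreal (l2norm M (\<lambda>\<omega>. F z \<omega> - Sz n z \<omega>)) \<partial>lborel) * ennreal (l2norm M Z)" for n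
  proof -
    have "norm (f z - s n z) \<le> l2norm M (\<lambda>\<omega>. F z \<omega> - Sz n z \<omega>) * l2norm M Z" for z
    proof -
      have "f z - s n z = (\<integral>\<omega>. (F z \<omega> - Sz n z \<omega>) \<bullet> Z \<omega> \<partial>M)"
        unfolding f_def s_def inner_diff_left
        by (intro Bochner_Integration.integral_diff[symmetric] integrable_inner_square_integrable F sS Z)
      then show ?thesis using inner_le_l2norm[OF square_integrable_diff[OF F sS] Z] by simp
    qed
    then have "(\<integral>\<^sup>+z. ennreal (norm (f z - s n z)) \<partial>lborel)
      \<le> (\<integral>\<^sup>+z. ennreal (l2norm M (\<lambda>\<omega>. F z \<omega> - Sz n z \<omega>)) * ennreal (l2norm M Z) \<partial>lborel)"
      by (intro nn_integral_mono) (simp add: ennreal_mult[symmetric] ennreal_leI)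
    also have "\<dots> = (\<integral>\<^sup>+z. ennreal (l2norm M (\<lambda>\<omega>. F z \<omega> - Sz n z \<omega>)) \<partial>lborel) * ennreal (l2norm M Z)"
      using Sm by (intro nn_integral_multc) (auto simp: Sz_def)
    finally show ?thesis .
  qed
  have lim0: "(\<lambda>n. \<integral>\<^sup>+z. ennreal (norm (f z - s n z)) \<partial>lborel) \<longlonglongrightarrow> 0"
  proof (rule tendsto_sandwich[OF _ _ tendsto_const])
    have "(\<lambda>n. ennreal (l2norm M Z) * (\<integral>\<^sup>+z. ennreal (l2norm M (\<lambda>\<omega>. F z \<omega> - Sz n z \<omega>)) \<partial>lborel)) \<longlonglongrightarrow> ennreal (l2norm M Z) * 0"
      using S0 unfolding Sz_def by (intro ennreal_tendsto_cmult) auto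
    then show "(\<lambda>n. (\<integral>\<^sup>+z. ennreal (l2norm M (\<lambda>\<omega>. F z \<omega> - Sz n z \<omega>)) \<partial>lborel) * ennreal (l2norm M Z)) \<longlonglongrightarrow> 0" by (simp add: mult.commute)
  qed (use diff in auto)
  have "\<forall>\<^sub>F n in sequentially. (\<integral>\<^sup>+z. ennreal (norm (f z - s n z)) \<partial>lborel) < 1"
    using lim0 by (rule order_tendstoD) simp
  then obtain n0 where n0: "(\<integral>\<^sup>+z. ennreal (norm (f z - s n0 z)) \<partial>lborel) < 1"
    by (auto simp: eventually_sequentially)
  \<comment> \<open>One index with finite \<open>L^1\<close> distance suffices: \<open>f\<close>
    differs from an integrable simple function by an integrable function.\<close>
  have "integrable lborel (\<lambda>z. f z - s n0 z)"
    using n0 isn[of n0] by (intro integrableI_bounded) (auto intro: less_trans)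
  then have "integrable lborel (\<lambda>z. (f z - s n0 z) + s n0 z)" by (intro Bochner_Integration.integrable_add isn)
  then have "integrable lborel f" by simp
  from this have l1: "(\<lambda>n. \<integral>z. s n z \<partial>lborel) \<longlonglongrightarrow> (\<integral>z. f z \<partial>lborel)"
    using lim0 isn by (intro tendsto_L1_int[where f=f]) (auto simp: abs_minus_commute)
  have "(\<lambda>n. (\<integral>\<omega>. X \<omega> \<bullet> Z \<omega> \<partial>M) - (\<integral>\<omega>. TS n \<omega> \<bullet> Z \<omega> \<partial>M)) \<longlonglongrightarrow> 0"
  proof (rule Lim_null_comparison)
    have "norm ((\<integral>\<omega>. X \<omega> \<bullet> Z \<omega> \<partial>M) - (\<integral>\<omega>. TS n \<omega> \<bullet> Z \<omega> \<partial>M)) \<le> l2norm M (\<lambda>\<omega>. X \<omega> - TS n \<omega>) * l2norm M Z" for n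
    proof -
      have "(\<integral>\<omega>. X \<omega> \<bullet> Z \<omega> \<partial>M) - (\<integral>\<omega>. TS n \<omega> \<bullet> Z \<omega> \<partial>M) = (\<integral>\<omega>. (X \<omega> - TS n \<omega>) \<bullet> Z \<omega> \<partial>M)"
        unfolding inner_diff_left
        by (intro Bochner_Integration.integral_diff[symmetric] integrable_inner_square_integrable X TS Z)
      then show ?thesis using inner_le_l2norm[OF square_integrable_diff[OF X TS] Z] by simp
    qed
    then show "\<forall>\<^sub>F n in sequentially. norm ((\<integral>\<omega>. X \<omega> \<bullet> Z \<omega> \<partial>M) - (\<integral>\<omega>. TS n \<omega> \<bullet> Z \<omega> \<partial>M)) \<le> l2norm M (\<lambda>\<omega>. X \<omega> - TS n \<omega>) * l2norm M Z"
      by simp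
    have "(\<lambda>n. l2norm M (\<lambda>\<omega>. X \<omega> - TS n \<omega>) * l2norm M Z) \<longlonglongrightarrow> 0 * l2norm M Z"
      using SX unfolding TS_def by (intro tendsto_intros)
    then show "(\<lambda>n. l2norm M (\<lambda>\<omega>. X \<omega> - TS n \<omega>) * l2norm M Z) \<longlonglongrightarrow> 0" by simp
  qed
  then have "(\<lambda>n. (\<integral>\<omega>. X \<omega> \<bullet> Z \<omega> \<partial>M) - ((\<integral>\<omega>. X \<omega> \<bullet> Z \<omega> \<partial>M) - (\<integral>\<omega>. TS n \<omega> \<bullet> Z \<omega> \<partial>M))) \<longlonglongrightarrow> (\<integral>\<omega>. X \<omega> \<bullet> Z \<omega> \<partial>M) - 0"
    by (intro tendsto_intros)
  then have "(\<lambda>n. \<integral>z. s n z \<partial>lborel) \<longlonglongrightarrow> (\<integral>\<omega>. X \<omega> \<bullet> Z \<omega> \<partial>M)" by (simp add: ints)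
  from LIMSEQ_unique[OF this l1] show ?thesis by (simp add: f_def)
qed

section \<open>Stochastic integrals\<close>

lemma integrable_mult_cnj:
  fixes f g :: "'a \<Rightarrow> complex"
  assumes f: "square_integrable M f" and g: "square_integrable M g"
  shows "integrable M (\<lambda>x. f x * cnj (g x))"
    and "cmod (\<integral>x. f x * cnj (g x) \<partial>M) \<le> l2norm M f * l2norm M g"
proof -
  have n: "square_integrable M (\<lambda>x. norm (f x))" "square_integrable M (\<lambda>x. norm (g x))"
    using f g by (auto simp: square_integrable_def)
  have [measurable]: "f \<in> borel_measurable M" "g \<in> borel_measurable M" using f g by auto
  show i: "integrable M (\<lambda>x. f x * cnj (g x))"
    by (rule Bochner_Integration.integrable_bound[OF integrable_mult_square_integrable[OF n]])
      (measurable, auto simp: norm_mult)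
  have "cmod (\<integral>x. f x * cnj (g x) \<partial>M) \<le> (\<integral>x. cmod (f x * cnj (g x)) \<partial>M)" by (rule integral_norm_bound)
  also have "\<dots> = (\<integral>x. norm (f x) \<bullet> norm (g x) \<partial>M)" by (simp add: norm_mult)
  also have "\<dots> \<le> l2norm M (\<lambda>x. norm (f x)) * l2norm M (\<lambda>x. norm (g x))"
    using inner_le_l2norm[OF n] by linarith
  also have "\<dots> = l2norm M f * l2norm M g" by (simp add: l2norm_def)
  finally show "cmod (\<integral>x. f x * cnj (g x) \<partial>M) \<le> l2norm M f * l2norm M g" .
qed

lemma square_integrable_l2_limit:
  fixes f :: "'a \<Rightarrow> 'b::euclidean_space"
  assumes f: "f \<in> borel_measurable M" and u: "\<And>n. square_integrable M (u n)"
    and lim: "(\<lambda>n. \<integral>\<^sup>+x. ennreal ((norm (f x - u n x))\<^sup>2) \<partial>M) \<longlonglongrightarrow> 0"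
  shows "square_integrable M f" "(\<lambda>n. l2norm M (\<lambda>x. f x - u n x)) \<longlonglongrightarrow> 0"
proof -
  have [measurable]: "f \<in> borel_measurable M" "\<And>n. u n \<in> borel_measurable M" using f u by auto
  have "\<forall>\<^sub>F n in sequentially. (\<integral>\<^sup>+x. ennreal ((norm (f x - u n x))\<^sup>2) \<partial>M) < 1"
    using lim by (rule order_tendstoD) simp
  then obtain n where n: "(\<integral>\<^sup>+x. ennreal ((norm (f x - u n x))\<^sup>2) \<partial>M) < 1"
    by (auto simp: eventually_sequentially)
  have "square_integrable M (\<lambda>x. f x - u n x)"
    unfolding square_integrable_def using n by (auto intro!: integrableI_bounded intro: less_trans)
  from square_integrable_add[OF this u[of n]] show sf: "square_integrable M f" by simp
  have d: "square_integrable M (\<lambda>x. f x - u n x)" for n by (intro square_integrable_diff sf u)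
  have "(\<integral>\<^sup>+x. ennreal ((norm (f x - u n x))\<^sup>2) \<partial>M) = ennreal ((l2norm M (\<lambda>x. f x - u n x))\<^sup>2)" for n
    unfolding l2norm_sq using d[of n] by (intro nn_integral_eq_integral) (auto simp: square_integrable_def)
  with lim have "(\<lambda>n. ennreal ((l2norm M (\<lambda>x. f x - u n x))\<^sup>2)) \<longlonglongrightarrow> ennreal 0" by simp
  then have "(\<lambda>n. (l2norm M (\<lambda>x. f x - u n x))\<^sup>2) \<longlonglongrightarrow> 0"
    by (subst (asm) tendsto_ennreal_iff) auto
  then have "(\<lambda>n. sqrt ((l2norm M (\<lambda>x. f x - u n x))\<^sup>2)) \<longlonglongrightarrow> sqrt 0" by (rule tendsto_real_sqrt)
  then show "(\<lambda>n. l2norm M (\<lambda>x. f x - u n x)) \<longlonglongrightarrow> 0" by simp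
qed

lemma tendsto_integral_mult_cnj:
  fixes f g :: "'a \<Rightarrow> complex"
  assumes f: "f \<in> borel_measurable M" "\<And>n. square_integrable M (u n)"
      "(\<lambda>n. \<integral>\<^sup>+x. ennreal ((norm (f x - u n x))\<^sup>2) \<partial>M) \<longlonglongrightarrow> 0"
    and g: "g \<in> borel_measurable M" "\<And>n. square_integrable M (v n)"
      "(\<lambda>n. \<integral>\<^sup>+x. ennreal ((norm (g x - v n x))\<^sup>2) \<partial>M) \<longlonglongrightarrow> 0"
  shows "(\<lambda>n. \<integral>x. u n x * cnj (v n x) \<partial>M) \<longlonglongrightarrow> (\<integral>x. f x * cnj (g x) \<partial>M)"
proof -
  note F = square_integrable_l2_limit[OF f] and G = square_integrable_l2_limit[OF g]
  have du: "square_integrable M (\<lambda>x. f x - u n x)" "square_integrable M (\<lambda>x. g x - v n x)" for n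
    by (intro square_integrable_diff F G f g)+
  have "(\<lambda>n. (\<integral>x. f x * cnj (g x) \<partial>M) - (\<integral>x. u n x * cnj (v n x) \<partial>M)) \<longlonglongrightarrow> 0"
  proof (rule Lim_null_comparison)
    have "norm ((\<integral>x. f x * cnj (g x) \<partial>M) - (\<integral>x. u n x * cnj (v n x) \<partial>M))
      \<le> l2norm M f * l2norm M (\<lambda>x. g x - v n x) + l2norm M (\<lambda>x. f x - u n x) * l2norm M g
         + l2norm M (\<lambda>x. f x - u n x) * l2norm M (\<lambda>x. g x - v n x)" for n
    proof -
      have "(\<integral>x. f x * cnj (g x) \<partial>M) - (\<integral>x. u n x * cnj (v n x) \<partial>M)
          = (\<integral>x. f x * cnj (g x) - u n x * cnj (v n x) \<partial>M)"
        by (intro Bochner_Integration.integral_diff[symmetric] integrable_mult_cnj F G f g)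
      also have "\<dots> = (\<integral>x. f x * cnj (g x - v n x) + (f x - u n x) * cnj (g x) - (f x - u n x) * cnj (g x - v n x) \<partial>M)"
        by (intro Bochner_Integration.integral_cong refl) (simp add: algebra_simps)
      also have "\<dots> = (\<integral>x. f x * cnj (g x - v n x) \<partial>M) + (\<integral>x. (f x - u n x) * cnj (g x) \<partial>M) - (\<integral>x. (f x - u n x) * cnj (g x - v n x) \<partial>M)"
        using integrable_mult_cnj(1)[OF F(1) du(2)] integrable_mult_cnj(1)[OF du(1) G(1)] integrable_mult_cnj(1)[OF du]
        by (simp del: complex_cnj_diff)
      finally show ?thesis
        using integrable_mult_cnj(2)[OF F(1) du(2), of n] integrable_mult_cnj(2)[OF du(1) G(1), of n] integrable_mult_cnj(2)[OF du, of n n]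
          norm_triangle_ineq4[of "(\<integral>x. f x * cnj (g x - v n x) \<partial>M) + (\<integral>x. (f x - u n x) * cnj (g x) \<partial>M)" "\<integral>x. (f x - u n x) * cnj (g x - v n x) \<partial>M"]
          norm_triangle_ineq[of "\<integral>x. f x * cnj (g x - v n x) \<partial>M" "\<integral>x. (f x - u n x) * cnj (g x) \<partial>M"]
        by (simp only:)
    qed
    then show "\<forall>\<^sub>F n in sequentially. norm ((\<integral>x. f x * cnj (g x) \<partial>M) - (\<integral>x. u n x * cnj (v n x) \<partial>M))
      \<le> l2norm M f * l2norm M (\<lambda>x. g x - v n x) + l2norm M (\<lambda>x. f x - u n x) * l2norm M g
         + l2norm M (\<lambda>x. f x - u n x) * l2norm M (\<lambda>x. g x - v n x)" by simp
    have "(\<lambda>n. l2norm M f * l2norm M (\<lambda>x. g x - v n x) + l2norm M (\<lambda>x. f x - u n x) * l2norm M g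
         + l2norm M (\<lambda>x. f x - u n x) * l2norm M (\<lambda>x. g x - v n x)) \<longlonglongrightarrow> l2norm M f * 0 + 0 * l2norm M g + 0 * 0"
      by (intro tendsto_intros F G)
    then show "(\<lambda>n. l2norm M f * l2norm M (\<lambda>x. g x - v n x) + l2norm M (\<lambda>x. f x - u n x) * l2norm M g
         + l2norm M (\<lambda>x. f x - u n x) * l2norm M (\<lambda>x. g x - v n x)) \<longlonglongrightarrow> 0" by simp
  qed
  from tendsto_diff[OF tendsto_const this, of "\<integral>x. f x * cnj (g x) \<partial>M"] show ?thesis by simp
qed

lemma sum_list_nth: "(\<Sum>p\<leftarrow>S. f p) $ i = (\<Sum>p\<leftarrow>S. f p $ i)"
  by (induction S) auto

lemma integral_bilinear_sum_list:
  fixes a :: "'p \<Rightarrow> 'a \<Rightarrow> complex" and b :: "'q \<Rightarrow> 'a \<Rightarrow> complex"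
  assumes a: "\<And>p. p \<in> set S \<Longrightarrow> square_integrable M (a p)" and b: "\<And>q. q \<in> set S' \<Longrightarrow> square_integrable M (b q)"
  shows "(\<integral>x. (\<Sum>p\<leftarrow>S. a p x) * cnj (\<Sum>q\<leftarrow>S'. b q x) \<partial>M)
       = (\<Sum>p\<leftarrow>S. \<Sum>q\<leftarrow>S'. \<integral>x. a p x * cnj (b q x) \<partial>M)"
  using a
proof (induction S)
  case (Cons p S)
  have p: "square_integrable M (a p)" using Cons.prems by simp
  have sS: "square_integrable M (\<lambda>x. \<Sum>p\<leftarrow>S. a p x)" using Cons.prems by (intro square_integrable_sum_list) auto
  have single: "(\<integral>x. a p x * cnj (\<Sum>q\<leftarrow>S'. b q x) \<partial>M) = (\<Sum>q\<leftarrow>S'. \<integral>x. a p x * cnj (b q x) \<partial>M)"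
    using b
  proof (induction S')
    case (Cons q S')
    have q: "square_integrable M (b q)" using Cons.prems by simp
    have sS': "square_integrable M (\<lambda>x. \<Sum>q\<leftarrow>S'. b q x)" using Cons.prems by (intro square_integrable_sum_list) auto
    have IH: "(\<integral>x. a p x * cnj (\<Sum>q\<leftarrow>S'. b q x) \<partial>M) = (\<Sum>q\<leftarrow>S'. \<integral>x. a p x * cnj (b q x) \<partial>M)"
      by (rule Cons.IH) (use Cons.prems in auto)
    show ?case using integrable_mult_cnj(1)[OF p q] integrable_mult_cnj(1)[OF p sS']
      by (simp add: distrib_left IH)
  qed simp
  have sS': "square_integrable M (\<lambda>x. \<Sum>q\<leftarrow>S'. b q x)" using b by (intro square_integrable_sum_list) auto
  have IH: "(\<integral>x. (\<Sum>p\<leftarrow>S. a p x) * cnj (\<Sum>q\<leftarrow>S'. b q x) \<partial>M) = (\<Sum>p\<leftarrow>S. \<Sum>q\<leftarrow>S'. \<integral>x. a p x * cnj (b q x) \<partial>M)"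
    by (rule Cons.IH) (use Cons.prems in auto)
  show ?case using integrable_mult_cnj(1)[OF p sS'] integrable_mult_cnj(1)[OF sS sS']
    by (simp add: distrib_right IH single)
qed simp

lemma square_integrable_complex_cmult:
  fixes f :: "'a \<Rightarrow> complex"
  shows "square_integrable M f \<Longrightarrow> square_integrable M (\<lambda>x. c * f x)"
  by (rule square_integrable_bound[where c="cmod c"]) (auto simp: norm_mult intro!: borel_measurable_times)

lemma square_integrable_complex_nth:
  fixes X :: "'a \<Rightarrow> complex^'n"
  assumes "square_integrable M X"
  shows "square_integrable M (\<lambda>\<omega>. X \<omega> $ i)"
proof (rule square_integrable_bound[OF assms, where c=1])
  have "(\<lambda>x :: complex^'n. x $ i) \<in> borel_measurable borel"
    by (intro borel_measurable_continuous_onI continuous_intros)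
  then show "(\<lambda>\<omega>. X \<omega> $ i) \<in> borel_measurable M" using assms by measurable
qed (simp add: Finite_Cartesian_Product.norm_nth_le)

lemma simple_isometry:
  assumes N: "hermitian_gaussian_measure N Bt" and E: "E \<in> finite_borel" and F: "F \<in> finite_borel"
  shows "square_integrable N (\<lambda>\<omega>. (C *v Bt E \<omega>) $ i)"
    and "square_integrable lborel (\<lambda>x. (indicator E x *\<^sub>R C) $ i $ p)"
    and "(\<integral>\<omega>. (C *v Bt E \<omega>) $ i * cnj ((C' *v Bt F \<omega>) $ k) \<partial>N)
       = (\<Sum>p\<in>UNIV. \<integral>x. (indicator E x *\<^sub>R C) $ i $ p * cnj ((indicator F x *\<^sub>R C') $ k $ p) \<partial>lborel)"
proof -
  have g: "centered_gaussian_family N finite_borel Bt" using N by (simp add: hermitian_gaussian_measure_def)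
  have B: "square_integrable N (Bt E)" if "E \<in> finite_borel" for E
    by (rule centered_gaussian_family_square_integrable[OF g that])
  have Bn: "square_integrable N (\<lambda>\<omega>. Bt E \<omega> $ p)" if "E \<in> finite_borel" for E p
    by (rule square_integrable_complex_nth[OF B[OF that]])
  have cB: "square_integrable N (\<lambda>\<omega>. cnj_vec (Bt F \<omega>))"
  proof (rule square_integrable_bound[OF B[OF F], where c=1])
    have "(cnj_vec :: complex^2 \<Rightarrow> _) \<in> borel_measurable borel"
      unfolding cnj_vec_def by (intro borel_measurable_continuous_onI continuous_intros)
    then show "(\<lambda>\<omega>. cnj_vec (Bt F \<omega>)) \<in> borel_measurable N" using B[OF F] by measurable
    show "norm (cnj_vec (Bt F \<omega>)) \<le> 1 * norm (Bt F \<omega>)" for \<omega>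
      by (simp add: norm_vec_def cnj_vec_def)
  qed
  show "square_integrable N (\<lambda>\<omega>. (C *v Bt E \<omega>) $ i)"
    unfolding matrix_vector_mult_def vec_lambda_beta
    by (intro square_integrable_sum square_integrable_complex_cmult Bn E)
  have ie: "integrable lborel (\<lambda>x. indicator E x :: real)" "integrable lborel (\<lambda>x. indicator E x * indicator F x :: real)"
  proof -
    show "integrable lborel (\<lambda>x. indicator E x :: real)" using E by (rule integrable_indicator_finite_borel)
    then show "integrable lborel (\<lambda>x. indicator E x * indicator F x :: real)"
      by (rule Bochner_Integration.integrable_bound) (use E F in \<open>auto simp: finite_borel_def indicator_def\<close>)
  qed
  have "square_integrable lborel (\<lambda>x. complex_of_real (indicator E x))"
    unfolding square_integrable_def using E
    by (auto simp: finite_borel_def indicator_eq_0_iff power2_eq_square simp flip: indicator_inter_arith)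
  then have "square_integrable lborel (\<lambda>x. C $ i $ p * complex_of_real (indicator E x))"
    by (rule square_integrable_complex_cmult)
  moreover have "(indicator E x *\<^sub>R C) $ i $ p = C $ i $ p * complex_of_real (indicator E x)" for x
    by (simp add: indicator_def)
  ultimately show "square_integrable lborel (\<lambda>x. (indicator E x *\<^sub>R C) $ i $ p)" by simp
  have cov: "(\<integral>\<omega>. Bt E \<omega> $ p * cnj (Bt F \<omega> $ q) \<partial>N) = (if p = q then complex_of_real (measure lborel (E \<inter> F)) else 0)" for p q
  proof -
    have "(\<integral>\<omega>. Bt E \<omega> $ p * cnj (Bt F \<omega> $ q) \<partial>N) = (\<integral>\<omega>. outer (Bt E \<omega>) (cnj_vec (Bt F \<omega>)) \<partial>N) $ p $ q"
      by (subst integral_outer_nth[OF B[OF E] cB]) (simp add: cnj_vec_def)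
    also have "\<dots> = mat (complex_of_real (measure lborel (E \<inter> F))) $ p $ q"
      using N E F by (simp add: hermitian_gaussian_measure_def)
    finally show ?thesis by (simp add: mat_def)
  qed
  have ib: "integrable N (\<lambda>\<omega>. Bt E \<omega> $ p * cnj (Bt F \<omega> $ q))" for p q
    by (intro integrable_mult_cnj Bn E F)
  have "(\<integral>\<omega>. (C *v Bt E \<omega>) $ i * cnj ((C' *v Bt F \<omega>) $ k) \<partial>N)
      = (\<integral>\<omega>. (\<Sum>p\<in>UNIV. \<Sum>q\<in>UNIV. (C $ i $ p * cnj (C' $ k $ q)) * (Bt E \<omega> $ p * cnj (Bt F \<omega> $ q))) \<partial>N)"
    unfolding matrix_vector_mult_def vec_lambda_beta cnj_sum sum_product
    by (intro Bochner_Integration.integral_cong sum.cong refl) simp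
  also have "\<dots> = (\<Sum>p\<in>UNIV. \<Sum>q\<in>UNIV. (C $ i $ p * cnj (C' $ k $ q)) * (\<integral>\<omega>. Bt E \<omega> $ p * cnj (Bt F \<omega> $ q) \<partial>N))"
    using ib by (simp add: Bochner_Integration.integral_sum)
  also have "\<dots> = (\<Sum>p\<in>UNIV. C $ i $ p * cnj (C' $ k $ p) * complex_of_real (measure lborel (E \<inter> F)))"
    unfolding cov by (intro sum.cong refl) (simp add: if_distrib[of "\<lambda>x. y * x" for y] cong: if_cong)
  also have "\<dots> = (\<Sum>p\<in>UNIV. \<integral>x. (indicator E x *\<^sub>R C) $ i $ p * cnj ((indicator F x *\<^sub>R C') $ k $ p) \<partial>lborel)"
  proof (intro sum.cong refl)
    fix p
    have "(\<integral>x. (indicator E x *\<^sub>R C) $ i $ p * cnj ((indicator F x *\<^sub>R C') $ k $ p) \<partial>lborel)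
      = (\<integral>x. C $ i $ p * cnj (C' $ k $ p) * complex_of_real (indicator E x * indicator F x) \<partial>lborel)"
      by (intro Bochner_Integration.integral_cong refl) (simp add: indicator_def)
    also have "\<dots> = C $ i $ p * cnj (C' $ k $ p) * complex_of_real (\<integral>x. indicator E x * indicator F x \<partial>lborel)"
      by (simp only: integral_mult_right_zero integral_complex_of_real)
    also have "(\<integral>x. indicator E x * indicator F x \<partial>lborel) = measure lborel (E \<inter> F)"
      using E F by (simp add: finite_borel_def indicator_inter_arith[symmetric])
    finally show "C $ i $ p * cnj (C' $ k $ p) * complex_of_real (measure lborel (E \<inter> F))
      = (\<integral>x. (indicator E x *\<^sub>R C) $ i $ p * cnj ((indicator F x *\<^sub>R C') $ k $ p) \<partial>lborel)" by simp
  qed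
  finally show "(\<integral>\<omega>. (C *v Bt E \<omega>) $ i * cnj ((C' *v Bt F \<omega>) $ k) \<partial>N)
       = (\<Sum>p\<in>UNIV. \<integral>x. (indicator E x *\<^sub>R C) $ i $ p * cnj ((indicator F x *\<^sub>R C') $ k $ p) \<partial>lborel)" .
qed

text \<open>The Ito isometry, polarized and read entry by entry: it holds for simple integrands by
  orthogonality of the increments, and both sides are continuous in mean square. Its first
  conclusion is the source of integrability for all spectral densities below.\<close>

lemma stochastic_integral_isometry:
  assumes N: "hermitian_gaussian_measure N Bt"
    and X: "stochastic_integral N Bt f X" and Y: "stochastic_integral N Bt g Y"
  shows "square_integrable lborel (\<lambda>x. f x $ i $ p)"
    and "(\<integral>\<omega>. X \<omega> $ i * cnj (Y \<omega> $ k) \<partial>N) = (\<Sum>p\<in>UNIV. \<integral>x. f x $ i $ p * cnj (g x $ k $ p) \<partial>lborel)"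
proof -
  have nth_m: "(\<lambda>x :: 'c::euclidean_space^2. x $ i) \<in> borel_measurable borel" for i
    by (intro borel_measurable_continuous_onI continuous_intros)
  have s1: "square_integrable N (\<lambda>\<omega>. (C *v Bt E \<omega>) $ i)" if "E \<in> finite_borel" for E C i
    by (rule simple_isometry(1)[OF N that that])
  have s2: "square_integrable lborel (\<lambda>x. (indicator E x *\<^sub>R C) $ i $ p)" if "E \<in> finite_borel" for E i p and C :: "complex^2^2"
    by (rule simple_isometry(2)[OF N that that])
  \<comment> \<open>The entrywise consequences of one approximating sequence, isolated because two
    integrals need them.\<close>
  have approx: "\<exists>S. (\<forall>n. \<forall>(E, C)\<in>set (S n). E \<in> finite_borel) \<and>
      (\<forall>i p. (\<lambda>x. f x $ i $ p) \<in> borel_measurable lborel) \<and> (\<forall>i. (\<lambda>\<omega>. X \<omega> $ i) \<in> borel_measurable N) \<and>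
      (\<forall>n i p. square_integrable lborel (\<lambda>x. \<Sum>(E, C)\<leftarrow>S n. (indicator E x *\<^sub>R C) $ i $ p)) \<and>
      (\<forall>n i. square_integrable N (\<lambda>\<omega>. \<Sum>(E, C)\<leftarrow>S n. (C *v Bt E \<omega>) $ i)) \<and>
      (\<forall>i p. (\<lambda>n. \<integral>\<^sup>+x. ennreal ((norm (f x $ i $ p - (\<Sum>(E, C)\<leftarrow>S n. (indicator E x *\<^sub>R C) $ i $ p)))\<^sup>2) \<partial>lborel) \<longlonglongrightarrow> 0) \<and>
      (\<forall>i. (\<lambda>n. \<integral>\<^sup>+\<omega>. ennreal ((norm (X \<omega> $ i - (\<Sum>(E, C)\<leftarrow>S n. (C *v Bt E \<omega>) $ i)))\<^sup>2) \<partial>N) \<longlonglongrightarrow> 0)"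
    if X: "stochastic_integral N Bt f X" for f X
  proof -
    from X obtain S where S: "\<And>n E C. (E, C) \<in> set (S n) \<Longrightarrow> E \<in> finite_borel"
      and S1: "(\<lambda>n. \<integral>\<^sup>+x. ennreal ((norm (f x - (\<Sum>(E, C)\<leftarrow>S n. indicator E x *\<^sub>R C)))\<^sup>2) \<partial>lborel) \<longlonglongrightarrow> 0"
      and S2: "(\<lambda>n. \<integral>\<^sup>+\<omega>. ennreal ((norm (X \<omega> - (\<Sum>(E, C)\<leftarrow>S n. C *v Bt E \<omega>)))\<^sup>2) \<partial>N) \<longlonglongrightarrow> 0"
      and [measurable]: "f \<in> borel_measurable borel" "X \<in> borel_measurable N"
      unfolding stochastic_integral_def by (auto split: prod.splits) blast
    note [measurable] = nth_m
    have "(\<lambda>x. f x $ i $ p) \<in> borel_measurable lborel" "(\<lambda>\<omega>. X \<omega> $ i) \<in> borel_measurable N" for i p by measurable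
    moreover have "square_integrable lborel (\<lambda>x. \<Sum>(E, C)\<leftarrow>S n. (indicator E x *\<^sub>R C) $ i $ p)" for n i p
      unfolding case_prod_unfold by (intro square_integrable_sum_list s2) (metis S prod.collapse)
    moreover have "square_integrable N (\<lambda>\<omega>. \<Sum>(E, C)\<leftarrow>S n. (C *v Bt E \<omega>) $ i)" for n i
      unfolding case_prod_unfold by (intro square_integrable_sum_list s1) (metis S prod.collapse)
    moreover have "(\<lambda>n. \<integral>\<^sup>+x. ennreal ((norm (f x $ i $ p - (\<Sum>(E, C)\<leftarrow>S n. (indicator E x *\<^sub>R C) $ i $ p)))\<^sup>2) \<partial>lborel) \<longlonglongrightarrow> 0" for i p
    proof (rule tendsto_sandwich[OF _ _ tendsto_const S1])
      have "norm (f x $ i $ p - (\<Sum>(E, C)\<leftarrow>S n. (indicator E x *\<^sub>R C) $ i $ p)) \<le> norm (f x - (\<Sum>(E, C)\<leftarrow>S n. indicator E x *\<^sub>R C))" for x n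
      proof -
        have eq: "f x $ i $ p - (\<Sum>(E, C)\<leftarrow>S n. (indicator E x *\<^sub>R C) $ i $ p) = (f x - (\<Sum>(E, C)\<leftarrow>S n. indicator E x *\<^sub>R C)) $ i $ p"
          by (simp only: vector_minus_component sum_list_nth case_prod_unfold)
        show ?thesis unfolding eq by (rule order.trans[OF Finite_Cartesian_Product.norm_nth_le Finite_Cartesian_Product.norm_nth_le])
      qed
      then show "\<forall>\<^sub>F n in sequentially. (\<integral>\<^sup>+x. ennreal ((norm (f x $ i $ p - (\<Sum>(E, C)\<leftarrow>S n. (indicator E x *\<^sub>R C) $ i $ p)))\<^sup>2) \<partial>lborel)
         \<le> (\<integral>\<^sup>+x. ennreal ((norm (f x - (\<Sum>(E, C)\<leftarrow>S n. indicator E x *\<^sub>R C)))\<^sup>2) \<partial>lborel)"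
        by (intro always_eventually allI nn_integral_mono ennreal_leI power_mono) auto
    qed auto
    moreover have "(\<lambda>n. \<integral>\<^sup>+\<omega>. ennreal ((norm (X \<omega> $ i - (\<Sum>(E, C)\<leftarrow>S n. (C *v Bt E \<omega>) $ i)))\<^sup>2) \<partial>N) \<longlonglongrightarrow> 0" for i
    proof (rule tendsto_sandwich[OF _ _ tendsto_const S2])
      have "norm (X \<omega> $ i - (\<Sum>(E, C)\<leftarrow>S n. (C *v Bt E \<omega>) $ i)) \<le> norm (X \<omega> - (\<Sum>(E, C)\<leftarrow>S n. C *v Bt E \<omega>))" for \<omega> n
      proof -
        have eq: "X \<omega> $ i - (\<Sum>(E, C)\<leftarrow>S n. (C *v Bt E \<omega>) $ i) = (X \<omega> - (\<Sum>(E, C)\<leftarrow>S n. C *v Bt E \<omega>)) $ i"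
          by (simp only: vector_minus_component sum_list_nth case_prod_unfold)
        show ?thesis unfolding eq by (rule Finite_Cartesian_Product.norm_nth_le)
      qed
      then show "\<forall>\<^sub>F n in sequentially. (\<integral>\<^sup>+\<omega>. ennreal ((norm (X \<omega> $ i - (\<Sum>(E, C)\<leftarrow>S n. (C *v Bt E \<omega>) $ i)))\<^sup>2) \<partial>N)
         \<le> (\<integral>\<^sup>+\<omega>. ennreal ((norm (X \<omega> - (\<Sum>(E, C)\<leftarrow>S n. C *v Bt E \<omega>)))\<^sup>2) \<partial>N)"
        by (intro always_eventually allI nn_integral_mono ennreal_leI power_mono) auto
    qed auto
    ultimately show ?thesis using S by (intro exI[of _ S]) auto
  qed
  obtain S where S: "\<forall>n. \<forall>(E, C)\<in>set (S n). E \<in> finite_borel" "\<And>i p. (\<lambda>x. f x $ i $ p) \<in> borel_measurable lborel" "\<And>i. (\<lambda>\<omega>. X \<omega> $ i) \<in> borel_measurable N"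
      "\<And>n i p. square_integrable lborel (\<lambda>x. \<Sum>(E, C)\<leftarrow>S n. (indicator E x *\<^sub>R C) $ i $ p)"
      "\<And>n i. square_integrable N (\<lambda>\<omega>. \<Sum>(E, C)\<leftarrow>S n. (C *v Bt E \<omega>) $ i)"
      "\<And>i p. (\<lambda>n. \<integral>\<^sup>+x. ennreal ((norm (f x $ i $ p - (\<Sum>(E, C)\<leftarrow>S n. (indicator E x *\<^sub>R C) $ i $ p)))\<^sup>2) \<partial>lborel) \<longlonglongrightarrow> 0"
      "\<And>i. (\<lambda>n. \<integral>\<^sup>+\<omega>. ennreal ((norm (X \<omega> $ i - (\<Sum>(E, C)\<leftarrow>S n. (C *v Bt E \<omega>) $ i)))\<^sup>2) \<partial>N) \<longlonglongrightarrow> 0"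
    using approx[OF X] by (elim exE conjE) blast
  obtain S' where S': "\<forall>n. \<forall>(E, C)\<in>set (S' n). E \<in> finite_borel" "\<And>i p. (\<lambda>x. g x $ i $ p) \<in> borel_measurable lborel" "\<And>i. (\<lambda>\<omega>. Y \<omega> $ i) \<in> borel_measurable N"
      "\<And>n i p. square_integrable lborel (\<lambda>x. \<Sum>(E, C)\<leftarrow>S' n. (indicator E x *\<^sub>R C) $ i $ p)"
      "\<And>n i. square_integrable N (\<lambda>\<omega>. \<Sum>(E, C)\<leftarrow>S' n. (C *v Bt E \<omega>) $ i)"
      "\<And>i p. (\<lambda>n. \<integral>\<^sup>+x. ennreal ((norm (g x $ i $ p - (\<Sum>(E, C)\<leftarrow>S' n. (indicator E x *\<^sub>R C) $ i $ p)))\<^sup>2) \<partial>lborel) \<longlonglongrightarrow> 0"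
      "\<And>i. (\<lambda>n. \<integral>\<^sup>+\<omega>. ennreal ((norm (Y \<omega> $ i - (\<Sum>(E, C)\<leftarrow>S' n. (C *v Bt E \<omega>) $ i)))\<^sup>2) \<partial>N) \<longlonglongrightarrow> 0"
    using approx[OF Y] by (elim exE conjE) blast
  show "square_integrable lborel (\<lambda>x. f x $ i $ p)"
    by (rule square_integrable_l2_limit(1)[OF S(2,4,6)])
  have "(\<lambda>n. \<integral>\<omega>. (\<Sum>(E, C)\<leftarrow>S n. (C *v Bt E \<omega>) $ i) * cnj (\<Sum>(E, C)\<leftarrow>S' n. (C *v Bt E \<omega>) $ k) \<partial>N)
      \<longlonglongrightarrow> (\<integral>\<omega>. X \<omega> $ i * cnj (Y \<omega> $ k) \<partial>N)"
    by (rule tendsto_integral_mult_cnj[OF S(3,5,7) S'(3,5,7)])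
  moreover have "(\<lambda>n. \<Sum>p\<in>UNIV. \<integral>x. (\<Sum>(E, C)\<leftarrow>S n. (indicator E x *\<^sub>R C) $ i $ p) * cnj (\<Sum>(E, C)\<leftarrow>S' n. (indicator E x *\<^sub>R C) $ k $ p) \<partial>lborel)
      \<longlonglongrightarrow> (\<Sum>p\<in>UNIV. \<integral>x. f x $ i $ p * cnj (g x $ k $ p) \<partial>lborel)"
    by (intro tendsto_sum tendsto_integral_mult_cnj[OF S(2,4,6) S'(2,4,6)])
  moreover have "(\<integral>\<omega>. (\<Sum>(E, C)\<leftarrow>S n. (C *v Bt E \<omega>) $ i) * cnj (\<Sum>(E, C)\<leftarrow>S' n. (C *v Bt E \<omega>) $ k) \<partial>N)
     = (\<Sum>p\<in>UNIV. \<integral>x. (\<Sum>(E, C)\<leftarrow>S n. (indicator E x *\<^sub>R C) $ i $ p) * cnj (\<Sum>(E, C)\<leftarrow>S' n. (indicator E x *\<^sub>R C) $ k $ p) \<partial>lborel)" for n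
  proof -
    have fb: "fst q \<in> finite_borel" if "q \<in> set (S n) \<or> q \<in> set (S' n)" for q
      using that S(1) S'(1) by (cases q) auto
    have "(\<integral>\<omega>. (\<Sum>q\<leftarrow>S n. (snd q *v Bt (fst q) \<omega>) $ i) * cnj (\<Sum>q\<leftarrow>S' n. (snd q *v Bt (fst q) \<omega>) $ k) \<partial>N)
      = (\<Sum>q\<leftarrow>S n. \<Sum>r\<leftarrow>S' n. \<integral>\<omega>. (snd q *v Bt (fst q) \<omega>) $ i * cnj ((snd r *v Bt (fst r) \<omega>) $ k) \<partial>N)"
      by (rule integral_bilinear_sum_list) (auto intro!: s1 fb)
    also have "\<dots> = (\<Sum>q\<leftarrow>S n. \<Sum>r\<leftarrow>S' n. \<Sum>p\<in>UNIV. \<integral>x. (indicator (fst q) x *\<^sub>R snd q) $ i $ p * cnj ((indicator (fst r) x *\<^sub>R snd r) $ k $ p) \<partial>lborel)"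
      by (intro arg_cong[where f=sum_list] map_cong refl simple_isometry(3)[OF N] fb) auto
    also have "\<dots> = (\<Sum>p\<in>UNIV. \<Sum>q\<leftarrow>S n. \<Sum>r\<leftarrow>S' n. \<integral>x. (indicator (fst q) x *\<^sub>R snd q) $ i $ p * cnj ((indicator (fst r) x *\<^sub>R snd r) $ k $ p) \<partial>lborel)"
      by (simp add: sum_2 sum_list_addf)
    also have "\<dots> = (\<Sum>p\<in>UNIV. \<integral>x. (\<Sum>q\<leftarrow>S n. (indicator (fst q) x *\<^sub>R snd q) $ i $ p) * cnj (\<Sum>r\<leftarrow>S' n. (indicator (fst r) x *\<^sub>R snd r) $ k $ p) \<partial>lborel)"
      by (intro sum.cong refl integral_bilinear_sum_list[symmetric]) (rule s2, rule fb, simp)+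
    finally show ?thesis by (simp add: case_prod_unfold)
  qed
  ultimately show "(\<integral>\<omega>. X \<omega> $ i * cnj (Y \<omega> $ k) \<partial>N) = (\<Sum>p\<in>UNIV. \<integral>x. f x $ i $ p * cnj (g x $ k $ p) \<partial>lborel)"
    by (auto dest: LIMSEQ_unique)
qed

section \<open>The covariance of operator fractional Brownian motion\<close>

lemma matrix_inv_cancel:
  fixes P :: "real^'n^'n"
  assumes "invertible P"
  shows "P ** matrix_inv P = mat 1" "matrix_inv P ** P = mat 1"
  using assms someI_ex[of "\<lambda>A'. P ** A' = mat 1 \<and> A' ** P = mat 1"]
  by (auto simp: invertible_def matrix_inv_def)

lemma diag2_nth: "diag2 x y $ i $ k = (if i = k then if i = 1 then x else y else 0)"
  using exhaust_2[of i] exhaust_2[of k] by (auto simp: diag2_def)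

lemma diag_sandwich_nth:
  "(P ** diag2 x y ** Q) $ i $ k = P $ i $ 1 * x * Q $ 1 $ k + P $ i $ 2 * y * Q $ 2 $ k"
  by (simp add: matrix_matrix_mult_def sum_2 diag2_def)

lemma diag_sandwich_split:
  "P ** diag2 x y ** Q = x *\<^sub>R (P ** diag2 1 0 ** Q) + y *\<^sub>R (P ** diag2 0 1 ** Q)"
  by (simp add: vec_eq_iff diag_sandwich_nth)

text \<open>Splitting every power into scalar multiples of two fixed matrices reduces the matrix
  series to two scalar exponential series.\<close>

lemma mat_exp_diag:
  assumes QP: "Q ** P = mat 1" and PQ: "P ** Q = mat 1"
  shows "mat_exp (P ** diag2 x y ** Q) = P ** diag2 (exp x) (exp y) ** Q"
proof -
  let ?M = "P ** diag2 x y ** Q" and ?U = "P ** diag2 1 0 ** Q" and ?V = "P ** diag2 0 1 ** Q"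
  have D: "diag2 x y ** diag2 u v = diag2 (x * u) (y * v)" for u v
    by (simp add: vec_eq_iff matrix_matrix_mult_def sum_2 diag2_nth forall_2)
  have pow: "((**) ?M ^^ k) (mat 1) = P ** diag2 (x ^ k) (y ^ k) ** Q" for k
  proof (induction k)
    case 0
    have "diag2 1 1 = mat 1" by (simp add: vec_eq_iff diag2_nth mat_def)
    then show ?case by (simp add: PQ)
  next
    case (Suc k)
    have "?M ** (P ** diag2 (x ^ k) (y ^ k) ** Q) = P ** diag2 x y ** (Q ** P) ** diag2 (x ^ k) (y ^ k) ** Q"
      by (simp only: matrix_mul_assoc)
    also have "\<dots> = P ** (diag2 x y ** diag2 (x ^ k) (y ^ k)) ** Q"
      by (simp only: QP matrix_mul_rid matrix_mul_assoc)
    finally show ?case using Suc by (simp add: D)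
  qed
  have "(\<lambda>k. (x ^ k /\<^sub>R fact k) *\<^sub>R ?U + (y ^ k /\<^sub>R fact k) *\<^sub>R ?V) sums (exp x *\<^sub>R ?U + exp y *\<^sub>R ?V)"
    by (intro sums_add sums_scaleR_left exp_converges)
  moreover have "(x ^ k /\<^sub>R fact k) *\<^sub>R ?U + (y ^ k /\<^sub>R fact k) *\<^sub>R ?V = (1 / fact k) *\<^sub>R ((**) ?M ^^ k) (mat 1)" for k
    unfolding pow by (subst (2) diag_sandwich_split) (simp add: scaleR_add_right divide_inverse mult.commute)
  ultimately have "(\<lambda>k. (1 / fact k) *\<^sub>R ((**) ?M ^^ k) (mat 1)) sums (exp x *\<^sub>R ?U + exp y *\<^sub>R ?V)" by simp
  then show ?thesis unfolding mat_exp_def by (subst diag_sandwich_split) (rule sums_unique[symmetric])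
qed

lemma mat_powr_diag:
  assumes "Q ** P = mat 1" "P ** Q = mat 1"
  shows "mat_powr c (P ** diag2 x y ** Q) = (if c > 0 then P ** diag2 (c powr x) (c powr y) ** Q else 0)"
proof -
  have "ln c *\<^sub>R (P ** diag2 x y ** Q) = P ** diag2 (x * ln c) (y * ln c) ** Q"
    by (simp add: vec_eq_iff diag_sandwich_nth algebra_simps)
  then show ?thesis by (simp add: mat_powr_def mat_exp_diag[OF assms] powr_def)
qed

text \<open>The integrand in the spectral formula for \<open>|u| powr h\<close>, where
  \<open>h\<close> will be a sum of two of the exponents. The normalizing constant is carried along
  as the integral for \<open>u = 1\<close> and never evaluated.\<close>

definition kap :: "real \<Rightarrow> real \<Rightarrow> real \<Rightarrow> real" where
  "kap h u x = (1 - cos (u * x)) * \<bar>x\<bar> powr (- 1 - h)"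

lemma kap_nonneg [simp]: "0 \<le> kap h u x"
  by (simp add: kap_def)

lemma kap_measurable [measurable]: "kap h u \<in> borel_measurable borel"
  unfolding kap_def by measurable

text \<open>Substitution of \<open>u * x\<close> for \<open>x\<close>; at \<open>u = 0\<close> both
  sides vanish.\<close>

lemma integral_kap:
  assumes "0 < h"
  shows "(\<integral>x. kap h u x \<partial>lborel) = \<bar>u\<bar> powr h * (\<integral>x. kap h 1 x \<partial>lborel)"
proof (cases "u = 0")
  case False
  have "(\<integral>x. kap h 1 x \<partial>lborel) = \<bar>u\<bar> * (\<integral>x. kap h 1 (u * x) \<partial>lborel)"
    using lborel_integral_real_affine[OF False, of "kap h 1" 0] by simp
  also have "(\<lambda>x. kap h 1 (u * x)) = (\<lambda>x. \<bar>u\<bar> powr (- 1 - h) * kap h u x)"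
    by (auto simp: kap_def abs_mult powr_mult)
  finally have "(\<integral>x. kap h 1 x \<partial>lborel) = \<bar>u\<bar> * \<bar>u\<bar> powr (- 1 - h) * (\<integral>x. kap h u x \<partial>lborel)" by simp
  moreover have "\<bar>u\<bar> * \<bar>u\<bar> powr (- 1 - h) = \<bar>u\<bar> powr (- h)"
    using False by (simp add: powr_mult_base)
  ultimately show ?thesis using False by (simp add: powr_minus field_simps)
qed (simp add: kap_def)

section \<open>Spectral representation in the eigencoordinates of \<open>H\<close>\<close>

locale ofbm_model =
  fixes M :: "'a measure" and B :: "real \<Rightarrow> 'a \<Rightarrow> real^2" and N :: "'b measure"
    and Bt :: "real set \<Rightarrow> 'b \<Rightarrow> complex^2" and P H :: "real^2^2" and A :: "complex^2^2" and h1 h2 :: real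
  assumes ofbm: "ofbm M B H A N Bt"
    and exponents: "0 < h1" "h1 < h2" "h2 < 1"
    and P: "invertible P"
    and H: "H = P ** diag2 h1 h2 ** matrix_inv P"
    and full_rank: "rank (map_matrix Re (A ** hermitian_transpose A)) = 2"
    and time_reversible: "map_matrix Im (A ** hermitian_transpose A) = 0"
begin

definition Q :: "real^2^2" where "Q = matrix_inv P"

definition hx :: "2 \<Rightarrow> real" where "hx i = (if i = 1 then h1 else h2)"

definition W :: "complex^2^2" where "W = map_matrix complex_of_real Q ** A"

text \<open>The spectral matrix in eigencoordinates, \<open>W\<close> times its Hermitian transpose;
  \<open>G_complex\<close> shows that it is real.\<close>

definition G :: "2 \<Rightarrow> 2 \<Rightarrow> real" where "G i k = Re (\<Sum>p\<in>UNIV. W $ i $ p * cnj (W $ k $ p))"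

text \<open>\<open>2 * g i k\<close> is the covariance of the coordinates \<open>i\<close> and
  \<open>k\<close> of the process in eigencoordinates at time 1.\<close>

definition g :: "2 \<Rightarrow> 2 \<Rightarrow> real" where "g i k = G i k * (\<integral>x. kap (hx i + hx k) 1 x \<partial>lborel)"

definition Bq :: "real \<Rightarrow> 2 \<Rightarrow> 'a \<Rightarrow> real" where "Bq t i \<omega> = (Q *v B t \<omega>) $ i"

lemma PQ: "P ** Q = mat 1" "Q ** P = mat 1"
  using matrix_inv_cancel[OF P] by (simp_all add: Q_def)

lemma hx_bounds: "0 < hx i" "hx i < 1"
  using exponents by (auto simp: hx_def)

lemma time_reversible_nth: "(A ** hermitian_transpose A) $ i $ k = complex_of_real (Re ((A ** hermitian_transpose A) $ i $ k))"
proof -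
  have "map_matrix Im (A ** hermitian_transpose A) $ i $ k = 0" unfolding time_reversible by simp
  then show ?thesis by (simp add: complex_eq_iff)
qed

lemma AA_nth: "(A ** hermitian_transpose A) $ i $ k = (\<Sum>p\<in>UNIV. A $ i $ p * cnj (A $ k $ p))"
  by (simp add: matrix_matrix_mult_def hermitian_transpose_def transpose_def)

lemma W_nth: "W $ i $ p = (\<Sum>q\<in>UNIV. complex_of_real (Q $ i $ q) * A $ q $ p)"
  by (simp add: W_def matrix_matrix_mult_def)

text \<open>Time reversibility makes \<open>A\<close> times its Hermitian transpose real, and
  \<open>Q\<close> is real. The half axes \<open>x > 0\<close> and \<open>x < 0\<close> then
  contribute the same matrix, which leaves only cosine terms in the covariance.\<close>

lemma G_complex: "(\<Sum>p\<in>UNIV. W $ i $ p * cnj (W $ k $ p)) = complex_of_real (G i k)"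
proof -
  have "(\<Sum>p\<in>UNIV. W $ i $ p * cnj (W $ k $ p))
     = (\<Sum>q\<in>UNIV. \<Sum>r\<in>UNIV. complex_of_real (Q $ i $ q * Q $ k $ r) * (A ** hermitian_transpose A) $ q $ r)"
    unfolding W_nth AA_nth by (simp add: sum_2 algebra_simps)
  also have "\<dots> = complex_of_real (\<Sum>q\<in>UNIV. \<Sum>r\<in>UNIV. Q $ i $ q * Q $ k $ r * Re ((A ** hermitian_transpose A) $ q $ r))"
    by (subst time_reversible_nth) simp
  finally show ?thesis by (simp add: G_def)
qed

lemma G_sym: "G i k = G k i"
proof -
  have "complex_of_real (G i k) = cnj (complex_of_real (G k i))"
    unfolding G_complex[symmetric] by (simp add: cnj_sum mult.commute)
  then show ?thesis by simp
qed

lemma g_sym: "g i k = g k i"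
  by (simp add: g_def G_sym[of i k] add.commute)

text \<open>If \<open>G i i\<close> vanished, row \<open>i\<close> of \<open>W\<close> would be 0,
  so the full-rank matrix would annihilate row \<open>i\<close> of \<open>Q\<close>; but an
  invertible matrix has no zero row.\<close>

lemma G_pos: "G i i > 0"
proof (rule ccontr)
  assume "\<not> G i i > 0"
  moreover have "G i i = (\<Sum>p\<in>UNIV. (cmod (W $ i $ p))\<^sup>2)"
    by (simp add: G_def complex_mult_cnj cmod_power2)
  ultimately have "(\<Sum>p\<in>UNIV. (cmod (W $ i $ p))\<^sup>2) = 0"
    by (metis less_eq_real_def sum_nonneg zero_le_power2)
  then have W0: "W $ i $ p = 0" for p by (simp add: sum_nonneg_eq_0_iff)
  let ?R = "map_matrix Re (A ** hermitian_transpose A)"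
  have "?R *v (Q $ i) = 0"
  proof -
    have "(?R *v (Q $ i)) $ r = 0" for r
    proof -
      have "complex_of_real ((?R *v (Q $ i)) $ r) = (\<Sum>q\<in>UNIV. (A ** hermitian_transpose A) $ r $ q * complex_of_real (Q $ i $ q))"
        by (subst time_reversible_nth) (simp add: matrix_vector_mult_def)
      also have "\<dots> = (\<Sum>p\<in>UNIV. A $ r $ p * cnj (W $ i $ p))"
        unfolding W_nth AA_nth by (simp add: sum_2 algebra_simps)
      finally show ?thesis by (simp add: W0)
    qed
    then show ?thesis by (simp add: vec_eq_iff)
  qed
  moreover have "inj ((*v) ?R)" using full_rank full_rank_injective[of ?R] by simp
  ultimately have "Q $ i = 0" by (metis injD matrix_vector_mult_0_right)
  then have "(Q ** P) $ i $ i = 0" by (simp add: matrix_matrix_mult_def)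
  then show False by (simp add: PQ mat_def)
qed

lemma H_minus_half: "- (H - (1/2) *\<^sub>R mat 1) = P ** diag2 (1/2 - h1) (1/2 - h2) ** Q"
proof -
  have "diag2 1 1 = mat 1" by (simp add: vec_eq_iff diag2_nth mat_def)
  then have "mat 1 = P ** diag2 1 1 ** Q" by (simp add: PQ)
  then show ?thesis unfolding H Q_def[symmetric]
    by (simp add: vec_eq_iff diag_sandwich_nth algebra_simps)
qed

definition m :: "real \<Rightarrow> real \<Rightarrow> complex" where
  "m t x = (exp (\<i> * complex_of_real (t * x)) - 1) / (\<i> * complex_of_real x)"

text \<open>Row \<open>i\<close> of \<open>Q\<close> is a left eigenvector of \<open>H\<close>, so
  the matrix power acts on it by a scalar power.\<close>

lemma Q_mat_powr:
  "(\<Sum>q\<in>UNIV. complex_of_real (Q $ i $ q) * (map_matrix complex_of_real (mat_powr c (- (H - (1/2) *\<^sub>R mat 1))) ** C) $ q $ p)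
     = (if c > 0 then complex_of_real (c powr (1/2 - hx i)) else 0) * (\<Sum>q\<in>UNIV. complex_of_real (Q $ i $ q) * C $ q $ p)"
proof (cases "c > 0")
  case True
  let ?D = "diag2 (c powr (1/2 - h1)) (c powr (1/2 - h2))"
  have eq: "(\<Sum>q\<in>UNIV. Q $ i $ q * (P ** ?D ** Q) $ q $ r) = c powr (1/2 - hx i) * Q $ i $ r" for r
  proof -
    have "(\<Sum>q\<in>UNIV. Q $ i $ q * (P ** ?D ** Q) $ q $ r) = (Q ** (P ** ?D ** Q)) $ i $ r"
      by (simp add: matrix_matrix_mult_def)
    also have "Q ** (P ** ?D ** Q) = ?D ** Q" by (simp add: matrix_mul_assoc PQ)
    also have "(?D ** Q) $ i $ r = c powr (1/2 - hx i) * Q $ i $ r"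
      using exhaust_2[of i] by (auto simp: matrix_matrix_mult_def sum_2 diag2_nth hx_def)
    finally show ?thesis .
  qed
  have "(\<Sum>q\<in>UNIV. complex_of_real (Q $ i $ q) * (map_matrix complex_of_real (P ** ?D ** Q) ** C) $ q $ p)
     = (\<Sum>r\<in>UNIV. complex_of_real (\<Sum>q\<in>UNIV. Q $ i $ q * (P ** ?D ** Q) $ q $ r) * C $ r $ p)"
  proof -
    have mm: "(map_matrix complex_of_real X ** C) $ q $ p = (\<Sum>r\<in>UNIV. complex_of_real (X $ q $ r) * C $ r $ p)" for X q
      by (simp add: matrix_matrix_mult_def)
    show ?thesis unfolding mm sum_2 by (simp add: algebra_simps)
  qed
  also have "\<dots> = complex_of_real (c powr (1/2 - hx i)) * (\<Sum>q\<in>UNIV. complex_of_real (Q $ i $ q) * C $ q $ p)"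
    unfolding eq by (simp add: sum_distrib_left mult.assoc)
  finally show ?thesis using True unfolding H_minus_half by (simp add: mat_powr_diag PQ)
next
  case False
  then show ?thesis by (simp add: mat_powr_def map_matrix_def matrix_matrix_mult_def)
qed

lemma kernel_eigen:
  "(\<Sum>q\<in>UNIV. complex_of_real (Q $ i $ q) * ofbm_kernel H A t x $ q $ p)
     = m t x * complex_of_real (\<bar>x\<bar> powr (1/2 - hx i)) * (if x \<ge> 0 then W $ i $ p else cnj (W $ i $ p))"
proof -
  have mat: "(mat c ** X) $ q $ r = c * X $ q $ r" for c :: complex and X :: "complex^2^2" and q r
    using exhaust_2[of q] by (auto simp: matrix_matrix_mult_def sum_2 mat_def)
  have cA: "(\<Sum>q\<in>UNIV. complex_of_real (Q $ i $ q) * map_matrix cnj A $ q $ p) = cnj (W $ i $ p)"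
    by (simp add: W_nth)
  have "(\<Sum>q\<in>UNIV. complex_of_real (Q $ i $ q) * ofbm_kernel H A t x $ q $ p)
     = m t x * ((\<Sum>q\<in>UNIV. complex_of_real (Q $ i $ q) * (map_matrix complex_of_real (mat_powr (max x 0) (- (H - (1/2) *\<^sub>R mat 1))) ** A) $ q $ p)
       + (\<Sum>q\<in>UNIV. complex_of_real (Q $ i $ q) * (map_matrix complex_of_real (mat_powr (max (- x) 0) (- (H - (1/2) *\<^sub>R mat 1))) ** map_matrix cnj A) $ q $ p))"
    unfolding ofbm_kernel_def Let_def mat vector_add_component m_def[symmetric]
    by (simp only: sum_distrib_left sum.distrib[symmetric] distrib_left mult_ac)
  then show ?thesis
    unfolding Q_mat_powr cA W_nth[symmetric]
    by (cases x "0 :: real" rule: linorder_cases) auto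
qed

lemma B_square_integrable: "square_integrable M (B t)"
  using ofbm by (intro centered_gaussian_family_square_integrable[where I=UNIV]) (auto simp: ofbm_def)

lemma B_nth_square_integrable: "square_integrable M (\<lambda>\<omega>. B t \<omega> $ i)"
  by (rule square_integrable_nth[OF B_square_integrable])

lemma Bq_sum: "Bq t i \<omega> = (\<Sum>q\<in>UNIV. Q $ i $ q * B t \<omega> $ q)"
  by (simp add: Bq_def matrix_vector_mult_def)

lemma Bq_square_integrable: "square_integrable M (Bq t i)"
  unfolding Bq_sum[abs_def] by (intro square_integrable_sum square_integrable_cmult B_nth_square_integrable)

lemma kernel_square_integrable: "square_integrable lborel (\<lambda>x. ofbm_kernel H A t x $ q $ p)"
  and B_covariance: "complex_of_real (\<integral>\<omega>. B s \<omega> $ q * B t \<omega> $ r \<partial>M)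
    = (\<Sum>p\<in>UNIV. \<integral>x. ofbm_kernel H A s x $ q $ p * cnj (ofbm_kernel H A t x $ r $ p) \<partial>lborel)"
proof -
  obtain Y where N: "hermitian_gaussian_measure N Bt"
    and Y: "\<And>t. stochastic_integral N Bt (ofbm_kernel H A t) (Y t)"
    and law: "\<And>J. finite J \<Longrightarrow> distr M (PiM J (\<lambda>_. borel)) (\<lambda>\<omega>. \<lambda>t\<in>J. complex_vec (B t \<omega>)) =
             distr N (PiM J (\<lambda>_. borel)) (\<lambda>\<omega>. \<lambda>t\<in>J. Y t \<omega>)"
    using ofbm unfolding ofbm_def by blast
  show "square_integrable lborel (\<lambda>x. ofbm_kernel H A t x $ q $ p)"
    by (rule stochastic_integral_isometry(1)[OF N Y Y])
  have [measurable]: "Y t \<in> borel_measurable N" for t using Y[of t] by (simp add: stochastic_integral_def)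
  have [measurable]: "B t \<in> borel_measurable M" for t using B_square_integrable by measurable
  have [measurable]: "(complex_vec :: real^2 \<Rightarrow> complex^2) \<in> borel_measurable borel"
    unfolding complex_vec_def by (intro borel_measurable_continuous_onI continuous_intros)
  have [measurable]: "(\<lambda>x :: complex^2. x $ i) \<in> borel_measurable borel" for i
    by (intro borel_measurable_continuous_onI continuous_intros)
  \<comment> \<open>A covariance depends on the law of the process at the two times \<open>s\<close>
    and \<open>t\<close> alone.\<close>
  have eq: "(\<integral>\<xi>. \<xi> s $ q * cnj (\<xi> t $ r) \<partial>distr M (PiM {s, t} (\<lambda>_. borel)) (\<lambda>\<omega>. \<lambda>t\<in>{s, t}. complex_vec (B t \<omega>)))
    = (\<integral>\<xi>. \<xi> s $ q * cnj (\<xi> t $ r) \<partial>distr N (PiM {s, t} (\<lambda>_. borel)) (\<lambda>\<omega>. \<lambda>t\<in>{s, t}. Y t \<omega>))"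
    by (subst law) auto
  have "complex_of_real (\<integral>\<omega>. B s \<omega> $ q * B t \<omega> $ r \<partial>M) = (\<integral>\<omega>. complex_vec (B s \<omega>) $ q * cnj (complex_vec (B t \<omega>) $ r) \<partial>M)"
    by (subst integral_complex_of_real[symmetric]) (simp add: complex_vec_def)
  also have "\<dots> = (\<integral>\<omega>. Y s \<omega> $ q * cnj (Y t \<omega> $ r) \<partial>N)"
    using eq by (subst (asm) integral_distr, simp_all) (subst (asm) integral_distr, simp_all)
  also have "\<dots> = (\<Sum>p\<in>UNIV. \<integral>x. ofbm_kernel H A s x $ q $ p * cnj (ofbm_kernel H A t x $ r $ p) \<partial>lborel)"
    by (rule stochastic_integral_isometry(2)[OF N Y Y])
  finally show "complex_of_real (\<integral>\<omega>. B s \<omega> $ q * B t \<omega> $ r \<partial>M)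
    = (\<Sum>p\<in>UNIV. \<integral>x. ofbm_kernel H A s x $ q $ p * cnj (ofbm_kernel H A t x $ r $ p) \<partial>lborel)" .
qed

text \<open>A polarization identity; it is the origin of the combination
  \<open>|s|^h + |t|^h - |s - t|^h\<close> in the covariance.\<close>

lemma m_mult_cnj:
  assumes "x \<noteq> 0"
  shows "Re (m s x * cnj (m t x)) = ((1 - cos (s * x)) + (1 - cos (t * x)) - (1 - cos ((s - t) * x))) / x\<^sup>2"
proof -
  have e: "exp (\<i> * complex_of_real y) = Complex (cos y) (sin y)" for y
    by (simp add: complex_eq_iff Re_exp Im_exp)
  have "m s x * cnj (m t x) = ((Complex (cos (s * x)) (sin (s * x)) - 1) * cnj (Complex (cos (t * x)) (sin (t * x)) - 1)) / complex_of_real (x\<^sup>2)"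
  proof -
    have "(\<i> * complex_of_real x) * cnj (\<i> * complex_of_real x) = complex_of_real (x\<^sup>2)"
      by (simp add: complex_eq_iff power2_eq_square)
    then show ?thesis unfolding m_def e by (simp only: complex_cnj_divide times_divide_times_eq)
  qed
  then have "Re (m s x * cnj (m t x)) = Re ((Complex (cos (s * x)) (sin (s * x)) - 1) * cnj (Complex (cos (t * x)) (sin (t * x)) - 1)) / x\<^sup>2"
    by (simp only: Re_divide_of_real)
  also have "Re ((Complex (cos (s * x)) (sin (s * x)) - 1) * cnj (Complex (cos (t * x)) (sin (t * x)) - 1))
     = (1 - cos (s * x)) + (1 - cos (t * x)) - (1 - cos ((s - t) * x))"
    by (simp add: left_diff_distrib cos_diff) (simp add: algebra_simps)
  finally show ?thesis .
qed

text \<open>The three terms stay under one integral because at this point only their combination is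
  known to be integrable, as a product of square-integrable kernels.\<close>

lemma Bq_covariance_raw:
  shows "integrable lborel (\<lambda>x. G i k * (kap (hx i + hx k) s x + kap (hx i + hx k) t x - kap (hx i + hx k) (s - t) x))"
    and "(\<integral>\<omega>. Bq s i \<omega> * Bq t k \<omega> \<partial>M)
      = (\<integral>x. G i k * (kap (hx i + hx k) s x + kap (hx i + hx k) t x - kap (hx i + hx k) (s - t) x) \<partial>lborel)"
proof -
  let ?f = "\<lambda>t i p x. \<Sum>q\<in>UNIV. complex_of_real (Q $ i $ q) * ofbm_kernel H A t x $ q $ p"
  let ?F = "\<lambda>x. \<Sum>p\<in>UNIV. ?f s i p x * cnj (?f t k p x)"
  have iB: "integrable M (\<lambda>\<omega>. B s \<omega> $ q * B t \<omega> $ r)" for q r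
    by (intro integrable_mult_square_integrable B_nth_square_integrable)
  have iK: "integrable lborel (\<lambda>x. ofbm_kernel H A s x $ q $ p * cnj (ofbm_kernel H A t x $ r $ p))" for q r p
    by (intro integrable_mult_cnj kernel_square_integrable)
  have Fx: "?F x = (\<Sum>q\<in>UNIV. \<Sum>r\<in>UNIV. \<Sum>p\<in>UNIV. complex_of_real (Q $ i $ q * Q $ k $ r) * (ofbm_kernel H A s x $ q $ p * cnj (ofbm_kernel H A t x $ r $ p)))" for x
    by (simp add: sum_2 algebra_simps)
  have iF: "integrable lborel ?F" unfolding Fx
    by (intro Bochner_Integration.integrable_sum integrable_mult_right iK)
  have "complex_of_real (\<integral>\<omega>. Bq s i \<omega> * Bq t k \<omega> \<partial>M)
      = complex_of_real (\<integral>\<omega>. (\<Sum>q\<in>UNIV. \<Sum>r\<in>UNIV. (Q $ i $ q * Q $ k $ r) * (B s \<omega> $ q * B t \<omega> $ r)) \<partial>M)"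
    unfolding Bq_sum by (simp add: sum_2 algebra_simps)
  also have "\<dots> = (\<Sum>q\<in>UNIV. \<Sum>r\<in>UNIV. complex_of_real (Q $ i $ q * Q $ k $ r) * complex_of_real (\<integral>\<omega>. B s \<omega> $ q * B t \<omega> $ r \<partial>M))"
    using iB by (simp add: Bochner_Integration.integral_sum)
  also have "\<dots> = (\<integral>x. ?F x \<partial>lborel)"
    unfolding B_covariance Fx using iK by (simp add: Bochner_Integration.integral_sum sum_distrib_left)
  finally have "(\<integral>\<omega>. Bq s i \<omega> * Bq t k \<omega> \<partial>M) = Re (\<integral>x. ?F x \<partial>lborel)" by (metis Re_complex_of_real)
  also have "\<dots> = (\<integral>x. Re (?F x) \<partial>lborel)" using iF by (rule integral_Re[symmetric])
  finally have e: "(\<integral>\<omega>. Bq s i \<omega> * Bq t k \<omega> \<partial>M) = (\<integral>x. Re (?F x) \<partial>lborel)" .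
  have iR: "integrable lborel (\<lambda>x. Re (?F x))" using iF by (rule integrable_Re)
  have r: "Re (?F x) = G i k * (kap (hx i + hx k) s x + kap (hx i + hx k) t x - kap (hx i + hx k) (s - t) x)" for x
  proof (cases "x = 0")
    case True
    then show ?thesis unfolding kernel_eigen by (simp add: m_def kap_def)
  next
    case False
    have pw: "\<bar>x\<bar> powr (1/2 - hx i) * \<bar>x\<bar> powr (1/2 - hx k) = x\<^sup>2 * \<bar>x\<bar> powr (- 1 - (hx i + hx k))"
    proof -
      have "x\<^sup>2 = \<bar>x\<bar> powr 2" using False by (simp add: powr_numeral)
      then show ?thesis by (simp only: powr_add[symmetric]) (simp add: algebra_simps)
    qed
    have "?F x = m s x * cnj (m t x) * complex_of_real (\<bar>x\<bar> powr (1/2 - hx i) * \<bar>x\<bar> powr (1/2 - hx k))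
        * (if x \<ge> 0 then (\<Sum>p\<in>UNIV. W $ i $ p * cnj (W $ k $ p)) else cnj (\<Sum>p\<in>UNIV. W $ i $ p * cnj (W $ k $ p)))"
      unfolding kernel_eigen by (simp add: sum_2 algebra_simps)
    also have "\<dots> = m s x * cnj (m t x) * complex_of_real (x\<^sup>2 * \<bar>x\<bar> powr (- 1 - (hx i + hx k)) * G i k)"
      unfolding G_complex pw by simp
    finally have Fe: "?F x = m s x * cnj (m t x) * complex_of_real (x\<^sup>2 * \<bar>x\<bar> powr (- 1 - (hx i + hx k)) * G i k)" .
    have Re1: "Re (?F x) = Re (m s x * cnj (m t x)) * (x\<^sup>2 * \<bar>x\<bar> powr (- 1 - (hx i + hx k)) * G i k)"
    proof -
      have "Re (z * complex_of_real c) = Re z * c" for z c by simp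
      then show ?thesis by (simp only: Fe)
    qed
    show ?thesis unfolding Re1 m_mult_cnj[OF False] using False by (simp add: kap_def field_simps)
  qed
  show "integrable lborel (\<lambda>x. G i k * (kap (hx i + hx k) s x + kap (hx i + hx k) t x - kap (hx i + hx k) (s - t) x))"
    using iR unfolding r .
  show "(\<integral>\<omega>. Bq s i \<omega> * Bq t k \<omega> \<partial>M)
      = (\<integral>x. G i k * (kap (hx i + hx k) s x + kap (hx i + hx k) t x - kap (hx i + hx k) (s - t) x) \<partial>lborel)"
    using e unfolding r .
qed

text \<open>For \<open>i = k\<close> and equal times the integrand of
  \<open>Bq_covariance_raw\<close> is \<open>2 * G i i\<close> times \<open>kap\<close>, and
  \<open>G i i\<close> is positive. For two different exponents, the power of \<open>|x|\<close> is
  the geometric mean of the two diagonal powers.\<close>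

lemma integrable_kap: "integrable lborel (kap (hx i + hx k) u)"
proof -
  have diag: "integrable lborel (kap (hx i + hx i) u)" for i
  proof -
    have "integrable lborel (\<lambda>x. (1 / (2 * G i i)) * (G i i * (kap (hx i + hx i) u x + kap (hx i + hx i) u x - kap (hx i + hx i) (u - u) x)))"
      by (intro integrable_mult_right Bq_covariance_raw)
    moreover have "kap (hx i + hx i) (u - u) x = 0" for x by (simp add: kap_def)
    ultimately show ?thesis using G_pos[of i] by simp
  qed
  have le: "\<bar>x\<bar> powr (- 1 - (hx i + hx k)) \<le> \<bar>x\<bar> powr (- 1 - (hx i + hx i)) + \<bar>x\<bar> powr (- 1 - (hx k + hx k))" for x :: real
  proof (cases "x = 0")
    case False
    define p q where "p = \<bar>x\<bar> powr (- 1/2 - hx i)" and "q = \<bar>x\<bar> powr (- 1/2 - hx k)"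
    have "\<bar>x\<bar> powr (- 1 - (hx i + hx k)) = p * q" "\<bar>x\<bar> powr (- 1 - (hx i + hx i)) = p * p"
      "\<bar>x\<bar> powr (- 1 - (hx k + hx k)) = q * q"
      by (simp_all add: p_def q_def powr_add[symmetric] algebra_simps)
    moreover have "p * q \<le> p * p + q * q"
    proof -
      have "0 \<le> p * q" by (simp add: p_def q_def)
      then show ?thesis using sum_squares_bound[of p q] unfolding power2_eq_square by linarith
    qed
    ultimately show ?thesis by simp
  qed simp
  have "integrable lborel (\<lambda>x. kap (hx i + hx i) u x + kap (hx k + hx k) u x)"
    by (intro Bochner_Integration.integrable_add diag)
  then show ?thesis
  proof (rule Bochner_Integration.integrable_bound)
    show "AE x in lborel. norm (kap (hx i + hx k) u x) \<le> norm (kap (hx i + hx i) u x + kap (hx k + hx k) u x)"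
    proof (rule AE_I2)
      fix x
      have "kap (hx i + hx k) u x \<le> kap (hx i + hx i) u x + kap (hx k + hx k) u x"
        unfolding kap_def distrib_left[symmetric] by (intro mult_left_mono le) simp
      then show "norm (kap (hx i + hx k) u x) \<le> norm (kap (hx i + hx i) u x + kap (hx k + hx k) u x)"
        by simp
    qed
  qed simp
qed

lemma Bq_covariance:
  "(\<integral>\<omega>. Bq s i \<omega> * Bq t k \<omega> \<partial>M)
     = g i k * (\<bar>s\<bar> powr (hx i + hx k) + \<bar>t\<bar> powr (hx i + hx k) - \<bar>s - t\<bar> powr (hx i + hx k))"
  using hx_bounds(1)[of i] hx_bounds(1)[of k]
  by (simp add: Bq_covariance_raw(2) integrable_kap integral_kap[of _ s] integral_kap[of _ t] integral_kap[of _ "s - t"] g_def algebra_simps)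

end

section \<open>Double integrals of a wavelet\<close>

lemma taylor_powr_remainder:
  fixes h x w :: real
  assumes h: "0 < h" "h < 2" and w: "w > 0" and x: "\<bar>x\<bar> \<le> w / 2"
  shows "\<bar>(w + x) powr h - (w powr h + h * w powr (h - 1) * x + h * (h - 1) / 2 * w powr (h - 2) * x\<^sup>2)\<bar>
     \<le> \<bar>h * (h - 1) * (h - 2)\<bar> * (w / 2) powr (h - 3) * \<bar>x\<bar> ^ 3"
proof (cases "x = 0")
  case False
  define d where "d m y = (if m = 0 then y powr h else if m = 1 then h * y powr (h - 1)
      else if m = 2 then h * (h - 1) * y powr (h - 2) else h * (h - 1) * (h - 2) * y powr (h - 3))" for m :: nat and y :: real
  have der: "DERIV (d m) t :> d (Suc m) t" if "m < 3" "w / 2 \<le> t" for m t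
  proof -
    have t: "t > 0" using that w by simp
    have "m = 0 \<or> m = 1 \<or> m = 2" using that by auto
    then show ?thesis
    proof (elim disjE)
      assume m: "m = 0"
      have "DERIV (\<lambda>y. y powr h) t :> h * t powr (h - 1)"
        by (rule has_real_derivative_powr[OF t])
      then show ?thesis by (simp add: m d_def[abs_def])
    next
      assume m: "m = 1"
      have "DERIV (\<lambda>y. h * y powr (h - 1)) t :> h * ((h - 1) * t powr (h - 1 - 1))"
        by (intro DERIV_cmult has_real_derivative_powr[OF t])
      then show ?thesis by (simp add: m d_def[abs_def] mult.assoc)
    next
      assume m: "m = 2"
      have "DERIV (\<lambda>y. h * (h - 1) * y powr (h - 2)) t :> h * (h - 1) * ((h - 2) * t powr (h - 2 - 1))"
        by (intro DERIV_cmult has_real_derivative_powr[OF t])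
      then show ?thesis by (simp add: m d_def[abs_def] mult.assoc)
    qed
  qed
  have "\<exists>t. (if w + x < w then w + x < t \<and> t < w else w < t \<and> t < w + x) \<and>
      d 0 (w + x) = (\<Sum>m<3. d m w / fact m * (w + x - w) ^ m) + d 3 t / fact 3 * (w + x - w) ^ 3"
    by (rule Taylor[where a="w / 2" and b="3 * w / 2"]) (use False x w der in \<open>auto simp: abs_le_iff\<close>)
  then obtain t where t: "if x < 0 then w + x < t \<and> t < w else w < t \<and> t < w + x"
    and eq: "d 0 (w + x) = (\<Sum>m<3. d m w / fact m * x ^ m) + d 3 t / fact 3 * x ^ 3"
    using w by (auto split: if_splits)
  have tw: "w / 2 \<le> t" using t x by (auto split: if_splits simp: abs_le_iff)
  have "(\<Sum>m<3. d m w / fact m * x ^ m) = w powr h + h * w powr (h - 1) * x + h * (h - 1) / 2 * w powr (h - 2) * x\<^sup>2"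
    by (simp add: numeral_3_eq_3 d_def power2_eq_square)
  with eq have "\<bar>(w + x) powr h - (w powr h + h * w powr (h - 1) * x + h * (h - 1) / 2 * w powr (h - 2) * x\<^sup>2)\<bar>
     = \<bar>h * (h - 1) * (h - 2)\<bar> * t powr (h - 3) * \<bar>x\<bar> ^ 3 / 6"
    by (simp add: d_def abs_mult power_abs fact_numeral)
  also have "\<dots> \<le> \<bar>h * (h - 1) * (h - 2)\<bar> * (w / 2) powr (h - 3) * \<bar>x\<bar> ^ 3 / 1"
  proof (intro frac_le mult_right_mono mult_left_mono)
    \<comment> \<open>The exponent is negative, so the third derivative is largest at the left end
      \<open>w / 2\<close> of the admissible range.\<close>
    show "t powr (h - 3) \<le> (w / 2) powr (h - 3)" using tw h w by (intro powr_mono2') auto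
  qed (auto intro!: mult_nonneg_nonneg)
  finally show ?thesis by simp
qed simp

text \<open>The coefficients remain existential because the double integral against the wavelet
  annihilates every quadratic polynomial in \<open>t - t'\<close>. Negative \<open>w\<close> is
  reduced to positive \<open>w\<close> by the reflection of \<open>x\<close>.\<close>

lemma taylor_abs_powr:
  fixes h x w :: real
  assumes h: "0 < h" "h < 2" and w: "w \<noteq> 0"
  shows "\<exists>\<alpha> \<beta> \<gamma>. \<forall>x. \<bar>x\<bar> \<le> \<bar>w\<bar> / 2 \<longrightarrow>
    \<bar>\<bar>x + w\<bar> powr h - (\<alpha> + \<beta> * x + \<gamma> * x\<^sup>2)\<bar> \<le> \<bar>h * (h - 1) * (h - 2)\<bar> * (\<bar>w\<bar> / 2) powr (h - 3) * \<bar>x\<bar> ^ 3"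
proof (cases "w > 0")
  case True
  show ?thesis
  proof (intro exI allI impI)
    fix x assume x: "\<bar>x\<bar> \<le> \<bar>w\<bar> / 2"
    have eq: "\<bar>x + w\<bar> = w + x" using x True by (auto simp: abs_le_iff)
    show "\<bar>\<bar>x + w\<bar> powr h - (w powr h + (h * w powr (h - 1)) * x + (h * (h - 1) / 2 * w powr (h - 2)) * x\<^sup>2)\<bar>
       \<le> \<bar>h * (h - 1) * (h - 2)\<bar> * (\<bar>w\<bar> / 2) powr (h - 3) * \<bar>x\<bar> ^ 3"
      unfolding eq using taylor_powr_remainder[OF h True, of x] x True by simp
  qed
next
  case False
  with w have wn: "- w > 0" by simp
  show ?thesis
  proof (intro exI allI impI)
    fix x assume x: "\<bar>x\<bar> \<le> \<bar>w\<bar> / 2"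
    have eq: "\<bar>x + w\<bar> = - w + - x" using x wn by (auto simp: abs_le_iff)
    show "\<bar>\<bar>x + w\<bar> powr h - ((- w) powr h + (- h * (- w) powr (h - 1)) * x + (h * (h - 1) / 2 * (- w) powr (h - 2)) * x\<^sup>2)\<bar>
       \<le> \<bar>h * (h - 1) * (h - 2)\<bar> * (\<bar>w\<bar> / 2) powr (h - 3) * \<bar>x\<bar> ^ 3"
      unfolding eq using taylor_powr_remainder[OF h wn, of "- x"] x wn by simp
  qed
qed

lemma continuous_AE_zero:
  fixes f :: "real \<Rightarrow> real"
  assumes f: "continuous_on UNIV f" and AE: "AE x in lborel. f x = 0"
  shows "f x = 0"
proof (rule ccontr)
  assume "f x \<noteq> 0"
  have "open {x. f x \<noteq> 0}"
    by (intro open_Collect_neq f continuous_on_const)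
  then obtain e where e: "e > 0" "ball x e \<subseteq> {x. f x \<noteq> 0}"
    using \<open>f x \<noteq> 0\<close> by (auto simp: open_contains_ball)
  from AE obtain Z where Z: "{x. f x \<noteq> 0} \<subseteq> Z" "emeasure lborel Z = 0" "Z \<in> sets lborel"
    by (auto elim!: AE_E)
  have "emeasure lborel {x - e<..<x + e} \<le> emeasure lborel Z"
    using e Z by (intro emeasure_mono) (auto simp: ball_eq_greaterThanLessThan)
  then show False using e Z by (simp add: ennreal_eq_0_iff)
qed

lemma continuous_abs_powr: "0 < h \<Longrightarrow> continuous_on UNIV (\<lambda>x :: real. \<bar>t - x\<bar> powr h)"
  by (intro continuous_on_powr' continuous_intros) auto

section \<open>Compactly supported filters with two vanishing moments\<close>

locale wavelet_filter =
  fixes \<psi> :: "real \<Rightarrow> real" and L :: real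
  assumes integrable_psi: "integrable lborel \<psi>"
    and support: "\<psi> t \<noteq> 0 \<Longrightarrow> \<bar>t\<bar> \<le> L" and L_pos: "0 < L"
    and moment0: "(\<integral>t. \<psi> t \<partial>lborel) = 0" and moment1: "(\<integral>t. t * \<psi> t \<partial>lborel) = 0"
    and unit: "(\<integral>t. (\<psi> t)\<^sup>2 \<partial>lborel) = 1"
begin

lemma psi_measurable [measurable]: "\<psi> \<in> borel_measurable borel"
  using integrable_psi by auto

definition nrm :: real where "nrm = (\<integral>t. \<bar>\<psi> t\<bar> \<partial>lborel)"

lemma integrable_psi_bounded:
  assumes [measurable]: "f \<in> borel_measurable borel" and le: "\<And>t. \<bar>t\<bar> \<le> L \<Longrightarrow> \<bar>f t\<bar> \<le> C"
  shows "integrable lborel (\<lambda>t. \<psi> t * f t)" "\<bar>\<integral>t. \<psi> t * f t \<partial>lborel\<bar> \<le> C * nrm"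
proof -
  have pw: "\<bar>\<psi> t * f t\<bar> \<le> C * \<bar>\<psi> t\<bar>" for t
    using le[of t] support[of t] by (cases "\<psi> t = 0") (auto simp: abs_mult mult.commute mult_right_mono)
  show i: "integrable lborel (\<lambda>t. \<psi> t * f t)"
    by (rule Bochner_Integration.integrable_bound[of _ "\<lambda>t. C * \<bar>\<psi> t\<bar>"])
      (use integrable_psi pw in \<open>auto intro: order.trans[OF pw abs_ge_self]\<close>)
  have "\<bar>\<integral>t. \<psi> t * f t \<partial>lborel\<bar> \<le> (\<integral>t. \<bar>\<psi> t * f t\<bar> \<partial>lborel)" by (rule integral_abs_bound)
  also have "\<dots> \<le> (\<integral>t. C * \<bar>\<psi> t\<bar> \<partial>lborel)"
    using integrable_psi i pw by (intro integral_mono) auto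
  finally show "\<bar>\<integral>t. \<psi> t * f t \<partial>lborel\<bar> \<le> C * nrm" by (simp add: nrm_def)
qed

lemma integrable_psi_continuous:
  assumes "continuous_on UNIV f"
  shows "integrable lborel (\<lambda>t. \<psi> t * f t)"
proof -
  have "compact (f ` {-L..L})" by (intro compact_continuous_image continuous_on_subset[OF assms]) auto
  then obtain C where "\<forall>y\<in>f ` {-L..L}. norm y \<le> C" using compact_imp_bounded bounded_iff by metis
  then have "\<bar>f t\<bar> \<le> C" if "\<bar>t\<bar> \<le> L" for t using that by (auto simp: abs_le_iff)
  then show ?thesis
    by (intro integrable_psi_bounded(1) borel_measurable_continuous_onI[OF assms])
qed

lemma double_psi_bounded:
  assumes f[measurable]: "case_prod f \<in> borel_measurable (borel \<Otimes>\<^sub>M borel)"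
    and le: "\<And>t t'. \<bar>t\<bar> \<le> L \<Longrightarrow> \<bar>t'\<bar> \<le> L \<Longrightarrow> \<bar>f t t'\<bar> \<le> C"
  shows "integrable lborel (\<lambda>t. \<psi> t * (\<integral>t'. \<psi> t' * f t t' \<partial>lborel))"
    and "\<bar>t\<bar> \<le> L \<Longrightarrow> integrable lborel (\<lambda>t'. \<psi> t' * f t t')"
    and "\<bar>\<integral>t. \<psi> t * (\<integral>t'. \<psi> t' * f t t' \<partial>lborel) \<partial>lborel\<bar> \<le> C * nrm\<^sup>2"
proof -
  have sec: "f t \<in> borel_measurable borel" for t
    using measurable_Pair2[OF f, of t] by simp
  have inner: "\<bar>\<integral>t'. \<psi> t' * f t t' \<partial>lborel\<bar> \<le> C * nrm" if "\<bar>t\<bar> \<le> L" for t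
    by (rule integrable_psi_bounded(2)[OF sec le[OF that]])
  have meas: "(\<lambda>t. \<integral>t'. \<psi> t' * f t t' \<partial>lborel) \<in> borel_measurable borel"
    by (rule sigma_finite_measure.borel_measurable_lebesgue_integral[OF sigma_finite_lborel]) measurable
  show "integrable lborel (\<lambda>t. \<psi> t * (\<integral>t'. \<psi> t' * f t t' \<partial>lborel))"
    by (rule integrable_psi_bounded(1)[OF meas inner])
  show "\<bar>t\<bar> \<le> L \<Longrightarrow> integrable lborel (\<lambda>t'. \<psi> t' * f t t')"
    by (rule integrable_psi_bounded(1)[OF sec le])
  show "\<bar>\<integral>t. \<psi> t * (\<integral>t'. \<psi> t' * f t t' \<partial>lborel) \<partial>lborel\<bar> \<le> C * nrm\<^sup>2"
    using integrable_psi_bounded(2)[OF meas inner] by (simp add: power2_eq_square mult.assoc)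
qed

definition J :: "real \<Rightarrow> real \<Rightarrow> real" where
  "J h w = (\<integral>t. \<psi> t * (\<integral>t'. \<psi> t' * \<bar>t - t' + w\<bar> powr h \<partial>lborel) \<partial>lborel)"

text \<open>A monomial \<open>t^a t'^b\<close> with \<open>a + b\<close> at most 2 contains one of
  the two variables to a power at most 1, so moments of order 0 and 1 suffice for a polynomial of
  degree 2.\<close>

lemma moments_poly: "(\<integral>t. \<psi> t * (\<integral>t'. \<psi> t' * (\<alpha> + \<beta> * (t - t') + \<gamma> * (t - t')\<^sup>2) \<partial>lborel) \<partial>lborel) = 0"
proof -
  define m2 where "m2 = (\<integral>t. \<psi> t * t\<^sup>2 \<partial>lborel)"
  have i: "integrable lborel (\<lambda>t. \<psi> t * t ^ n)" for n by (intro integrable_psi_continuous continuous_intros)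
  have i1: "integrable lborel (\<lambda>t. \<psi> t * t)" using i[of 1] by simp
  have "(\<integral>t'. \<psi> t' * (\<alpha> + \<beta> * (t - t') + \<gamma> * (t - t')\<^sup>2) \<partial>lborel) = \<gamma> * m2" for t
  proof -
    have "(\<integral>t'. \<psi> t' * (\<alpha> + \<beta> * (t - t') + \<gamma> * (t - t')\<^sup>2) \<partial>lborel)
      = (\<integral>t'. (\<alpha> + \<beta> * t + \<gamma> * t\<^sup>2) * \<psi> t' - (\<beta> + 2 * \<gamma> * t) * (\<psi> t' * t') + \<gamma> * (\<psi> t' * t'\<^sup>2) \<partial>lborel)"
      by (intro Bochner_Integration.integral_cong refl) (simp add: algebra_simps power2_eq_square)
    also have "\<dots> = (\<alpha> + \<beta> * t + \<gamma> * t\<^sup>2) * (\<integral>t. \<psi> t \<partial>lborel) - (\<beta> + 2 * \<gamma> * t) * (\<integral>t. \<psi> t * t \<partial>lborel) + \<gamma> * m2"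
      using integrable_psi i1 i[of 2] by (simp add: m2_def)
    finally show ?thesis using moment0 moment1 by (simp add: mult.commute)
  qed
  then show ?thesis using moment0 by simp
qed

lemma abs_diff_powr_measurable [measurable]:
  "(\<lambda>(t, t'). \<bar>t - t' + w\<bar> powr h) \<in> borel_measurable (borel \<Otimes>\<^sub>M (borel :: real measure))"
  by measurable

lemma abs_diff_powr_bound:
  "0 < h \<Longrightarrow> \<bar>t\<bar> \<le> L \<Longrightarrow> \<bar>t'\<bar> \<le> L \<Longrightarrow> \<bar>\<bar>t - t' + w\<bar> powr h\<bar> \<le> (2 * L + \<bar>w\<bar>) powr h"
  by (auto intro!: powr_mono2)

text \<open>For \<open>|w|\<close> at least \<open>4 L\<close> the differences \<open>t - t'\<close>
  lie within the range \<open>|w| / 2\<close> of the Taylor bound. The quadratic part integrates to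
  0, and the remainder has exponent \<open>h - 3 < -1\<close>, which makes it summable over the
  lags.\<close>

lemma J_decay:
  assumes h: "0 < h" "h < 2" and w: "4 * L \<le> \<bar>w\<bar>"
  shows "\<bar>J h w\<bar> \<le> \<bar>h * (h - 1) * (h - 2)\<bar> * (2 * L) ^ 3 * nrm\<^sup>2 * (\<bar>w\<bar> / 2) powr (h - 3)"
proof -
  have w0: "w \<noteq> 0" using w L_pos by auto
  obtain \<alpha> \<beta> \<gamma> where T: "\<And>x. \<bar>x\<bar> \<le> \<bar>w\<bar> / 2 \<Longrightarrow>
    \<bar>\<bar>x + w\<bar> powr h - (\<alpha> + \<beta> * x + \<gamma> * x\<^sup>2)\<bar> \<le> \<bar>h * (h - 1) * (h - 2)\<bar> * (\<bar>w\<bar> / 2) powr (h - 3) * \<bar>x\<bar> ^ 3"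
    using taylor_abs_powr[OF h w0] by blast
  let ?p = "\<lambda>t t'. \<alpha> + \<beta> * (t - t') + \<gamma> * (t - t')\<^sup>2"
  let ?q = "\<lambda>t t'. \<bar>t - t' + w\<bar> powr h"
  have pm: "case_prod ?p \<in> borel_measurable (borel \<Otimes>\<^sub>M borel)" by measurable
  have pb: "\<bar>?p t t'\<bar> \<le> \<bar>\<alpha>\<bar> + \<bar>\<beta>\<bar> * (2 * L) + \<bar>\<gamma>\<bar> * (2 * L)\<^sup>2" if "\<bar>t\<bar> \<le> L" "\<bar>t'\<bar> \<le> L" for t t'
  proof -
    have d: "\<bar>t - t'\<bar> \<le> 2 * L" using that by auto
    have "\<bar>?p t t'\<bar> \<le> \<bar>\<alpha>\<bar> + \<bar>\<beta> * (t - t')\<bar> + \<bar>\<gamma> * (t - t')\<^sup>2\<bar>" by linarith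
    also have "\<dots> \<le> \<bar>\<alpha>\<bar> + \<bar>\<beta>\<bar> * (2 * L) + \<bar>\<gamma>\<bar> * (2 * L)\<^sup>2"
      using d power_mono[OF d abs_ge_zero, of 2] unfolding abs_mult
      by (intro add_mono mult_left_mono) auto
    finally show ?thesis .
  qed
  have P1: "integrable lborel (\<lambda>t. \<psi> t * (\<integral>t'. \<psi> t' * ?p t t' \<partial>lborel))"
    by (rule double_psi_bounded(1)[OF pm]) (rule pb)
  have P2: "integrable lborel (\<lambda>t'. \<psi> t' * ?p t t')" if "\<bar>t\<bar> \<le> L" for t
    by (rule double_psi_bounded(2)[OF pm _ that]) (rule pb)
  have qb: "\<bar>?q t t'\<bar> \<le> (2 * L + \<bar>w\<bar>) powr h" if "\<bar>t\<bar> \<le> L" "\<bar>t'\<bar> \<le> L" for t t'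
    by (rule abs_diff_powr_bound[OF h(1) that])
  have Q1: "integrable lborel (\<lambda>t. \<psi> t * (\<integral>t'. \<psi> t' * ?q t t' \<partial>lborel))"
    by (rule double_psi_bounded(1)[OF abs_diff_powr_measurable]) (rule qb)
  have Q2: "integrable lborel (\<lambda>t'. \<psi> t' * ?q t t')" if "\<bar>t\<bar> \<le> L" for t
    by (rule double_psi_bounded(2)[OF abs_diff_powr_measurable _ that]) (rule qb)
  let ?C = "\<bar>h * (h - 1) * (h - 2)\<bar> * (\<bar>w\<bar> / 2) powr (h - 3) * (2 * L) ^ 3"
  have dm: "case_prod (\<lambda>t t'. ?q t t' - ?p t t') \<in> borel_measurable (borel \<Otimes>\<^sub>M borel)" by measurable
  have db: "\<bar>?q t t' - ?p t t'\<bar> \<le> ?C" if "\<bar>t\<bar> \<le> L" "\<bar>t'\<bar> \<le> L" for t t'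
  proof -
    have d: "\<bar>t - t'\<bar> \<le> 2 * L" using that by auto
    have "\<bar>?q t t' - ?p t t'\<bar> \<le> \<bar>h * (h - 1) * (h - 2)\<bar> * (\<bar>w\<bar> / 2) powr (h - 3) * \<bar>t - t'\<bar> ^ 3"
      using T[of "t - t'"] d w by auto
    also have "\<dots> \<le> ?C" using d by (intro mult_left_mono power_mono) auto
    finally show ?thesis .
  qed
  have "(\<integral>t. \<psi> t * (\<integral>t'. \<psi> t' * (?q t t' - ?p t t') \<partial>lborel) \<partial>lborel)
     = (\<integral>t. \<psi> t * (\<integral>t'. \<psi> t' * ?q t t' \<partial>lborel) - \<psi> t * (\<integral>t'. \<psi> t' * ?p t t' \<partial>lborel) \<partial>lborel)"
  proof (intro Bochner_Integration.integral_cong refl)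
    fix t
    show "\<psi> t * (\<integral>t'. \<psi> t' * (?q t t' - ?p t t') \<partial>lborel)
      = \<psi> t * (\<integral>t'. \<psi> t' * ?q t t' \<partial>lborel) - \<psi> t * (\<integral>t'. \<psi> t' * ?p t t' \<partial>lborel)"
    proof (cases "\<psi> t = 0")
      case False
      then have t: "\<bar>t\<bar> \<le> L" by (rule support)
      have "(\<integral>t'. \<psi> t' * (?q t t' - ?p t t') \<partial>lborel) = (\<integral>t'. \<psi> t' * ?q t t' \<partial>lborel) - (\<integral>t'. \<psi> t' * ?p t t' \<partial>lborel)"
        unfolding right_diff_distrib[of "\<psi> _"]
        by (rule Bochner_Integration.integral_diff[OF Q2[OF t] P2[OF t]])
      then show ?thesis by (simp only: right_diff_distrib)
    qed simp
  qed
  also have "\<dots> = J h w - 0"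
    unfolding J_def moments_poly[symmetric, of \<alpha> \<beta> \<gamma>]
    by (rule Bochner_Integration.integral_diff[OF Q1 P1])
  finally have "\<bar>J h w\<bar> \<le> ?C * nrm\<^sup>2"
    using double_psi_bounded(3)[OF dm db] by simp
  then show ?thesis by (simp add: mult_ac)
qed

lemma psi_not_AE_zero: "\<not> (AE t in lborel. \<psi> t = 0)"
proof
  assume "AE t in lborel. \<psi> t = 0"
  then have "(\<integral>t. (\<psi> t)\<^sup>2 \<partial>lborel) = 0" by (intro integral_eq_zero_AE) auto
  then show False using unit by simp
qed

text \<open>If the transform vanished, the positive and the negative part of the wavelet would give
  the same mass to every Borel set. Testing with the sets where the wavelet is positive and where it
  is negative makes both parts vanish almost everywhere.\<close>

lemma fourier_nonzero:
  "\<not> (\<forall>x. (\<integral>t. \<psi> t * cos (x * t) \<partial>lborel) = 0 \<and> (\<integral>t. \<psi> t * sin (x * t) \<partial>lborel) = 0)"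
proof
  assume 0: "\<forall>x. (\<integral>t. \<psi> t * cos (x * t) \<partial>lborel) = 0 \<and> (\<integral>t. \<psi> t * sin (x * t) \<partial>lborel) = 0"
  let ?p = "\<lambda>t. max (\<psi> t) 0" and ?n = "\<lambda>t. max (- \<psi> t) 0"
  have i: "integrable lborel ?p" "integrable lborel ?n" using integrable_psi by auto
  have ii: "integrable lborel (\<lambda>t. complex_of_real (f t) * iexp (u * t))" if "integrable lborel f" for f :: "real \<Rightarrow> real" and u
    by (rule Bochner_Integration.integrable_bound[OF that]) (use that in \<open>auto simp: norm_mult\<close>)
  have eq: "(CLINT t|lborel. ?p t * iexp (u * t)) = (CLINT t|lborel. ?n t * iexp (u * t))" for u
  proof -
    have "(CLINT t|lborel. ?p t * iexp (u * t)) - (CLINT t|lborel. ?n t * iexp (u * t)) = (CLINT t|lborel. \<psi> t * iexp (u * t))"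
      unfolding Bochner_Integration.integral_diff[OF ii[OF i(1)] ii[OF i(2)], symmetric]
      by (intro Bochner_Integration.integral_cong refl) (auto simp: max_def)
    also have "\<dots> = 0"
    proof (rule complex_eqI)
      show "Re (CLINT t|lborel. \<psi> t * iexp (u * t)) = Re 0"
        using 0 by (subst integral_Re[OF ii[OF integrable_psi], symmetric]) (simp add: Re_exp)
      show "Im (CLINT t|lborel. \<psi> t * iexp (u * t)) = Im 0"
        using 0 by (subst integral_Im[OF ii[OF integrable_psi], symmetric]) (simp add: Im_exp)
    qed
    finally show ?thesis by simp
  qed
  have meq: "(\<integral>t. ?p t * indicator A t \<partial>lborel) = (\<integral>t. ?n t * indicator A t \<partial>lborel)" if "A \<in> sets borel" for A
    using that by (intro fourier_determines_nonneg[OF i(1) _ i(2), where X="\<lambda>t. t" and X'="\<lambda>t. t"] eq) auto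
  have "(\<integral>t. ?p t \<partial>lborel) = (\<integral>t. ?p t * indicator {t. \<psi> t > 0} t \<partial>lborel)"
    by (intro Bochner_Integration.integral_cong refl) (auto simp: indicator_def max_def)
  also have "\<dots> = (\<integral>t. ?n t * indicator {t. \<psi> t > 0} t \<partial>lborel)" by (intro meq) measurable
  also have "\<dots> = 0" by (rule integral_eq_zero_AE) (auto simp: indicator_def)
  finally have p0: "AE t in lborel. ?p t = 0" using i by (subst (asm) integral_nonneg_eq_0_iff_AE) auto
  have "(\<integral>t. ?n t \<partial>lborel) = (\<integral>t. ?n t * indicator {t. \<psi> t < 0} t \<partial>lborel)"
    by (intro Bochner_Integration.integral_cong refl) (auto simp: indicator_def max_def)
  also have "\<dots> = (\<integral>t. ?p t * indicator {t. \<psi> t < 0} t \<partial>lborel)" by (intro meq[symmetric]) measurable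
  also have "\<dots> = 0" by (rule integral_eq_zero_AE) (auto simp: indicator_def)
  finally have n0: "AE t in lborel. ?n t = 0" using i by (subst (asm) integral_nonneg_eq_0_iff_AE) auto
  from p0 n0 have "AE t in lborel. \<psi> t = 0" by eventually_elim (auto simp: max_def split: if_splits)
  then show False using psi_not_AE_zero by simp
qed

lemma continuous_trig_transform:
  assumes "\<And>y. \<bar>c y\<bar> \<le> 1" and c: "continuous_on UNIV (c :: real \<Rightarrow> real)"
  shows "continuous_on UNIV (\<lambda>x. \<integral>t. \<psi> t * c (x * t) \<partial>lborel)"
  unfolding continuous_on_sequentially
proof (intro allI impI ballI, elim conjE)
  fix u x assume u: "u \<longlonglongrightarrow> (x :: real)"
  have [measurable]: "c \<in> borel_measurable borel" by (rule borel_measurable_continuous_onI[OF c])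
  show "((\<lambda>x. \<integral>t. \<psi> t * c (x * t) \<partial>lborel) \<circ> u) \<longlonglongrightarrow> (\<integral>t. \<psi> t * c (x * t) \<partial>lborel)"
    unfolding o_def
  proof (rule integral_dominated_convergence[where w="\<lambda>t. \<bar>\<psi> t\<bar>"])
    show "AE t in lborel. (\<lambda>n. \<psi> t * c (u n * t)) \<longlonglongrightarrow> \<psi> t * c (x * t)"
      using c u by (intro AE_I2 tendsto_intros isCont_tendsto_compose[where g=c]) (auto simp: continuous_on_eq_continuous_at)
    show "AE t in lborel. norm (\<psi> t * c (u n * t)) \<le> \<bar>\<psi> t\<bar>" for n
      using assms(1) by (auto simp: abs_mult mult_left_le)
  qed (use integrable_psi in auto)
qed

text \<open>In spectral form the product is minus the integral of \<open>|x| powr (- 1 - h)\<close>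
  times the squared modulus of the Fourier transform of the wavelet. The transform is continuous and
  not identically 0, so the sign is strict. Fubini is used twice, first for \<open>t'\<close> and
  \<open>x\<close>, then for \<open>t\<close> and \<open>x\<close>.\<close>

lemma J_negative:
  assumes h: "0 < h" and kap: "\<And>u. integrable lborel (kap h u)"
  shows "(\<integral>x. kap h 1 x \<partial>lborel) * J h 0 < 0"
proof -
  define c where "c = (\<integral>x. kap h 1 x \<partial>lborel)"
  have c: "(\<integral>x. kap h u x \<partial>lborel) = c * \<bar>u\<bar> powr h" for u
    using integral_kap[OF h, of u] by (simp add: c_def)
  have c0: "0 \<le> c" by (simp add: c_def)
  have [measurable]: "(\<lambda>(u, x). kap h u x) \<in> borel_measurable (borel \<Otimes>\<^sub>M borel)"
    unfolding kap_def by measurable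
  define Cx where "Cx x = (\<integral>t. \<psi> t * cos (x * t) \<partial>lborel)" for x
  define Sx where "Sx x = (\<integral>t. \<psi> t * sin (x * t) \<partial>lborel)" for x
  have ic: "integrable lborel (\<lambda>t. \<psi> t * cos (x * t))" "integrable lborel (\<lambda>t. \<psi> t * sin (x * t))" for x
    by (intro integrable_psi_continuous continuous_intros)+
  \<comment> \<open>The 1 in \<open>1 - cos\<close> disappears by the zeroth moment, and the
    addition formula separates \<open>t\<close> from \<open>t'\<close>.\<close>
  have inner: "(\<integral>t'. \<psi> t' * kap h (t - t') x \<partial>lborel) = - (\<bar>x\<bar> powr (- 1 - h)) * (cos (x * t) * Cx x + sin (x * t) * Sx x)" for t x
  proof -
    have "(\<integral>t'. \<psi> t' * kap h (t - t') x \<partial>lborel)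
      = (\<integral>t'. \<bar>x\<bar> powr (- 1 - h) * (\<psi> t' - cos (x * t) * (\<psi> t' * cos (x * t')) - sin (x * t) * (\<psi> t' * sin (x * t'))) \<partial>lborel)"
      by (intro Bochner_Integration.integral_cong refl) (simp add: kap_def left_diff_distrib cos_diff mult.commute algebra_simps)
    also have "\<dots> = \<bar>x\<bar> powr (- 1 - h) * (0 - cos (x * t) * Cx x - sin (x * t) * Sx x)"
      using ic[of x] integrable_psi moment0 by (simp add: Cx_def Sx_def)
    finally show ?thesis by (simp add: algebra_simps)
  qed
  have outer: "(\<integral>t. \<psi> t * (\<integral>t'. \<psi> t' * kap h (t - t') x \<partial>lborel) \<partial>lborel) = - (\<bar>x\<bar> powr (- 1 - h)) * ((Cx x)\<^sup>2 + (Sx x)\<^sup>2)" for x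
  proof -
    have "(\<integral>t. \<psi> t * (\<integral>t'. \<psi> t' * kap h (t - t') x \<partial>lborel) \<partial>lborel)
      = (\<integral>t. - (\<bar>x\<bar> powr (- 1 - h)) * (Cx x * (\<psi> t * cos (x * t)) + Sx x * (\<psi> t * sin (x * t))) \<partial>lborel)"
      unfolding inner by (intro Bochner_Integration.integral_cong refl) (simp add: algebra_simps)
    also have "\<dots> = - (\<bar>x\<bar> powr (- 1 - h)) * (Cx x * Cx x + Sx x * Sx x)"
      using ic[of x] by (simp add: Cx_def Sx_def)
    finally show ?thesis by (simp add: power2_eq_square)
  qed
  have powm: "\<bar>t - t'\<bar> powr h \<le> (2 * L) powr h" if "\<bar>t\<bar> \<le> L" "\<bar>t'\<bar> \<le> L" for t t'
    using that h by (intro powr_mono2) auto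
  have i1: "integrable (lborel \<Otimes>\<^sub>M lborel) (\<lambda>(t', x). \<psi> t' * kap h (t - t') x)" for t
  proof (rule lborel_pair.Fubini_integrable)
    have "integrable lborel (\<lambda>t'. \<psi> t' * (c * \<bar>t - t'\<bar> powr h))"
      by (intro integrable_psi_continuous continuous_on_mult continuous_on_const continuous_abs_powr h)
    then have "integrable lborel (\<lambda>t'. \<bar>\<psi> t' * (c * \<bar>t - t'\<bar> powr h)\<bar>)" by (rule integrable_abs)
    then show "integrable lborel (\<lambda>t'. \<integral>x. norm (case (t', x) of (t', x) \<Rightarrow> \<psi> t' * kap h (t - t') x) \<partial>lborel)"
      using c0 by (simp add: abs_mult c)
  qed (use kap in auto)
  have swap1: "(\<integral>t'. \<psi> t' * (c * \<bar>t - t'\<bar> powr h) \<partial>lborel) = (\<integral>x. (\<integral>t'. \<psi> t' * kap h (t - t') x \<partial>lborel) \<partial>lborel)" for t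
    using lborel_pair.Fubini_integral[OF i1[of t]] by (simp add: c)
  \<comment> \<open>Absolute integrability comes from \<open>|t - t'| <= 2 L\<close> on the support,
    which bounds the integral of \<open>kap\<close> over \<open>x\<close>.\<close>
  have i2: "integrable (lborel \<Otimes>\<^sub>M lborel) (\<lambda>(t, x). \<psi> t * (\<integral>t'. \<psi> t' * kap h (t - t') x \<partial>lborel))"
  proof (rule lborel_pair.Fubini_integrable)
    have ix: "integrable lborel (\<lambda>x. \<integral>t'. \<psi> t' * kap h (t - t') x \<partial>lborel)" for t
      using lborel_pair.integrable_snd[OF i1[of t]] by simp
    then show "AE t in lborel. integrable lborel (\<lambda>x. case (t, x) of (t, x) \<Rightarrow> \<psi> t * (\<integral>t'. \<psi> t' * kap h (t - t') x \<partial>lborel))"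
      by simp
    have [measurable]: "Cx \<in> borel_measurable borel" "Sx \<in> borel_measurable borel"
      unfolding Cx_def[abs_def] Sx_def[abs_def]
      by (intro borel_measurable_continuous_onI continuous_trig_transform continuous_intros; simp)+
    show "(\<lambda>(t, x). \<psi> t * (\<integral>t'. \<psi> t' * kap h (t - t') x \<partial>lborel)) \<in> borel_measurable (lborel \<Otimes>\<^sub>M lborel)"
      unfolding inner by measurable
    have le: "(\<integral>x. \<bar>\<integral>t'. \<psi> t' * kap h (t - t') x \<partial>lborel\<bar> \<partial>lborel) \<le> c * (2 * L) powr h * nrm" if t: "\<bar>t\<bar> \<le> L" for t
    proof -
      have ia: "integrable (lborel \<Otimes>\<^sub>M lborel) (\<lambda>(t', x). \<bar>\<psi> t'\<bar> * kap h (t - t') x)"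
        using integrable_abs[OF i1[of t]] by (simp add: abs_mult case_prod_unfold)
      have "(\<integral>x. \<bar>\<integral>t'. \<psi> t' * kap h (t - t') x \<partial>lborel\<bar> \<partial>lborel) \<le> (\<integral>x. (\<integral>t'. \<bar>\<psi> t'\<bar> * kap h (t - t') x \<partial>lborel) \<partial>lborel)"
      proof (rule integral_mono)
        show "integrable lborel (\<lambda>x. \<bar>\<integral>t'. \<psi> t' * kap h (t - t') x \<partial>lborel\<bar>)" by (rule integrable_abs[OF ix])
        show "integrable lborel (\<lambda>x. \<integral>t'. \<bar>\<psi> t'\<bar> * kap h (t - t') x \<partial>lborel)"
          using lborel_pair.integrable_snd[OF ia] by simp
        show "\<bar>\<integral>t'. \<psi> t' * kap h (t - t') x \<partial>lborel\<bar> \<le> (\<integral>t'. \<bar>\<psi> t'\<bar> * kap h (t - t') x \<partial>lborel)" for x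
          using integral_abs_bound[of lborel "\<lambda>t'. \<psi> t' * kap h (t - t') x"] by (simp add: abs_mult)
      qed
      also have "\<dots> = (\<integral>t'. \<bar>\<psi> t'\<bar> * (c * \<bar>t - t'\<bar> powr h) \<partial>lborel)"
        using lborel_pair.Fubini_integral[OF ia] by (simp add: c)
      also have "\<dots> \<le> (\<integral>t'. \<bar>\<psi> t'\<bar> * (c * (2 * L) powr h) \<partial>lborel)"
      proof (rule integral_mono)
        have "integrable lborel (\<lambda>t'. \<psi> t' * (c * \<bar>t - t'\<bar> powr h))"
          by (intro integrable_psi_continuous continuous_on_mult continuous_on_const continuous_abs_powr h)
        then have "integrable lborel (\<lambda>t'. \<bar>\<psi> t' * (c * \<bar>t - t'\<bar> powr h)\<bar>)" by (rule integrable_abs)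
        then show "integrable lborel (\<lambda>t'. \<bar>\<psi> t'\<bar> * (c * \<bar>t - t'\<bar> powr h))" using c0 by (simp add: abs_mult)
        show "integrable lborel (\<lambda>t'. \<bar>\<psi> t'\<bar> * (c * (2 * L) powr h))" using integrable_psi by auto
        show "\<bar>\<psi> t'\<bar> * (c * \<bar>t - t'\<bar> powr h) \<le> \<bar>\<psi> t'\<bar> * (c * (2 * L) powr h)" for t'
          using support[of t'] powm[OF t, of t'] c0 by (cases "\<psi> t' = 0") (auto intro!: mult_left_mono)
      qed
      finally show ?thesis by (simp add: nrm_def mult_ac)
    qed
    have meas: "(\<lambda>t. \<integral>x. \<bar>\<integral>t'. \<psi> t' * kap h (t - t') x \<partial>lborel\<bar> \<partial>lborel) \<in> borel_measurable borel"
      unfolding inner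
      by (rule sigma_finite_measure.borel_measurable_lebesgue_integral[OF sigma_finite_lborel]) measurable
    have "integrable lborel (\<lambda>t. \<psi> t * (\<integral>x. \<bar>\<integral>t'. \<psi> t' * kap h (t - t') x \<partial>lborel\<bar> \<partial>lborel))"
      by (rule integrable_psi_bounded(1)[OF meas]) (use le in auto)
    then have "integrable lborel (\<lambda>t. \<bar>\<psi> t * (\<integral>x. \<bar>\<integral>t'. \<psi> t' * kap h (t - t') x \<partial>lborel\<bar> \<partial>lborel)\<bar>)" by (rule integrable_abs)
    then show "integrable lborel (\<lambda>t. \<integral>x. norm (case (t, x) of (t, x) \<Rightarrow> \<psi> t * (\<integral>t'. \<psi> t' * kap h (t - t') x \<partial>lborel)) \<partial>lborel)"
      by (simp add: abs_mult)
  qed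
  have "c * J h 0 = (\<integral>t. \<psi> t * (\<integral>t'. \<psi> t' * (c * \<bar>t - t'\<bar> powr h) \<partial>lborel) \<partial>lborel)"
    unfolding J_def by (simp add: mult.left_commute[of _ c])
  also have "\<dots> = (\<integral>t. (\<integral>x. \<psi> t * (\<integral>t'. \<psi> t' * kap h (t - t') x \<partial>lborel) \<partial>lborel) \<partial>lborel)"
    unfolding swap1 by simp
  also have "\<dots> = (\<integral>x. (\<integral>t. \<psi> t * (\<integral>t'. \<psi> t' * kap h (t - t') x \<partial>lborel) \<partial>lborel) \<partial>lborel)"
    by (rule lborel_pair.Fubini_integral[OF i2, symmetric])
  also have "\<dots> = - (\<integral>x. \<bar>x\<bar> powr (- 1 - h) * ((Cx x)\<^sup>2 + (Sx x)\<^sup>2) \<partial>lborel)"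
    unfolding outer by simp
  finally have main: "c * J h 0 = - (\<integral>x. \<bar>x\<bar> powr (- 1 - h) * ((Cx x)\<^sup>2 + (Sx x)\<^sup>2) \<partial>lborel)" .
  have ii: "integrable lborel (\<lambda>x. \<bar>x\<bar> powr (- 1 - h) * ((Cx x)\<^sup>2 + (Sx x)\<^sup>2))"
    using lborel_pair.integrable_snd[OF i2] unfolding outer by simp
  have "(\<integral>x. \<bar>x\<bar> powr (- 1 - h) * ((Cx x)\<^sup>2 + (Sx x)\<^sup>2) \<partial>lborel) \<noteq> 0"
  proof
    assume "(\<integral>x. \<bar>x\<bar> powr (- 1 - h) * ((Cx x)\<^sup>2 + (Sx x)\<^sup>2) \<partial>lborel) = 0"
    then have "AE x in lborel. \<bar>x\<bar> powr (- 1 - h) * ((Cx x)\<^sup>2 + (Sx x)\<^sup>2) = 0"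
      by (subst (asm) integral_nonneg_eq_0_iff_AE[OF ii]) auto
    \<comment> \<open>At \<open>x = 0\<close> the weight has the value 0, so this point is set aside
      before the weight is cancelled.\<close>
    moreover have "AE x in lborel. x \<noteq> (0 :: real)" by (rule AE_lborel_singleton)
    ultimately have "AE x in lborel. (Cx x)\<^sup>2 + (Sx x)\<^sup>2 = 0" by eventually_elim auto
    then have "(Cx x)\<^sup>2 + (Sx x)\<^sup>2 = 0" for x
      unfolding Cx_def Sx_def
      by (intro continuous_AE_zero[where f="\<lambda>x. (\<integral>t. \<psi> t * cos (x * t) \<partial>lborel)\<^sup>2 + (\<integral>t. \<psi> t * sin (x * t) \<partial>lborel)\<^sup>2"]
          continuous_on_add continuous_on_power continuous_trig_transform continuous_intros) auto
    then have "Cx x = 0 \<and> Sx x = 0" for x by (simp add: sum_power2_eq_zero_iff)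
    then show False using fourier_nonzero by (simp add: Cx_def Sx_def)
  qed
  moreover have "(\<integral>x. \<bar>x\<bar> powr (- 1 - h) * ((Cx x)\<^sup>2 + (Sx x)\<^sup>2) \<partial>lborel) \<ge> 0" by (intro Bochner_Integration.integral_nonneg) auto
  ultimately show ?thesis using main unfolding c_def[symmetric] by linarith
qed

end

section \<open>Wavelet coefficients\<close>

lemma l2norm_scaleR: "l2norm M (\<lambda>\<omega>. c *\<^sub>R X \<omega>) = \<bar>c\<bar> * l2norm M X"
  by (simp add: l2norm_def power_mult_distrib real_sqrt_mult)

lemma l2norm_mono:
  assumes X: "square_integrable M X" and Y: "Y \<in> borel_measurable M" and le: "\<And>\<omega>. norm (Y \<omega>) \<le> norm (X \<omega>)"
  shows "l2norm M Y \<le> l2norm M X"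
proof -
  have "square_integrable M Y" by (rule square_integrable_bound[OF X Y, where c=1]) (simp add: le)
  then show ?thesis using X le
    unfolding l2norm_def square_integrable_def
    by (intro real_sqrt_le_mono integral_mono) (auto intro!: power_mono)
qed

lemma l2norm_sum:
  fixes X :: "'i \<Rightarrow> 'a \<Rightarrow> 'b::euclidean_space"
  assumes "finite K" "\<And>k. k \<in> K \<Longrightarrow> square_integrable M (X k)"
  shows "l2norm M (\<lambda>\<omega>. \<Sum>k\<in>K. X k \<omega>) \<le> (\<Sum>k\<in>K. l2norm M (X k))"
  using assms
proof (induction K)
  case empty
  then show ?case by (simp add: l2norm_def)
next
  case (insert k K)
  have "l2norm M (\<lambda>\<omega>. X k \<omega> + (\<Sum>k\<in>K. X k \<omega>)) \<le> l2norm M (X k) + l2norm M (\<lambda>\<omega>. \<Sum>k\<in>K. X k \<omega>)"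
    using insert.prems by (intro l2norm_triangle square_integrable_sum) auto
  also have "\<dots> \<le> l2norm M (X k) + (\<Sum>k\<in>K. l2norm M (X k))"
    using insert by auto
  finally show ?case using insert.hyps by simp
qed

lemma l2norm_inner_le:
  fixes X :: "'a \<Rightarrow> 'b::euclidean_space"
  assumes "square_integrable M X"
  shows "l2norm M (\<lambda>\<omega>. v \<bullet> X \<omega>) \<le> norm v * l2norm M X"
proof -
  have "l2norm M (\<lambda>\<omega>. v \<bullet> X \<omega>) \<le> l2norm M (\<lambda>\<omega>. norm v *\<^sub>R X \<omega>)"
  proof (rule l2norm_mono)
    show "square_integrable M (\<lambda>\<omega>. norm v *\<^sub>R X \<omega>)" by (rule square_integrable_scaleR[OF assms])
    show "(\<lambda>\<omega>. v \<bullet> X \<omega>) \<in> borel_measurable M" using assms by measurable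
    show "norm (v \<bullet> X \<omega>) \<le> norm (norm v *\<^sub>R X \<omega>)" for \<omega>
      using Cauchy_Schwarz_ineq2[of v "X \<omega>"] by simp
  qed
  then show ?thesis by (simp add: l2norm_scaleR)
qed

lemma (in prob_space) abs_integral_le_l2norm:
  fixes X :: "'a \<Rightarrow> real"
  assumes "square_integrable M X"
  shows "(\<integral>\<omega>. \<bar>X \<omega>\<bar> \<partial>M) \<le> l2norm M X"
proof -
  have "\<bar>\<integral>\<omega>. 1 \<bullet> \<bar>X \<omega>\<bar> \<partial>M\<bar> \<le> l2norm M (\<lambda>_. 1::real) * l2norm M (\<lambda>\<omega>. \<bar>X \<omega>\<bar>)"
    by (rule inner_le_l2norm) (use assms in \<open>auto simp: square_integrable_def\<close>)
  then show ?thesis by (simp add: l2norm_def prob_space)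
qed

lemma cmod_iexp_diff: "cmod (iexp a - iexp b) \<le> \<bar>a - b\<bar>"
proof -
  have "iexp a - iexp b = iexp b * (iexp (a - b) - 1)"
    by (simp add: right_diff_distrib exp_add[symmetric] algebra_simps)
  then have "cmod (iexp a - iexp b) = cmod (iexp (a - b) - 1)"
    by (simp only: norm_mult cmod_iexp mult_1)
  also have "\<dots> \<le> \<bar>a - b\<bar>" using iexp_approx1[of "a - b" 0] by simp
  finally show ?thesis .
qed

text \<open>Characteristic functions and second moments are both continuous for convergence in mean
  square, so the Gaussian relation between them passes to the limit.\<close>

lemma (in prob_space) gaussian_char_l2_limit:
  fixes T :: "'a \<Rightarrow> real"
  assumes X: "\<And>n. square_integrable M (X n)" and T: "square_integrable M T"
    and lim: "(\<lambda>n. l2norm M (\<lambda>\<omega>. X n \<omega> - T \<omega>)) \<longlonglongrightarrow> 0"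
    and ch: "\<And>n. (CLINT \<omega>|M. iexp (X n \<omega>)) = complex_of_real (exp (- (\<integral>\<omega>. (X n \<omega>)\<^sup>2 \<partial>M) / 2))"
  shows "(CLINT \<omega>|M. iexp (T \<omega>)) = complex_of_real (exp (- (\<integral>\<omega>. (T \<omega>)\<^sup>2 \<partial>M) / 2))"
proof (rule LIMSEQ_unique)
  note d = square_integrable_diff[OF X T]
  have "(\<lambda>n. (CLINT \<omega>|M. iexp (X n \<omega>)) - (CLINT \<omega>|M. iexp (T \<omega>))) \<longlonglongrightarrow> 0"
  proof (rule Lim_null_comparison[OF _ lim], intro always_eventually allI)
    fix n
    have i: "integrable M (\<lambda>\<omega>. iexp (X n \<omega>))" "integrable M (\<lambda>\<omega>. iexp (T \<omega>))"
      using integrable_iexp_scaled[of "X n" 1] integrable_iexp_scaled[of T 1] X T by auto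
    have "norm ((CLINT \<omega>|M. iexp (X n \<omega>)) - (CLINT \<omega>|M. iexp (T \<omega>))) = norm (CLINT \<omega>|M. iexp (X n \<omega>) - iexp (T \<omega>))"
      using i by simp
    also have "\<dots> \<le> (\<integral>\<omega>. norm (iexp (X n \<omega>) - iexp (T \<omega>)) \<partial>M)" by (rule integral_norm_bound)
    also have "\<dots> \<le> (\<integral>\<omega>. \<bar>X n \<omega> - T \<omega>\<bar> \<partial>M)"
    proof (rule integral_mono)
      show "integrable M (\<lambda>\<omega>. norm (iexp (X n \<omega>) - iexp (T \<omega>)))"
        by (intro integrable_norm Bochner_Integration.integrable_diff i)
      show "integrable M (\<lambda>\<omega>. \<bar>X n \<omega> - T \<omega>\<bar>)"
        using integrable_mult_square_integrable[OF d, of "\<lambda>_. 1"] by (simp add: square_integrable_def)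
    qed (rule cmod_iexp_diff)
    also have "\<dots> \<le> l2norm M (\<lambda>\<omega>. X n \<omega> - T \<omega>)" by (rule abs_integral_le_l2norm[OF d])
    finally show "norm ((CLINT \<omega>|M. iexp (X n \<omega>)) - (CLINT \<omega>|M. iexp (T \<omega>))) \<le> l2norm M (\<lambda>\<omega>. X n \<omega> - T \<omega>)" .
  qed
  then show "(\<lambda>n. CLINT \<omega>|M. iexp (X n \<omega>)) \<longlonglongrightarrow> (CLINT \<omega>|M. iexp (T \<omega>))"
    by (rule LIM_zero_cancel)
  have l2: "(\<lambda>n. l2norm M (X n)) \<longlonglongrightarrow> l2norm M T"
  proof (rule LIM_zero_cancel, rule Lim_null_comparison[OF _ lim], intro always_eventually allI)
    fix n
    have "l2norm M (X n) \<le> l2norm M (\<lambda>\<omega>. X n \<omega> - T \<omega>) + l2norm M T"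
      using l2norm_triangle[OF d T, of n] by simp
    moreover have "l2norm M T \<le> l2norm M (\<lambda>\<omega>. T \<omega> - X n \<omega>) + l2norm M (X n)"
      using l2norm_triangle[OF square_integrable_diff[OF T X[of n]] X[of n]] by simp
    ultimately show "norm (l2norm M (X n) - l2norm M T) \<le> l2norm M (\<lambda>\<omega>. X n \<omega> - T \<omega>)"
      by (simp add: l2norm_minus[of M T])
  qed
  have sq: "(\<integral>\<omega>. (Y \<omega>)\<^sup>2 \<partial>M) = (l2norm M Y)\<^sup>2" for Y :: "'a \<Rightarrow> real" by (simp add: l2norm_sq)
  show "(\<lambda>n. CLINT \<omega>|M. iexp (X n \<omega>)) \<longlonglongrightarrow> complex_of_real (exp (- (\<integral>\<omega>. (T \<omega>)\<^sup>2 \<partial>M) / 2))"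
    unfolding ch sq by (intro tendsto_intros l2) simp
qed

lemma gaussian_family_char:
  fixes X :: "'i \<Rightarrow> 'a \<Rightarrow> 'b::euclidean_space"
  assumes "prob_space M" and X: "centered_gaussian_family M UNIV X" and J: "finite J"
  shows "(CLINT \<omega>|M. iexp (\<Sum>i\<in>J. c i \<bullet> X i \<omega>))
     = complex_of_real (exp (- (\<integral>\<omega>. (\<Sum>i\<in>J. c i \<bullet> X i \<omega>)\<^sup>2 \<partial>M) / 2))"
proof -
  interpret prob_space M by fact
  have [measurable]: "X i \<in> borel_measurable M" for i using X by (auto simp: centered_gaussian_family_def)
  obtain v where v: "v \<ge> 0" "distr M borel (\<lambda>\<omega>. \<Sum>i\<in>J. c i \<bullet> X i \<omega>) = centered_normal v"
    using X J unfolding centered_gaussian_family_def by blast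
  have "(CLINT \<omega>|M. iexp (\<Sum>i\<in>J. c i \<bullet> X i \<omega>)) = char (distr M borel (\<lambda>\<omega>. \<Sum>i\<in>J. c i \<bullet> X i \<omega>)) 1"
    by (subst integral_iexp_distr) auto
  also have "\<dots> = complex_of_real (exp (- v / 2))" unfolding v(2) by (simp add: char_centered_normal v(1))
  finally show ?thesis
    using square_integrable_of_centered_normal(2)[OF _ v(2) v(1)] by simp
qed

section \<open>Covariances and joint Gaussianity of the wavelet coefficients\<close>

locale ofbm_wavelet = ofbm_model M B N Bt P H A h1 h2 + wavelet_filter \<psi> L
  for M :: "'a measure" and B :: "real \<Rightarrow> 'a \<Rightarrow> real^2" and N :: "'b measure"
    and Bt :: "real set \<Rightarrow> 'b \<Rightarrow> complex^2" and P H :: "real^2^2" and A :: "complex^2^2" and h1 h2 :: real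
    and \<psi> :: "real \<Rightarrow> real" and L :: real +
  fixes D :: "nat \<Rightarrow> int \<Rightarrow> 'a \<Rightarrow> real^2"
  assumes coefficients: "wavelet_coefficients M B \<psi> D"
begin

sublocale prob_space M
  using ofbm by (simp add: ofbm_def)

lemma g_diag_nonneg: "0 \<le> g i i"
  using G_pos[of i] by (simp add: g_def)

text \<open>A modulus of continuity of the process in mean square, summed over the
  eigencoordinates.\<close>

definition modulus :: "real \<Rightarrow> real" where
  "modulus \<delta> = (\<Sum>i\<in>UNIV. norm (column i P) * (sqrt (2 * g i i) * \<delta> powr (hx i)))"

lemma l2norm_Bq_diff: "l2norm M (\<lambda>\<omega>. Bq u i \<omega> - Bq v i \<omega>) = sqrt (2 * g i i) * \<bar>u - v\<bar> powr (hx i)"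
proof -
  have ii: "integrable M (\<lambda>\<omega>. Bq x i \<omega> * Bq y i \<omega>)" for x y
    by (intro integrable_mult_square_integrable Bq_square_integrable)
  have "(l2norm M (\<lambda>\<omega>. Bq u i \<omega> - Bq v i \<omega>))\<^sup>2
    = (\<integral>\<omega>. Bq u i \<omega> * Bq u i \<omega> - 2 * (Bq u i \<omega> * Bq v i \<omega>) + Bq v i \<omega> * Bq v i \<omega> \<partial>M)"
    unfolding l2norm_sq by (intro Bochner_Integration.integral_cong refl) (simp add: power2_eq_square algebra_simps)
  also have "\<dots> = 2 * g i i * \<bar>u - v\<bar> powr (hx i + hx i)"
    using ii by (simp add: Bq_covariance algebra_simps)
  also have "\<dots> = (sqrt (2 * g i i) * \<bar>u - v\<bar> powr (hx i))\<^sup>2"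
    using g_diag_nonneg[of i] by (simp only: power_mult_distrib powr_add real_sqrt_pow2 mult_nonneg_nonneg zero_le_numeral) (simp only: power2_eq_square)
  finally show ?thesis
    by (rule power2_eq_imp_eq) (use g_diag_nonneg[of i] in auto)
qed

lemma B_expand: "B t \<omega> = (\<Sum>i\<in>UNIV. Bq t i \<omega> *\<^sub>R column i P)"
proof -
  have "P *v (Q *v B t \<omega>) = B t \<omega>" by (simp add: matrix_vector_mul_assoc PQ)
  then show ?thesis unfolding matrix_mult_sum[of P] by (simp add: Bq_def scalar_mult_eq_scaleR)
qed

lemma l2norm_B_diff: "l2norm M (\<lambda>\<omega>. B u \<omega> - B v \<omega>) \<le> modulus \<bar>u - v\<bar>"
proof -
  have "(\<lambda>\<omega>. B u \<omega> - B v \<omega>) = (\<lambda>\<omega>. \<Sum>i\<in>UNIV. (Bq u i \<omega> - Bq v i \<omega>) *\<^sub>R column i P)"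
    by (subst (1 2) B_expand) (simp add: sum_subtractf scaleR_diff_left)
  then have "l2norm M (\<lambda>\<omega>. B u \<omega> - B v \<omega>) \<le> (\<Sum>i\<in>UNIV. l2norm M (\<lambda>\<omega>. (Bq u i \<omega> - Bq v i \<omega>) *\<^sub>R column i P))"
  proof (simp only:, intro l2norm_sum)
    fix i
    have sd: "square_integrable M (\<lambda>\<omega>. Bq u i \<omega> - Bq v i \<omega>)" by (intro square_integrable_diff Bq_square_integrable)
    note [measurable] = square_integrable_measurable[OF Bq_square_integrable]
    show "square_integrable M (\<lambda>\<omega>. (Bq u i \<omega> - Bq v i \<omega>) *\<^sub>R column i P)"
      by (rule square_integrable_bound[OF sd, where c="norm (column i P)"]) auto
  qed simp
  also have "\<dots> = modulus \<bar>u - v\<bar>"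
  proof -
    have "l2norm M (\<lambda>\<omega>. (Bq u i \<omega> - Bq v i \<omega>) *\<^sub>R column i P) = norm (column i P) * l2norm M (\<lambda>\<omega>. Bq u i \<omega> - Bq v i \<omega>)" for i
      by (simp add: l2norm_def power_mult_distrib real_sqrt_mult)
    then show ?thesis by (simp add: modulus_def l2norm_Bq_diff)
  qed
  finally show ?thesis .
qed

lemma modulus_mono: "0 \<le> x \<Longrightarrow> x \<le> y \<Longrightarrow> modulus x \<le> modulus y"
  unfolding modulus_def using hx_bounds g_diag_nonneg
  by (intro sum_mono mult_left_mono powr_mono2) (auto simp: less_imp_le)

lemma modulus_tendsto:
  assumes "x \<longlonglongrightarrow> 0" "\<And>n. 0 \<le> x n"
  shows "(\<lambda>n. modulus (x n)) \<longlonglongrightarrow> 0"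
proof -
  have "(\<lambda>n. x n powr hx i) \<longlonglongrightarrow> 0" for i
    using tendsto_zero_powrI[OF assms(1) tendsto_const[of "hx i"]] assms(2) hx_bounds[of i] by simp
  then have "(\<lambda>n. modulus (x n)) \<longlonglongrightarrow> (\<Sum>i\<in>UNIV. norm (column i P) * (sqrt (2 * g i i) * 0))"
    unfolding modulus_def by (intro tendsto_intros)
  then show ?thesis by simp
qed

lemma D_integral: "mean_square_integral M (\<lambda>z \<omega>. \<psi> z *\<^sub>R B (2 ^ n * z + 2 ^ n * of_int k) \<omega>) (D (2 ^ n) k)"
  using coefficients by (auto simp: wavelet_coefficients_def)

lemma D_square_integrable: "square_integrable M (D (2 ^ n) k)"
  using D_integral[of n k] by (simp add: mean_square_integral_def)

definition Dq :: "nat \<Rightarrow> int \<Rightarrow> 2 \<Rightarrow> 'a \<Rightarrow> real" where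
  "Dq n k i \<omega> = (Q *v D (2 ^ n) k \<omega>) $ i"

lemma Q_row_inner: "(Q *v x) $ i = Q $ i \<bullet> x"
  by (simp add: matrix_vector_mult_def inner_vec_def)

lemma Dq_square_integrable: "square_integrable M (Dq n k i)"
  unfolding Dq_def[abs_def] Q_row_inner by (rule square_integrable_inner_const[OF D_square_integrable])

text \<open>Testing the vector-valued integral with \<open>Z\<close> times row \<open>i\<close> of
  \<open>Q\<close> singles out one eigencoordinate.\<close>

lemma Dq_weak:
  assumes Z: "square_integrable M Z"
    and m[measurable]: "(\<lambda>z. \<integral>\<omega>. Bq (2 ^ n * z + 2 ^ n * of_int k) i \<omega> * Z \<omega> \<partial>M) \<in> borel_measurable borel"
  shows "(\<integral>\<omega>. Dq n k i \<omega> * Z \<omega> \<partial>M) = (\<integral>z. \<psi> z * (\<integral>\<omega>. Bq (2 ^ n * z + 2 ^ n * of_int k) i \<omega> * Z \<omega> \<partial>M) \<partial>lborel)"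
proof -
  have ZQ: "square_integrable M (\<lambda>\<omega>. Z \<omega> *\<^sub>R Q $ i)"
    by (rule square_integrable_bound[OF Z, where c="norm (Q $ i)"]) (use Z in \<open>auto simp: square_integrable_def\<close>)
  have F: "(\<integral>\<omega>. (\<psi> z *\<^sub>R B (2 ^ n * z + 2 ^ n * of_int k) \<omega>) \<bullet> (Z \<omega> *\<^sub>R Q $ i) \<partial>M)
      = \<psi> z * (\<integral>\<omega>. Bq (2 ^ n * z + 2 ^ n * of_int k) i \<omega> * Z \<omega> \<partial>M)" for z
    by (subst integral_mult_right_zero[symmetric])
      (simp add: Bq_def Q_row_inner inner_commute mult_ac)
  have "(\<integral>\<omega>. D (2 ^ n) k \<omega> \<bullet> (Z \<omega> *\<^sub>R Q $ i) \<partial>M) = (\<integral>z. \<psi> z * (\<integral>\<omega>. Bq (2 ^ n * z + 2 ^ n * of_int k) i \<omega> * Z \<omega> \<partial>M) \<partial>lborel)"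
    by (subst mean_square_integral_inner[OF D_integral ZQ]) (unfold F, measurable)
  then show ?thesis by (simp add: Dq_def Q_row_inner inner_commute mult_ac)
qed

lemma Dq_Bq:
  "(\<integral>\<omega>. Dq n k i \<omega> * Bq t i' \<omega> \<partial>M) = (\<integral>z. \<psi> z * (g i i' * (\<bar>2 ^ n * z + 2 ^ n * of_int k\<bar> powr (hx i + hx i')
      + \<bar>t\<bar> powr (hx i + hx i') - \<bar>2 ^ n * z + 2 ^ n * of_int k - t\<bar> powr (hx i + hx i'))) \<partial>lborel)"
  by (subst Dq_weak[OF Bq_square_integrable]) (simp_all add: Bq_covariance)

lemma continuous_affine_powr: "0 < h \<Longrightarrow> continuous_on UNIV (\<lambda>x :: real. \<bar>a * x + b\<bar> powr h)"
  by (intro continuous_on_powr' continuous_intros) auto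

text \<open>The terms \<open>|s|^h\<close> and \<open>|t|^h\<close> of the process covariance depend
  on one variable only and are killed by the zeroth moment. In \<open>|s - t|^h\<close> the scale
  factors out by homogeneity, and what remains depends on the shifts through their difference: the
  coefficients are stationary although the process is not.\<close>

lemma Dq_covariance:
  "(\<integral>\<omega>. Dq n k i \<omega> * Dq n l i' \<omega> \<partial>M) = - g i i' * (2 ^ n) powr (hx i + hx i') * J (hx i + hx i') (of_int (k - l))"
proof -
  define h where "h = hx i + hx i'"
  have h: "0 < h" using hx_bounds[of i] hx_bounds[of i'] by (simp add: h_def)
  define s :: real where "s = 2 ^ n"
  have s: "0 < s" by (simp add: s_def)
  \<comment> \<open>The part of the inner integral that is free of \<open>z\<close>; integration
    against the wavelet removes it.\<close>
  define c where "c = (\<integral>z'. \<psi> z' * \<bar>s * z' + s * of_int l\<bar> powr h \<partial>lborel)"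
  have hx': "hx i' + hx i = h" by (simp add: h_def)
  have inner: "(\<integral>\<omega>. Bq (s * z + s * of_int k) i \<omega> * Dq n l i' \<omega> \<partial>M)
      = g i i' * (c - s powr h * (\<integral>z'. \<psi> z' * \<bar>z - z' + of_int (k - l)\<bar> powr h \<partial>lborel))" for z
  proof -
    let ?t = "s * z + s * of_int k"
    have pw: "\<bar>s * z' + s * of_int l - ?t\<bar> powr h = s powr h * \<bar>z - z' + of_int (k - l)\<bar> powr h" for z'
    proof -
      have "s * z' + s * of_int l - ?t = - (s * (z - z' + of_int (k - l)))" by (simp add: algebra_simps)
      then have "\<bar>s * z' + s * of_int l - ?t\<bar> = s * \<bar>z - z' + of_int (k - l)\<bar>" using s by (simp only: abs_minus_cancel abs_mult)
      then show ?thesis using s by (simp add: powr_mult)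
    qed
    have i1: "integrable lborel (\<lambda>z'. \<psi> z' * \<bar>s * z' + s * of_int l\<bar> powr h)"
      by (intro integrable_psi_continuous continuous_affine_powr h)
    have "continuous_on UNIV (\<lambda>z'. \<bar>z - z' + of_int (k - l)\<bar> powr h)"
      by (intro continuous_on_powr' continuous_intros) (use h in auto)
    then have i2: "integrable lborel (\<lambda>z'. \<psi> z' * \<bar>z - z' + of_int (k - l)\<bar> powr h)"
      by (rule integrable_psi_continuous)
    have "(\<integral>\<omega>. Bq ?t i \<omega> * Dq n l i' \<omega> \<partial>M) = (\<integral>\<omega>. Dq n l i' \<omega> * Bq ?t i \<omega> \<partial>M)" by (simp add: mult.commute)
    also have "\<dots> = (\<integral>z'. \<psi> z' * (g i i' * (\<bar>s * z' + s * of_int l\<bar> powr h + \<bar>?t\<bar> powr h - \<bar>s * z' + s * of_int l - ?t\<bar> powr h)) \<partial>lborel)"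
      unfolding Dq_Bq hx' s_def[symmetric] g_sym[of i' i] ..
    also have "\<dots> = (\<integral>z'. g i i' * ((\<psi> z' * \<bar>s * z' + s * of_int l\<bar> powr h) + \<bar>?t\<bar> powr h * \<psi> z' - s powr h * (\<psi> z' * \<bar>z - z' + of_int (k - l)\<bar> powr h)) \<partial>lborel)"
      unfolding pw by (intro Bochner_Integration.integral_cong refl) (simp add: algebra_simps)
    also have "\<dots> = g i i' * (c + \<bar>?t\<bar> powr h * 0 - s powr h * (\<integral>z'. \<psi> z' * \<bar>z - z' + of_int (k - l)\<bar> powr h \<partial>lborel))"
      using i1 i2 integrable_psi by (simp add: c_def moment0)
    finally show ?thesis by simp
  qed
  have qm: "(\<lambda>(t, t'). \<bar>t - t' + of_int (k - l)\<bar> powr h) \<in> borel_measurable (borel \<Otimes>\<^sub>M (borel :: real measure))" by measurable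
  have im: "(\<lambda>z. \<integral>z'. \<psi> z' * \<bar>z - z' + of_int (k - l)\<bar> powr h \<partial>lborel) \<in> borel_measurable borel"
    by (rule sigma_finite_measure.borel_measurable_lebesgue_integral[OF sigma_finite_lborel]) measurable
  have iJ: "integrable lborel (\<lambda>z. \<psi> z * (\<integral>z'. \<psi> z' * \<bar>z - z' + of_int (k - l)\<bar> powr h \<partial>lborel))"
    by (rule double_psi_bounded(1)[OF qm]) (rule abs_diff_powr_bound[OF h])
  have "(\<integral>\<omega>. Dq n k i \<omega> * Dq n l i' \<omega> \<partial>M) = (\<integral>z. \<psi> z * (\<integral>\<omega>. Bq (s * z + s * of_int k) i \<omega> * Dq n l i' \<omega> \<partial>M) \<partial>lborel)"
    unfolding s_def
  proof (rule Dq_weak[OF Dq_square_integrable])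
    show "(\<lambda>z. \<integral>\<omega>. Bq (2 ^ n * z + 2 ^ n * of_int k) i \<omega> * Dq n l i' \<omega> \<partial>M) \<in> borel_measurable borel"
      unfolding inner[unfolded s_def] using im by measurable
  qed
  also have "\<dots> = (\<integral>z. g i i' * (c * \<psi> z - s powr h * (\<psi> z * (\<integral>z'. \<psi> z' * \<bar>z - z' + of_int (k - l)\<bar> powr h \<partial>lborel))) \<partial>lborel)"
    unfolding inner by (intro Bochner_Integration.integral_cong refl) (simp add: algebra_simps)
  also have "\<dots> = g i i' * (c * 0 - s powr h * J h (of_int (k - l)))"
    using iJ integrable_psi by (simp add: J_def moment0)
  finally show ?thesis by (simp add: h_def s_def)
qed

definition cell :: "nat \<Rightarrow> int \<Rightarrow> real \<Rightarrow> real" where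
  "cell r p z = \<psi> z * indicator {z. \<lfloor>real (Suc r) * z\<rfloor> = p} z"

definition bound :: "nat \<Rightarrow> int" where "bound r = \<lceil>real (Suc r) * L\<rceil> + 1"

text \<open>The weights are integrals of the wavelet over cells of length \<open>1 / (r + 1)\<close>
  rather than its values at nodes: the wavelet is only integrable, whereas the process is continuous
  in mean square.\<close>

definition riemann :: "nat \<Rightarrow> nat \<Rightarrow> int \<Rightarrow> 'a \<Rightarrow> real^2" where
  "riemann n r k \<omega> = (\<Sum>p\<leftarrow>[- bound r..bound r]. (\<integral>z. cell r p z \<partial>lborel) *\<^sub>R
      B (2 ^ n * (of_int p / real (Suc r)) + 2 ^ n * of_int k) \<omega>)"

text \<open>On each cell the process is frozen at the left end point, which moves its time argument
  by at most \<open>2^n / (r + 1)\<close>; \<open>mean_square_integral_approx\<close> integrates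
  this pointwise error.\<close>

lemma l2norm_riemann:
  "l2norm M (\<lambda>\<omega>. D (2 ^ n) k \<omega> - riemann n r k \<omega>) \<le> modulus (2 ^ n / real (Suc r)) * nrm"
proof -
  let ?t = "\<lambda>p. 2 ^ n * (of_int p / real (Suc r)) + 2 ^ n * of_int k"
  let ?L = "map (\<lambda>p. (cell r p, B (?t p))) [- bound r..bound r]"
  have cm: "(\<lambda>z. indicator {z. \<lfloor>real (Suc r) * z\<rfloor> = p} z :: real) \<in> borel_measurable borel" for p
    by measurable
  have mem: "integrable lborel g \<and> square_integrable M Y" if gy: "(g, Y) \<in> set ?L" for g Y
  proof -
    from gy obtain p where p: "g = cell r p" "Y = B (?t p)" by auto
    have "integrable lborel (\<lambda>z. \<psi> z * indicator {z. \<lfloor>real (Suc r) * z\<rfloor> = p} z)"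
      by (rule integrable_psi_bounded(1)[OF cm, where C=1]) (auto simp: indicator_def)
    then show ?thesis using p B_square_integrable by (simp add: cell_def[abs_def])
  qed
  have approx: "(\<Sum>(g, Y)\<leftarrow>?L. g z *\<^sub>R Y \<omega>) = \<psi> z *\<^sub>R B (?t \<lfloor>real (Suc r) * z\<rfloor>) \<omega>" for z \<omega>
  proof -
    have "(\<Sum>(g, Y)\<leftarrow>?L. g z *\<^sub>R Y \<omega>) = (\<Sum>p\<in>{- bound r..bound r}. cell r p z *\<^sub>R B (?t p) \<omega>)"
      by (simp add: o_def sum_list_distinct_conv_sum_set)
    also have "\<dots> = \<psi> z *\<^sub>R B (?t \<lfloor>real (Suc r) * z\<rfloor>) \<omega>"
    proof (cases "\<psi> z = 0")
      case True
      then show ?thesis by (simp add: cell_def)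
    next
      case False
      then have z: "\<bar>z\<bar> \<le> L" by (rule support)
      have "\<bar>real (Suc r) * z\<bar> \<le> real (Suc r) * L"
        unfolding abs_mult using z by (intro mult_mono) auto
      then have "real (Suc r) * z \<le> real (Suc r) * L" "- (real (Suc r) * L) \<le> real (Suc r) * z" by linarith+
      then have "\<lfloor>real (Suc r) * z\<rfloor> \<le> \<lfloor>real (Suc r) * L\<rfloor>" "\<lfloor>- (real (Suc r) * L)\<rfloor> \<le> \<lfloor>real (Suc r) * z\<rfloor>"
        using floor_mono by blast+
      then have mem: "\<lfloor>real (Suc r) * z\<rfloor> \<in> {- bound r..bound r}"
        unfolding bound_def floor_minus atLeastAtMost_iff using floor_le_ceiling[of "real (Suc r) * L"] by linarith
      have "(\<Sum>p\<in>{- bound r..bound r}. cell r p z *\<^sub>R B (?t p) \<omega>)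
        = (\<Sum>p\<in>{- bound r..bound r}. if p = \<lfloor>real (Suc r) * z\<rfloor> then \<psi> z *\<^sub>R B (?t p) \<omega> else 0)"
        by (intro sum.cong refl) (simp add: cell_def)
      also have "\<dots> = \<psi> z *\<^sub>R B (?t \<lfloor>real (Suc r) * z\<rfloor>) \<omega>"
        using mem by (subst sum.delta) auto
      finally show ?thesis .
    qed
    finally show ?thesis .
  qed
  have "l2norm M (\<lambda>\<omega>. D (2 ^ n) k \<omega> - (\<Sum>(g, Y)\<leftarrow>?L. (\<integral>z. g z \<partial>lborel) *\<^sub>R Y \<omega>)) \<le> (\<integral>z. \<bar>\<psi> z\<bar> * modulus (2 ^ n / real (Suc r)) \<partial>lborel)"
  proof (rule mean_square_integral_approx[OF D_integral mem])
    show "integrable lborel (\<lambda>z. \<bar>\<psi> z\<bar> * modulus (2 ^ n / real (Suc r)))" using integrable_psi by auto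
    fix z
    let ?u = "2 ^ n * z + 2 ^ n * of_int k" and ?v = "?t \<lfloor>real (Suc r) * z\<rfloor>"
    have "\<bar>?u - ?v\<bar> \<le> 2 ^ n / real (Suc r)"
    proof -
      have fl: "0 \<le> real (Suc r) * z - of_int \<lfloor>real (Suc r) * z\<rfloor>" "real (Suc r) * z - of_int \<lfloor>real (Suc r) * z\<rfloor> \<le> 1" by linarith+
      have "?u - ?v = 2 ^ n / real (Suc r) * (real (Suc r) * z - of_int \<lfloor>real (Suc r) * z\<rfloor>)"
        by (simp add: field_simps)
      then have "\<bar>?u - ?v\<bar> = 2 ^ n / real (Suc r) * (real (Suc r) * z - of_int \<lfloor>real (Suc r) * z\<rfloor>)"
        using fl(1) by (simp only: abs_mult) simp
      also have "\<dots> \<le> 2 ^ n / real (Suc r) * 1" using fl by (intro mult_left_mono) auto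
      finally show ?thesis by simp
    qed
    then have le: "l2norm M (\<lambda>\<omega>. B ?u \<omega> - B ?v \<omega>) \<le> modulus (2 ^ n / real (Suc r))"
      by (intro order.trans[OF l2norm_B_diff] modulus_mono) auto
    have "l2norm M (\<lambda>\<omega>. \<psi> z *\<^sub>R B ?u \<omega> - (\<Sum>(g, Y)\<leftarrow>?L. g z *\<^sub>R Y \<omega>)) = \<bar>\<psi> z\<bar> * l2norm M (\<lambda>\<omega>. B ?u \<omega> - B ?v \<omega>)"
      unfolding approx scaleR_diff_right[symmetric] by (rule l2norm_scaleR)
    also have "\<dots> \<le> \<bar>\<psi> z\<bar> * modulus (2 ^ n / real (Suc r))" by (intro mult_left_mono le) simp
    finally show "l2norm M (\<lambda>\<omega>. \<psi> z *\<^sub>R B ?u \<omega> - (\<Sum>(g, Y)\<leftarrow>?L. g z *\<^sub>R Y \<omega>)) \<le> \<bar>\<psi> z\<bar> * modulus (2 ^ n / real (Suc r))" .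
  qed
  moreover have "(\<Sum>(g, Y)\<leftarrow>?L. (\<integral>z. g z \<partial>lborel) *\<^sub>R Y \<omega>) = riemann n r k \<omega>" for \<omega>
    by (simp add: riemann_def o_def)
  ultimately show ?thesis by (simp add: nrm_def mult.commute)
qed

definition lin_comb :: "('a \<Rightarrow> real) set" where
  "lin_comb = {T. \<exists>J c. finite J \<and> T = (\<lambda>\<omega>. \<Sum>t\<in>J. c t \<bullet> B t \<omega>)}"

lemma lin_comb_add:
  assumes "S \<in> lin_comb" "T \<in> lin_comb"
  shows "(\<lambda>\<omega>. S \<omega> + T \<omega>) \<in> lin_comb"
proof -
  obtain J c J' c' where S: "finite J" "S = (\<lambda>\<omega>. \<Sum>t\<in>J. c t \<bullet> B t \<omega>)" and T: "finite J'" "T = (\<lambda>\<omega>. \<Sum>t\<in>J'. c' t \<bullet> B t \<omega>)"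
    using assms by (auto simp: lin_comb_def)
  let ?c = "\<lambda>t. (if t \<in> J then c t else 0) + (if t \<in> J' then c' t else 0)"
  have "(\<Sum>t\<in>J \<union> J'. ?c t \<bullet> B t \<omega>) = S \<omega> + T \<omega>" for \<omega>
  proof -
    have "(\<Sum>t\<in>J \<union> J'. (if t \<in> J then c t else 0) \<bullet> B t \<omega>) = S \<omega>"
      unfolding S(2) using S(1) T(1) by (intro sum.mono_neutral_cong_right) auto
    moreover have "(\<Sum>t\<in>J \<union> J'. (if t \<in> J' then c' t else 0) \<bullet> B t \<omega>) = T \<omega>"
      unfolding T(2) using S(1) T(1) by (intro sum.mono_neutral_cong_right) auto
    ultimately show ?thesis by (simp add: inner_add_left sum.distrib)
  qed
  then show ?thesis using S(1) T(1) unfolding lin_comb_def by (auto intro!: exI[of _ "J \<union> J'"] exI[of _ ?c])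
qed

lemma lin_comb_zero: "(\<lambda>_. 0) \<in> lin_comb"
  unfolding lin_comb_def by (auto intro!: exI[of _ "{}"])

lemma lin_comb_single: "(\<lambda>\<omega>. v \<bullet> B t \<omega>) \<in> lin_comb"
  unfolding lin_comb_def by (auto intro!: exI[of _ "{t}"] exI[of _ "\<lambda>_. v"])

lemma lin_comb_sum:
  assumes "finite K" "\<And>k. k \<in> K \<Longrightarrow> T k \<in> lin_comb"
  shows "(\<lambda>\<omega>. \<Sum>k\<in>K. T k \<omega>) \<in> lin_comb"
  using assms by (induction K) (auto intro: lin_comb_zero lin_comb_add)

lemma lin_comb_char:
  assumes "T \<in> lin_comb"
  shows "square_integrable M T"
    and "(CLINT \<omega>|M. iexp (T \<omega>)) = complex_of_real (exp (- (\<integral>\<omega>. (T \<omega>)\<^sup>2 \<partial>M) / 2))"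
proof -
  obtain J c where T: "finite J" "T = (\<lambda>\<omega>. \<Sum>t\<in>J. c t \<bullet> B t \<omega>)" using assms by (auto simp: lin_comb_def)
  show "square_integrable M T" unfolding T(2)
    by (intro square_integrable_sum square_integrable_inner_const B_square_integrable)
  have "centered_gaussian_family M UNIV B" using ofbm by (simp add: ofbm_def)
  from gaussian_family_char[OF prob_space_axioms this T(1)]
  show "(CLINT \<omega>|M. iexp (T \<omega>)) = complex_of_real (exp (- (\<integral>\<omega>. (T \<omega>)\<^sup>2 \<partial>M) / 2))" unfolding T(2) .
qed

lemma inner_riemann_lin_comb: "(\<lambda>\<omega>. v \<bullet> riemann n r k \<omega>) \<in> lin_comb"
proof -
  have "v \<bullet> riemann n r k \<omega> = (\<Sum>p\<in>{- bound r..bound r}. ((\<integral>z. cell r p z \<partial>lborel) *\<^sub>R v) \<bullet>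
      B (2 ^ n * (of_int p / real (Suc r)) + 2 ^ n * of_int k) \<omega>)" for \<omega>
    by (simp add: riemann_def sum_list_distinct_conv_sum_set inner_sum_right)
  then show ?thesis by (simp only:) (intro lin_comb_sum lin_comb_single, simp)
qed

text \<open>Riemann sums are finite linear combinations of values of the process, hence jointly
  Gaussian, and they converge to the coefficients in mean square.\<close>

lemma D_char:
  assumes K: "finite K"
  shows "(CLINT \<omega>|M. iexp (\<Sum>k\<in>K. v k \<bullet> D (2 ^ n) k \<omega>))
     = complex_of_real (exp (- (\<integral>\<omega>. (\<Sum>k\<in>K. v k \<bullet> D (2 ^ n) k \<omega>)\<^sup>2 \<partial>M) / 2))"
proof (rule gaussian_char_l2_limit)
  let ?X = "\<lambda>r \<omega>. \<Sum>k\<in>K. v k \<bullet> riemann n r k \<omega>" and ?T = "\<lambda>\<omega>. \<Sum>k\<in>K. v k \<bullet> D (2 ^ n) k \<omega>"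
  have lc: "?X r \<in> lin_comb" for r by (intro lin_comb_sum K inner_riemann_lin_comb)
  show "square_integrable M (?X r)" for r by (rule lin_comb_char(1)[OF lc])
  show "(CLINT \<omega>|M. iexp (?X r \<omega>)) = complex_of_real (exp (- (\<integral>\<omega>. (?X r \<omega>)\<^sup>2 \<partial>M) / 2))" for r
    by (rule lin_comb_char(2)[OF lc])
  show "square_integrable M ?T"
    by (intro square_integrable_sum square_integrable_inner_const D_square_integrable)
  have rs: "square_integrable M (riemann n r k)" for r k
    unfolding riemann_def[abs_def] by (intro square_integrable_sum_list square_integrable_scaleR B_square_integrable)
  show "(\<lambda>r. l2norm M (\<lambda>\<omega>. ?X r \<omega> - ?T \<omega>)) \<longlonglongrightarrow> 0"
  proof (rule Lim_null_comparison, intro always_eventually allI)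
    fix r
    have "l2norm M (\<lambda>\<omega>. ?X r \<omega> - ?T \<omega>) = l2norm M (\<lambda>\<omega>. \<Sum>k\<in>K. v k \<bullet> (riemann n r k \<omega> - D (2 ^ n) k \<omega>))"
      by (simp add: inner_diff_right sum_subtractf)
    also have "\<dots> \<le> (\<Sum>k\<in>K. l2norm M (\<lambda>\<omega>. v k \<bullet> (riemann n r k \<omega> - D (2 ^ n) k \<omega>)))"
      by (intro l2norm_sum K square_integrable_inner_const square_integrable_diff rs D_square_integrable)
    also have "\<dots> \<le> (\<Sum>k\<in>K. norm (v k) * (modulus (2 ^ n / real (Suc r)) * nrm))"
    proof (rule sum_mono)
      fix k
      have "l2norm M (\<lambda>\<omega>. v k \<bullet> (riemann n r k \<omega> - D (2 ^ n) k \<omega>)) \<le> norm (v k) * l2norm M (\<lambda>\<omega>. riemann n r k \<omega> - D (2 ^ n) k \<omega>)"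
        by (intro l2norm_inner_le square_integrable_diff rs D_square_integrable)
      also have "\<dots> \<le> norm (v k) * (modulus (2 ^ n / real (Suc r)) * nrm)"
        unfolding l2norm_minus[of M "riemann n r k"] by (intro mult_left_mono l2norm_riemann) simp
      finally show "l2norm M (\<lambda>\<omega>. v k \<bullet> (riemann n r k \<omega> - D (2 ^ n) k \<omega>)) \<le> norm (v k) * (modulus (2 ^ n / real (Suc r)) * nrm)" .
    qed
    finally show "norm (l2norm M (\<lambda>\<omega>. ?X r \<omega> - ?T \<omega>)) \<le> (\<Sum>k\<in>K. norm (v k) * (modulus (2 ^ n / real (Suc r)) * nrm))" by simp
  next
    have "(\<lambda>r. 2 ^ n / real (Suc r)) \<longlonglongrightarrow> 2 ^ n * 0"
      unfolding divide_inverse by (intro tendsto_intros LIMSEQ_inverse_real_of_nat)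
    then have "(\<lambda>r. modulus (2 ^ n / real (Suc r))) \<longlonglongrightarrow> 0" by (intro modulus_tendsto) auto
    then have "(\<lambda>r. \<Sum>k\<in>K. norm (v k) * (modulus (2 ^ n / real (Suc r)) * nrm)) \<longlonglongrightarrow> (\<Sum>k\<in>K. norm (v k) * (0 * nrm))"
      by (intro tendsto_intros)
    then show "(\<lambda>r. \<Sum>k\<in>K. norm (v k) * (modulus (2 ^ n / real (Suc r)) * nrm)) \<longlonglongrightarrow> 0" by simp
  qed
qed

lemma gaussian_vector_Dq:
  assumes K: "finite K"
  shows "gaussian_vector M (K \<times> UNIV) (\<lambda>p \<omega>. s (snd p) * Dq n (fst p) (snd p) \<omega>)"
proof
  show "finite (K \<times> (UNIV :: 2 set))" using K by simp
  show "square_integrable M (\<lambda>\<omega>. s (snd p) * Dq n (fst p) (snd p) \<omega>)" for p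
    by (intro square_integrable_cmult Dq_square_integrable)
  fix c :: "int \<times> 2 \<Rightarrow> real"
  have "(\<Sum>p\<in>K \<times> UNIV. c p * (s (snd p) * Dq n (fst p) (snd p) \<omega>))
      = (\<Sum>k\<in>K. (\<Sum>i\<in>UNIV. (c (k, i) * s i) *\<^sub>R Q $ i) \<bullet> D (2 ^ n) k \<omega>)" for \<omega>
  proof -
    have "(\<Sum>p\<in>K \<times> UNIV. f p) = (\<Sum>k\<in>K. \<Sum>i\<in>UNIV. f (k, i))" for f :: "int \<times> 2 \<Rightarrow> real"
      by (simp add: sum.cartesian_product)
    then show ?thesis by (simp add: inner_sum_left Dq_def Q_row_inner mult_ac)
  qed
  then show "(CLINT \<omega>|M. iexp (\<Sum>p\<in>K \<times> UNIV. c p * (s (snd p) * Dq n (fst p) (snd p) \<omega>)))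
     = complex_of_real (exp (- (\<integral>\<omega>. (\<Sum>p\<in>K \<times> UNIV. c p * (s (snd p) * Dq n (fst p) (snd p) \<omega>))\<^sup>2 \<partial>M) / 2))"
    by (simp only: D_char[OF K])
qed

end

section \<open>Slopes of eigenvectors and convergence in probability\<close>

text \<open>The quotient of \<open>lambda_1 - a\<close> by \<open>b\<close>, with the root moved
  into the denominator. This form is continuous at \<open>b = 0\<close> as long as
  \<open>c > a\<close>, and its value 0 at \<open>b = 0\<close> agrees with the totalized
  quotient.\<close>

definition slope :: "real \<Rightarrow> real \<Rightarrow> real \<Rightarrow> real" where
  "slope a b c = - 2 * b / (c - a + sqrt ((c - a)\<^sup>2 + 4 * b\<^sup>2))"

lemma slope_denominator:
  assumes "b \<noteq> 0"
  shows "c - a + sqrt ((c - a)\<^sup>2 + 4 * b\<^sup>2) > 0"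
proof -
  have "\<bar>c - a\<bar> < sqrt ((c - a)\<^sup>2 + 4 * b\<^sup>2)"
    using assms by (intro real_less_rsqrt) simp
  then show ?thesis by linarith
qed

text \<open>For the vector \<open>(1, theta)\<close>, eliminating the eigenvalue from
  \<open>a + b theta = lambda\<close> and \<open>b + c theta = lambda theta\<close> gives this
  quadratic equation.\<close>

lemma slope_quadratic: "b * (slope a b c)\<^sup>2 + (a - c) * slope a b c - b = 0"
proof (cases "b = 0")
  case False
  define r where "r = sqrt ((c - a)\<^sup>2 + 4 * b\<^sup>2)"
  define q where "q = c - a + r"
  have q: "q > 0" using slope_denominator[OF False] by (simp add: q_def r_def)
  have r2: "r\<^sup>2 = (c - a)\<^sup>2 + 4 * b\<^sup>2" by (simp add: r_def)
  have s: "slope a b c = - 2 * b / q" by (simp add: slope_def q_def r_def)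
  have q2: "q\<^sup>2 = 2 * (c - a) * q + 4 * b\<^sup>2"
    using r2 by (simp add: q_def power2_eq_square algebra_simps)
  have "(b * (slope a b c)\<^sup>2 + (a - c) * slope a b c - b) * q\<^sup>2 = b * (4 * b\<^sup>2 + 2 * (c - a) * q - q\<^sup>2)"
    using q by (simp add: s power2_eq_square field_simps)
  also have "\<dots> = 0" by (simp add: q2)
  finally show ?thesis using q by simp
qed (simp add: slope_def)

lemma slope_scale:
  assumes "k > 0"
  shows "slope (k * a) (k * b) (k * c) = slope a b c"
proof -
  have eq: "(k * c - k * a)\<^sup>2 + 4 * (k * b)\<^sup>2 = k\<^sup>2 * ((c - a)\<^sup>2 + 4 * b\<^sup>2)"
    by (simp add: power2_eq_square algebra_simps)
  then have "k * c - k * a + sqrt ((k * c - k * a)\<^sup>2 + 4 * (k * b)\<^sup>2) = k * (c - a + sqrt ((c - a)\<^sup>2 + 4 * b\<^sup>2))"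
    unfolding eq real_sqrt_mult using assms by (simp add: distrib_left right_diff_distrib)
  moreover have "- 2 * (k * b) = k * (- 2 * b)" by simp
  ultimately show ?thesis using assms by (simp only: slope_def mult_divide_mult_cancel_left_if) simp
qed

lemma smallest_eigenvalue_2:
  fixes S :: "real^2^2"
  assumes sym: "S $ 2 $ 1 = S $ 1 $ 2"
  shows "smallest_eigenvalue S = (S $ 1 $ 1 + S $ 2 $ 2 - sqrt ((S $ 2 $ 2 - S $ 1 $ 1)\<^sup>2 + 4 * (S $ 1 $ 2)\<^sup>2)) / 2"
proof -
  define a b c where "a = S $ 1 $ 1" and "b = S $ 1 $ 2" and "c = S $ 2 $ 2"
  define r where "r = sqrt ((c - a)\<^sup>2 + 4 * b\<^sup>2)"
  have r2: "r\<^sup>2 = (c - a)\<^sup>2 + 4 * b\<^sup>2" by (simp add: r_def)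
  have r0: "r \<ge> 0" by (simp add: r_def)
  \<comment> \<open>An eigenvector exists exactly at the zeros of the characteristic polynomial; the
    witness is \<open>(b, l - a)\<close>, or \<open>(1, 0)\<close> when that vector is 0.\<close>
  have ev: "(\<exists>v. v \<noteq> 0 \<and> S *v v = l *\<^sub>R v) \<longleftrightarrow> (a - l) * (c - l) = b\<^sup>2" for l
  proof -
    have eq: "S *v v = l *\<^sub>R v \<longleftrightarrow> a * v $ 1 + b * v $ 2 = l * v $ 1 \<and> b * v $ 1 + c * v $ 2 = l * v $ 2" for v
      by (simp add: vec_eq_iff matrix_vector_mult_def sum_2 forall_2 a_def b_def c_def sym)
    show ?thesis
    proof
      assume "\<exists>v. v \<noteq> 0 \<and> S *v v = l *\<^sub>R v"
      then obtain v :: "real^2" where v: "v \<noteq> 0" "a * v $ 1 + b * v $ 2 = l * v $ 1" "b * v $ 1 + c * v $ 2 = l * v $ 2"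
        using eq by auto
      have e1: "(a - l) * v $ 1 = - b * v $ 2" and e2: "(c - l) * v $ 2 = - b * v $ 1"
        using v by (simp_all add: algebra_simps)
      have "((a - l) * (c - l) - b\<^sup>2) * v $ 1 = 0"
        using e1 e2 by algebra
      moreover have "((a - l) * (c - l) - b\<^sup>2) * v $ 2 = 0"
        using e1 e2 by algebra
      ultimately show "(a - l) * (c - l) = b\<^sup>2" using v(1) by (auto simp: vec_eq_iff forall_2)
    next
      assume d: "(a - l) * (c - l) = b\<^sup>2"
      show "\<exists>v. v \<noteq> 0 \<and> S *v v = l *\<^sub>R v"
      proof (cases "b = 0 \<and> l = a")
        case True
        then show ?thesis unfolding eq by (intro exI[of _ "vector [1, 0]"]) (auto simp: vec_eq_iff intro!: exI[of _ 1])
      next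
        case False
        then have "vector [b, l - a] \<noteq> (0 :: real^2)" by (auto simp: vec_eq_iff forall_2)
        then show ?thesis unfolding eq using d
          by (intro exI[of _ "vector [b, l - a]"]) (simp add: power2_eq_square algebra_simps)
      qed
    qed
  qed
  have rts: "(a - l) * (c - l) = b\<^sup>2 \<longleftrightarrow> l = (a + c - r) / 2 \<or> l = (a + c + r) / 2" for l
  proof -
    have "(a - l) * (c - l) - b\<^sup>2 = (l - (a + c - r) / 2) * (l - (a + c + r) / 2)"
      using r2 by (simp add: power2_eq_square field_simps)
    then show ?thesis by (metis eq_iff_diff_eq_0 mult_eq_0_iff)
  qed
  have "{l. \<exists>v. v \<noteq> 0 \<and> S *v v = l *\<^sub>R v} = {(a + c - r) / 2, (a + c + r) / 2}"
    unfolding ev rts by blast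
  then show ?thesis unfolding smallest_eigenvalue_def using r0 by (simp add: r_def a_def b_def c_def)
qed

text \<open>Multiplying by the conjugate of the root moves the root into the denominator; if the
  off-diagonal entry is 0, both sides are 0.\<close>

lemma eigen_ratio_slope:
  fixes S :: "real^2^2"
  assumes sym: "S $ 2 $ 1 = S $ 1 $ 2"
  shows "eigen_ratio S = slope (S $ 1 $ 1) (S $ 1 $ 2) (S $ 2 $ 2)"
proof (cases "S $ 1 $ 2 = 0")
  case False
  define a b c where "a = S $ 1 $ 1" and "b = S $ 1 $ 2" and "c = S $ 2 $ 2"
  define r where "r = sqrt ((c - a)\<^sup>2 + 4 * b\<^sup>2)"
  have b: "b \<noteq> 0" using False by (simp add: b_def)
  have q: "c - a + r > 0" using slope_denominator[OF b] by (simp add: r_def)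
  have r2: "r\<^sup>2 = (c - a)\<^sup>2 + 4 * b\<^sup>2" by (simp add: r_def)
  have "eigen_ratio S = (c - a - r) / (2 * b)"
    unfolding eigen_ratio_def smallest_eigenvalue_2[OF sym] a_def[symmetric] b_def[symmetric] c_def[symmetric] r_def[symmetric]
    using b by (simp add: field_simps)
  also have "\<dots> = - 2 * b / (c - a + r)"
  proof (rule frac_eq_eq[THEN iffD2])
    show "(c - a - r) * (c - a + r) = - 2 * b * (2 * b)" using r2 by algebra
  qed (use b q in auto)
  finally show ?thesis by (simp add: slope_def a_def b_def c_def r_def)
qed (simp add: eigen_ratio_def slope_def)

text \<open>Formulated in metric spaces so that a tuple of random variables converges as one object
  and continuous maps can be applied to it.\<close>

definition in_prob :: "'a measure \<Rightarrow> (nat \<Rightarrow> 'a \<Rightarrow> 'b::metric_space) \<Rightarrow> 'b \<Rightarrow> bool" where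
  "in_prob M X c \<longleftrightarrow> (\<forall>e>0. (\<lambda>n. measure M {\<omega> \<in> space M. dist (X n \<omega>) c > e}) \<longlonglongrightarrow> 0)"

lemma in_probD: "in_prob M X c \<Longrightarrow> e > 0 \<Longrightarrow> (\<lambda>n. measure M {\<omega> \<in> space M. dist (X n \<omega>) c > e}) \<longlonglongrightarrow> 0"
  by (simp add: in_prob_def)

lemma in_prob_real: "in_prob M X c \<longleftrightarrow> tendsto_in_prob M X c"
  by (simp add: in_prob_def tendsto_in_prob_def dist_real_def)

section \<open>Calculus of convergence in probability\<close>

context prob_space
begin

lemma in_prob_dominated:
  assumes "\<And>e. e > 0 \<Longrightarrow> (\<lambda>n. p e n) \<longlonglongrightarrow> 0"
    and "\<And>e. e > 0 \<Longrightarrow> \<forall>\<^sub>F n in sequentially. measure M {\<omega> \<in> space M. dist (X n \<omega>) c > e} \<le> p e n"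
  shows "in_prob M X c"
  unfolding in_prob_def
proof (intro allI impI)
  fix e :: real assume e: "e > 0"
  show "(\<lambda>n. measure M {\<omega> \<in> space M. dist (X n \<omega>) c > e}) \<longlonglongrightarrow> 0"
    by (rule Lim_null_comparison[OF _ assms(1)[OF e]]) (use assms(2)[OF e] in simp)
qed

text \<open>Continuity at the limit point alone is enough, so quotients and roots are admissible
  when they are regular there.\<close>

lemma in_prob_compose:
  fixes X :: "nat \<Rightarrow> 'a \<Rightarrow> 'b::{metric_space, second_countable_topology}" and g :: "'b \<Rightarrow> 'c::metric_space"
  assumes X: "in_prob M X c" and [measurable]: "\<And>n. X n \<in> borel_measurable M" and g: "isCont g c"
  shows "in_prob M (\<lambda>n \<omega>. g (X n \<omega>)) (g c)"
  unfolding in_prob_def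
proof (intro allI impI)
  fix e :: real assume e: "e > 0"
  from g e obtain d where d: "d > 0" "\<And>x. dist x c < d \<Longrightarrow> dist (g x) (g c) < e"
    unfolding continuous_at_eps_delta by blast
  show "(\<lambda>n. measure M {\<omega> \<in> space M. dist (g (X n \<omega>)) (g c) > e}) \<longlonglongrightarrow> 0"
  proof (rule Lim_null_comparison)
    have "measure M {\<omega> \<in> space M. dist (g (X n \<omega>)) (g c) > e} \<le> measure M {\<omega> \<in> space M. dist (X n \<omega>) c > d / 2}" for n
    proof (rule finite_measure_mono)
      have "dist (X n \<omega>) c > d / 2" if "dist (g (X n \<omega>)) (g c) > e" for \<omega>
        using d(2)[of "X n \<omega>"] d(1) that by fastforce
      then show "{\<omega> \<in> space M. dist (g (X n \<omega>)) (g c) > e} \<subseteq> {\<omega> \<in> space M. dist (X n \<omega>) c > d / 2}" by auto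
    qed measurable
    then show "\<forall>\<^sub>F n in sequentially. norm (measure M {\<omega> \<in> space M. dist (g (X n \<omega>)) (g c) > e})
        \<le> measure M {\<omega> \<in> space M. dist (X n \<omega>) c > d / 2}" by simp
    show "(\<lambda>n. measure M {\<omega> \<in> space M. dist (X n \<omega>) c > d / 2}) \<longlonglongrightarrow> 0"
      by (rule in_probD[OF X]) (use d(1) in simp)
  qed
qed

lemma in_prob_Pair:
  fixes X :: "nat \<Rightarrow> 'a \<Rightarrow> 'b::{metric_space, second_countable_topology}"
    and Y :: "nat \<Rightarrow> 'a \<Rightarrow> 'c::{metric_space, second_countable_topology}"
  assumes X: "in_prob M X c" and [measurable]: "\<And>n. X n \<in> borel_measurable M"
    and Y: "in_prob M Y d" and [measurable]: "\<And>n. Y n \<in> borel_measurable M"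
  shows "in_prob M (\<lambda>n \<omega>. (X n \<omega>, Y n \<omega>)) (c, d)"
proof (rule in_prob_dominated)
  fix e :: real assume e: "e > 0"
  show "(\<lambda>n. measure M {\<omega> \<in> space M. dist (X n \<omega>) c > e / 2} + measure M {\<omega> \<in> space M. dist (Y n \<omega>) d > e / 2}) \<longlonglongrightarrow> 0"
    by (intro tendsto_add_zero in_probD[OF X] in_probD[OF Y]) (use e in auto)
  show "\<forall>\<^sub>F n in sequentially. measure M {\<omega> \<in> space M. dist (X n \<omega>, Y n \<omega>) (c, d) > e}
     \<le> measure M {\<omega> \<in> space M. dist (X n \<omega>) c > e / 2} + measure M {\<omega> \<in> space M. dist (Y n \<omega>) d > e / 2}"
  proof (intro always_eventually allI)
    fix n
    have sub: "{\<omega> \<in> space M. dist (X n \<omega>, Y n \<omega>) (c, d) > e}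
       \<subseteq> {\<omega> \<in> space M. dist (X n \<omega>) c > e / 2} \<union> {\<omega> \<in> space M. dist (Y n \<omega>) d > e / 2}"
    proof
      fix \<omega> assume \<omega>: "\<omega> \<in> {\<omega> \<in> space M. dist (X n \<omega>, Y n \<omega>) (c, d) > e}"
      have "dist (X n \<omega>, Y n \<omega>) (c, d) \<le> dist (X n \<omega>) c + dist (Y n \<omega>) d"
        unfolding dist_Pair_Pair by (rule real_sqrt_sum_squares_triangle_ineq[of "dist (X n \<omega>) c" 0 0 "dist (Y n \<omega>) d", simplified])
      then show "\<omega> \<in> {\<omega> \<in> space M. dist (X n \<omega>) c > e / 2} \<union> {\<omega> \<in> space M. dist (Y n \<omega>) d > e / 2}"
        using \<omega> by auto
    qed
    have "measure M {\<omega> \<in> space M. dist (X n \<omega>, Y n \<omega>) (c, d) > e}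
       \<le> measure M ({\<omega> \<in> space M. dist (X n \<omega>) c > e / 2} \<union> {\<omega> \<in> space M. dist (Y n \<omega>) d > e / 2})"
      by (rule finite_measure_mono[OF sub]) measurable
    also have "\<dots> \<le> measure M {\<omega> \<in> space M. dist (X n \<omega>) c > e / 2} + measure M {\<omega> \<in> space M. dist (Y n \<omega>) d > e / 2}"
      by (rule measure_Un_le) measurable
    finally show "measure M {\<omega> \<in> space M. dist (X n \<omega>, Y n \<omega>) (c, d) > e}
     \<le> measure M {\<omega> \<in> space M. dist (X n \<omega>) c > e / 2} + measure M {\<omega> \<in> space M. dist (Y n \<omega>) d > e / 2}" .
  qed
qed

text \<open>Each event is empty or the whole space. The embedding lets the population ratio follow
  from the same lemmas as the sample ratio.\<close>

lemma in_prob_deterministic: "in_prob M (\<lambda>n \<omega>. x n) c \<longleftrightarrow> x \<longlonglongrightarrow> c"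
proof
  assume x: "x \<longlonglongrightarrow> c"
  show "in_prob M (\<lambda>n \<omega>. x n) c"
  proof (rule in_prob_dominated[where p="\<lambda>_ _. 0"])
    fix e :: real assume "e > 0"
    then have "\<forall>\<^sub>F n in sequentially. dist (x n) c < e" using x by (simp add: tendsto_iff)
    then show "\<forall>\<^sub>F n in sequentially. measure M {\<omega> \<in> space M. dist (x n) c > e} \<le> 0"
      by eventually_elim auto
  qed simp
next
  assume p: "in_prob M (\<lambda>n \<omega>. x n) c"
  show "x \<longlonglongrightarrow> c"
    unfolding tendsto_iff
  proof (intro allI impI)
    fix e :: real assume e: "e > 0"
    have "(\<lambda>n. measure M {\<omega> \<in> space M. dist (x n) c > e / 2}) \<longlonglongrightarrow> 0"
      by (rule in_probD[OF p]) (use e in simp)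
    then have "\<forall>\<^sub>F n in sequentially. measure M {\<omega> \<in> space M. dist (x n) c > e / 2} < 1"
      by (rule order_tendstoD) simp
    then show "\<forall>\<^sub>F n in sequentially. dist (x n) c < e"
    proof eventually_elim
      case (elim n)
      show ?case
      proof (rule ccontr)
        assume "\<not> dist (x n) c < e"
        then have "{\<omega> \<in> space M. dist (x n) c > e / 2} = space M" using e by auto
        then show False using elim by (simp add: prob_space)
      qed
    qed
  qed
qed

text \<open>Meant for identities that divide by \<open>Z\<close>: where \<open>Z\<close> is 0 its
  distance from the nonzero limit \<open>z\<close> exceeds \<open>|z| / 2\<close>, an event of
  vanishing probability.\<close>

lemma in_prob_cong_nonzero:
  fixes X Y :: "nat \<Rightarrow> 'a \<Rightarrow> 'b::{metric_space, second_countable_topology}" and Z :: "nat \<Rightarrow> 'a \<Rightarrow> real"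
  assumes X: "in_prob M X c" and [measurable]: "\<And>n. X n \<in> borel_measurable M"
    and Z: "in_prob M Z z" "z \<noteq> 0" and [measurable]: "\<And>n. Z n \<in> borel_measurable M"
    and eq: "\<And>n \<omega>. Z n \<omega> \<noteq> 0 \<Longrightarrow> Y n \<omega> = X n \<omega>"
  shows "in_prob M Y c"
proof (rule in_prob_dominated)
  fix e :: real assume e: "e > 0"
  show "(\<lambda>n. measure M {\<omega> \<in> space M. dist (X n \<omega>) c > e} + measure M {\<omega> \<in> space M. dist (Z n \<omega>) z > \<bar>z\<bar> / 2}) \<longlonglongrightarrow> 0"
    by (intro tendsto_add_zero in_probD[OF X] in_probD[OF Z(1)]) (use e Z(2) in auto)
  show "\<forall>\<^sub>F n in sequentially. measure M {\<omega> \<in> space M. dist (Y n \<omega>) c > e}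
     \<le> measure M {\<omega> \<in> space M. dist (X n \<omega>) c > e} + measure M {\<omega> \<in> space M. dist (Z n \<omega>) z > \<bar>z\<bar> / 2}"
  proof (intro always_eventually allI)
    fix n
    have "{\<omega> \<in> space M. dist (Y n \<omega>) c > e}
       \<subseteq> {\<omega> \<in> space M. dist (X n \<omega>) c > e} \<union> {\<omega> \<in> space M. dist (Z n \<omega>) z > \<bar>z\<bar> / 2}"
    proof
      fix \<omega> assume \<omega>: "\<omega> \<in> {\<omega> \<in> space M. dist (Y n \<omega>) c > e}"
      show "\<omega> \<in> {\<omega> \<in> space M. dist (X n \<omega>) c > e} \<union> {\<omega> \<in> space M. dist (Z n \<omega>) z > \<bar>z\<bar> / 2}"
      proof (cases "Z n \<omega> = 0")
        case True
        then show ?thesis using \<omega> Z(2) by (simp add: dist_real_def)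
      next
        case False
        then show ?thesis using \<omega> eq by simp
      qed
    qed
    then have "measure M {\<omega> \<in> space M. dist (Y n \<omega>) c > e}
       \<le> measure M ({\<omega> \<in> space M. dist (X n \<omega>) c > e} \<union> {\<omega> \<in> space M. dist (Z n \<omega>) z > \<bar>z\<bar> / 2})"
      by (rule finite_measure_mono) measurable
    also have "\<dots> \<le> measure M {\<omega> \<in> space M. dist (X n \<omega>) c > e} + measure M {\<omega> \<in> space M. dist (Z n \<omega>) z > \<bar>z\<bar> / 2}"
      by (rule measure_Un_le) measurable
    finally show "measure M {\<omega> \<in> space M. dist (Y n \<omega>) c > e}
     \<le> measure M {\<omega> \<in> space M. dist (X n \<omega>) c > e} + measure M {\<omega> \<in> space M. dist (Z n \<omega>) z > \<bar>z\<bar> / 2}" .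
  qed
qed

lemma markov_square:
  fixes X :: "'a \<Rightarrow> real"
  assumes X: "square_integrable M X" and e: "e > 0"
  shows "measure M {\<omega> \<in> space M. \<bar>X \<omega>\<bar> > e} \<le> (\<integral>\<omega>. (X \<omega>)\<^sup>2 \<partial>M) / e\<^sup>2"
proof -
  have [measurable]: "X \<in> borel_measurable M" using X by measurable
  have "{\<omega> \<in> space M. \<bar>X \<omega>\<bar> > e} \<subseteq> {\<omega> \<in> space M. e\<^sup>2 \<le> (X \<omega>)\<^sup>2}"
    using e by (auto simp: abs_le_square_iff[symmetric])
  then have "measure M {\<omega> \<in> space M. \<bar>X \<omega>\<bar> > e} \<le> measure M {\<omega> \<in> space M. e\<^sup>2 \<le> (X \<omega>)\<^sup>2}"
    by (rule finite_measure_mono) measurable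
  also have "\<dots> \<le> (\<integral>\<omega>. (X \<omega>)\<^sup>2 \<partial>M) / e\<^sup>2"
    using integral_Markov_inequality_measure[of M "\<lambda>\<omega>. (X \<omega>)\<^sup>2" "space M" "e\<^sup>2"] X e
    by (simp add: square_integrable_def)
  finally show ?thesis .
qed

text \<open>Second moments bounded by \<open>C\<close> make \<open>Z\<close> tight by Markov's
  inequality, and a tight factor cannot undo convergence to 0 in probability.\<close>

lemma in_prob_mult_bounded:
  fixes X Z :: "nat \<Rightarrow> 'a \<Rightarrow> real"
  assumes X: "in_prob M X 0" and [measurable]: "\<And>n. X n \<in> borel_measurable M"
    and Z: "\<And>n. square_integrable M (Z n)" "\<forall>\<^sub>F n in sequentially. (\<integral>\<omega>. (Z n \<omega>)\<^sup>2 \<partial>M) \<le> C"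
  shows "in_prob M (\<lambda>n \<omega>. X n \<omega> * Z n \<omega>) 0"
  unfolding in_prob_def
proof (intro allI impI)
  fix e :: real assume e: "e > 0"
  have [measurable]: "Z n \<in> borel_measurable M" for n using Z(1) by measurable
  show "(\<lambda>n. measure M {\<omega> \<in> space M. dist (X n \<omega> * Z n \<omega>) 0 > e}) \<longlonglongrightarrow> 0"
  proof (rule LIMSEQ_I)
    fix r :: real assume r: "r > 0"
    \<comment> \<open>Chosen so that the Markov bound \<open>C d^2 / e^2\<close> is at most
      \<open>r / 2\<close>.\<close>
    define d where "d = sqrt (r / (2 * (\<bar>C\<bar> + 1))) * e"
    have d: "d > 0" using r e by (simp add: d_def)
    have dC: "C / (e / d)\<^sup>2 \<le> r / 2"
    proof -
      have "(e / d)\<^sup>2 = 2 * (\<bar>C\<bar> + 1) / r" using r e by (simp add: d_def power_divide power_mult_distrib)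
      then have "C / (e / d)\<^sup>2 = (C / (\<bar>C\<bar> + 1)) * (r / 2)" by simp
      also have "\<dots> \<le> 1 * (r / 2)" using r by (intro mult_right_mono) (auto simp: divide_le_eq)
      finally show ?thesis by simp
    qed
    have "(\<lambda>n. measure M {\<omega> \<in> space M. dist (X n \<omega>) 0 > d}) \<longlonglongrightarrow> 0" by (rule in_probD[OF X d])
    then have "\<forall>\<^sub>F n in sequentially. measure M {\<omega> \<in> space M. dist (X n \<omega>) 0 > d} < r / 2"
      by (rule order_tendstoD) (use r in simp)
    then have "\<forall>\<^sub>F n in sequentially. norm (measure M {\<omega> \<in> space M. dist (X n \<omega> * Z n \<omega>) 0 > e} - 0) < r"
      using Z(2)
    proof eventually_elim
      case (elim n)
      have ed: "e / d > 0" using e d by simp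
      have "{\<omega> \<in> space M. dist (X n \<omega> * Z n \<omega>) 0 > e}
         \<subseteq> {\<omega> \<in> space M. dist (X n \<omega>) 0 > d} \<union> {\<omega> \<in> space M. \<bar>Z n \<omega>\<bar> > e / d}"
      proof (safe, rule ccontr)
        fix \<omega> assume "dist (X n \<omega> * Z n \<omega>) 0 > e" "\<not> \<bar>Z n \<omega>\<bar> > e / d" "\<not> dist (X n \<omega>) 0 > d"
        then have "\<bar>X n \<omega>\<bar> * \<bar>Z n \<omega>\<bar> > e" "\<bar>Z n \<omega>\<bar> \<le> e / d" "\<bar>X n \<omega>\<bar> \<le> d" by (auto simp: abs_mult)
        moreover have "\<bar>X n \<omega>\<bar> * \<bar>Z n \<omega>\<bar> \<le> d * (e / d)" using calculation d by (intro mult_mono) auto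
        ultimately show False using d by simp
      qed
      then have "measure M {\<omega> \<in> space M. dist (X n \<omega> * Z n \<omega>) 0 > e}
         \<le> measure M ({\<omega> \<in> space M. dist (X n \<omega>) 0 > d} \<union> {\<omega> \<in> space M. \<bar>Z n \<omega>\<bar> > e / d})"
        by (rule finite_measure_mono) measurable
      also have "\<dots> \<le> measure M {\<omega> \<in> space M. dist (X n \<omega>) 0 > d} + measure M {\<omega> \<in> space M. \<bar>Z n \<omega>\<bar> > e / d}"
        by (rule measure_Un_le) measurable
      also have "measure M {\<omega> \<in> space M. \<bar>Z n \<omega>\<bar> > e / d} \<le> (\<integral>\<omega>. (Z n \<omega>)\<^sup>2 \<partial>M) / (e / d)\<^sup>2"
        by (rule markov_square[OF Z(1) ed])
      also have "\<dots> \<le> C / (e / d)\<^sup>2" using elim by (intro divide_right_mono) auto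
      also have "\<dots> \<le> r / 2" by (rule dC)
      finally show ?case using elim by simp
    qed
    then show "\<exists>no. \<forall>n\<ge>no. norm (measure M {\<omega> \<in> space M. dist (X n \<omega> * Z n \<omega>) 0 > e} - 0) < r"
      by (simp add: eventually_sequentially)
  qed
qed

lemma in_prob_add:
  fixes X Y :: "nat \<Rightarrow> 'a \<Rightarrow> real"
  assumes "in_prob M X c" "\<And>n. X n \<in> borel_measurable M" "in_prob M Y d" "\<And>n. Y n \<in> borel_measurable M"
  shows "in_prob M (\<lambda>n \<omega>. X n \<omega> + Y n \<omega>) (c + d)"
  using in_prob_compose[OF in_prob_Pair[OF assms], of "\<lambda>p. fst p + snd p"] assms(2,4)
  by (simp add: borel_measurable_Pair)

text \<open>The two exponentials differ by at most \<open>|s| e\<close> where the variables differ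
  by at most \<open>e\<close>, and by at most 2 on the remaining event.\<close>

lemma slutsky_char:
  assumes S[measurable]: "\<And>n. S n \<in> borel_measurable M" and T[measurable]: "\<And>n. T n \<in> borel_measurable M"
    and d: "in_prob M (\<lambda>n \<omega>. S n \<omega> - T n \<omega>) (0 :: real)"
    and lim: "(\<lambda>n. CLINT \<omega>|M. iexp (s * T n \<omega>)) \<longlonglongrightarrow> \<phi>"
  shows "(\<lambda>n. CLINT \<omega>|M. iexp (s * S n \<omega>)) \<longlonglongrightarrow> \<phi>"
proof -
  have le: "norm ((CLINT \<omega>|M. iexp (s * S n \<omega>)) - (CLINT \<omega>|M. iexp (s * T n \<omega>)))
     \<le> \<bar>s\<bar> * e + 2 * measure M {\<omega> \<in> space M. dist (S n \<omega> - T n \<omega>) 0 > e}" if e: "e > 0" for e n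
  proof -
    let ?A = "{\<omega> \<in> space M. dist (S n \<omega> - T n \<omega>) 0 > e}"
    have i: "integrable M (\<lambda>\<omega>. iexp (s * S n \<omega>))" "integrable M (\<lambda>\<omega>. iexp (s * T n \<omega>))"
      by (rule integrable_iexp_scaled, measurable)+
    have A: "?A \<in> sets M" by measurable
    have "norm ((CLINT \<omega>|M. iexp (s * S n \<omega>)) - (CLINT \<omega>|M. iexp (s * T n \<omega>))) = norm (CLINT \<omega>|M. iexp (s * S n \<omega>) - iexp (s * T n \<omega>))"
      using i by simp
    also have "\<dots> \<le> (\<integral>\<omega>. norm (iexp (s * S n \<omega>) - iexp (s * T n \<omega>)) \<partial>M)" by (rule integral_norm_bound)
    also have "\<dots> \<le> (\<integral>\<omega>. \<bar>s\<bar> * e + 2 * indicator ?A \<omega> \<partial>M)"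
    proof (rule integral_mono)
      show "integrable M (\<lambda>\<omega>. norm (iexp (s * S n \<omega>) - iexp (s * T n \<omega>)))"
        by (intro integrable_norm Bochner_Integration.integrable_diff i)
      show "integrable M (\<lambda>\<omega>. \<bar>s\<bar> * e + 2 * indicator ?A \<omega>)"
        using A by (auto simp: emeasure_eq_measure)
      fix \<omega> assume \<omega>: "\<omega> \<in> space M"
      show "norm (iexp (s * S n \<omega>) - iexp (s * T n \<omega>)) \<le> \<bar>s\<bar> * e + 2 * indicator ?A \<omega>"
      proof (cases "\<omega> \<in> ?A")
        case True
        have "norm (iexp (s * S n \<omega>) - iexp (s * T n \<omega>)) \<le> 2"
          using norm_triangle_ineq4[of "iexp (s * S n \<omega>)" "iexp (s * T n \<omega>)"] by (simp only: cmod_iexp)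
        moreover have "0 \<le> \<bar>s\<bar> * e" using e by simp
        ultimately show ?thesis using True by simp
      next
        case False
        then have "\<bar>S n \<omega> - T n \<omega>\<bar> \<le> e" using \<omega> by (simp add: dist_real_def)
        then have "\<bar>s\<bar> * \<bar>S n \<omega> - T n \<omega>\<bar> \<le> \<bar>s\<bar> * e" by (intro mult_left_mono) auto
        then show ?thesis using cmod_iexp_diff[of "s * S n \<omega>" "s * T n \<omega>"] False
          by (simp add: abs_mult right_diff_distrib[symmetric])
      qed
    qed
    also have "\<dots> = \<bar>s\<bar> * e + 2 * measure M ?A"
      using A by (simp add: prob_space emeasure_eq_measure)
    finally show ?thesis .
  qed
  have "(\<lambda>n. (CLINT \<omega>|M. iexp (s * S n \<omega>)) - (CLINT \<omega>|M. iexp (s * T n \<omega>))) \<longlonglongrightarrow> 0"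
  proof (rule LIMSEQ_I)
    fix r :: real assume r: "r > 0"
    \<comment> \<open>This makes the first contribution at most \<open>r / 2\<close>; the
      exceptional event, of probability below \<open>r / 4\<close>, contributes less than the other
      half.\<close>
    define e where "e = r / (2 * (\<bar>s\<bar> + 1))"
    have e: "e > 0" using r by (simp add: e_def)
    have se: "\<bar>s\<bar> * e \<le> r / 2"
    proof -
      have "\<bar>s\<bar> * e = (\<bar>s\<bar> / (\<bar>s\<bar> + 1)) * (r / 2)" by (simp add: e_def)
      also have "\<dots> \<le> 1 * (r / 2)" using r by (intro mult_right_mono) auto
      finally show ?thesis by simp
    qed
    have "(\<lambda>n. measure M {\<omega> \<in> space M. dist (S n \<omega> - T n \<omega>) 0 > e}) \<longlonglongrightarrow> 0" by (rule in_probD[OF d e])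
    then have "\<forall>\<^sub>F n in sequentially. measure M {\<omega> \<in> space M. dist (S n \<omega> - T n \<omega>) 0 > e} < r / 4"
      by (rule order_tendstoD) (use r in simp)
    then have "\<forall>\<^sub>F n in sequentially. norm ((CLINT \<omega>|M. iexp (s * S n \<omega>)) - (CLINT \<omega>|M. iexp (s * T n \<omega>)) - 0) < r"
    proof eventually_elim
      case (elim n)
      show ?case using le[OF e, of n] se elim unfolding diff_0_right by linarith
    qed
    then show "\<exists>no. \<forall>n\<ge>no. norm ((CLINT \<omega>|M. iexp (s * S n \<omega>)) - (CLINT \<omega>|M. iexp (s * T n \<omega>)) - 0) < r"
      by (simp add: eventually_sequentially)
  qed
  from tendsto_add[OF this lim] show ?thesis by simp
qed

end

text \<open>The three arguments are the entries (1,1), (1,2) and (2,2) of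
  \<open>P diag(e, 1) b diag(e, 1) P^T\<close>.\<close>

definition eps_slope :: "real^2^2 \<Rightarrow> real \<Rightarrow> real \<Rightarrow> real \<Rightarrow> real \<Rightarrow> real" where
  "eps_slope P e b11 b12 b22 = slope
     ((P$1$1)\<^sup>2 * e\<^sup>2 * b11 + 2 * P$1$1 * P$1$2 * e * b12 + (P$1$2)\<^sup>2 * b22)
     (P$1$1 * P$2$1 * e\<^sup>2 * b11 + (P$1$1 * P$2$2 + P$1$2 * P$2$1) * e * b12 + P$1$2 * P$2$2 * b22)
     ((P$2$1)\<^sup>2 * e\<^sup>2 * b11 + 2 * P$2$1 * P$2$2 * e * b12 + (P$2$2)\<^sup>2 * b22)"

text \<open>
  \<open>u\<close> and \<open>v\<close> below are, up to a factor \<open>e\<close> in \<open>v\<close>, the vectors \<open>diag(e, 1) P\<^sup>T (-\<theta>, 1)\<close> and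
  \<open>diag(e, 1) P\<^sup>T (1, \<theta>)\<close> for \<open>\<theta> = - p\<^sub>1\<^sub>2 / p\<^sub>2\<^sub>2 + e t\<close>. Two eigenvectors of a symmetric matrix are
  orthogonal with respect to it, which makes the bilinear form vanish.
\<close>

lemma eps_slope_equation:
  fixes P :: "real^2^2" and e t b11 b12 b22 :: real
  defines "\<alpha> \<equiv> P$1$1 - P$1$2 * P$2$1 / P$2$2" and "\<beta> \<equiv> P$2$1 + P$1$1 * P$1$2 / P$2$2"
    and "\<kappa> \<equiv> P$2$2 + (P$1$2)\<^sup>2 / P$2$2"
  defines "v1 \<equiv> \<alpha> + e * P$2$1 * t" and "v2 \<equiv> P$2$2 * t"
    and "u1 \<equiv> e * (\<beta> - e * P$1$1 * t)" and "u2 \<equiv> \<kappa> - e * P$1$2 * t"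
  assumes p22: "P$2$2 \<noteq> 0" and e: "e \<noteq> 0" and t: "eps_slope P e b11 b12 b22 = - (P$1$2 / P$2$2) + e * t"
  shows "b11 * (u1 * v1) + b12 * (u1 * v2 + u2 * v1) + b22 * (u2 * v2) = 0"
proof -
  define \<theta> where "\<theta> = - (P$1$2 / P$2$2) + e * t"
  define a where "a = (P$1$1)\<^sup>2 * e\<^sup>2 * b11 + 2 * P$1$1 * P$1$2 * e * b12 + (P$1$2)\<^sup>2 * b22"
  define b where "b = P$1$1 * P$2$1 * e\<^sup>2 * b11 + (P$1$1 * P$2$2 + P$1$2 * P$2$1) * e * b12 + P$1$2 * P$2$2 * b22"
  define c where "c = (P$2$1)\<^sup>2 * e\<^sup>2 * b11 + 2 * P$2$1 * P$2$2 * e * b12 + (P$2$2)\<^sup>2 * b22"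
  have q: "b * \<theta>\<^sup>2 + (a - c) * \<theta> - b = 0"
    using slope_quadratic[of b a c] t by (simp add: eps_slope_def a_def b_def c_def \<theta>_def)
  have v: "P$1$1 + P$2$1 * \<theta> = v1" "P$1$2 + P$2$2 * \<theta> = e * v2"
    using p22 by (simp_all add: \<theta>_def v1_def v2_def \<alpha>_def algebra_simps)
  have u: "e * (P$2$1 - P$1$1 * \<theta>) = u1" "P$2$2 - P$1$2 * \<theta> = u2"
    using p22 by (simp_all add: \<theta>_def u1_def u2_def \<beta>_def \<kappa>_def power2_eq_square algebra_simps)
  have "b * \<theta>\<^sup>2 + (a - c) * \<theta> - b
      = - (b11 * (e\<^sup>2 * (P$2$1 - P$1$1 * \<theta>) * (P$1$1 + P$2$1 * \<theta>))
        + b12 * (e * (P$2$1 - P$1$1 * \<theta>) * (P$1$2 + P$2$2 * \<theta>) + e * (P$2$2 - P$1$2 * \<theta>) * (P$1$1 + P$2$1 * \<theta>))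
        + b22 * ((P$2$2 - P$1$2 * \<theta>) * (P$1$2 + P$2$2 * \<theta>)))"
    unfolding a_def b_def c_def by algebra
  also have "\<dots> = - (b11 * (e * (e * (P$2$1 - P$1$1 * \<theta>)) * (P$1$1 + P$2$1 * \<theta>))
        + b12 * ((e * (P$2$1 - P$1$1 * \<theta>)) * (P$1$2 + P$2$2 * \<theta>) + e * (P$2$2 - P$1$2 * \<theta>) * (P$1$1 + P$2$1 * \<theta>))
        + b22 * ((P$2$2 - P$1$2 * \<theta>) * (P$1$2 + P$2$2 * \<theta>)))"
    by (simp only: power2_eq_square mult.assoc)
  also have "\<dots> = - e * (b11 * (u1 * v1) + b12 * (u1 * v2 + u2 * v1) + b22 * (u2 * v2))"
    unfolding u v by (simp add: algebra_simps)
  finally show ?thesis using q e by simp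
qed

section \<open>The delta method for the slope\<close>

lemma eps_slope_measurable [measurable]:
  assumes [measurable]: "B11 \<in> borel_measurable M" "B12 \<in> borel_measurable M" "B22 \<in> borel_measurable M"
  shows "(\<lambda>\<omega>. eps_slope P e (B11 \<omega>) (B12 \<omega>) (B22 \<omega>)) \<in> borel_measurable M"
  unfolding eps_slope_def slope_def by measurable

text \<open>At \<open>e = 0\<close> the matrix is \<open>b22\<close> times the outer square of the
  second column of \<open>P\<close>, so the discriminant is a perfect square. The positive
  denominator in the second part is what gives continuity there, whatever \<open>p12\<close>
  is.\<close>

lemma eps_slope_zero:
  assumes b: "b22 > 0" and p: "P$2$2 \<noteq> 0"
  shows "eps_slope P 0 b11 b12 b22 = - (P$1$2 / P$2$2)"
    and "(P$2$2)\<^sup>2 * b22 - (P$1$2)\<^sup>2 * b22 + sqrt (((P$2$2)\<^sup>2 * b22 - (P$1$2)\<^sup>2 * b22)\<^sup>2 + 4 * (P$1$2 * P$2$2 * b22)\<^sup>2) = 2 * (P$2$2)\<^sup>2 * b22"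
proof -
  have "((P$2$2)\<^sup>2 * b22 - (P$1$2)\<^sup>2 * b22)\<^sup>2 + 4 * (P$1$2 * P$2$2 * b22)\<^sup>2 = (((P$2$2)\<^sup>2 + (P$1$2)\<^sup>2) * b22)\<^sup>2"
    by (simp add: power2_eq_square algebra_simps)
  moreover have "((P$2$2)\<^sup>2 + (P$1$2)\<^sup>2) * b22 \<ge> 0" using b by simp
  ultimately have s: "sqrt (((P$2$2)\<^sup>2 * b22 - (P$1$2)\<^sup>2 * b22)\<^sup>2 + 4 * (P$1$2 * P$2$2 * b22)\<^sup>2) = ((P$2$2)\<^sup>2 + (P$1$2)\<^sup>2) * b22"
    by (simp only: real_sqrt_abs abs_of_nonneg)
  show d: "(P$2$2)\<^sup>2 * b22 - (P$1$2)\<^sup>2 * b22 + sqrt (((P$2$2)\<^sup>2 * b22 - (P$1$2)\<^sup>2 * b22)\<^sup>2 + 4 * (P$1$2 * P$2$2 * b22)\<^sup>2) = 2 * (P$2$2)\<^sup>2 * b22"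
    unfolding s by (simp add: algebra_simps)
  have "eps_slope P 0 b11 b12 b22 = - 2 * (P$1$2 * P$2$2 * b22) / (2 * (P$2$2)\<^sup>2 * b22)"
    unfolding eps_slope_def slope_def d[symmetric] by simp
  then show "eps_slope P 0 b11 b12 b22 = - (P$1$2 / P$2$2)"
    using b p by (simp add: power2_eq_square)
qed

context prob_space
begin

lemma in_prob_const: "in_prob M (\<lambda>n \<omega>. c) c"
  by (simp add: in_prob_deterministic)

text \<open>Continuous mapping for the slope as a function of \<open>e\<close> and the three entries
  jointly, at the point \<open>e = 0\<close>.\<close>

lemma eps_slope_in_prob:
  assumes b: "b22 > 0" and p: "P$2$2 \<noteq> 0" and e: "e \<longlonglongrightarrow> 0"
    and m[measurable]: "\<And>n. B11 n \<in> borel_measurable M" "\<And>n. B12 n \<in> borel_measurable M" "\<And>n. B22 n \<in> borel_measurable M"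
    and B: "in_prob M B11 b11" "in_prob M B12 b12" "in_prob M B22 b22"
  shows "in_prob M (\<lambda>n \<omega>. eps_slope P (e n) (B11 n \<omega>) (B12 n \<omega>) (B22 n \<omega>)) (- (P$1$2 / P$2$2))"
proof -
  let ?g = "\<lambda>x :: real \<times> real \<times> real \<times> real. eps_slope P (fst x) (fst (snd x)) (fst (snd (snd x))) (snd (snd (snd x)))"
  have tuple: "in_prob M (\<lambda>n \<omega>. (e n, B11 n \<omega>, B12 n \<omega>, B22 n \<omega>)) (0, b11, b12, b22)"
    by (intro in_prob_Pair B in_prob_deterministic[THEN iffD2] e) measurable
  have cont: "isCont ?g (0, b11, b12, b22)"
    unfolding eps_slope_def slope_def
    by (intro continuous_intros) (simp add: eps_slope_zero(2)[OF b p], use b p in simp)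
  have "in_prob M (\<lambda>n \<omega>. ?g (e n, B11 n \<omega>, B12 n \<omega>, B22 n \<omega>)) (?g (0, b11, b12, b22))"
    by (rule in_prob_compose[OF tuple _ cont]) measurable
  then show ?thesis using eps_slope_zero(1)[OF b p] by simp
qed

text \<open>In \<open>eps_slope_equation\<close> each product \<open>e t\<close> is replaced by
  \<open>\<delta>\<close>, which is already known to tend to 0. What remains is linear in
  \<open>t\<close> and can be solved, with a leading coefficient that converges to a nonzero
  limit.\<close>

lemma eps_slope_quotient_in_prob:
  assumes b: "b22 > 0" and p: "P$2$2 \<noteq> 0" and e: "e \<longlonglongrightarrow> 0" "\<And>n. e n > 0"
    and m[measurable]: "\<And>n. B11 n \<in> borel_measurable M" "\<And>n. B12 n \<in> borel_measurable M" "\<And>n. B22 n \<in> borel_measurable M"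
    and B: "in_prob M B11 b11" "in_prob M B12 b12" "in_prob M B22 b22"
  shows "in_prob M (\<lambda>n \<omega>. (eps_slope P (e n) (B11 n \<omega>) (B12 n \<omega>) (B22 n \<omega>) + P$1$2 / P$2$2) / e n)
     (- ((P$1$1 - P$1$2 * P$2$1 / P$2$2) * b12 / (P$2$2 * b22)))"
proof -
  define \<alpha> where "\<alpha> = P$1$1 - P$1$2 * P$2$1 / P$2$2"
  define \<beta> where "\<beta> = P$2$1 + P$1$1 * P$1$2 / P$2$2"
  define \<kappa> where "\<kappa> = P$2$2 + (P$1$2)\<^sup>2 / P$2$2"
  \<comment> \<open>\<open>\<kappa> * p22\<close> is the squared length of the second column of
    \<open>P\<close>.\<close>
  have k0: "\<kappa> \<noteq> 0"
  proof -
    have "\<kappa> * P$2$2 = (P$2$2)\<^sup>2 + (P$1$2)\<^sup>2" using p by (simp add: \<kappa>_def power2_eq_square field_simps)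
    then show ?thesis using p by (metis mult_zero_left sum_power2_eq_zero_iff)
  qed
  define \<delta> where "\<delta> n \<omega> = eps_slope P (e n) (B11 n \<omega>) (B12 n \<omega>) (B22 n \<omega>) + P$1$2 / P$2$2" for n \<omega>
  have dm[measurable]: "\<delta> n \<in> borel_measurable M" for n unfolding \<delta>_def[abs_def] by measurable
  have d0: "in_prob M \<delta> 0"
    using in_prob_add[OF eps_slope_in_prob[OF b p e(1) m B] _ in_prob_const[of "P$1$2 / P$2$2"]]
    by (simp add: \<delta>_def[abs_def])
  let ?num = "\<lambda>x :: real \<times> real \<times> real \<times> real \<times> real. - (\<alpha> + P$2$1 * fst (snd x)) * (fst x * (\<beta> - P$1$1 * fst (snd x)) * fst (snd (snd x)) + (\<kappa> - P$1$2 * fst (snd x)) * fst (snd (snd (snd x))))"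
  let ?den = "\<lambda>x :: real \<times> real \<times> real \<times> real \<times> real. fst x * (\<beta> - P$1$1 * fst (snd x)) * fst (snd (snd (snd x))) + (\<kappa> - P$1$2 * fst (snd x)) * snd (snd (snd (snd x)))"
  let ?X = "\<lambda>n \<omega>. (e n, \<delta> n \<omega>, B11 n \<omega>, B12 n \<omega>, B22 n \<omega>)"
  have tuple: "in_prob M ?X (0, 0, b11, b12, b22)"
    by (intro in_prob_Pair B in_prob_deterministic[THEN iffD2] e d0) measurable
  have Xm: "?X n \<in> borel_measurable M" for n by measurable
  have "in_prob M (\<lambda>n \<omega>. ?den (?X n \<omega>)) (?den (0, 0, b11, b12, b22))"
    by (rule in_prob_compose[OF tuple Xm]) (intro continuous_intros)
  then have den: "in_prob M (\<lambda>n \<omega>. ?den (?X n \<omega>)) (\<kappa> * b22)" by simp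
  have quot: "in_prob M (\<lambda>n \<omega>. ?num (?X n \<omega>) / (P$2$2 * ?den (?X n \<omega>))) (?num (0, 0, b11, b12, b22) / (P$2$2 * ?den (0, 0, b11, b12, b22)))"
    by (rule in_prob_compose[OF tuple Xm, of "\<lambda>x. ?num x / (P$2$2 * ?den x)"]) (intro continuous_intros, use k0 b p in simp)
  have lim: "?num (0, 0, b11, b12, b22) / (P$2$2 * ?den (0, 0, b11, b12, b22)) = - (\<alpha> * b12 / (P$2$2 * b22))"
    using k0 by simp
  have "in_prob M (\<lambda>n \<omega>. \<delta> n \<omega> / e n) (- (\<alpha> * b12 / (P$2$2 * b22)))"
  proof (rule in_prob_cong_nonzero[OF quot[unfolded lim] _ den])
    show "(\<lambda>\<omega>. ?num (?X n \<omega>) / (P$2$2 * ?den (?X n \<omega>))) \<in> borel_measurable M" for n unfolding fst_conv snd_conv by measurable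
    show "\<kappa> * b22 \<noteq> 0" using k0 b by simp
    show "(\<lambda>\<omega>. ?den (?X n \<omega>)) \<in> borel_measurable M" for n unfolding fst_conv snd_conv by measurable
    fix n \<omega> assume nz: "?den (?X n \<omega>) \<noteq> 0"
    define t where "t = \<delta> n \<omega> / e n"
    have et: "e n * t = \<delta> n \<omega>" using e(2)[of n] by (simp add: t_def)
    have "eps_slope P (e n) (B11 n \<omega>) (B12 n \<omega>) (B22 n \<omega>) = - (P$1$2 / P$2$2) + e n * t"
      unfolding et by (simp add: \<delta>_def)
    from eps_slope_equation[OF p _ this] e(2)[of n]
    have "B11 n \<omega> * (e n * (\<beta> - e n * P$1$1 * t) * (\<alpha> + e n * P$2$1 * t))
      + B12 n \<omega> * (e n * (\<beta> - e n * P$1$1 * t) * (P$2$2 * t) + (\<kappa> - e n * P$1$2 * t) * (\<alpha> + e n * P$2$1 * t))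
      + B22 n \<omega> * ((\<kappa> - e n * P$1$2 * t) * (P$2$2 * t)) = 0"
      by (simp add: \<alpha>_def \<beta>_def \<kappa>_def)
    moreover have "e n * P$1$1 * t = P$1$1 * \<delta> n \<omega>" "e n * P$2$1 * t = P$2$1 * \<delta> n \<omega>" "e n * P$1$2 * t = P$1$2 * \<delta> n \<omega>"
      unfolding et[symmetric] by simp_all
    ultimately have "B11 n \<omega> * (e n * (\<beta> - P$1$1 * \<delta> n \<omega>) * (\<alpha> + P$2$1 * \<delta> n \<omega>))
      + B12 n \<omega> * (e n * (\<beta> - P$1$1 * \<delta> n \<omega>) * (P$2$2 * t) + (\<kappa> - P$1$2 * \<delta> n \<omega>) * (\<alpha> + P$2$1 * \<delta> n \<omega>))
      + B22 n \<omega> * ((\<kappa> - P$1$2 * \<delta> n \<omega>) * (P$2$2 * t)) = 0" by simp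
    \<comment> \<open>The linear equation for \<open>t\<close>, solved up to division by its leading
      coefficient.\<close>
    then have "t * (P$2$2 * ?den (?X n \<omega>)) = ?num (?X n \<omega>)" by (simp add: algebra_simps)
    then show "\<delta> n \<omega> / e n = ?num (?X n \<omega>) / (P$2$2 * ?den (?X n \<omega>))"
      using nz p unfolding t_def by (simp only: eq_divide_eq) simp
  qed
  then show ?thesis by (simp add: \<delta>_def \<alpha>_def)
qed

text \<open>The polynomial of \<open>eps_slope_equation\<close> vanishes at \<open>th\<close> for
  the random entries and at \<open>t\<close> for the deterministic ones. Subtracting,
  \<open>th - t\<close> times a difference quotient is a linear form in the errors of the entries.
  Its coefficients converge in probability and the normalized errors are bounded in mean square, so
  the coefficients may be replaced by their limits.\<close>

lemma eps_slope_delta_method: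
  fixes k :: "nat \<Rightarrow> real" and C :: real
  assumes b: "b22 > 0" and p: "P$2$2 \<noteq> 0" and e: "e \<longlonglongrightarrow> 0" "\<And>n. e n > 0"
    and m[measurable]: "\<And>n. B11 n \<in> borel_measurable M" "\<And>n. B12 n \<in> borel_measurable M" "\<And>n. B22 n \<in> borel_measurable M"
    and B: "in_prob M B11 b11" "in_prob M B12 b12" "in_prob M B22 b22"
    and Z11: "\<And>n. square_integrable M (\<lambda>\<omega>. k n * (B11 n \<omega> - b11))" "\<forall>\<^sub>F n in sequentially. (\<integral>\<omega>. (k n * (B11 n \<omega> - b11))\<^sup>2 \<partial>M) \<le> C"
    and Z12: "\<And>n. square_integrable M (\<lambda>\<omega>. k n * (B12 n \<omega> - b12))" "\<forall>\<^sub>F n in sequentially. (\<integral>\<omega>. (k n * (B12 n \<omega> - b12))\<^sup>2 \<partial>M) \<le> C"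
    and Z22: "\<And>n. square_integrable M (\<lambda>\<omega>. k n * (B22 n \<omega> - b22))" "\<forall>\<^sub>F n in sequentially. (\<integral>\<omega>. (k n * (B22 n \<omega> - b22))\<^sup>2 \<partial>M) \<le> C"
  defines "r \<equiv> (P$1$1 * P$2$2 - P$1$2 * P$2$1) / (b22 * (P$2$2)\<^sup>2)"
  shows "in_prob M (\<lambda>n \<omega>. k n * (eps_slope P (e n) (B11 n \<omega>) (B12 n \<omega>) (B22 n \<omega>) - eps_slope P (e n) b11 b12 b22) / e n
      - (- r * (k n * (B12 n \<omega> - b12)) + r * b12 / b22 * (k n * (B22 n \<omega> - b22)))) 0"
proof -
  define \<alpha> where "\<alpha> = P$1$1 - P$1$2 * P$2$1 / P$2$2"
  define \<beta> where "\<beta> = P$2$1 + P$1$1 * P$1$2 / P$2$2"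
  define \<kappa> where "\<kappa> = P$2$2 + (P$1$2)\<^sup>2 / P$2$2"
  have k0: "\<kappa> \<noteq> 0"
  proof -
    have "\<kappa> * P$2$2 = (P$2$2)\<^sup>2 + (P$1$2)\<^sup>2" using p by (simp add: \<kappa>_def power2_eq_square field_simps)
    then show ?thesis using p by (metis mult_zero_left sum_power2_eq_zero_iff)
  qed
  \<comment> \<open>Because \<open>\<alpha> * p22\<close> is the determinant of
    \<open>P\<close>.\<close>
  have r: "r = \<alpha> / (b22 * P$2$2)"
    using p b by (simp add: r_def \<alpha>_def power2_eq_square field_simps)
  define ts where "ts = - (\<alpha> * b12 / (P$2$2 * b22))"
  define th where "th n \<omega> = (eps_slope P (e n) (B11 n \<omega>) (B12 n \<omega>) (B22 n \<omega>) + P$1$2 / P$2$2) / e n" for n \<omega>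
  define t where "t n = (eps_slope P (e n) b11 b12 b22 + P$1$2 / P$2$2) / e n" for n
  have th_meas[measurable]: "th n \<in> borel_measurable M" for n unfolding th_def[abs_def] by measurable
  have th: "in_prob M th ts"
    using eps_slope_quotient_in_prob[OF b p e m B] by (simp add: th_def[abs_def] ts_def \<alpha>_def)
  have tt: "in_prob M (\<lambda>n \<omega>. t n) ts"
    unfolding t_def ts_def \<alpha>_def by (rule eps_slope_quotient_in_prob[OF b p e]) (rule in_prob_const | simp)+
  let ?v1 = "\<lambda>x :: real \<times> real \<times> real. \<alpha> + fst x * P$2$1 * fst (snd x)" and ?v2 = "\<lambda>x :: real \<times> real \<times> real. P$2$2 * fst (snd x)"
  let ?u1 = "\<lambda>x :: real \<times> real \<times> real. fst x * (\<beta> - fst x * P$1$1 * fst (snd x))" and ?u2 = "\<lambda>x :: real \<times> real \<times> real. \<kappa> - fst x * P$1$2 * fst (snd x)"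
  \<comment> \<open>\<open>G (e, t, s)\<close> is the difference quotient in \<open>t\<close> of the quadratic polynomial of \<open>eps_slope_equation\<close>.\<close>
  let ?G = "\<lambda>x :: real \<times> real \<times> real. b11 * (fst x)\<^sup>2 * (\<beta> * P$2$1 - P$1$1 * \<alpha>) + b12 * fst x * (\<beta> * P$2$2 + \<kappa> * P$2$1 - P$1$2 * \<alpha>) + b22 * \<kappa> * P$2$2
     - (b11 * (fst x) ^ 3 * P$1$1 * P$2$1 + b12 * (fst x)\<^sup>2 * (P$1$1 * P$2$2 + P$1$2 * P$2$1) + b22 * fst x * P$1$2 * P$2$2) * (fst (snd x) + snd (snd x))"
  let ?X = "\<lambda>n \<omega>. (e n, th n \<omega>, t n)"
  have tuple: "in_prob M ?X (0, ts, ts)"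
    by (intro in_prob_Pair th tt in_prob_deterministic[THEN iffD2] e) measurable
  have Xm: "?X n \<in> borel_measurable M" for n by measurable
  have G0: "?G (0, ts, ts) \<noteq> 0" using k0 b p by simp
  have Gp: "in_prob M (\<lambda>n \<omega>. ?G (?X n \<omega>)) (?G (0, ts, ts))"
    by (rule in_prob_compose[OF tuple Xm]) (intro continuous_intros)
  \<comment> \<open>\<open>u1\<close> contains the factor \<open>e\<close>, so the error of the
    entry (1,1) drops out of the limit.\<close>
  have c11: "in_prob M (\<lambda>n \<omega>. - (?u1 (?X n \<omega>) * ?v1 (?X n \<omega>)) / ?G (?X n \<omega>)) 0"
    using in_prob_compose[OF tuple Xm, of "\<lambda>x. - (?u1 x * ?v1 x) / ?G x"] G0
    by (simp add: continuous_intros)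
  have c12: "in_prob M (\<lambda>n \<omega>. - (?u1 (?X n \<omega>) * ?v2 (?X n \<omega>) + ?u2 (?X n \<omega>) * ?v1 (?X n \<omega>)) / ?G (?X n \<omega>) + r) 0"
  proof -
    have "in_prob M (\<lambda>n \<omega>. - (?u1 (?X n \<omega>) * ?v2 (?X n \<omega>) + ?u2 (?X n \<omega>) * ?v1 (?X n \<omega>)) / ?G (?X n \<omega>) + r)
        (- (?u1 (0, ts, ts) * ?v2 (0, ts, ts) + ?u2 (0, ts, ts) * ?v1 (0, ts, ts)) / ?G (0, ts, ts) + r)"
      by (rule in_prob_compose[OF tuple Xm, of "\<lambda>x. - (?u1 x * ?v2 x + ?u2 x * ?v1 x) / ?G x + r"]) (intro continuous_intros G0)
    moreover have "- (?u1 (0, ts, ts) * ?v2 (0, ts, ts) + ?u2 (0, ts, ts) * ?v1 (0, ts, ts)) / ?G (0, ts, ts) + r = 0"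
      using k0 b p by (simp add: r)
    ultimately show ?thesis by simp
  qed
  have c22: "in_prob M (\<lambda>n \<omega>. - (?u2 (?X n \<omega>) * ?v2 (?X n \<omega>)) / ?G (?X n \<omega>) - r * b12 / b22) 0"
  proof -
    have "in_prob M (\<lambda>n \<omega>. - (?u2 (?X n \<omega>) * ?v2 (?X n \<omega>)) / ?G (?X n \<omega>) - r * b12 / b22)
        (- (?u2 (0, ts, ts) * ?v2 (0, ts, ts)) / ?G (0, ts, ts) - r * b12 / b22)"
      by (rule in_prob_compose[OF tuple Xm, of "\<lambda>x. - (?u2 x * ?v2 x) / ?G x - r * b12 / b22"]) (intro continuous_intros G0)
    moreover have "- (?u2 (0, ts, ts) * ?v2 (0, ts, ts)) / ?G (0, ts, ts) - r * b12 / b22 = 0"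
      using k0 b p by (simp add: r ts_def)
    ultimately show ?thesis by simp
  qed
  have cm: "(\<lambda>\<omega>. - (?u1 (?X n \<omega>) * ?v1 (?X n \<omega>)) / ?G (?X n \<omega>)) \<in> borel_measurable M"
    "(\<lambda>\<omega>. - (?u1 (?X n \<omega>) * ?v2 (?X n \<omega>) + ?u2 (?X n \<omega>) * ?v1 (?X n \<omega>)) / ?G (?X n \<omega>) + r) \<in> borel_measurable M"
    "(\<lambda>\<omega>. - (?u2 (?X n \<omega>) * ?v2 (?X n \<omega>)) / ?G (?X n \<omega>) - r * b12 / b22) \<in> borel_measurable M" for n
    unfolding fst_conv snd_conv by measurable
  define V where "V n \<omega> = (- (?u1 (?X n \<omega>) * ?v1 (?X n \<omega>)) / ?G (?X n \<omega>)) * (k n * (B11 n \<omega> - b11))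
     + ((- (?u1 (?X n \<omega>) * ?v2 (?X n \<omega>) + ?u2 (?X n \<omega>) * ?v1 (?X n \<omega>)) / ?G (?X n \<omega>) + r) * (k n * (B12 n \<omega> - b12))
     + (- (?u2 (?X n \<omega>) * ?v2 (?X n \<omega>)) / ?G (?X n \<omega>) - r * b12 / b22) * (k n * (B22 n \<omega> - b22)))" for n \<omega>
  have "in_prob M V (0 + (0 + 0))"
    unfolding V_def[abs_def]
    by (intro in_prob_add in_prob_mult_bounded[OF c11 cm(1) Z11] in_prob_mult_bounded[OF c12 cm(2) Z12] in_prob_mult_bounded[OF c22 cm(3) Z22]) (unfold fst_conv snd_conv, measurable)
  then have V: "in_prob M V 0" by simp
  have Vm: "V n \<in> borel_measurable M" for n unfolding V_def[abs_def] fst_conv snd_conv by measurable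
  show ?thesis
  proof (rule in_prob_cong_nonzero[OF V Vm Gp G0])
    show "(\<lambda>\<omega>. ?G (?X n \<omega>)) \<in> borel_measurable M" for n unfolding fst_conv snd_conv by measurable
    fix n \<omega> assume nz: "?G (?X n \<omega>) \<noteq> 0"
    have en: "e n \<noteq> 0" using e(2)[of n] by simp
    have s1: "eps_slope P (e n) (B11 n \<omega>) (B12 n \<omega>) (B22 n \<omega>) = - (P$1$2 / P$2$2) + e n * th n \<omega>"
      and s2: "eps_slope P (e n) b11 b12 b22 = - (P$1$2 / P$2$2) + e n * t n"
      using en by (simp_all add: th_def t_def)
    let ?x = "?X n \<omega>" and ?y = "(e n, t n, t n)"
    have E1: "B11 n \<omega> * (?u1 ?x * ?v1 ?x) + B12 n \<omega> * (?u1 ?x * ?v2 ?x + ?u2 ?x * ?v1 ?x) + B22 n \<omega> * (?u2 ?x * ?v2 ?x) = 0"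
      using eps_slope_equation[OF p en s1] by (simp add: \<alpha>_def \<beta>_def \<kappa>_def)
    have E2: "b11 * (?u1 ?y * ?v1 ?y) + b12 * (?u1 ?y * ?v2 ?y + ?u2 ?y * ?v1 ?y) + b22 * (?u2 ?y * ?v2 ?y) = 0"
      using eps_slope_equation[OF p en s2] by (simp add: \<alpha>_def \<beta>_def \<kappa>_def)
    have E3: "(th n \<omega> - t n) * ?G ?x = (b11 * (?u1 ?x * ?v1 ?x) + b12 * (?u1 ?x * ?v2 ?x + ?u2 ?x * ?v1 ?x) + b22 * (?u2 ?x * ?v2 ?x))
       - (b11 * (?u1 ?y * ?v1 ?y) + b12 * (?u1 ?y * ?v2 ?y + ?u2 ?y * ?v1 ?y) + b22 * (?u2 ?y * ?v2 ?y))"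
      unfolding fst_conv snd_conv by algebra
    \<comment> \<open>At \<open>th\<close> the polynomial with the random entries is 0, so the one
      with deterministic entries equals minus its change when the errors are added.\<close>
    have E4: "k n * (th n \<omega> - t n) * ?G ?x = - ((k n * (B11 n \<omega> - b11)) * (?u1 ?x * ?v1 ?x) + (k n * (B12 n \<omega> - b12)) * (?u1 ?x * ?v2 ?x + ?u2 ?x * ?v1 ?x) + (k n * (B22 n \<omega> - b22)) * (?u2 ?x * ?v2 ?x))"
    proof -
      have "k n * (th n \<omega> - t n) * ?G ?x = k n * ((b11 * (?u1 ?x * ?v1 ?x) + b12 * (?u1 ?x * ?v2 ?x + ?u2 ?x * ?v1 ?x) + b22 * (?u2 ?x * ?v2 ?x))
         - (B11 n \<omega> * (?u1 ?x * ?v1 ?x) + B12 n \<omega> * (?u1 ?x * ?v2 ?x + ?u2 ?x * ?v1 ?x) + B22 n \<omega> * (?u2 ?x * ?v2 ?x)))"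
        unfolding mult.assoc[of "k n"] E3 E1 E2 by simp
      also have "\<dots> = k n * ((b11 * a + b12 * b' + b22 * c) - (B11 n \<omega> * a + B12 n \<omega> * b' + B22 n \<omega> * c))"
        if "a = ?u1 ?x * ?v1 ?x" "b' = ?u1 ?x * ?v2 ?x + ?u2 ?x * ?v1 ?x" "c = ?u2 ?x * ?v2 ?x" for a b' c
        unfolding that ..
      also have "k n * ((b11 * a + b12 * b' + b22 * c) - (B11 n \<omega> * a + B12 n \<omega> * b' + B22 n \<omega> * c))
         = - ((k n * (B11 n \<omega> - b11)) * a + (k n * (B12 n \<omega> - b12)) * b' + (k n * (B22 n \<omega> - b22)) * c)" for a b' c
        by (simp add: algebra_simps)
      finally show ?thesis by blast
    qed
    have gen: "S - (- r * z2 + r * b12 / b22 * z3) = (- a / g) * z1 + ((- b' / g + r) * z2 + (- c / g - r * b12 / b22) * z3)"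
      if "g \<noteq> 0" "S * g = - (z1 * a + z2 * b' + z3 * c)" for S g a b' c z1 z2 z3 :: real
    proof -
      have "S = - (z1 * a + z2 * b' + z3 * c) / g" using that by (simp add: eq_divide_eq)
      also have "\<dots> = - (z1 * a / g) - z2 * b' / g - z3 * c / g" by (simp add: add_divide_distrib diff_divide_distrib)
      finally show ?thesis by (simp add: algebra_simps)
    qed
    have S: "k n * (eps_slope P (e n) (B11 n \<omega>) (B12 n \<omega>) (B22 n \<omega>) - eps_slope P (e n) b11 b12 b22) / e n = k n * (th n \<omega> - t n)"
      unfolding s1 s2 using en by (simp add: right_diff_distrib[symmetric])
    show "k n * (eps_slope P (e n) (B11 n \<omega>) (B12 n \<omega>) (B22 n \<omega>) - eps_slope P (e n) b11 b12 b22) / e n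
      - (- r * (k n * (B12 n \<omega> - b12)) + r * b12 / b22 * (k n * (B22 n \<omega> - b22))) = V n \<omega>"
      unfolding S V_def by (rule gen[OF nz E4])
  qed
qed

end

section \<open>Central limit theorem for the sample covariance\<close>

lemma cesaro:
  fixes u :: "nat \<Rightarrow> real"
  assumes u: "u \<longlonglongrightarrow> l"
  shows "(\<lambda>n. (\<Sum>k<n. u k) / real n) \<longlonglongrightarrow> l"
proof (rule LIMSEQ_I)
  fix e :: real assume e: "e > 0"
  then obtain n0 where n0: "\<And>n. n \<ge> n0 \<Longrightarrow> \<bar>u n - l\<bar> < e / 2"
    using LIMSEQ_D[OF u, of "e / 2"] by auto
  define C where "C = (\<Sum>k<n0. \<bar>u k - l\<bar>)"
  have C0: "C \<ge> 0" by (simp add: C_def sum_nonneg)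
  obtain n1 :: nat where n1: "real n1 > 2 * C / e" using reals_Archimedean2 by blast
  show "\<exists>no. \<forall>n\<ge>no. norm ((\<Sum>k<n. u k) / real n - l) < e"
  proof (intro exI allI impI)
    fix n assume n: "n \<ge> max (n0 + 1) n1"
    then have np: "real n > 0" by simp
    have "(\<Sum>k<n. u k) / real n - l = (\<Sum>k<n. u k - l) / real n"
      using np by (simp add: sum_subtractf diff_divide_distrib)
    then have "norm ((\<Sum>k<n. u k) / real n - l) \<le> (\<Sum>k<n. \<bar>u k - l\<bar>) / real n"
      by (simp add: divide_right_mono)
    also have "(\<Sum>k<n. \<bar>u k - l\<bar>) = C + (\<Sum>k\<in>{n0..<n}. \<bar>u k - l\<bar>)"
      unfolding C_def using n by (subst sum.union_disjoint[symmetric]) (auto intro!: sum.cong)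
    also have "\<dots> \<le> C + (\<Sum>k\<in>{n0..<n}. e / 2)"
      by (intro add_left_mono sum_mono) (use n0 in \<open>auto intro: less_imp_le\<close>)
    also have "\<dots> \<le> C + real n * (e / 2)" using e by (simp add: mult_right_mono)
    finally have "norm ((\<Sum>k<n. u k) / real n - l) \<le> (C + real n * (e / 2)) / real n"
      using np by (simp add: divide_right_mono)
    also have "\<dots> = C / real n + e / 2" using np by (simp add: add_divide_distrib)
    also have "C / real n < e / 2"
    proof -
      have "2 * C / e < real n" using n1 n by simp
      then show ?thesis using e np by (simp add: field_simps)
    qed
    finally show "norm ((\<Sum>k<n. u k) / real n - l) < e" by simp
  qed
qed

text \<open>An unordered sum is a limit along all finite sets; symmetric intervals are eventually
  larger than any given one.\<close>

lemma symmetric_partial_sums: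
  fixes f :: "int \<Rightarrow> real"
  assumes "f summable_on UNIV"
  shows "(\<lambda>n. \<Sum>z\<in>{- int n..int n}. f z) \<longlonglongrightarrow> infsum f UNIV"
proof -
  have "(f has_sum infsum f UNIV) UNIV" using assms by simp
  then have lim: "(sum f \<longlongrightarrow> infsum f UNIV) (finite_subsets_at_top UNIV)" by (simp add: has_sum_def)
  have "filterlim (\<lambda>n. {- int n..int n}) (finite_subsets_at_top UNIV) sequentially"
    unfolding filterlim_finite_subsets_at_top
  proof (intro allI impI)
    fix X :: "int set" assume X: "finite X \<and> X \<subseteq> UNIV"
    obtain N :: nat where N: "\<And>z. z \<in> X \<Longrightarrow> \<bar>z\<bar> \<le> int N"
    proof
      show "\<bar>z\<bar> \<le> int (nat (\<Sum>z\<in>X. \<bar>z\<bar>))" if "z \<in> X" for z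
        using member_le_sum[of z X abs] X that by (simp add: sum_nonneg)
    qed
    show "\<forall>\<^sub>F n in sequentially. finite {- int n..int n} \<and> X \<subseteq> {- int n..int n} \<and> {- int n..int n} \<subseteq> UNIV"
      unfolding eventually_sequentially
    proof (intro exI allI impI)
      fix n assume n: "N \<le> n"
      have "z \<in> {- int n..int n}" if "z \<in> X" for z using N[OF that] n by auto
      then show "finite {- int n..int n} \<and> X \<subseteq> {- int n..int n} \<and> {- int n..int n} \<subseteq> UNIV" by auto
    qed
  qed
  from filterlim_compose[OF lim this] show ?thesis by simp
qed

text \<open>Enlarging the square by one adds a row, a column and a corner, whose differences run
  exactly once through \<open>- n\<close> to \<open>n\<close>.\<close>

lemma double_sum_Suc:
  fixes f :: "int \<Rightarrow> real"
  shows "(\<Sum>k=1..int (Suc n). \<Sum>l=1..int (Suc n). f (k - l))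
    = (\<Sum>k=1..int n. \<Sum>l=1..int n. f (k - l)) + (\<Sum>z\<in>{- int n..int n}. f z)"
proof -
  have I: "{1..int (Suc n)} = insert (int n + 1) {1..int n}" by auto
  have "(\<Sum>k=1..int (Suc n). \<Sum>l=1..int (Suc n). f (k - l))
      = (\<Sum>k=1..int n. \<Sum>l=1..int n. f (k - l)) + ((\<Sum>k=1..int n. f (k - (int n + 1))) + (f 0 + (\<Sum>l=1..int n. f (int n + 1 - l))))"
    unfolding I by (simp add: sum.distrib)
  also have "(\<Sum>k=1..int n. f (k - (int n + 1))) = (\<Sum>z\<in>{- int n..-1}. f z)"
    by (rule sum.reindex_bij_witness[of _ "\<lambda>z. z + (int n + 1)" "\<lambda>k. k - (int n + 1)"]) auto
  also have "(\<Sum>l=1..int n. f (int n + 1 - l)) = (\<Sum>z\<in>{1..int n}. f z)"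
    by (rule sum.reindex_bij_witness[of _ "\<lambda>z. int n + 1 - z" "\<lambda>l. int n + 1 - l"]) auto
  also have "(\<Sum>z\<in>{- int n..-1}. f z) + (f 0 + (\<Sum>z\<in>{1..int n}. f z)) = (\<Sum>z\<in>{- int n..int n}. f z)"
  proof -
    have "{- int n..int n} = {- int n..-1} \<union> insert 0 {1..int n}" by auto
    then show ?thesis by (subst \<open>{- int n..int n} = _\<close>, subst sum.union_disjoint) auto
  qed
  finally show ?thesis .
qed

text \<open>By \<open>double_sum_Suc\<close> the double sum adds up symmetric partial sums, so its
  average is their Cesaro mean.\<close>

lemma toeplitz_mean:
  fixes f :: "int \<Rightarrow> real"
  assumes f: "f summable_on UNIV"
  shows "(\<lambda>n. (\<Sum>k=1..int n. \<Sum>l=1..int n. f (k - l)) / real n) \<longlonglongrightarrow> infsum f UNIV"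
proof -
  have "(\<Sum>k=1..int n. \<Sum>l=1..int n. f (k - l)) = (\<Sum>m<n. \<Sum>z\<in>{- int m..int m}. f z)" for n
  proof (induction n)
    case (Suc n)
    show ?case unfolding double_sum_Suc Suc by simp
  qed simp
  then show ?thesis using cesaro[OF symmetric_partial_sums[OF f]] by simp
qed

lemma summable_on_int:
  fixes f :: "int \<Rightarrow> real"
  assumes nonneg: "\<And>z. f z \<ge> 0" and s: "summable (\<lambda>n. f (int n))" "summable (\<lambda>n. f (- int n))"
  shows "f summable_on UNIV"
proof -
  have "f summable_on range int"
    using s(1) nonneg by (subst summable_on_reindex) (auto simp: o_def summable_on_UNIV_nonneg_real_iff)
  moreover have "f summable_on range (\<lambda>n. - int n)"
    using s(2) nonneg by (subst summable_on_reindex) (auto simp: o_def summable_on_UNIV_nonneg_real_iff inj_on_def)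
  ultimately have "f summable_on (range int \<union> range (\<lambda>n. - int n))" by (rule summable_on_union)
  moreover have "range int \<union> range (\<lambda>n. - int n) = UNIV"
  proof -
    have "z \<in> range int \<union> range (\<lambda>n. - int n)" for z by (cases z rule: int_cases2) auto
    then show ?thesis by blast
  qed
  ultimately show ?thesis by simp
qed

section \<open>Autocovariance and central limit theorem of the rescaled coefficients\<close>

context ofbm_wavelet
begin

text \<open>Covariance of the eigencoordinates \<open>i\<close> and \<open>k\<close> of the
  coefficients at scale \<open>2^j\<close> and lag \<open>z\<close>, by \<open>Dq_gam\<close>; at
  lag 0 it is the matrix \<open>b\<close> of the theorem.\<close>

definition gam :: "nat \<Rightarrow> 2 \<Rightarrow> 2 \<Rightarrow> int \<Rightarrow> real" where
  "gam j i k z = - g i k * (2 ^ j) powr (hx i + hx k) * J (hx i + hx k) (of_int z)"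

lemma Dq_gam: "(\<integral>\<omega>. Dq j k i \<omega> * Dq j l i' \<omega> \<partial>M) = gam j i i' (k - l)"
  by (simp add: Dq_covariance gam_def)

lemma gam_sym: "gam j i k z = gam j k i z"
  by (simp add: gam_def g_sym[of i k] add.commute)

text \<open>Exchanging the two factors of the covariance reverses the lag and swaps the indices, and
  \<open>gam\<close> is symmetric in the indices.\<close>

lemma gam_even: "gam j i k (- z) = gam j i k z"
proof -
  have "gam j i k (- z) = (\<integral>\<omega>. Dq j 0 i \<omega> * Dq j z k \<omega> \<partial>M)" by (simp add: Dq_gam)
  also have "\<dots> = (\<integral>\<omega>. Dq j z k \<omega> * Dq j 0 i \<omega> \<partial>M)" by (simp add: mult.commute)
  also have "\<dots> = gam j k i z" by (simp add: Dq_gam)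
  finally show ?thesis by (simp add: gam_sym)
qed

text \<open>The strict sign in \<open>J_negative\<close> is combined with that of
  \<open>G i i\<close>. For \<open>i = 2\<close> this is \<open>b22 > 0\<close>, which keeps the
  denominators of the delta method away from 0.\<close>

lemma gam_pos: "gam j i i 0 > 0"
proof -
  have "(\<integral>x. kap (hx i + hx i) 1 x \<partial>lborel) * J (hx i + hx i) 0 < 0"
    using hx_bounds[of i] by (intro J_negative integrable_kap) simp
  then have "G i i * ((\<integral>x. kap (hx i + hx i) 1 x \<partial>lborel) * J (hx i + hx i) 0) < 0"
    using G_pos[of i] by (simp add: mult_less_0_iff)
  then have "g i i * J (hx i + hx i) 0 < 0" by (simp add: g_def mult.assoc)
  then show ?thesis by (simp add: gam_def mult_less_0_iff zero_less_mult_iff)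
qed

text \<open>\<open>J_decay\<close> gives the power \<open>h - 3\<close>, which is below -1 since a
  sum of two exponents is below 2.\<close>

lemma gam_abs_summable: "(\<lambda>z. \<bar>gam j i k z\<bar>) summable_on UNIV"
proof -
  define h where "h = hx i + hx k"
  have h: "0 < h" "h < 2" using hx_bounds[of i] hx_bounds[of k] by (auto simp: h_def)
  define C where "C = \<bar>g i k * (2 ^ j) powr h\<bar> * (\<bar>h * (h - 1) * (h - 2)\<bar> * (2 * L) ^ 3 * nrm\<^sup>2)"
  have s: "summable (\<lambda>n. \<bar>gam j i k (int n)\<bar>)"
  proof (rule summable_comparison_test_ev)
    show "summable (\<lambda>n. C * (1 / 2) powr (h - 3) * real n powr (h - 3))"
      using h by (intro summable_mult) (simp add: summable_real_powr_iff)
    obtain n0 :: nat where n0: "real n0 \<ge> 4 * L" using real_arch_simple by blast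
    show "\<forall>\<^sub>F n in sequentially. norm \<bar>gam j i k (int n)\<bar> \<le> C * (1 / 2) powr (h - 3) * real n powr (h - 3)"
      unfolding eventually_sequentially
    proof (intro exI allI impI)
      fix n assume n: "n0 \<le> n"
      have "\<bar>J h (real n)\<bar> \<le> \<bar>h * (h - 1) * (h - 2)\<bar> * (2 * L) ^ 3 * nrm\<^sup>2 * (\<bar>real n\<bar> / 2) powr (h - 3)"
        using n n0 by (intro J_decay h) linarith
      then have "\<bar>g i k * (2 ^ j) powr h\<bar> * \<bar>J h (real n)\<bar> \<le> \<bar>g i k * (2 ^ j) powr h\<bar> * (\<bar>h * (h - 1) * (h - 2)\<bar> * (2 * L) ^ 3 * nrm\<^sup>2 * (\<bar>real n\<bar> / 2) powr (h - 3))"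
        by (intro mult_left_mono) auto
      moreover have "(\<bar>real n\<bar> / 2) powr (h - 3) = (1 / 2) powr (h - 3) * real n powr (h - 3)"
        using powr_mult[of "1 / 2" "real n" "h - 3"] by simp
      ultimately show "norm \<bar>gam j i k (int n)\<bar> \<le> C * (1 / 2) powr (h - 3) * real n powr (h - 3)"
        by (simp add: gam_def h_def[symmetric] C_def abs_mult mult_ac)
    qed
  qed
  show ?thesis by (rule summable_on_int) (use s in \<open>auto simp: gam_even\<close>)
qed

definition gam_sum :: "nat \<Rightarrow> real" where
  "gam_sum j = (\<Sum>i\<in>UNIV. \<Sum>k\<in>UNIV. infsum (\<lambda>z. \<bar>gam j i k z\<bar>) UNIV)"

lemma gam_sum_nonneg: "0 \<le> gam_sum j"
  unfolding gam_sum_def by (intro sum_nonneg infsum_nonneg) auto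

lemma sum_gam_le: "finite Z \<Longrightarrow> (\<Sum>l\<in>Z. \<bar>gam j i k (c - l)\<bar>) \<le> infsum (\<lambda>z. \<bar>gam j i k z\<bar>) UNIV"
proof -
  assume Z: "finite Z"
  have "(\<Sum>l\<in>Z. \<bar>gam j i k (c - l)\<bar>) = (\<Sum>z\<in>(\<lambda>l. c - l) ` Z. \<bar>gam j i k z\<bar>)"
    by (subst sum.reindex) (auto simp: inj_on_def)
  also have "\<dots> \<le> infsum (\<lambda>z. \<bar>gam j i k z\<bar>) UNIV"
    using Z by (intro finite_sum_le_infsum gam_abs_summable) auto
  finally show ?thesis .
qed

lemma gam_le_sum: "\<bar>gam j i k z\<bar> \<le> gam_sum j"
proof -
  have "\<bar>gam j i k z\<bar> \<le> infsum (\<lambda>z. \<bar>gam j i k z\<bar>) UNIV"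
    using sum_gam_le[of "{0}" j i k z] by simp
  also have "\<dots> \<le> (\<Sum>k\<in>UNIV. infsum (\<lambda>z. \<bar>gam j i k z\<bar>) UNIV)"
    by (rule member_le_sum) (auto intro!: infsum_nonneg)
  also have "\<dots> \<le> gam_sum j"
    unfolding gam_sum_def by (rule member_le_sum) (auto intro!: infsum_nonneg sum_nonneg)
  finally show ?thesis .
qed

definition scl :: "nat \<Rightarrow> 2 \<Rightarrow> real" where "scl n i = (2 ^ n) powr (- hx i)"

text \<open>Sample covariance of the coefficients at scale \<open>2\<^sup>n\<^sup>+\<^sup>j\<close>, rescaled to the law of those at scale \<open>2\<^sup>j\<close>.\<close>

definition sample :: "nat \<Rightarrow> nat \<Rightarrow> nat \<Rightarrow> 2 \<Rightarrow> 2 \<Rightarrow> 'a \<Rightarrow> real" where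
  "sample j n K i k \<omega> = (\<Sum>l=1..int K. (scl n i * Dq (n + j) l i \<omega>) * (scl n k * Dq (n + j) l k \<omega>)) / real K"

definition form :: "(2 \<Rightarrow> 2 \<Rightarrow> real) \<Rightarrow> nat \<Rightarrow> nat \<Rightarrow> nat \<Rightarrow> 'a \<Rightarrow> real" where
  "form c j n K \<omega> = sqrt (real K) * (\<Sum>i\<in>UNIV. \<Sum>k\<in>UNIV. c i k * (sample j n K i k \<omega> - gam j i k 0))"

text \<open>Block diagonal in the shift, so that only coefficients at the same shift are multiplied;
  the normalization makes the row sums of order \<open>K^(-1/2)\<close>.\<close>

definition weight :: "(2 \<Rightarrow> 2 \<Rightarrow> real) \<Rightarrow> nat \<Rightarrow> int \<times> 2 \<Rightarrow> int \<times> 2 \<Rightarrow> real" where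
  "weight c K p q = (if fst p = fst q then c (snd p) (snd q) / sqrt (real K) else 0)"

definition csize :: "(2 \<Rightarrow> 2 \<Rightarrow> real) \<Rightarrow> real" where "csize c = (\<Sum>i\<in>UNIV. \<Sum>k\<in>UNIV. \<bar>c i k\<bar>)"

text \<open>For symmetric \<open>c\<close>, the trace of \<open>c \<Gamma> c \<Gamma>\<close> with
  \<open>\<Gamma>\<close> the covariance matrix at lag \<open>z\<close>; twice its sum over all lags
  is the limiting variance of \<open>form c\<close>.\<close>

definition quartic :: "(2 \<Rightarrow> 2 \<Rightarrow> real) \<Rightarrow> nat \<Rightarrow> int \<Rightarrow> real" where
  "quartic c j z = (\<Sum>i\<in>UNIV. \<Sum>k\<in>UNIV. \<Sum>p\<in>UNIV. \<Sum>r\<in>UNIV. c i p * gam j p r z * c r k * gam j i k z)"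

text \<open>Self-similarity in eigencoordinates: the powers of \<open>2^n\<close> in the covariance
  are cancelled by the scaling, and \<open>n\<close> disappears.\<close>

lemma scl_gam:
  "(\<integral>\<omega>. (scl n i * Dq (n + j) k i \<omega>) * (scl n i' * Dq (n + j) l i' \<omega>) \<partial>M) = gam j i i' (k - l)"
proof -
  have "(\<integral>\<omega>. (scl n i * Dq (n + j) k i \<omega>) * (scl n i' * Dq (n + j) l i' \<omega>) \<partial>M)
     = scl n i * scl n i' * (\<integral>\<omega>. Dq (n + j) k i \<omega> * Dq (n + j) l i' \<omega> \<partial>M)"
    by (subst integral_mult_right_zero[symmetric]) (simp only: mult_ac)
  also have "\<dots> = scl n i * scl n i' * gam (n + j) i i' (k - l)" by (simp only: Dq_gam)
  also have "scl n i * scl n i' * gam (n + j) i i' (k - l) = gam j i i' (k - l)"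
  proof -
    have "scl n i * scl n i' * (2 ^ (n + j)) powr (hx i + hx i') = (2 ^ j) powr (hx i + hx i')"
    proof -
      have "(2 ^ (n + j) :: real) powr (hx i + hx i') = (2 ^ n) powr (hx i + hx i') * (2 ^ j) powr (hx i + hx i')"
        by (simp add: power_add powr_mult)
      moreover have "scl n i * scl n i' * (2 ^ n) powr (hx i + hx i') = 1"
        unfolding scl_def powr_add[symmetric] by simp
      ultimately show ?thesis by (simp only: mult.assoc[symmetric] mult_1_left)
    qed
    moreover have "scl n i * scl n i' * (- g i i' * x * y) = - g i i' * (scl n i * scl n i' * x) * y" for x y
      by (simp only: mult_ac)
    ultimately show ?thesis unfolding gam_def by simp
  qed
  finally show ?thesis .
qed

lemma sum_ints_times: "(\<Sum>p\<in>K \<times> UNIV. f p) = (\<Sum>k\<in>K. \<Sum>i\<in>UNIV. f (k, i))" for f :: "int \<times> 2 \<Rightarrow> real"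
  by (simp add: sum.cartesian_product)

lemma weight_sum:
  assumes "finite Z" "fst p \<in> Z"
  shows "(\<Sum>q\<in>Z \<times> UNIV. weight c K p q * f q) = (\<Sum>k\<in>UNIV. c (snd p) k / sqrt (real K) * f (fst p, k))"
proof -
  have "(\<Sum>q\<in>Z \<times> UNIV. weight c K p q * f q) = (\<Sum>l\<in>Z. if fst p = l then (\<Sum>k\<in>UNIV. c (snd p) k / sqrt (real K) * f (l, k)) else 0)"
    unfolding sum_ints_times weight_def by (intro sum.cong refl) simp
  then show ?thesis using assms by (simp add: sum.delta)
qed

context
  fixes c :: "2 \<Rightarrow> 2 \<Rightarrow> real" and j n K :: nat
  assumes csym: "\<And>i k. c i k = c k i"
begin

interpretation V: gaussian_vector M "{1..int K} \<times> UNIV" "\<lambda>p \<omega>. scl n (snd p) * Dq (n + j) (fst p) (snd p) \<omega>"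
  by (rule gaussian_vector_Dq) simp

lemma V_Cov: "V.Cov p q = gam j (snd p) (snd q) (fst p - fst q)"
  unfolding V.Cov_def by (rule scl_gam)

lemma weight_sym: "weight c K p q = weight c K q p"
  using csym by (simp add: weight_def)

lemma V_quad: "V.quad (weight c K) \<omega> = sqrt (real K) * (\<Sum>i\<in>UNIV. \<Sum>k\<in>UNIV. c i k * sample j n K i k \<omega>)"
proof (cases "K = 0")
  case False
  let ?Y = "\<lambda>l i. scl n i * Dq (n + j) l i \<omega>"
  have sK: "real K / sqrt (real K) = sqrt (real K)" by (simp add: real_div_sqrt)
  have "V.quad (weight c K) \<omega> = (\<Sum>p\<in>{1..int K} \<times> UNIV. ?Y (fst p) (snd p) * (\<Sum>q\<in>{1..int K} \<times> UNIV. weight c K p q * ?Y (fst q) (snd q)))"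
    unfolding V.quad_def sum_distrib_left by (intro sum.cong refl) (simp only: mult_ac)
  also have "\<dots> = (\<Sum>p\<in>{1..int K} \<times> UNIV. ?Y (fst p) (snd p) * (\<Sum>k\<in>UNIV. c (snd p) k / sqrt (real K) * ?Y (fst p) k))"
    by (intro sum.cong refl arg_cong2[where f="(*)"], subst weight_sum) auto
  also have "\<dots> = (\<Sum>l=1..int K. \<Sum>i\<in>UNIV. \<Sum>k\<in>UNIV. c i k / sqrt (real K) * (?Y l i * ?Y l k))"
    unfolding sum_ints_times fst_conv snd_conv sum_distrib_left by (intro sum.cong refl) (simp only: mult_ac)
  also have "\<dots> = (\<Sum>i\<in>UNIV. \<Sum>k\<in>UNIV. \<Sum>l=1..int K. c i k / sqrt (real K) * (?Y l i * ?Y l k))"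
    by (subst sum.swap, intro sum.cong refl, rule sum.swap)
  also have "\<dots> = (\<Sum>i\<in>UNIV. \<Sum>k\<in>UNIV. sqrt (real K) * (c i k * sample j n K i k \<omega>))"
  proof (intro sum.cong refl)
    fix i k
    have "(\<Sum>l=1..int K. ?Y l i * ?Y l k) = real K * sample j n K i k \<omega>" using False by (simp add: sample_def)
    then have "(\<Sum>l=1..int K. c i k / sqrt (real K) * (?Y l i * ?Y l k)) = c i k / sqrt (real K) * (real K * sample j n K i k \<omega>)"
      by (simp only: sum_distrib_left[symmetric])
    also have "\<dots> = (real K / sqrt (real K)) * (c i k * sample j n K i k \<omega>)"
      by (simp only: times_divide_eq_left times_divide_eq_right mult_ac)
    finally show "(\<Sum>l=1..int K. c i k / sqrt (real K) * (?Y l i * ?Y l k)) = sqrt (real K) * (c i k * sample j n K i k \<omega>)"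
      unfolding sK .
  qed
  finally show ?thesis by (simp only: sum_distrib_left)
qed (unfold V.quad_def, simp)

lemma V_mean: "V.mean (weight c K) = sqrt (real K) * (\<Sum>i\<in>UNIV. \<Sum>k\<in>UNIV. c i k * gam j i k 0)"
proof -
  have "V.mean (weight c K) = (\<Sum>p\<in>{1..int K} \<times> UNIV. \<Sum>k\<in>UNIV. c (snd p) k / sqrt (real K) * gam j (snd p) k 0)"
    unfolding V.mean_def by (intro sum.cong refl, subst weight_sum) (auto simp: V_Cov)
  also have "\<dots> = real K * (\<Sum>i\<in>UNIV. \<Sum>k\<in>UNIV. c i k / sqrt (real K) * gam j i k 0)"
    unfolding sum_ints_times by simp
  also have "\<dots> = (real K / sqrt (real K)) * (\<Sum>i\<in>UNIV. \<Sum>k\<in>UNIV. c i k * gam j i k 0)"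
    by (simp add: sum_divide_distrib[symmetric])
  finally show ?thesis by (simp add: real_div_sqrt)
qed

lemma V_centered: "V.centered (weight c K) \<omega> = form c j n K \<omega>"
  unfolding V.centered_def V_quad V_mean form_def by (simp add: right_diff_distrib sum_subtractf)

text \<open>A row runs over distinct lags, so the total of the absolute autocovariances bounds it
  uniformly in \<open>K\<close> and \<open>n\<close>.\<close>

lemma V_row_sum: "p \<in> {1..int K} \<times> UNIV \<Longrightarrow> (\<Sum>q\<in>{1..int K} \<times> UNIV. \<bar>V.Cov p q\<bar>) \<le> gam_sum j"
proof -
  have "(\<Sum>q\<in>{1..int K} \<times> UNIV. \<bar>V.Cov p q\<bar>) = (\<Sum>k\<in>UNIV. \<Sum>l=1..int K. \<bar>gam j (snd p) k (fst p - l)\<bar>)"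
    unfolding V_Cov sum_ints_times fst_conv snd_conv by (rule sum.swap)
  also have "\<dots> \<le> (\<Sum>k\<in>UNIV. infsum (\<lambda>z. \<bar>gam j (snd p) k z\<bar>) UNIV)"
    by (intro sum_mono sum_gam_le) simp
  also have "\<dots> \<le> gam_sum j"
    unfolding gam_sum_def by (rule member_le_sum) (auto intro!: infsum_nonneg sum_nonneg)
  finally show ?thesis .
qed

lemma weight_row_sum: "p \<in> {1..int K} \<times> UNIV \<Longrightarrow> (\<Sum>q\<in>{1..int K} \<times> UNIV. \<bar>weight c K p q\<bar>) \<le> csize c / sqrt (real K)"
proof -
  assume p: "p \<in> {1..int K} \<times> UNIV"
  have "\<bar>weight c K p q\<bar> = weight (\<lambda>i k. \<bar>c i k\<bar>) K p q * 1" for q by (simp add: weight_def)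
  then have "(\<Sum>q\<in>{1..int K} \<times> UNIV. \<bar>weight c K p q\<bar>) = (\<Sum>q\<in>{1..int K} \<times> UNIV. weight (\<lambda>i k. \<bar>c i k\<bar>) K p q * 1)" by simp
  also have "\<dots> = (\<Sum>k\<in>UNIV. \<bar>c (snd p) k\<bar> / sqrt (real K) * 1)" by (rule weight_sum) (use p in auto)
  also have "\<dots> = (\<Sum>k\<in>UNIV. \<bar>c (snd p) k\<bar>) / sqrt (real K)" by (simp add: sum_divide_distrib)
  also have "\<dots> \<le> csize c / sqrt (real K)"
    unfolding csize_def by (intro divide_right_mono member_le_sum[of "snd p" UNIV "\<lambda>i. \<Sum>k\<in>UNIV. \<bar>c i k\<bar>"]) (auto intro!: sum_nonneg)
  finally show ?thesis .
qed

lemma csize_nonneg: "0 \<le> csize c"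
  unfolding csize_def by (intro sum_nonneg) auto

lemma form_square_integrable: "square_integrable M (form c j n K)"
  using V.centered_sq[of "weight c K"] by (simp add: V_centered[abs_def])

lemma form_second_moment: "(\<integral>\<omega>. (form c j n K \<omega>)\<^sup>2 \<partial>M) \<le> 4 * (csize c * gam_sum j)\<^sup>2"
proof -
  have "(\<integral>\<omega>. (V.centered (weight c K) \<omega>)\<^sup>2 \<partial>M) \<le> real (2 * card ({1..int K} \<times> (UNIV :: 2 set))) * (csize c / sqrt (real K) * gam_sum j)\<^sup>2"
    by (rule V.variance_quad_le)
      (auto intro: weight_sym V_row_sum weight_row_sum gam_sum_nonneg csize_nonneg divide_nonneg_nonneg simp del: sum.cartesian_product)
  also have "\<dots> = 4 * (real K / (sqrt (real K))\<^sup>2) * (csize c * gam_sum j)\<^sup>2"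
    by (simp add: card_cartesian_product power_divide power_mult_distrib)
  \<comment> \<open>The quotient is 1 for positive \<open>K\<close> and 0 for
    \<open>K = 0\<close>.\<close>
  also have "\<dots> \<le> 4 * 1 * (csize c * gam_sum j)\<^sup>2"
    by (intro mult_right_mono mult_left_mono) (auto simp: divide_le_eq_1)
  finally show ?thesis by (simp add: V_centered)
qed

text \<open>Since \<open>weight\<close> is block diagonal, the entries of its sandwich depend on the
  two shifts through their difference only, and half the variance becomes a Toeplitz
  average.\<close>

lemma V_variance: "V.mean (V.sandwich (weight c K)) = (\<Sum>k=1..int K. \<Sum>l=1..int K. quartic c j (k - l)) / real K"
proof -
  let ?I = "{1..int K} \<times> (UNIV :: 2 set)" and ?w = "weight c K"
  have sw: "V.sandwich ?w p q = (\<Sum>a\<in>UNIV. \<Sum>b\<in>UNIV. c (snd p) a / sqrt (real K) * gam j a b (fst p - fst q) * (c b (snd q) / sqrt (real K)))"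
    if p: "p \<in> ?I" and q: "q \<in> ?I" for p q
  proof -
    have "V.sandwich ?w p q = (\<Sum>x\<in>?I. ?w p x * (\<Sum>y\<in>?I. ?w q y * gam j (snd x) (snd y) (fst x - fst y)))"
      unfolding V.sandwich_def V_Cov sum_distrib_left by (intro sum.cong refl) (simp add: weight_sym[of _ q] mult_ac)
    also have "\<dots> = (\<Sum>a\<in>UNIV. c (snd p) a / sqrt (real K) * (\<Sum>b\<in>UNIV. c (snd q) b / sqrt (real K) * gam j a b (fst p - fst q)))"
      using p q by (subst weight_sum, simp, force, subst weight_sum) auto
    also have "\<dots> = (\<Sum>a\<in>UNIV. \<Sum>b\<in>UNIV. c (snd p) a / sqrt (real K) * gam j a b (fst p - fst q) * (c b (snd q) / sqrt (real K)))"
      unfolding sum_distrib_left by (intro sum.cong refl) (simp add: csym[of "snd q"] mult_ac)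
    finally show ?thesis .
  qed
  have "V.mean (V.sandwich ?w) = (\<Sum>p\<in>?I. \<Sum>q\<in>?I. (\<Sum>a\<in>UNIV. \<Sum>b\<in>UNIV. c (snd p) a * gam j a b (fst p - fst q) * c b (snd q) * gam j (snd p) (snd q) (fst p - fst q)) / real K)"
    unfolding V.mean_def V_Cov
  proof (intro sum.cong refl)
    fix p q assume "p \<in> ?I" "q \<in> ?I"
    then show "V.sandwich ?w p q * gam j (snd p) (snd q) (fst p - fst q)
      = (\<Sum>a\<in>UNIV. \<Sum>b\<in>UNIV. c (snd p) a * gam j a b (fst p - fst q) * c b (snd q) * gam j (snd p) (snd q) (fst p - fst q)) / real K"
      by (simp add: sw sum_distrib_right sum_divide_distrib)
  qed
  also have "\<dots> = (\<Sum>k=1..int K. \<Sum>l=1..int K. \<Sum>i\<in>UNIV. \<Sum>i'\<in>UNIV. (\<Sum>a\<in>UNIV. \<Sum>b\<in>UNIV. c i a * gam j a b (k - l) * c b i' * gam j i i' (k - l)) / real K)"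
    unfolding sum_ints_times fst_conv snd_conv
    by (intro sum.cong refl) (rule sum.swap)
  also have "\<dots> = (\<Sum>k=1..int K. \<Sum>l=1..int K. quartic c j (k - l)) / real K"
    unfolding quartic_def by (simp only: sum_divide_distrib)
  finally show ?thesis .
qed

text \<open>Row sums of order \<open>K^(-1/2)\<close> against \<open>2 K\<close> indices leave an
  error of order \<open>K^(-1/2)\<close>, with a constant that involves neither \<open>n\<close> nor
  \<open>K\<close>.\<close>

lemma form_char_bound:
  "cmod ((CLINT \<omega>|M. iexp (s * form c j n K \<omega>)) - complex_of_real (exp (- ((\<Sum>k=1..int K. \<Sum>l=1..int K. quartic c j (k - l)) / real K) * s\<^sup>2)))
     \<le> 4 * s\<^sup>2 * (csize c * gam_sum j)\<^sup>2 / sqrt (real K)"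
proof (cases "K = 0")
  \<comment> \<open>For \<open>K = 0\<close> both terms on the left are 1, and the right-hand side
    is 0 by the division convention.\<close>
  case True
  then show ?thesis by (simp add: form_def prob_space)
next
  case False
  have "cmod ((CLINT \<omega>|M. iexp (s * V.centered (weight c K) \<omega>)) - complex_of_real (exp (- V.mean (V.sandwich (weight c K)) * s\<^sup>2)))
     \<le> 2 * s\<^sup>2 * (sqrt (real (2 * card ({1..int K} \<times> (UNIV :: 2 set)))) * (csize c / sqrt (real K) * gam_sum j)\<^sup>2)"
    by (rule V.char_quad_row_sum_bound)
      (auto intro: weight_sym V_row_sum weight_row_sum gam_sum_nonneg csize_nonneg divide_nonneg_nonneg simp del: sum.cartesian_product)
  also have "\<dots> = 4 * s\<^sup>2 * (csize c * gam_sum j)\<^sup>2 / sqrt (real K)"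
  proof -
    have "sqrt (real (2 * card ({1..int K} \<times> (UNIV :: 2 set)))) = sqrt (2 * 2) * sqrt (real K)"
      by (simp add: card_cartesian_product real_sqrt_mult mult.assoc)
    moreover have "sqrt (2 * 2 :: real) = 2" using real_sqrt_abs[of 2] by simp
    moreover have "sqrt (real K) * (csize c / sqrt (real K) * gam_sum j)\<^sup>2 = (csize c * gam_sum j)\<^sup>2 / sqrt (real K)"
      using False by (simp add: power_mult_distrib power_divide power2_eq_square field_simps)
    ultimately show ?thesis by (simp add: mult.assoc)
  qed
  finally show ?thesis by (simp add: V_centered V_variance)
qed

end

lemma summable_on_sum_finite:
  fixes f :: "'x \<Rightarrow> 'y \<Rightarrow> real"
  assumes "finite F" "\<And>i. i \<in> F \<Longrightarrow> f i summable_on S"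
  shows "(\<lambda>z. \<Sum>i\<in>F. f i z) summable_on S"
  using assms by (induction F rule: finite_induct) (auto intro: summable_on_add)

lemma gam_product_summable: "(\<lambda>z. gam j p r z * gam j i k z) summable_on UNIV"
proof -
  have "(\<lambda>z. norm (gam j p r z * gam j i k z)) summable_on UNIV"
  proof (rule summable_on_comparison_test)
    show "(\<lambda>z. gam_sum j * \<bar>gam j i k z\<bar>) summable_on UNIV"
      by (intro summable_on_cmult_right gam_abs_summable)
    show "norm (gam j p r z * gam j i k z) \<le> gam_sum j * \<bar>gam j i k z\<bar>" for z
      by (simp add: abs_mult mult_right_mono gam_le_sum)
  qed simp
  then show ?thesis by (rule abs_summable_summable)
qed

lemma quartic_summable: "quartic c j summable_on UNIV"
  unfolding quartic_def[abs_def]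
proof (intro summable_on_sum_finite finite)
  fix i k p r
  have "(\<lambda>z. (c i p * c r k) * (gam j p r z * gam j i k z)) summable_on UNIV"
    by (intro summable_on_cmult_right gam_product_summable)
  then show "(\<lambda>z. c i p * gam j p r z * c r k * gam j i k z) summable_on UNIV" by (simp add: mult_ac)
qed

text \<open>The scales \<open>n m\<close> may vary with the sample because the error bound is
  uniform in them; the variance term is a Toeplitz mean and tends to the sum over all lags.\<close>

lemma form_clt:
  assumes csym: "\<And>i k. c i k = c k i" and K: "filterlim K at_top sequentially"
  shows "(\<lambda>m. CLINT \<omega>|M. iexp (s * form c j (n m) (K m) \<omega>)) \<longlonglongrightarrow> complex_of_real (exp (- infsum (quartic c j) UNIV * s\<^sup>2))"
proof -
  let ?v = "\<lambda>K. (\<Sum>k=1..int K. \<Sum>l=1..int K. quartic c j (k - l)) / real K"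
  have "(\<lambda>m. ?v (K m)) \<longlonglongrightarrow> infsum (quartic c j) UNIV"
    by (rule filterlim_compose[OF toeplitz_mean[OF quartic_summable] K])
  then have "(\<lambda>m. complex_of_real (exp (- ?v (K m) * s\<^sup>2))) \<longlonglongrightarrow> complex_of_real (exp (- infsum (quartic c j) UNIV * s\<^sup>2))"
    by (intro tendsto_intros)
  moreover have "(\<lambda>m. (CLINT \<omega>|M. iexp (s * form c j (n m) (K m) \<omega>)) - complex_of_real (exp (- ?v (K m) * s\<^sup>2))) \<longlonglongrightarrow> 0"
  proof (rule Lim_null_comparison)
    show "\<forall>\<^sub>F m in sequentially. norm ((CLINT \<omega>|M. iexp (s * form c j (n m) (K m) \<omega>)) - complex_of_real (exp (- ?v (K m) * s\<^sup>2)))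
       \<le> 4 * s\<^sup>2 * (csize c * gam_sum j)\<^sup>2 / sqrt (real (K m))"
      by (intro always_eventually allI form_char_bound csym)
    have "filterlim (\<lambda>m. sqrt (real (K m))) at_top sequentially"
      by (intro filterlim_compose[OF sqrt_at_top] filterlim_compose[OF filterlim_real_sequentially K])
    then show "(\<lambda>m. 4 * s\<^sup>2 * (csize c * gam_sum j)\<^sup>2 / sqrt (real (K m))) \<longlonglongrightarrow> 0"
      by (intro tendsto_divide_0[OF tendsto_const] filterlim_at_top_imp_at_infinity)
  qed
  ultimately have "(\<lambda>m. complex_of_real (exp (- ?v (K m) * s\<^sup>2)) + ((CLINT \<omega>|M. iexp (s * form c j (n m) (K m) \<omega>)) - complex_of_real (exp (- ?v (K m) * s\<^sup>2)))) \<longlonglongrightarrow> complex_of_real (exp (- infsum (quartic c j) UNIV * s\<^sup>2)) + 0"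
    by (rule tendsto_add)
  then show ?thesis by simp
qed

end

section \<open>The asymptotic covariance matrix\<close>

lemma linear_sandwich_nth: "linear (\<lambda>S :: real^2^2. (X ** S ** transpose X) $ a $ b)"
  by (rule linearI) (simp_all add: matrix_matrix_mult_def transpose_def sum_2 algebra_simps)

lemma sandwich_outer: "(X ** outer x x ** transpose X) $ a $ b = (X *v x) $ a * (X *v x) $ b"
  for X :: "real^2^2"
  by (simp add: matrix_matrix_mult_def matrix_vector_mult_def transpose_def sum_2 algebra_simps)

lemma sandwich_covariance:
  fixes X :: "real^2^2" and Z :: "'s \<Rightarrow> real^2"
  assumes "square_integrable M Z"
  shows "(X ** (\<integral>\<omega>. outer (Z \<omega>) (Z \<omega>) \<partial>M) ** transpose X) $ a $ b = (\<integral>\<omega>. (X *v Z \<omega>) $ a * (X *v Z \<omega>) $ b \<partial>M)"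
  using integral_bounded_linear[OF linear_conv_bounded_linear[THEN iffD1, OF linear_sandwich_nth] integrable_outer[OF assms assms], of X a b]
  by (simp add: sandwich_outer)

lemma diag2_sandwich_nth:
  "(diag2 x y ** S ** diag2 x y) $ a $ b = (if a = 1 then x else y) * S $ a $ b * (if b = 1 then x else y)"
  using exhaust_2[of a] exhaust_2[of b] by (auto simp: matrix_matrix_mult_def sum_2 diag2_def)

lemma transpose_matrix_inv:
  fixes P :: "real^2^2"
  assumes "invertible P"
  shows "matrix_inv (transpose P) = transpose (matrix_inv P)"
proof -
  let ?X = "transpose P" and ?Y = "transpose (matrix_inv P)"
  have XY: "?X ** ?Y = mat 1" "?Y ** ?X = mat 1"
    by (simp_all add: matrix_transpose_mul[symmetric] matrix_inv_cancel[OF assms] transpose_mat)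
  then have "invertible ?X" unfolding invertible_def by blast
  then have "matrix_inv ?X ** ?X = mat 1" by (rule matrix_inv_cancel)
  then have "matrix_inv ?X ** (?X ** ?Y) = ?Y" unfolding matrix_mul_assoc by (simp add: matrix_mul_lid)
  then show ?thesis by (simp add: XY matrix_mul_rid)
qed

lemma sandwich_nth: "(X ** S ** transpose X) $ i $ k = (\<Sum>a\<in>UNIV. \<Sum>b\<in>UNIV. S $ a $ b * (X $ i $ a * X $ k $ b))"
  for X :: "real^2^2"
  by (simp add: matrix_matrix_mult_def transpose_def sum_2 algebra_simps)

lemma has_sum_sum_finite:
  fixes f :: "'x \<Rightarrow> 'y \<Rightarrow> real"
  assumes "finite F" "\<And>i. i \<in> F \<Longrightarrow> (f i has_sum s i) S"
  shows "((\<lambda>z. \<Sum>i\<in>F. f i z) has_sum (\<Sum>i\<in>F. s i)) S"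
  using assms by (induction F rule: finite_induct) (auto intro: has_sum_add)

text \<open>Isserlis' covariances of the entries of a Gaussian \<open>x x\<^sup>T\<close>, contracted with the symmetric matrix \<open>n\<close>.\<close>

lemma isserlis_contraction:
  fixes O' n :: "real^2^2" and q :: "3 \<Rightarrow> real"
  assumes sym: "O' $ 2 $ 1 = O' $ 1 $ 2" "n $ 2 $ 1 = n $ 1 $ 2"
    and q: "q 1 = n $ 1 $ 1" "q 2 = 2 * n $ 1 $ 2" "q 3 = n $ 2 $ 2"
  shows "(\<Sum>r\<in>UNIV. \<Sum>s\<in>UNIV. q r * q s *
      (case (pair_index r, pair_index s) of ((i1, i2), (l1, l2)) \<Rightarrow> O' $ i1 $ l1 * O' $ i2 $ l2 + O' $ i1 $ l2 * O' $ i2 $ l1))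
    = 2 * trace (n ** O' ** n ** O')"
  by (simp add: sum_3 pair_index_def q trace_def matrix_matrix_mult_def sum_2 sym) algebra

context ofbm_wavelet
begin

lemma B_covariance_eigen:
  "(Q ** (\<integral>\<omega>. outer (B 1 \<omega>) (B 1 \<omega>) \<partial>M) ** transpose Q) $ a $ b = 2 * g a b"
  unfolding sandwich_covariance[OF B_square_integrable] Bq_def[symmetric] Bq_covariance by simp

text \<open>In eigencoordinates the power acts diagonally on the covariance \<open>2 g\<close>,
  which splits the product into scalar powers times fixed matrices. At \<open>u = 0\<close> both
  sides are 0.\<close>

lemma mat_powr_sandwich:
  assumes S: "S = (\<integral>\<omega>. outer (B 1 \<omega>) (B 1 \<omega>) \<partial>M)" and u: "0 \<le> u"
  shows "mat_powr u H ** S ** transpose (mat_powr u H)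
    = (\<Sum>a\<in>UNIV. \<Sum>b\<in>UNIV. (u powr (hx a + hx b)) *\<^sub>R ((2 * g a b) *\<^sub>R (\<chi> i k. P $ i $ a * P $ k $ b)))"
proof (cases "u = 0")
  case False
  let ?d = "diag2 (u powr h1) (u powr h2)" and ?T = "Q ** S ** transpose Q"
  have d: "transpose ?d = ?d" by (simp add: vec_eq_iff transpose_def diag2_nth)
  have "mat_powr u H = P ** ?d ** Q"
    using mat_powr_diag[OF PQ(2,1), of u h1 h2] False u by (simp add: H Q_def[symmetric])
  then have "mat_powr u H ** S ** transpose (mat_powr u H) = P ** (?d ** ?T ** ?d) ** transpose P"
    by (simp add: matrix_transpose_mul matrix_mul_assoc d)
  moreover have "(?d ** ?T ** ?d) $ a $ b = u powr (hx a + hx b) * (2 * g a b)" for a b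
    unfolding diag2_sandwich_nth B_covariance_eigen[folded S] by (simp add: hx_def powr_add)
  ultimately show ?thesis
    by (simp add: vec_eq_iff sandwich_nth sum_2 mult.assoc)
qed (simp add: mat_powr_def)

text \<open>The powers of \<open>u\<close> integrate to the double integrals \<open>J\<close>, and
  the factor \<open>- 1/2\<close> against \<open>2 g\<close> gives exactly \<open>gam\<close>. So
  \<open>Omega\<close> is the covariance of the coefficients at lag \<open>z\<close> in the original
  coordinates.\<close>

lemma Omega_gam:
  assumes S: "S = (\<integral>\<omega>. outer (B 1 \<omega>) (B 1 \<omega>) \<partial>M)"
  shows "Omega \<psi> H S j z = (\<Sum>a\<in>UNIV. \<Sum>b\<in>UNIV. gam j a b z *\<^sub>R (\<chi> i k. P $ i $ a * P $ k $ b))"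
proof -
  define F :: "2 \<Rightarrow> 2 \<Rightarrow> real^2^2" where
    "F a b = ((2 ^ j) powr (hx a + hx b) * (2 * g a b)) *\<^sub>R (\<chi> i k. P $ i $ a * P $ k $ b)" for a b
  let ?f = "\<lambda>a b t t'. \<psi> t' * \<bar>t - t' + of_int z\<bar> powr (hx a + hx b)"
  have h: "0 < hx a + hx b" for a b using hx_bounds[of a] hx_bounds[of b] by simp
  have integrand: "(let R = mat_powr \<bar>2 ^ j * (t - t' + of_int z)\<bar> H in (\<psi> t * \<psi> t') *\<^sub>R (R ** S ** transpose R))
     = (\<Sum>a\<in>UNIV. \<Sum>b\<in>UNIV. (\<psi> t * ?f a b t t') *\<^sub>R F a b)" for t t'
    unfolding Let_def mat_powr_sandwich[OF S abs_ge_zero] scaleR_sum_right F_def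
    by (intro sum.cong refl) (simp add: abs_mult powr_mult mult_ac)
  have i1: "integrable lborel (?f a b t)" for a b t
  proof (rule integrable_psi_bounded(1))
    show "\<bar>\<bar>t - t' + of_int z\<bar> powr (hx a + hx b)\<bar> \<le> (\<bar>t\<bar> + L + \<bar>of_int z\<bar>) powr (hx a + hx b)" if "\<bar>t'\<bar> \<le> L" for t'
      using that h[of a b] by (auto intro!: powr_mono2)
  qed measurable
  have i2: "integrable lborel (\<lambda>t. \<psi> t * (\<integral>t'. ?f a b t t' \<partial>lborel))" for a b
    by (rule double_psi_bounded(1)[OF _ abs_diff_powr_bound[OF h]]) measurable
  have "(\<integral>t. (\<integral>t'. (\<Sum>a\<in>UNIV. \<Sum>b\<in>UNIV. (\<psi> t * ?f a b t t') *\<^sub>R F a b) \<partial>lborel) \<partial>lborel)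
      = (\<Sum>a\<in>UNIV. \<Sum>b\<in>UNIV. J (hx a + hx b) (of_int z) *\<^sub>R F a b)"
  proof -
    have inner: "(\<integral>t'. (\<Sum>a\<in>UNIV. \<Sum>b\<in>UNIV. (\<psi> t * ?f a b t t') *\<^sub>R F a b) \<partial>lborel)
      = (\<Sum>a\<in>UNIV. \<Sum>b\<in>UNIV. (\<psi> t * (\<integral>t'. ?f a b t t' \<partial>lborel)) *\<^sub>R F a b)" for t
    proof -
      have "integrable lborel (\<lambda>t'. (\<psi> t * ?f a b t t') *\<^sub>R F a b)" for a b
        by (intro integrable_scaleR_left integrable_mult_right i1)
      then show ?thesis
        by (simp add: Bochner_Integration.integral_sum Bochner_Integration.integrable_sum integral_scaleR_left i1)
    qed
    have "integrable lborel (\<lambda>t. (\<psi> t * (\<integral>t'. ?f a b t t' \<partial>lborel)) *\<^sub>R F a b)" for a b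
      by (intro integrable_scaleR_left i2)
    then show ?thesis
      unfolding inner J_def
      by (simp add: Bochner_Integration.integral_sum Bochner_Integration.integrable_sum integral_scaleR_left i2)
  qed
  then have "Omega \<psi> H S j z = - (1/2) *\<^sub>R (\<Sum>a\<in>UNIV. \<Sum>b\<in>UNIV. J (hx a + hx b) (of_int z) *\<^sub>R F a b)"
    unfolding Omega_def integrand by simp
  also have "\<dots> = (\<Sum>a\<in>UNIV. \<Sum>b\<in>UNIV. gam j a b z *\<^sub>R (\<chi> i k. P $ i $ a * P $ k $ b))"
    unfolding scaleR_sum_right by (intro sum.cong refl) (simp add: F_def gam_def)
  finally show ?thesis .
qed

definition gam_mat :: "nat \<Rightarrow> int \<Rightarrow> real^2^2" where "gam_mat j z = (\<chi> a b. gam j a b z)"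

lemma Omega_sandwich:
  assumes S: "S = (\<integral>\<omega>. outer (B 1 \<omega>) (B 1 \<omega>) \<partial>M)"
  shows "Omega \<psi> H S j z = P ** gam_mat j z ** transpose P"
  unfolding Omega_gam[OF S]
  by (simp add: vec_eq_iff gam_mat_def matrix_matrix_mult_def transpose_def sum_2 algebra_simps)

lemma Omega_product_summable:
  assumes S: "S = (\<integral>\<omega>. outer (B 1 \<omega>) (B 1 \<omega>) \<partial>M)"
  shows "(\<lambda>z. Omega \<psi> H S j z $ i $ k * Omega \<psi> H S j z $ l $ p) summable_on UNIV"
proof -
  have "Omega \<psi> H S j z $ i $ k * Omega \<psi> H S j z $ l $ p
    = (\<Sum>a\<in>UNIV. \<Sum>b\<in>UNIV. \<Sum>a'\<in>UNIV. \<Sum>b'\<in>UNIV. (P $ i $ a * P $ k $ b * (P $ l $ a' * P $ p $ b')) * (gam j a b z * gam j a' b' z))" for z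
    unfolding Omega_gam[OF S] by (simp add: sum_2 algebra_simps)
  moreover have "(\<lambda>z. \<Sum>a\<in>UNIV. \<Sum>b\<in>UNIV. \<Sum>a'\<in>UNIV. \<Sum>b'\<in>UNIV. (P $ i $ a * P $ k $ b * (P $ l $ a' * P $ p $ b')) * (gam j a b z * gam j a' b' z)) summable_on UNIV"
    by (intro summable_on_sum_finite finite summable_on_cmult_right gam_product_summable)
  ultimately show ?thesis by simp
qed

text \<open>The symmetric matrix whose pairing with a symmetric matrix is the pairing of
  \<open>R\<close> with its entries (1,1), (1,2), (2,2); hence the halved off-diagonal
  entry.\<close>

definition coef :: "real^3 \<Rightarrow> 2 \<Rightarrow> 2 \<Rightarrow> real" where
  "coef R i k = (if i = 1 \<and> k = 1 then R $ 1 else if i = 2 \<and> k = 2 then R $ 3 else R $ 2 / 2)"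

text \<open>\<open>isserlis_contraction\<close> turns the summand at each lag into a trace in the
  original coordinates; conjugation by \<open>Q\<close> turns this trace into
  \<open>quartic\<close>.\<close>

lemma asymptotic_variance:
  assumes S: "S = (\<integral>\<omega>. outer (B 1 \<omega>) (B 1 \<omega>) \<partial>M)"
  shows "R \<bullet> (Sigma_B \<psi> P H S j *v R) = 2 * infsum (quartic (coef R) j) UNIV"
proof -
  define q where "q = R v* cal_P P"
  define n where "n = transpose Q ** (\<chi> i k. coef R i k) ** Q"
  let ?G = "G_mat \<psi> H S j" and ?O = "Omega \<psi> H S j"
  let ?T = "\<lambda>r s z. case (pair_index r, pair_index s) of ((i1, i2), (l1, l2)) \<Rightarrow> ?O z $ i1 $ l1 * ?O z $ i2 $ l2 + ?O z $ i1 $ l2 * ?O z $ i2 $ l1"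
  \<comment> \<open>\<open>cal_P\<close> is the action of \<open>S\<close> to \<open>Q S Q^T\<close>
    on the three independent entries, so its transpose takes \<open>coef R\<close> to
    \<open>n\<close>, with the off-diagonal entry counted twice.\<close>
  have q: "q $ 1 = n $ 1 $ 1" "q $ 2 = 2 * n $ 1 $ 2" "q $ 3 = n $ 2 $ 2" and n_sym: "n $ 2 $ 1 = n $ 1 $ 2"
    unfolding q_def n_def
    by (simp_all add: vector_matrix_mult_def cal_P_def Q_def[symmetric] sum_3 Let_def vector_3 matrix_matrix_mult_def
        transpose_def sum_2 coef_def power2_eq_square algebra_simps)
  have "R \<bullet> (Sigma_B \<psi> P H S j *v R) = q \<bullet> (?G *v q)"
    by (simp add: Sigma_B_def q_def dot_lmul_matrix matrix_vector_mul_assoc[symmetric] transpose_matrix_vector)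
  also have "\<dots> = (\<Sum>r\<in>UNIV. \<Sum>s\<in>UNIV. q $ r * q $ s * ?G $ r $ s)"
    by (simp add: inner_vec_def matrix_vector_mult_def sum_distrib_left mult_ac)
  also have "\<dots> = infsum (\<lambda>z. \<Sum>r\<in>UNIV. \<Sum>s\<in>UNIV. q $ r * q $ s * ?T r s z) UNIV"
  proof (rule infsumI[symmetric], intro has_sum_sum_finite finite has_sum_cmult_right)
    fix r s
    have "?T r s summable_on UNIV"
      by (cases "pair_index r", cases "pair_index s") (simp add: summable_on_add Omega_product_summable[OF S])
    moreover have "?G $ r $ s = infsum (?T r s) UNIV"
      by (cases "pair_index r", cases "pair_index s") (simp add: G_mat_def)
    ultimately show "(?T r s has_sum ?G $ r $ s) UNIV" by (simp only: has_sum_infsum)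
  qed
  also have "\<dots> = infsum (\<lambda>z. 2 * quartic (coef R) j z) UNIV"
  proof (rule infsum_cong)
    fix z
    have O_sym: "?O z $ 2 $ 1 = ?O z $ 1 $ 2"
      unfolding Omega_gam[OF S] by (simp add: sum_2 gam_sym[of j 2 1] algebra_simps)
    have T: "Q ** ?O z ** transpose Q = gam_mat j z"
    proof -
      have "Q ** ?O z ** transpose Q = (Q ** P) ** gam_mat j z ** transpose (Q ** P)"
        by (simp add: Omega_sandwich[OF S] matrix_transpose_mul matrix_mul_assoc)
      then show ?thesis by (simp add: PQ transpose_mat)
    qed
    have "(\<Sum>r\<in>UNIV. \<Sum>s\<in>UNIV. q $ r * q $ s * ?T r s z) = 2 * trace (n ** ?O z ** n ** ?O z)"
      by (rule isserlis_contraction[OF O_sym n_sym q])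
    also have "trace (n ** ?O z ** n ** ?O z) = trace (transpose Q ** ((\<chi> i k. coef R i k) ** Q ** ?O z ** n ** ?O z))"
      by (simp add: n_def matrix_mul_assoc)
    \<comment> \<open>Cyclicity moves \<open>transpose Q\<close> to the end, so that each
      \<open>Omega\<close> is enclosed by \<open>Q\<close> and its transpose.\<close>
    also have "\<dots> = trace ((\<chi> i k. coef R i k) ** Q ** ?O z ** n ** ?O z ** transpose Q)"
      by (rule trace_mul_sym)
    also have "(\<chi> i k. coef R i k) ** Q ** ?O z ** n ** ?O z ** transpose Q
       = (\<chi> i k. coef R i k) ** gam_mat j z ** (\<chi> i k. coef R i k) ** gam_mat j z"
      unfolding T[symmetric] n_def by (simp add: matrix_mul_assoc)
    also have "trace \<dots> = quartic (coef R) j z"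
      by (simp add: trace_def quartic_def gam_mat_def matrix_matrix_mult_def sum_2 gam_sym[of j 2 1] algebra_simps)
    finally show "(\<Sum>r\<in>UNIV. \<Sum>s\<in>UNIV. q $ r * q $ s * ?T r s z) = 2 * quartic (coef R) j z" .
  qed
  also have "\<dots> = 2 * infsum (quartic (coef R) j) UNIV" by (rule infsum_cmult_right')
  finally show ?thesis .
qed

end

section \<open>The eigenvector ratio\<close>

lemma weak_conv_m_eventually_cong:
  assumes "\<forall>\<^sub>F n in sequentially. X n = Y n" "weak_conv_m X Z"
  shows "weak_conv_m Y Z"
  unfolding weak_conv_m_def weak_conv_def
proof (intro allI impI)
  fix x assume "isCont (cdf Z) x"
  then have "(\<lambda>n. cdf (X n) x) \<longlonglongrightarrow> cdf Z x"
    using assms(2) by (simp add: weak_conv_m_def weak_conv_def)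
  moreover have "\<forall>\<^sub>F n in sequentially. cdf (X n) x = cdf (Y n) x"
    using assms(1) by eventually_elim simp
  ultimately show "(\<lambda>n. cdf (Y n) x) \<longlonglongrightarrow> cdf Z x" by (rule Lim_transform_eventually)
qed

context prob_space
begin

lemma in_prob_eventually_cong:
  assumes "in_prob M X c" "\<forall>\<^sub>F n in sequentially. X n = Y n"
  shows "in_prob M Y c"
  unfolding in_prob_def
proof (intro allI impI)
  fix e :: real assume "e > 0"
  then have "(\<lambda>n. measure M {\<omega> \<in> space M. dist (X n \<omega>) c > e}) \<longlonglongrightarrow> 0" by (rule in_probD[OF assms(1)])
  moreover have "\<forall>\<^sub>F n in sequentially. measure M {\<omega> \<in> space M. dist (X n \<omega>) c > e} = measure M {\<omega> \<in> space M. dist (Y n \<omega>) c > e}"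
    using assms(2) by eventually_elim simp
  ultimately show "(\<lambda>n. measure M {\<omega> \<in> space M. dist (Y n \<omega>) c > e}) \<longlonglongrightarrow> 0" by (rule Lim_transform_eventually)
qed

end

context ofbm_wavelet
begin

text \<open>Dividing the matrix by the dominant factor \<open>a powr (2 * h2)\<close> leaves the
  slope unchanged and turns the three powers of \<open>a\<close> into \<open>e^2\<close>,
  \<open>e\<close> and 1.\<close>

lemma eigen_ratio_eps_slope:
  assumes a: "a > 0" and T: "\<And>i k. (Q ** S ** transpose Q) $ i $ k = a powr (hx i + hx k) * s i k" and s: "s 2 1 = s 1 2"
  shows "eigen_ratio S = eps_slope P (a powr (h1 - h2)) (s 1 1) (s 1 2) (s 2 2)"
proof -
  define k where "k = a powr (2 * h2)"
  define e where "e = a powr (h1 - h2)"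
  have k: "k > 0" using a by (simp add: k_def)
  have "P ** (Q ** S ** transpose Q) ** transpose P = (P ** Q) ** S ** transpose (P ** Q)"
    by (simp add: matrix_transpose_mul matrix_mul_assoc)
  then have S: "S = P ** (Q ** S ** transpose Q) ** transpose P" by (simp add: PQ transpose_mat)
  have p: "a powr (h1 + h1) = k * e\<^sup>2" "a powr (h1 + h2) = k * e" "a powr (h2 + h1) = k * e" "a powr (h2 + h2) = k"
    by (simp_all add: k_def e_def power2_eq_square powr_add[symmetric] algebra_simps)
  have T': "(Q ** S ** transpose Q) $ 1 $ 1 = k * e\<^sup>2 * s 1 1" "(Q ** S ** transpose Q) $ 1 $ 2 = k * e * s 1 2"
    "(Q ** S ** transpose Q) $ 2 $ 1 = k * e * s 1 2" "(Q ** S ** transpose Q) $ 2 $ 2 = k * s 2 2"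
  proof -
    have h: "hx 1 = h1" "hx 2 = h2" by (simp_all add: hx_def)
    show "(Q ** S ** transpose Q) $ 1 $ 1 = k * e\<^sup>2 * s 1 1" "(Q ** S ** transpose Q) $ 1 $ 2 = k * e * s 1 2"
      "(Q ** S ** transpose Q) $ 2 $ 1 = k * e * s 1 2" "(Q ** S ** transpose Q) $ 2 $ 2 = k * s 2 2"
      unfolding T h p s by (rule refl)+
  qed
  have E: "S $ 1 $ 1 = k * ((P$1$1)\<^sup>2 * e\<^sup>2 * s 1 1 + 2 * P$1$1 * P$1$2 * e * s 1 2 + (P$1$2)\<^sup>2 * s 2 2)"
    "S $ 1 $ 2 = k * (P$1$1 * P$2$1 * e\<^sup>2 * s 1 1 + (P$1$1 * P$2$2 + P$1$2 * P$2$1) * e * s 1 2 + P$1$2 * P$2$2 * s 2 2)"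
    "S $ 2 $ 1 = k * (P$1$1 * P$2$1 * e\<^sup>2 * s 1 1 + (P$1$1 * P$2$2 + P$1$2 * P$2$1) * e * s 1 2 + P$1$2 * P$2$2 * s 2 2)"
    "S $ 2 $ 2 = k * ((P$2$1)\<^sup>2 * e\<^sup>2 * s 1 1 + 2 * P$2$1 * P$2$2 * e * s 1 2 + (P$2$2)\<^sup>2 * s 2 2)"
    by (subst S, unfold sandwich_nth[of P] sum_2 T', simp add: power2_eq_square algebra_simps)+
  have "eigen_ratio S = slope (S $ 1 $ 1) (S $ 1 $ 2) (S $ 2 $ 2)"
    by (rule eigen_ratio_slope) (simp only: E)
  then show ?thesis unfolding E slope_scale[OF k] eps_slope_def e_def .
qed

lemma gam_scale: "gam (i + j) p r 0 = (2 ^ i) powr (hx p + hx r) * gam j p r 0"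
  by (simp add: gam_def power_add powr_mult mult_ac)

lemma wavelet_variance_eigen: "(Q ** wavelet_variance M D (2 ^ j) ** transpose Q) $ p $ r = gam j p r 0"
  unfolding wavelet_variance_def sandwich_covariance[OF D_square_integrable] Dq_def[symmetric] Dq_gam by simp

lemma theta_eps_slope:
  "eigen_ratio (wavelet_variance M D (2 ^ i * 2 ^ j))
     = eps_slope P ((2 ^ i) powr (h1 - h2)) (gam j 1 1 0) (gam j 1 2 0) (gam j 2 2 0)"
  by (rule eigen_ratio_eps_slope[where s = "\<lambda>p r. gam j p r 0"])
    (simp_all only: power_add[symmetric] wavelet_variance_eigen gam_scale, simp_all add: gam_sym[of j 2 1])

lemma sample_sym: "sample j n K i k = sample j n K k i"
  by (simp add: sample_def fun_eq_iff mult.commute)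

lemma theta_hat_eps_slope:
  "eigen_ratio (sample_wavelet_variance D (2 ^ i * 2 ^ j) K \<omega>)
     = eps_slope P ((2 ^ i) powr (h1 - h2)) (sample j i K 1 1 \<omega>) (sample j i K 1 2 \<omega>) (sample j i K 2 2 \<omega>)"
proof (rule eigen_ratio_eps_slope[where s = "\<lambda>p r. sample j i K p r \<omega>"])
  fix p r
  have sc: "(2 ^ i) powr hx p * scl i p = 1" for p by (simp add: scl_def powr_add[symmetric])
  have "(Q ** sample_wavelet_variance D (2 ^ i * 2 ^ j) K \<omega> ** transpose Q) $ p $ r
      = (\<Sum>k=1..K. Dq (i + j) (int k) p \<omega> * Dq (i + j) (int k) r \<omega>) / real K"
    unfolding sample_wavelet_variance_def linear_scale[OF linear_sandwich_nth] linear_sum[OF linear_sandwich_nth]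
      sandwich_outer Dq_def power_add[symmetric] by simp
  also have "(\<Sum>k=1..K. Dq (i + j) (int k) p \<omega> * Dq (i + j) (int k) r \<omega>)
      = (\<Sum>l=1..int K. Dq (i + j) l p \<omega> * Dq (i + j) l r \<omega>)"
    by (rule sum.reindex_bij_witness[of _ nat int]) auto
  also have "\<dots> = (\<Sum>l=1..int K. (2 ^ i) powr (hx p + hx r) * ((scl i p * Dq (i + j) l p \<omega>) * (scl i r * Dq (i + j) l r \<omega>)))"
  proof (rule sum.cong[OF refl])
    fix l
    have "(2 ^ i) powr (hx p + hx r) * ((scl i p * x) * (scl i r * y)) = ((2 ^ i) powr hx p * scl i p) * ((2 ^ i) powr hx r * scl i r) * (x * y)" for x y
      by (simp only: powr_add mult_ac)
    then show "Dq (i + j) l p \<omega> * Dq (i + j) l r \<omega> = (2 ^ i) powr (hx p + hx r) * ((scl i p * Dq (i + j) l p \<omega>) * (scl i r * Dq (i + j) l r \<omega>))"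
      by (simp add: sc)
  qed
  finally show "(Q ** sample_wavelet_variance D (2 ^ i * 2 ^ j) K \<omega> ** transpose Q) $ p $ r
      = (2 ^ i) powr (hx p + hx r) * sample j i K p r \<omega>"
    by (simp add: sample_def sum_distrib_left[symmetric])
qed (simp_all add: sample_sym[of j i K 2 1])

lemma sample_measurable [measurable]: "sample j n K i k \<in> borel_measurable M"
proof -
  have [measurable]: "Dq n k i \<in> borel_measurable M" for n k i
    using Dq_square_integrable[of n k i] by (simp add: square_integrable_def)
  show ?thesis unfolding sample_def[abs_def] by measurable
qed

text \<open>A symmetrized indicator of the pair \<open>(i, k)\<close>: it makes \<open>form\<close>
  the error of a single sample covariance while keeping the weight symmetric.\<close>

definition esym :: "2 \<Rightarrow> 2 \<Rightarrow> 2 \<Rightarrow> 2 \<Rightarrow> real" where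
  "esym i k p r = (of_bool (p = i \<and> r = k) + of_bool (p = k \<and> r = i)) / 2"

lemma esym_form: "form (esym i k) j n K \<omega> = sqrt (real K) * (sample j n K i k \<omega> - gam j i k 0)"
proof -
  have "i = 1 \<and> k = 1 \<or> i = 1 \<and> k = 2 \<or> i = 2 \<and> k = 1 \<or> i = 2 \<and> k = 2"
    using exhaust_2[of i] exhaust_2[of k] by blast
  then show ?thesis
    by (elim disjE conjE; hypsubst; unfold form_def sum_2 esym_def sample_sym[of j n K 2 1] gam_sym[of j 2 1]; simp)
qed

lemma esym_sym: "esym i k p r = esym i k r p"
  unfolding esym_def conj_commute[of "r = i"] conj_commute[of "r = k"] by (simp only: add.commute)

lemma csize_esym: "csize (esym i k) = 1"
proof -
  have "i = 1 \<and> k = 1 \<or> i = 1 \<and> k = 2 \<or> i = 2 \<and> k = 1 \<or> i = 2 \<and> k = 2"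
    using exhaust_2[of i] exhaust_2[of k] by blast
  then show ?thesis
    by (elim disjE conjE; hypsubst; unfold csize_def sum_2 esym_def; simp)
qed

lemma sample_error_square_integrable:
  "square_integrable M (\<lambda>\<omega>. sqrt (real K) * (sample j n K i k \<omega> - gam j i k 0))"
  using form_square_integrable[of "esym i k" j n K, OF esym_sym] by (simp add: esym_form[abs_def])

lemma sample_error_second_moment:
  "(\<integral>\<omega>. (sqrt (real K) * (sample j n K i k \<omega> - gam j i k 0))\<^sup>2 \<partial>M) \<le> 4 * (gam_sum j)\<^sup>2"
  using form_second_moment[of "esym i k" j n K, OF esym_sym] by (simp add: esym_form[abs_def] csize_esym)

text \<open>Characteristic functions have modulus at most 1, so their limit \<open>exp (- v)\<close>
  at 1 has too.\<close>

lemma quartic_infsum_nonneg: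
  assumes csym: "\<And>i k. c i k = c k i"
  shows "0 \<le> infsum (quartic c j) UNIV"
proof -
  have [measurable]: "form c j 0 m \<in> borel_measurable M" for m
    using form_square_integrable[of c, OF csym] by (simp add: square_integrable_def)
  have lim: "(\<lambda>m. norm (CLINT \<omega>|M. iexp (1 * form c j 0 m \<omega>))) \<longlonglongrightarrow> norm (complex_of_real (exp (- infsum (quartic c j) UNIV * 1\<^sup>2)))"
    by (intro tendsto_norm form_clt[of c id 1 j "\<lambda>_. 0", unfolded id_def] csym) (simp add: filterlim_ident)
  have bound: "norm (CLINT \<omega>|M. iexp (1 * form c j 0 m \<omega>)) \<le> 1" for m
  proof -
    interpret D: real_distribution "distr M borel (form c j 0 m)" by (rule real_distribution_distr) measurable
    show ?thesis using D.cmod_char_le_1[of 1] by (subst (asm) integral_iexp_distr) simp_all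
  qed
  have "norm (complex_of_real (exp (- infsum (quartic c j) UNIV * 1\<^sup>2))) \<le> 1"
    by (rule LIMSEQ_le_const2[OF lim]) (intro exI allI impI bound)
  then show ?thesis by simp
qed

section \<open>Limit theorems for the eigenvector ratio\<close>

context
  fixes n K :: "nat \<Rightarrow> nat"
  assumes K: "filterlim K at_top sequentially" and p22: "P$2$2 \<noteq> 0"
    and e0: "(\<lambda>m. (2 ^ n m) powr (h1 - h2)) \<longlonglongrightarrow> 0"
begin

lemma sample_in_prob: "in_prob M (\<lambda>m. sample j (n m) (K m) i k) (gam j i k 0)"
proof -
  let ?Z = "\<lambda>m \<omega>. sqrt (real (K m)) * (sample j (n m) (K m) i k \<omega> - gam j i k 0)"
  have "filterlim (\<lambda>m. sqrt (real (K m))) at_top sequentially"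
    by (intro filterlim_compose[OF sqrt_at_top] filterlim_compose[OF filterlim_real_sequentially K])
  then have "(\<lambda>m. 1 / sqrt (real (K m))) \<longlonglongrightarrow> 0"
    by (intro tendsto_divide_0[OF tendsto_const] filterlim_at_top_imp_at_infinity)
  then have "in_prob M (\<lambda>m \<omega>. 1 / sqrt (real (K m))) 0" by (simp only: in_prob_deterministic)
  then have "in_prob M (\<lambda>m \<omega>. 1 / sqrt (real (K m)) * ?Z m \<omega>) 0"
    by (rule in_prob_mult_bounded[where C = "4 * (gam_sum j)\<^sup>2"])
      (simp_all add: sample_error_square_integrable sample_error_second_moment del: power_mult_distrib)
  then have "in_prob M (\<lambda>m \<omega>. gam j i k 0 + 1 / sqrt (real (K m)) * ?Z m \<omega>) (gam j i k 0 + 0)"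
    by (intro in_prob_add in_prob_const) measurable
  then have "in_prob M (\<lambda>m \<omega>. gam j i k 0 + 1 / sqrt (real (K m)) * ?Z m \<omega>) (gam j i k 0)" by simp
  \<comment> \<open>Cancelling the root needs \<open>K\<close> positive, which holds from some index
    on.\<close>
  moreover have "\<forall>\<^sub>F m in sequentially. (\<lambda>\<omega>. gam j i k 0 + 1 / sqrt (real (K m)) * ?Z m \<omega>) = sample j (n m) (K m) i k"
    using filterlim_at_top[THEN iffD1, OF K, rule_format, of 1] by eventually_elim (simp add: fun_eq_iff)
  ultimately show ?thesis by (rule in_prob_eventually_cong)
qed

lemma ratio_in_prob:
  "in_prob M (\<lambda>m \<omega>. eps_slope P ((2 ^ n m) powr (h1 - h2)) (sample j (n m) (K m) 1 1 \<omega>)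
      (sample j (n m) (K m) 1 2 \<omega>) (sample j (n m) (K m) 2 2 \<omega>)) (- (P$1$2 / P$2$2))"
  by (rule eps_slope_in_prob[OF gam_pos[of j 2] p22 e0]; rule sample_measurable sample_in_prob)

lemma ratio_convergence:
  "(\<lambda>m. eps_slope P ((2 ^ n m) powr (h1 - h2)) (gam j 1 1 0) (gam j 1 2 0) (gam j 2 2 0)) \<longlonglongrightarrow> - (P$1$2 / P$2$2)"
  unfolding in_prob_deterministic[symmetric]
  by (rule eps_slope_in_prob[OF gam_pos[of j 2] p22 e0]; rule borel_measurable_const in_prob_const)

text \<open>The linear form left by the delta method is \<open>form (coef R)\<close>, which is where
  \<open>R\<close> comes from. Its characteristic function tends to \<open>exp (- v s^2)\<close>,
  and \<open>asymptotic_variance\<close> identifies \<open>2 v\<close> as the variance.\<close>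

lemma ratio_clt:
  assumes R: "R = (det P / (gam j 2 2 0 * (P$2$2)\<^sup>2)) *\<^sub>R vector [0, -1, gam j 1 2 0 / gam j 2 2 0]"
    and S: "S = (\<integral>\<omega>. outer (B 1 \<omega>) (B 1 \<omega>) \<partial>M)"
  shows "weak_conv_m (\<lambda>m. distr M borel (\<lambda>\<omega>. sqrt (real (K m)) *
      (eps_slope P ((2 ^ n m) powr (h1 - h2)) (sample j (n m) (K m) 1 1 \<omega>) (sample j (n m) (K m) 1 2 \<omega>) (sample j (n m) (K m) 2 2 \<omega>)
       - eps_slope P ((2 ^ n m) powr (h1 - h2)) (gam j 1 1 0) (gam j 1 2 0) (gam j 2 2 0)) / (2 ^ n m) powr (h1 - h2)))
    (centered_normal (R \<bullet> (Sigma_B \<psi> P H S j *v R)))"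
proof (rule levy_continuity)
  let ?e = "\<lambda>m. (2 ^ n m) powr (h1 - h2)"
  let ?U = "\<lambda>m \<omega>. sqrt (real (K m)) *
      (eps_slope P (?e m) (sample j (n m) (K m) 1 1 \<omega>) (sample j (n m) (K m) 1 2 \<omega>) (sample j (n m) (K m) 2 2 \<omega>)
       - eps_slope P (?e m) (gam j 1 1 0) (gam j 1 2 0) (gam j 2 2 0)) / ?e m"
  let ?v = "infsum (quartic (coef R) j) UNIV"
  have csym: "coef R i k = coef R k i" for i k by (auto simp: coef_def)
  have v: "0 \<le> ?v" by (rule quartic_infsum_nonneg) (rule csym)
  have U[measurable]: "?U m \<in> borel_measurable M" for m by measurable
  have F[measurable]: "form (coef R) j (n m) (K m) \<in> borel_measurable M" for m
    using form_square_integrable[of "coef R", OF csym] by (simp add: square_integrable_def)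
  show "real_distribution (distr M borel (?U m))" for m by (rule real_distribution_distr) measurable
  show "real_distribution (centered_normal (R \<bullet> (Sigma_B \<psi> P H S j *v R)))"
    using v by (intro real_distribution_centered_normal) (simp add: asymptotic_variance[OF S])
  show "(\<lambda>m. char (distr M borel (?U m)) s) \<longlonglongrightarrow> char (centered_normal (R \<bullet> (Sigma_B \<psi> P H S j *v R))) s" for s
  proof -
    let ?r = "(P$1$1 * P$2$2 - P$1$2 * P$2$1) / (gam j 2 2 0 * (P$2$2)\<^sup>2)"
    have "in_prob M (\<lambda>m \<omega>. ?U m \<omega>
        - (- ?r * (sqrt (real (K m)) * (sample j (n m) (K m) 1 2 \<omega> - gam j 1 2 0))
           + ?r * gam j 1 2 0 / gam j 2 2 0 * (sqrt (real (K m)) * (sample j (n m) (K m) 2 2 \<omega> - gam j 2 2 0)))) 0"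
      by (rule eps_slope_delta_method[where ?b11.0 = "gam j 1 1 0" and C = "4 * (gam_sum j)\<^sup>2", OF gam_pos[of j 2] p22 e0])
        (simp_all add: sample_in_prob sample_error_square_integrable sample_error_second_moment del: power_mult_distrib)
    moreover have "- ?r * (sqrt (real (K m)) * (sample j (n m) (K m) 1 2 \<omega> - gam j 1 2 0))
           + ?r * gam j 1 2 0 / gam j 2 2 0 * (sqrt (real (K m)) * (sample j (n m) (K m) 2 2 \<omega> - gam j 2 2 0))
        = form (coef R) j (n m) (K m) \<omega>" for m \<omega>
    proof -
      have c: "coef R 1 1 = 0" "coef R 1 2 = - ?r / 2" "coef R 2 1 = - ?r / 2" "coef R 2 2 = ?r * gam j 1 2 0 / gam j 2 2 0"
        by (simp_all add: coef_def R det_2)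
      show ?thesis
        unfolding form_def sum_2 c sample_sym[of j "n m" "K m" 2 1] gam_sym[of j 2 1] by (simp add: algebra_simps)
    qed
    ultimately have d: "in_prob M (\<lambda>m \<omega>. ?U m \<omega> - form (coef R) j (n m) (K m) \<omega>) 0" by simp
    have "(\<lambda>m. CLINT \<omega>|M. iexp (s * ?U m \<omega>)) \<longlonglongrightarrow> complex_of_real (exp (- ?v * s\<^sup>2))"
      by (rule slutsky_char[OF U F d]) (rule form_clt[of "coef R", OF csym K])
    moreover have "char (centered_normal (R \<bullet> (Sigma_B \<psi> P H S j *v R))) s = complex_of_real (exp (- ?v * s\<^sup>2))"
      using v by (subst char_centered_normal) (simp_all add: asymptotic_variance[OF S])
    ultimately show ?thesis by (simp only: integral_iexp_distr[OF U])
  qed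
qed

end

end

text \<open>The condition \<open>a / \<nu>\<close> to 0 yields \<open>K\<close> to infinity. The
  condition on \<open>\<nu> / a^(1 + 2 h1)\<close> forces \<open>a\<close> to grow at least like a
  power of \<open>\<nu> = 2^m\<close>, so \<open>e\<close> decays geometrically in
  \<open>m\<close>.\<close>

lemma scale_limits:
  fixes a K :: "nat \<Rightarrow> nat" and h1 h2 :: real
  assumes h: "0 < h1" "h1 < h2"
    and a_power: "\<forall>\<^sub>F m in sequentially. (\<exists>i. a (2 ^ m) = 2 ^ i) \<and> real (a (2 ^ m)) \<le> 2 ^ m / 2 ^ j"
    and a_rate: "(\<lambda>m. real (a (2 ^ m)) / 2 ^ m + 2 ^ m / real (a (2 ^ m)) powr (1 + 2 * h1)) \<longlonglongrightarrow> 0"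
    and K: "\<And>\<nu>. K \<nu> = \<nu> div (a \<nu> * 2 ^ j)"
  obtains n where "\<forall>\<^sub>F m in sequentially. a (2 ^ m) = 2 ^ n m"
    and "filterlim (\<lambda>m. K (2 ^ m)) at_top sequentially"
    and "(\<lambda>m. (2 ^ n m) powr (h1 - h2)) \<longlonglongrightarrow> 0"
proof
  define n where "n m = (SOME i. a (2 ^ m) = 2 ^ i)" for m
  show a_eq: "\<forall>\<^sub>F m in sequentially. a (2 ^ m) = 2 ^ n m"
    using a_power unfolding n_def by eventually_elim (blast intro: someI_ex[of "\<lambda>i. a _ = 2 ^ i"])
  \<comment> \<open>Both summands of the rate are nonnegative, so each one tends to 0.\<close>
  have r1: "(\<lambda>m. real (a (2 ^ m)) / 2 ^ m) \<longlonglongrightarrow> 0"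
    by (rule Lim_null_comparison[OF _ a_rate]) simp
  have r2: "(\<lambda>m. 2 ^ m / real (a (2 ^ m)) powr (1 + 2 * h1)) \<longlonglongrightarrow> 0"
    by (rule Lim_null_comparison[OF _ a_rate]) simp
  show "filterlim (\<lambda>m. K (2 ^ m)) at_top sequentially"
    unfolding filterlim_sequentially_iff_filterlim_real
  proof -
    have "filterlim (\<lambda>m. inverse (real (a (2 ^ m)) / 2 ^ m)) at_top sequentially"
      by (rule filterlim_inverse_at_top[OF r1]) (use a_eq in eventually_elim, simp)
    then have "filterlim (\<lambda>m. 1 / 2 ^ j * inverse (real (a (2 ^ m)) / 2 ^ m)) at_top sequentially"
      by (intro filterlim_tendsto_pos_mult_at_top[OF tendsto_const]) auto
    moreover have "\<forall>\<^sub>F m in sequentially. 1 / 2 ^ j * inverse (real (a (2 ^ m)) / 2 ^ m) = real (K (2 ^ m))"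
      using a_eq a_power
    proof eventually_elim
      case (elim m)
      have "(2 :: real) ^ (n m + j) \<le> 2 ^ m" using elim by (simp add: power_add field_simps)
      \<comment> \<open>The bound on \<open>a\<close> makes the natural-number division in
        \<open>K\<close> an exact division of powers of 2.\<close>
      then have le: "n m + j \<le> m" by simp
      have "K (2 ^ m) = 2 ^ m div 2 ^ (n m + j)" using elim by (simp add: K power_add)
      also have "\<dots> = 2 ^ (m - (n m + j))" using le by (simp add: power_diff)
      finally have "real (K (2 ^ m)) = 2 ^ (m - (n m + j))" by simp
      also have "\<dots> = 2 ^ m / 2 ^ (n m + j)" by (rule power_diff[OF _ le]) simp
      finally have "real (K (2 ^ m)) = 2 ^ m / 2 ^ (n m + j)" .
      then show ?case using elim by (simp add: power_add mult.commute)
    qed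
    ultimately show "filterlim (\<lambda>m. real (K (2 ^ m))) at_top sequentially"
      by (rule filterlim_cong[THEN iffD1, OF refl refl, rotated])
  qed
  \<comment> \<open>This exponent turns the eventual bound \<open>2^m <= a powr (1 + 2 h1)\<close>
    into \<open>e <= (2^m) powr (- \<delta>)\<close>.\<close>
  define \<delta> where "\<delta> = (h2 - h1) / (1 + 2 * h1)"
  have \<delta>: "\<delta> > 0" "(1 + 2 * h1) * - \<delta> = h1 - h2" using h by (simp_all add: \<delta>_def)
  have pw: "(2 ^ m) powr x = (2 powr x) ^ m" for m and x :: real
    by (induction m) (simp_all add: powr_mult)
  show "(\<lambda>m. (2 ^ n m) powr (h1 - h2)) \<longlonglongrightarrow> 0"
  proof (rule Lim_null_comparison)
    have "2 powr (- \<delta>) < 2 powr (0 :: real)" using \<delta> by (intro powr_less_mono) auto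
    then show "(\<lambda>m. (2 powr (- \<delta>)) ^ m) \<longlonglongrightarrow> (0 :: real)" by (intro LIMSEQ_realpow_zero) auto
    have "\<forall>\<^sub>F m in sequentially. 2 ^ m / real (a (2 ^ m)) powr (1 + 2 * h1) < 1"
      by (rule order_tendstoD(2)[OF r2]) simp
    then show "\<forall>\<^sub>F m in sequentially. norm ((2 ^ n m) powr (h1 - h2)) \<le> (2 powr (- \<delta>)) ^ m"
      using a_eq
    proof eventually_elim
      case (elim m)
      let ?A = "(2 :: real) ^ n m"
      have le: "2 ^ m \<le> ?A powr (1 + 2 * h1)" using elim by (simp add: field_simps)
      have "?A powr (h1 - h2) = (?A powr (1 + 2 * h1)) powr (- \<delta>)" unfolding powr_powr \<delta>(2) ..
      also have "\<dots> \<le> (2 ^ m) powr (- \<delta>)" using \<delta>(1) le by (intro powr_mono2') auto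
      also have "\<dots> = (2 powr (- \<delta>)) ^ m" by (rule pw)
      finally show ?case by simp
    qed
  qed
qed

lemma wavelet_imp_filter:
  assumes "wavelet \<psi> N\<^sub>\<psi> \<alpha>"
  obtains L where "wavelet_filter \<psi> L"
proof -
  from assms obtain c d where i: "integrable lborel \<psi>" and u: "(\<integral>t. (\<psi> t)\<^sup>2 \<partial>lborel) = 1" and N: "N\<^sub>\<psi> \<ge> 2"
    and m: "\<And>q. q < N\<^sub>\<psi> \<Longrightarrow> (\<integral>t. t ^ q * \<psi> t \<partial>lborel) = 0" and cd: "closure {t. \<psi> t \<noteq> 0} = {c..d}"
    unfolding wavelet_def by blast
  \<comment> \<open>The summand 1 keeps the radius positive even if both end points are 0.\<close>
  have "\<bar>t\<bar> \<le> \<bar>c\<bar> + \<bar>d\<bar> + 1" if "\<psi> t \<noteq> 0" for t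
  proof -
    have "t \<in> {c..d}" using that closure_subset[of "{t. \<psi> t \<noteq> 0}"] unfolding cd by blast
    then show ?thesis by auto
  qed
  moreover have "(\<integral>t. \<psi> t \<partial>lborel) = 0" "(\<integral>t. t * \<psi> t \<partial>lborel) = 0"
    using m[of 0] m[of 1] N by simp_all
  ultimately have "wavelet_filter \<psi> (\<bar>c\<bar> + \<bar>d\<bar> + 1)" using i u by unfold_locales auto
  then show ?thesis by (rule that)
qed

theorem theorem4p2:
  fixes M :: "'a measure" and B\<^sub>H :: "real \<Rightarrow> 'a \<Rightarrow> real^2"
    and N :: "'b measure" and Bt :: "real set \<Rightarrow> 'b \<Rightarrow> complex^2"
    and P H \<Sigma> b :: "real^2^2" and A :: "complex^2^2" and h1 h2 :: real
    and \<psi> :: "real \<Rightarrow> real" and N\<^sub>\<psi> :: nat and \<alpha> :: real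
    and D :: "nat \<Rightarrow> int \<Rightarrow> 'a \<Rightarrow> real^2"
    and j :: nat and a K :: "nat \<Rightarrow> nat"
    and \<theta>h :: "nat \<Rightarrow> 'a \<Rightarrow> real" and \<theta> :: "nat \<Rightarrow> real" and R :: "real^3"
  assumes ofbm: "ofbm M B\<^sub>H H A N Bt"
    and exponents: "0 < h1" "h1 < h2" "h2 < 1"
    and P: "invertible P" "\<And>i. norm (column i P) = 1"
    and H: "H = P ** diag2 h1 h2 ** matrix_inv P"
    and full_rank: "rank (map_matrix Re (A ** hermitian_transpose A)) = 2"
    and time_reversible: "map_matrix Im (A ** hermitian_transpose A) = 0"
    and Sigma: "\<Sigma> = (\<integral>\<omega>. outer (B\<^sub>H 1 \<omega>) (B\<^sub>H 1 \<omega>) \<partial>M)"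
    and wavelet: "wavelet \<psi> N\<^sub>\<psi> \<alpha>"
    and coefficients: "wavelet_coefficients M B\<^sub>H \<psi> D"
    and j: "j \<ge> 1"
    and a_power: "\<forall>\<^sub>F m in sequentially. (\<exists>i. a (2 ^ m) = 2 ^ i) \<and>
                    real (a (2 ^ m)) \<le> 2 ^ m / 2 ^ j"
    and a_rate: "(\<lambda>m. real (a (2 ^ m)) / 2 ^ m + 2 ^ m / real (a (2 ^ m)) powr (1 + 2 * h1))
                   \<longlonglongrightarrow> 0"
    and K: "\<And>\<nu>. K \<nu> = \<nu> div (a \<nu> * 2 ^ j)"
    and theta_hat: "\<And>\<nu> \<omega>. \<theta>h \<nu> \<omega> =
                      eigen_ratio (sample_wavelet_variance D (a \<nu> * 2 ^ j) (K \<nu>) \<omega>)"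
    and theta: "\<And>\<nu>. \<theta> \<nu> = eigen_ratio (wavelet_variance M D (a \<nu> * 2 ^ j))"
    and b: "b = matrix_inv P ** wavelet_variance M D (2 ^ j) ** matrix_inv (transpose P)"
    and R: "R = (det P / (b$2$2 * (P$2$2)\<^sup>2)) *\<^sub>R vector [0, -1, b$1$2 / b$2$2]"
    and p22: "P$2$2 \<noteq> 0"
  shows "(P$1$2 \<noteq> 0 \<or> (P$1$2 = 0 \<and> b$1$2 \<noteq> 0) \<longrightarrow>
            tendsto_in_prob M (\<lambda>m. \<theta>h (2 ^ m)) (- (P$1$2 / P$2$2)) \<and>
            (\<lambda>m. \<theta> (2 ^ m)) \<longlonglongrightarrow> - (P$1$2 / P$2$2)) \<and>
         (P$1$2 \<noteq> 0 \<and> b$1$2 \<noteq> 0 \<longrightarrow>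
            weak_conv_m
              (\<lambda>m. distr M borel (\<lambda>\<omega>. real (a (2 ^ m)) powr (h2 - h1) * sqrt (real (K (2 ^ m))) *
                                      (\<theta>h (2 ^ m) \<omega> - \<theta> (2 ^ m))))
              (centered_normal (R \<bullet> (Sigma_B \<psi> P H \<Sigma> j *v R))))"
proof -
  obtain L where L: "wavelet_filter \<psi> L" using wavelet by (rule wavelet_imp_filter)
  interpret ofbm_wavelet M B\<^sub>H N Bt P H A h1 h2 \<psi> L D
    by (intro ofbm_wavelet.intro ofbm_model.intro ofbm_wavelet_axioms.intro ofbm exponents P(1) H full_rank
        time_reversible coefficients L)
  obtain n where n: "\<forall>\<^sub>F m in sequentially. a (2 ^ m) = 2 ^ n m"
    and K_lim: "filterlim (\<lambda>m. K (2 ^ m)) at_top sequentially"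
    and e: "(\<lambda>m. (2 ^ n m) powr (h1 - h2)) \<longlonglongrightarrow> 0"
    by (rule scale_limits[OF exponents(1,2) a_power a_rate K])
  \<comment> \<open>This identifies the constants in \<open>R\<close> with those of
    \<open>ratio_clt\<close>.\<close>
  have b_gam: "b $ i $ k = gam j i k 0" for i k
    unfolding b transpose_matrix_inv[OF P(1)] Q_def[symmetric] by (rule wavelet_variance_eigen)
  let ?e = "\<lambda>m. (2 ^ n m) powr (h1 - h2)"
  let ?th = "\<lambda>m \<omega>. eps_slope P (?e m) (sample j (n m) (K (2 ^ m)) 1 1 \<omega>) (sample j (n m) (K (2 ^ m)) 1 2 \<omega>) (sample j (n m) (K (2 ^ m)) 2 2 \<omega>)"
  let ?t = "\<lambda>m. eps_slope P (?e m) (gam j 1 1 0) (gam j 1 2 0) (gam j 2 2 0)"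
  \<comment> \<open>\<open>a\<close> is known to be a power of 2 only from some index on, hence the
    eventual equalities.\<close>
  have th: "\<forall>\<^sub>F m in sequentially. ?th m = \<theta>h (2 ^ m)"
    using n by eventually_elim (simp add: fun_eq_iff theta_hat theta_hat_eps_slope)
  have t: "\<forall>\<^sub>F m in sequentially. ?t m = \<theta> (2 ^ m)"
    using n by eventually_elim (simp add: theta theta_eps_slope)
  have "tendsto_in_prob M (\<lambda>m. \<theta>h (2 ^ m)) (- (P$1$2 / P$2$2))"
    using in_prob_eventually_cong[OF ratio_in_prob[OF K_lim p22 e] th] by (simp only: in_prob_real)
  moreover have "(\<lambda>m. \<theta> (2 ^ m)) \<longlonglongrightarrow> - (P$1$2 / P$2$2)"
    by (rule Lim_transform_eventually[OF ratio_convergence[OF K_lim p22 e] t])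
  moreover have "weak_conv_m
      (\<lambda>m. distr M borel (\<lambda>\<omega>. real (a (2 ^ m)) powr (h2 - h1) * sqrt (real (K (2 ^ m))) * (\<theta>h (2 ^ m) \<omega> - \<theta> (2 ^ m))))
      (centered_normal (R \<bullet> (Sigma_B \<psi> P H \<Sigma> j *v R)))"
  proof (rule weak_conv_m_eventually_cong[OF _ ratio_clt[OF K_lim p22 e R[unfolded b_gam] Sigma]])
    show "\<forall>\<^sub>F m in sequentially. distr M borel (\<lambda>\<omega>. sqrt (real (K (2 ^ m))) * (?th m \<omega> - ?t m) / ?e m)
      = distr M borel (\<lambda>\<omega>. real (a (2 ^ m)) powr (h2 - h1) * sqrt (real (K (2 ^ m))) * (\<theta>h (2 ^ m) \<omega> - \<theta> (2 ^ m)))"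
      using n th t
    proof eventually_elim
      case (elim m)
      \<comment> \<open>The rate in the theorem is the reciprocal of the small parameter
        \<open>e\<close>.\<close>
      have a: "real (a (2 ^ m)) powr (h2 - h1) = 1 / ?e m"
        unfolding elim(1) powr_minus_divide[symmetric] by simp
      have "sqrt (real (K (2 ^ m))) * (?th m \<omega> - ?t m) / ?e m
        = real (a (2 ^ m)) powr (h2 - h1) * sqrt (real (K (2 ^ m))) * (\<theta>h (2 ^ m) \<omega> - \<theta> (2 ^ m))" for \<omega>
        unfolding a fun_cong[OF elim(2), symmetric] elim(3)[symmetric] by simp
      then show ?case by simp
    qed
  qed
  ultimately show ?thesis by blast
qed

end
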